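(* Let $1<\gamma\le2$ and let $m$ be a smooth transformed solution on $[0,T]$ (see context). When $1<\gamma<2$, assume that $\mathcal A_\Psi^\gamma$ satisfies the paralinearization, form bounds and coercivity listed in the context; when $\gamma=2$, let it be the divergence-form operator $\mathcal A_\Psi^2f=-\partial_y(af_y)$, $a=(J^2)^\Phi$. Assume also that $0<J_*\le J\le J^*<\infty$, that $\Psi,\Phi$ are uniformly bi-Lipschitz, and that $$a\in L^\infty(0,T;C^\beta),\qquad Q_0,Q_\lambda\in L^{\gamma/(\gamma-1)}(0,T;C^\rho),\qquad R\in L^2(0,T;H^{1-\gamma/2})$$ with $\rho>1-\frac\gamma2$ and $1-\frac\gamma2<\beta<1$. Then $$\sup_{t\le T}\|m(t)\|_{L^1}\lesssim_\Psi N_T<\infty.$$ Moreover, there is a finite constant $C_T$, depending only on $T$, the initial norms, and the coefficient, ellipticity, bi-Lipschitz, and operator bounds in these assumptions, such that $$\sup_{t\le T}\|m(t)\|_{L^2}^2+\int_0^T\|m(t)\|_{H^{\gamma/2}}^2\,dt+Z_T^\beta(m)\le C_T.$$ For every $0<s<1/3$ there is a finite constant $C_{T,s}$, with the same dependence as $C_T$ and additionally on $s$, such that $$K_T^s(m)\le C_{T,s}<\infty.$$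
   Context: $\mathbb T=\mathbb R/\mathbb Z$; $\delta_hf(y)=f(y+h)-f(y)$; $\Lambda^s$ is the Fourier multiplier $|2\pi k|^s$ ($k\ne0$), zero at $k=0$; $\mathcal R_\gamma=\Lambda^{\gamma-2}\partial_x$; dotted norms are homogeneous seminorms; $f^\Theta=f\circ\Theta$ (spatial composition). **Transformed solution.** For smooth $\ell,\psi$ on $[0,T]\times\mathbb T$ (linear response and Zvonkin corrector) and $\lambda\ge0$, let $\Psi(t,x)=x+\psi(t,x)$, $J=\partial_x\Psi$, $\Phi=\Psi^{-1}$, and $$m_t-\partial_y\mathcal D_\Psi^\gamma m=\partial_y(am^2+2Q_\lambda m+R),$$ $a=(J^2)^\Phi$, $Q_0=(\ell J)^\Phi$, $Q_\lambda=Q_0+\frac\lambda2\psi^\Phi$, $R=(\ell^2)^\Phi$, $\mathcal D_\Psi^\gamma f=[\mathcal R_\gamma(Jf^\Psi)+f^\Psi\Lambda^\gamma\psi]^\Phi$, $\mathcal A_\Psi^\gamma=-\partial_y\mathcal D_\Psi^\gamma$. **Operator assumptions ($1<\gamma<2$), uniformly in $t\in[0,T]$.** $\mathcal D_\Psi^\gamma f=(J^\gamma)^\Phi\prec\mathcal R_\gamma f+\mathcal S_\Psi f$ (with $\prec$ the Bony paraproduct), $\|\mathcal S_\Psi f\|_{H^\sigma}\lesssim\|f\|_{H^{\gamma/2}}$ for all $\sigma<\min\{\gamma/2,1-\gamma/2+\beta\}$; $\|\mathcal D_\Psi^\gamma f\|_{H^{1-\gamma/2}}\lesssim\|f\|_{H^{\gamma/2}}$;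 $\|\mathcal A_\Psi^\gamma f\|_{H^{-\gamma/2}}\lesssim\|f\|_{H^{\gamma/2}}$; $\langle f,\mathcal A_\Psi^\gamma f\rangle\asymp_\Psi\|f\|_{\dot H^{\gamma/2}}^2$ for $f\in H^{\gamma/2}$. **Functionals.** $Z_T^\beta(m)=\int_0^T\|m(t)^3\|_{B^{1-\beta}_{1,1}}dt$; $K_T^s(m)=\int_0^T\int_0^1h^{-1-3s}\|\delta_hm(t)\|_{L^3}^3\,dh\,dt$; $$N_T=\int_{\mathbb T}\chi(m(0,y))dy+\|a\|_{L^2(0,T;\dot H^{1-\gamma/2})}^2+\|Q_0\|_{L^2(0,T;H^{1-\gamma/2})}^2+\|R\|_{L^2(0,T;H^{1-\gamma/2})}^2+\lambda\|J-1\|_{L^1(0,T;L^1)},$$ with $\chi$ a fixed even, smooth, convex function with $|\chi'|\le1$, $0\le\chi''\lesssim1$, $\operatorname{supp}\chi''\subset\{|z|\le1\}$, $0\le\chi(z)-|z|\lesssim1$. *)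

theory Defs
  imports "HOL-Analysis.Analysis"
begin

text \<open>
  Functions on the torus \<open>\<real>/\<int>\<close> are 1-periodic functions on \<^typ>\<open>real\<close>; a time-dependent
  function is curried, time first.  All norms take values in \<^typ>\<open>ennreal\<close>, so that a
  bound \<open>\<le> ennreal C\<close> includes finiteness.
\<close>

definition periodic1 :: "(real \<Rightarrow> 'a) \<Rightarrow> bool" where
  "periodic1 f \<longleftrightarrow> (\<forall>x. f (x + 1) = f x)"

definition smooth :: "(real \<Rightarrow> real) \<Rightarrow> bool" where
  "smooth f \<longleftrightarrow> (\<forall>n x. (deriv ^^ n) f differentiable (at x))"

text \<open>
  Smoothness on \<open>[0,T] \<times> \<real>/\<int>\<close> up to the (one-sided) time endpoints: \<open>d i j\<close> is the
  mixed derivative of order \<open>i\<close> in time and \<open>j\<close> in space.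
\<close>
definition smooth_strip :: "real \<Rightarrow> (real \<Rightarrow> real \<Rightarrow> real) \<Rightarrow> bool" where
  "smooth_strip T f \<longleftrightarrow>
     (\<forall>t\<in>{0..T}. periodic1 (f t)) \<and>
     (\<exists>d :: nat \<Rightarrow> nat \<Rightarrow> real \<Rightarrow> real \<Rightarrow> real.
        (\<forall>t\<in>{0..T}. \<forall>x. d 0 0 t x = f t x) \<and>
        (\<forall>i j. continuous_on ({0..T} \<times> UNIV) (\<lambda>(t, x). d i j t x)) \<and>
        (\<forall>i j. \<forall>t\<in>{0..T}. \<forall>x.
           ((\<lambda>s. d i j s x) has_real_derivative d (Suc i) j t x) (at t within {0..T}) \<and>
           ((\<lambda>z. d i j t z) has_real_derivative d i (Suc j) t x) (at x)))"

definition fc :: "(real \<Rightarrow> real) \<Rightarrow> int \<Rightarrow> complex" where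
  "fc f k = (LINT x:{0..1}|lborel. complex_of_real (f x) * cis (- 2 * pi * of_int k * x))"

text \<open>
  The multiplier with symbol \<open>\<sigma>\<close>, summed pointwise through symmetric partial sums, so that it
  is also meaningful (almost everywhere) if the resulting function is only square integrable.
  It is used for symbols with \<open>\<sigma> (- k) = cnj (\<sigma> k)\<close>, for which the partial sums are real.
\<close>
definition fmult :: "(int \<Rightarrow> complex) \<Rightarrow> (real \<Rightarrow> real) \<Rightarrow> real \<Rightarrow> real" where
  "fmult \<sigma> f x =
     lim (\<lambda>N::nat. Re (\<Sum>k\<in>{- int N..int N}. \<sigma> k * fc f k * cis (2 * pi * of_int k * x)))"

text \<open>Note \<^prop>\<open>(0::real) powr s = 0\<close> for every \<open>s\<close>: the zero mode is removed.\<close>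
definition Lam :: "real \<Rightarrow> (real \<Rightarrow> real) \<Rightarrow> real \<Rightarrow> real" where
  "Lam s = fmult (\<lambda>k. of_real (\<bar>2 * pi * of_int k\<bar> powr s))"

definition Riesz :: "real \<Rightarrow> (real \<Rightarrow> real) \<Rightarrow> real \<Rightarrow> real" where
  "Riesz \<gamma> = fmult (\<lambda>k. of_real (\<bar>2 * pi * of_int k\<bar> powr (\<gamma> - 2)) * (2 * pi * \<i> * of_int k))"

text \<open>
  Squared Sobolev norm and squared homogeneous seminorm of the distribution whose Fourier
  coefficients are \<open>c\<close>.
\<close>
definition Hs_sq :: "real \<Rightarrow> (int \<Rightarrow> complex) \<Rightarrow> ennreal" where
  "Hs_sq s c = (\<integral>\<^sup>+k. ennreal ((1 + (2 * pi * of_int k)\<^sup>2) powr s * (cmod (c k))\<^sup>2) \<partial>count_space UNIV)"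

definition Hs_hom_sq :: "real \<Rightarrow> (int \<Rightarrow> complex) \<Rightarrow> ennreal" where
  "Hs_hom_sq s c = (\<integral>\<^sup>+k. ennreal (\<bar>2 * pi * of_int k\<bar> powr (2 * s) * (cmod (c k))\<^sup>2) \<partial>count_space UNIV)"

definition in_Hs :: "real \<Rightarrow> (real \<Rightarrow> real) \<Rightarrow> bool" where
  "in_Hs s f \<longleftrightarrow> periodic1 f \<and> f \<in> borel_measurable borel \<and>
     set_integrable lborel {0..1} (\<lambda>x. (f x)\<^sup>2) \<and> Hs_sq s (fc f) < \<infinity>"

definition L1_norm :: "(real \<Rightarrow> real) \<Rightarrow> ennreal" where
  "L1_norm f = (\<integral>\<^sup>+x\<in>{0..1}. ennreal \<bar>f x\<bar> \<partial>lborel)"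

definition L2_sq :: "(real \<Rightarrow> real) \<Rightarrow> ennreal" where
  "L2_sq f = (\<integral>\<^sup>+x\<in>{0..1}. ennreal ((f x)\<^sup>2) \<partial>lborel)"

definition dyadic_partition :: "(real \<Rightarrow> real) \<Rightarrow> (real \<Rightarrow> real) \<Rightarrow> bool" where
  "dyadic_partition \<theta> \<phi> \<longleftrightarrow>
     smooth \<theta> \<and> smooth \<phi> \<and>
     (\<forall>\<xi>. \<theta> (- \<xi>) = \<theta> \<xi> \<and> \<phi> (- \<xi>) = \<phi> \<xi>) \<and>
     (\<forall>\<xi>. 0 \<le> \<theta> \<xi> \<and> \<theta> \<xi> \<le> 1 \<and> 0 \<le> \<phi> \<xi> \<and> \<phi> \<xi> \<le> 1) \<and>
     (\<forall>\<xi>. \<theta> \<xi> \<noteq> 0 \<longrightarrow> \<bar>\<xi>\<bar> \<le> 4 / 3) \<and>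
     (\<forall>\<xi>. \<phi> \<xi> \<noteq> 0 \<longrightarrow> 3 / 4 \<le> \<bar>\<xi>\<bar> \<and> \<bar>\<xi>\<bar> \<le> 8 / 3) \<and>
     (\<forall>\<xi>. (\<lambda>j. \<phi> (\<xi> / 2 ^ j)) sums (1 - \<theta> \<xi>))"

text \<open>
  Blocks are indexed by \<^typ>\<open>nat\<close>: index \<open>0\<close> is the low-frequency block (usually numbered
  \<open>-1\<close>) and index \<open>Suc j\<close> the block at frequency \<open>2\<^sup>j\<close>.
\<close>
fun lp_symbol :: "(real \<Rightarrow> real) \<Rightarrow> (real \<Rightarrow> real) \<Rightarrow> nat \<Rightarrow> real \<Rightarrow> real" where
  "lp_symbol \<theta> \<phi> 0 \<xi> = \<theta> \<xi>"
| "lp_symbol \<theta> \<phi> (Suc j) \<xi> = \<phi> (\<xi> / 2 ^ j)"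

definition lp_block ::
  "(real \<Rightarrow> real) \<Rightarrow> (real \<Rightarrow> real) \<Rightarrow> nat \<Rightarrow> (real \<Rightarrow> real) \<Rightarrow> real \<Rightarrow> real" where
  "lp_block \<theta> \<phi> J f x =
     Re (\<Sum>k | lp_symbol \<theta> \<phi> J (of_int k) \<noteq> 0.
           of_real (lp_symbol \<theta> \<phi> J (of_int k)) * fc f k * cis (2 * pi * of_int k * x))"

text \<open>The Hoelder--Zygmund space \<open>C\<^sup>s\<close> (that is, \<open>B\<^sup>s\<close> with both indices infinite) and
  the space \<open>B\<^sup>s\<close> with both indices equal to one.\<close>
definition C_norm :: "(real \<Rightarrow> real) \<Rightarrow> (real \<Rightarrow> real) \<Rightarrow> real \<Rightarrow> (real \<Rightarrow> real) \<Rightarrow> ennreal" where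
  "C_norm \<theta> \<phi> s f =
     (SUP J::nat. ennreal (2 powr ((real J - 1) * s)) * (SUP x. ennreal \<bar>lp_block \<theta> \<phi> J f x\<bar>))"

definition B11_norm :: "(real \<Rightarrow> real) \<Rightarrow> (real \<Rightarrow> real) \<Rightarrow> real \<Rightarrow> (real \<Rightarrow> real) \<Rightarrow> ennreal" where
  "B11_norm \<theta> \<phi> s f =
     (\<Sum>J::nat. ennreal (2 powr ((real J - 1) * s)) * L1_norm (lp_block \<theta> \<phi> J f))"

text \<open>Bony's paraproduct \<open>u \<prec> v\<close>, the sum of \<open>S\<^bsub>j-1\<^esub> u \<cdot> \<Delta>\<^sub>j v\<close>, where \<open>S\<^bsub>j-1\<^esub>\<close> is the sum of
  the blocks numbered at most \<open>j - 2\<close>.\<close>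
definition para ::
  "(real \<Rightarrow> real) \<Rightarrow> (real \<Rightarrow> real) \<Rightarrow> (real \<Rightarrow> real) \<Rightarrow> (real \<Rightarrow> real) \<Rightarrow> real \<Rightarrow> real" where
  "para \<theta> \<phi> u v x = (\<Sum>J::nat. (\<Sum>I<J - 1. lp_block \<theta> \<phi> I u x) * lp_block \<theta> \<phi> J v x)"

definition Psi :: "(real \<Rightarrow> real \<Rightarrow> real) \<Rightarrow> real \<Rightarrow> real \<Rightarrow> real" where
  "Psi \<psi> t x = x + \<psi> t x"

definition Jac :: "(real \<Rightarrow> real \<Rightarrow> real) \<Rightarrow> real \<Rightarrow> real \<Rightarrow> real" where
  "Jac \<psi> t = deriv (Psi \<psi> t)"

definition Phi :: "(real \<Rightarrow> real \<Rightarrow> real) \<Rightarrow> real \<Rightarrow> real \<Rightarrow> real" where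
  "Phi \<psi> t = inv (Psi \<psi> t)"

definition coef_a :: "(real \<Rightarrow> real \<Rightarrow> real) \<Rightarrow> real \<Rightarrow> real \<Rightarrow> real" where
  "coef_a \<psi> t y = (Jac \<psi> t (Phi \<psi> t y))\<^sup>2"

definition coef_Q0 ::
  "(real \<Rightarrow> real \<Rightarrow> real) \<Rightarrow> (real \<Rightarrow> real \<Rightarrow> real) \<Rightarrow> real \<Rightarrow> real \<Rightarrow> real" where
  "coef_Q0 l \<psi> t y = l t (Phi \<psi> t y) * Jac \<psi> t (Phi \<psi> t y)"

definition coef_Q ::
  "real \<Rightarrow> (real \<Rightarrow> real \<Rightarrow> real) \<Rightarrow> (real \<Rightarrow> real \<Rightarrow> real) \<Rightarrow> real \<Rightarrow> real \<Rightarrow> real" where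
  "coef_Q lam l \<psi> t y = coef_Q0 l \<psi> t y + lam / 2 * \<psi> t (Phi \<psi> t y)"

definition coef_R ::
  "(real \<Rightarrow> real \<Rightarrow> real) \<Rightarrow> (real \<Rightarrow> real \<Rightarrow> real) \<Rightarrow> real \<Rightarrow> real \<Rightarrow> real" where
  "coef_R l \<psi> t y = (l t (Phi \<psi> t y))\<^sup>2"

text \<open>For \<open>\<gamma> = 2\<close> the operator \<open>- \<partial>\<^sub>y \<D> f\<close> is the divergence-form operator \<open>- \<partial>\<^sub>y (a f\<^sub>y)\<close>.\<close>
definition Dop ::
  "real \<Rightarrow> (real \<Rightarrow> real \<Rightarrow> real) \<Rightarrow> real \<Rightarrow> (real \<Rightarrow> real) \<Rightarrow> real \<Rightarrow> real" where
  "Dop \<gamma> \<psi> t f y =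
     (if \<gamma> = 2 then coef_a \<psi> t y * deriv f y
      else Riesz \<gamma> (\<lambda>x. Jac \<psi> t x * f (Psi \<psi> t x)) (Phi \<psi> t y)
           + f (Psi \<psi> t (Phi \<psi> t y)) * Lam \<gamma> (\<psi> t) (Phi \<psi> t y))"

text \<open>Fourier coefficients of the distribution \<open>\<A> f = - \<partial>\<^sub>y \<D> f\<close>.\<close>
definition Aop_fc ::
  "real \<Rightarrow> (real \<Rightarrow> real \<Rightarrow> real) \<Rightarrow> real \<Rightarrow> (real \<Rightarrow> real) \<Rightarrow> int \<Rightarrow> complex" where
  "Aop_fc \<gamma> \<psi> t f k = - (2 * pi * \<i> * of_int k) * fc (Dop \<gamma> \<psi> t f) k"

definition pairing :: "(int \<Rightarrow> complex) \<Rightarrow> (int \<Rightarrow> complex) \<Rightarrow> real" where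
  "pairing c d = (\<Sum>\<^sub>\<infinity>k. Re (c k * cnj (d k)))"

definition Sop ::
  "(real \<Rightarrow> real) \<Rightarrow> (real \<Rightarrow> real) \<Rightarrow> real \<Rightarrow> (real \<Rightarrow> real \<Rightarrow> real) \<Rightarrow> real \<Rightarrow> (real \<Rightarrow> real) \<Rightarrow> real \<Rightarrow> real"
where
  "Sop \<theta> \<phi> \<gamma> \<psi> t f y =
     Dop \<gamma> \<psi> t f y - para \<theta> \<phi> (\<lambda>z. Jac \<psi> t (Phi \<psi> t z) powr \<gamma>) (Riesz \<gamma> f) y"

definition transformed_solution ::
  "real \<Rightarrow> real \<Rightarrow> real \<Rightarrow> (real \<Rightarrow> real \<Rightarrow> real) \<Rightarrow> (real \<Rightarrow> real \<Rightarrow> real) \<Rightarrow>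
   (real \<Rightarrow> real \<Rightarrow> real) \<Rightarrow> bool" where
  "transformed_solution \<gamma> T lam l \<psi> m \<longleftrightarrow>
     smooth_strip T l \<and> smooth_strip T \<psi> \<and> smooth_strip T m \<and>
     (\<forall>t\<in>{0..T}. \<forall>y.
        ((\<lambda>s. m s y) has_real_derivative
           deriv (Dop \<gamma> \<psi> t (m t)) y
           + deriv (\<lambda>z. coef_a \<psi> t z * (m t z)\<^sup>2 + 2 * coef_Q lam l \<psi> t z * m t z
                        + coef_R l \<psi> t z) y)
          (at t within {0..T}))"

definition elliptic_bilipschitz ::
  "real \<Rightarrow> (real \<Rightarrow> real \<Rightarrow> real) \<Rightarrow> real \<Rightarrow> real \<Rightarrow> real \<Rightarrow> bool" where
  "elliptic_bilipschitz T \<psi> J0 J1 L \<longleftrightarrow>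
     (\<forall>t\<in>{0..T}. (\<forall>x. J0 \<le> Jac \<psi> t x \<and> Jac \<psi> t x \<le> J1) \<and>
        L-lipschitz_on UNIV (Psi \<psi> t) \<and> L-lipschitz_on UNIV (Phi \<psi> t))"

text \<open>\<open>CS \<sigma>\<close> is the constant of the remainder bound at regularity \<open>\<sigma>\<close>.\<close>
definition operator_bounds ::
  "(real \<Rightarrow> real) \<Rightarrow> (real \<Rightarrow> real) \<Rightarrow> real \<Rightarrow> real \<Rightarrow> real \<Rightarrow> (real \<Rightarrow> real \<Rightarrow> real) \<Rightarrow>
   (real \<Rightarrow> real) \<Rightarrow> real \<Rightarrow> real \<Rightarrow> real \<Rightarrow> real \<Rightarrow> bool" where
  "operator_bounds \<theta> \<phi> \<gamma> \<beta> T \<psi> CS CD CA c0 c1 \<longleftrightarrow>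
     (\<forall>t\<in>{0..T}. \<forall>f. in_Hs (\<gamma> / 2) f \<longrightarrow>
        (\<forall>\<sigma>. \<sigma> < min (\<gamma> / 2) (1 - \<gamma> / 2 + \<beta>) \<longrightarrow>
           Hs_sq \<sigma> (fc (Sop \<theta> \<phi> \<gamma> \<psi> t f)) \<le> ennreal ((CS \<sigma>)\<^sup>2) * Hs_sq (\<gamma> / 2) (fc f)) \<and>
        Hs_sq (1 - \<gamma> / 2) (fc (Dop \<gamma> \<psi> t f)) \<le> ennreal (CD\<^sup>2) * Hs_sq (\<gamma> / 2) (fc f) \<and>
        Hs_sq (- \<gamma> / 2) (Aop_fc \<gamma> \<psi> t f) \<le> ennreal (CA\<^sup>2) * Hs_sq (\<gamma> / 2) (fc f) \<and>
        ennreal c0 * Hs_hom_sq (\<gamma> / 2) (fc f) \<le> ennreal (pairing (fc f) (Aop_fc \<gamma> \<psi> t f)) \<and>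
        ennreal (pairing (fc f) (Aop_fc \<gamma> \<psi> t f)) \<le> ennreal c1 * Hs_hom_sq (\<gamma> / 2) (fc f))"

definition ennpowr :: "ennreal \<Rightarrow> real \<Rightarrow> ennreal" where
  "ennpowr x p = (if x = \<infinity> then \<infinity> else ennreal (enn2real x powr p))"

definition coefficient_bounds ::
  "(real \<Rightarrow> real) \<Rightarrow> (real \<Rightarrow> real) \<Rightarrow> real \<Rightarrow> real \<Rightarrow> real \<Rightarrow> real \<Rightarrow> real \<Rightarrow>
   (real \<Rightarrow> real \<Rightarrow> real) \<Rightarrow> (real \<Rightarrow> real \<Rightarrow> real) \<Rightarrow> real \<Rightarrow> real \<Rightarrow> real \<Rightarrow> real \<Rightarrow> bool" where
  "coefficient_bounds \<theta> \<phi> \<gamma> \<beta> \<rho> T lam l \<psi> Ma MQ0 MQ MR \<longleftrightarrow>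
     (AE t in lborel. t \<in> {0..T} \<longrightarrow> C_norm \<theta> \<phi> \<beta> (coef_a \<psi> t) \<le> ennreal Ma) \<and>
     (let p = \<gamma> / (\<gamma> - 1) in
        (\<integral>\<^sup>+t\<in>{0..T}. ennpowr (C_norm \<theta> \<phi> \<rho> (coef_Q0 l \<psi> t)) p \<partial>lborel) \<le> ennreal (MQ0 powr p) \<and>
        (\<integral>\<^sup>+t\<in>{0..T}. ennpowr (C_norm \<theta> \<phi> \<rho> (coef_Q lam l \<psi> t)) p \<partial>lborel) \<le> ennreal (MQ powr p)) \<and>
     (\<integral>\<^sup>+t\<in>{0..T}. Hs_sq (1 - \<gamma> / 2) (fc (coef_R l \<psi> t)) \<partial>lborel) \<le> ennreal (MR\<^sup>2)"

text \<open>
  A smooth transformed solution together with all bounds assumed on it: ellipticity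
  constants \<open>J0\<close>, \<open>J1\<close>, bi-Lipschitz constant \<open>L\<close>, coefficient bounds \<open>Ma\<close>, \<open>MQ0\<close>, \<open>MQ\<close>, \<open>MR\<close>, and
  (for \<open>\<gamma> < 2\<close> only) operator bounds \<open>CS\<close>, \<open>CD\<close>, \<open>CA\<close>, \<open>c0\<close>, \<open>c1\<close>.
\<close>
definition bounded_solution ::
  "(real \<Rightarrow> real) \<Rightarrow> (real \<Rightarrow> real) \<Rightarrow> real \<Rightarrow> real \<Rightarrow> real \<Rightarrow>
   real \<Rightarrow> real \<Rightarrow> real \<Rightarrow> real \<Rightarrow> real \<Rightarrow> real \<Rightarrow> real \<Rightarrow> real \<Rightarrow>
   (real \<Rightarrow> real) \<Rightarrow> real \<Rightarrow> real \<Rightarrow> real \<Rightarrow> real \<Rightarrow>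
   real \<Rightarrow> (real \<Rightarrow> real \<Rightarrow> real) \<Rightarrow> (real \<Rightarrow> real \<Rightarrow> real) \<Rightarrow> (real \<Rightarrow> real \<Rightarrow> real) \<Rightarrow> bool" where
  "bounded_solution \<theta> \<phi> \<gamma> \<beta> \<rho> T J0 J1 L Ma MQ0 MQ MR CS CD CA c0 c1 lam l \<psi> m \<longleftrightarrow>
     0 < T \<and> 0 \<le> lam \<and> transformed_solution \<gamma> T lam l \<psi> m \<and>
     0 < J0 \<and> elliptic_bilipschitz T \<psi> J0 J1 L \<and>
     coefficient_bounds \<theta> \<phi> \<gamma> \<beta> \<rho> T lam l \<psi> Ma MQ0 MQ MR \<and>
     (\<gamma> < 2 \<longrightarrow> 0 < c0 \<and> operator_bounds \<theta> \<phi> \<gamma> \<beta> T \<psi> CS CD CA c0 c1)"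

definition convex_cutoff :: "(real \<Rightarrow> real) \<Rightarrow> bool" where
  "convex_cutoff \<eta> \<longleftrightarrow>
     smooth \<eta> \<and> (\<forall>z. \<eta> (- z) = \<eta> z) \<and> convex_on UNIV \<eta> \<and>
     (\<forall>z. \<bar>deriv \<eta> z\<bar> \<le> 1) \<and>
     (\<exists>C. \<forall>z. 0 \<le> deriv (deriv \<eta>) z \<and> deriv (deriv \<eta>) z \<le> C) \<and>
     closure {z. deriv (deriv \<eta>) z \<noteq> 0} \<subseteq> {z. \<bar>z\<bar> \<le> 1} \<and>
     (\<exists>C. \<forall>z. 0 \<le> \<eta> z - \<bar>z\<bar> \<and> \<eta> z - \<bar>z\<bar> \<le> C)"

definition N_fun ::
  "(real \<Rightarrow> real) \<Rightarrow> real \<Rightarrow> real \<Rightarrow> real \<Rightarrow>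
   (real \<Rightarrow> real \<Rightarrow> real) \<Rightarrow> (real \<Rightarrow> real \<Rightarrow> real) \<Rightarrow> (real \<Rightarrow> real \<Rightarrow> real) \<Rightarrow> ennreal" where
  "N_fun \<eta> \<gamma> T lam l \<psi> m =
     (\<integral>\<^sup>+y\<in>{0..1}. ennreal (\<eta> (m 0 y)) \<partial>lborel)
     + (\<integral>\<^sup>+t\<in>{0..T}. Hs_hom_sq (1 - \<gamma> / 2) (fc (coef_a \<psi> t)) \<partial>lborel)
     + (\<integral>\<^sup>+t\<in>{0..T}. Hs_sq (1 - \<gamma> / 2) (fc (coef_Q0 l \<psi> t)) \<partial>lborel)
     + (\<integral>\<^sup>+t\<in>{0..T}. Hs_sq (1 - \<gamma> / 2) (fc (coef_R l \<psi> t)) \<partial>lborel)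
     + ennreal lam * (\<integral>\<^sup>+t\<in>{0..T}. L1_norm (\<lambda>x. Jac \<psi> t x - 1) \<partial>lborel)"

definition Z_fun ::
  "(real \<Rightarrow> real) \<Rightarrow> (real \<Rightarrow> real) \<Rightarrow> real \<Rightarrow> real \<Rightarrow> (real \<Rightarrow> real \<Rightarrow> real) \<Rightarrow> ennreal" where
  "Z_fun \<theta> \<phi> \<beta> T m = (\<integral>\<^sup>+t\<in>{0..T}. B11_norm \<theta> \<phi> (1 - \<beta>) (\<lambda>y. (m t y) ^ 3) \<partial>lborel)"

definition K_fun :: "real \<Rightarrow> real \<Rightarrow> (real \<Rightarrow> real \<Rightarrow> real) \<Rightarrow> ennreal" where
  "K_fun s T m =
     (\<integral>\<^sup>+t\<in>{0..T}. (\<integral>\<^sup>+h\<in>{0..1}. ennreal (h powr (- 1 - 3 * s)) *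
        (\<integral>\<^sup>+y\<in>{0..1}. ennreal (\<bar>m t (y + h) - m t y\<bar> ^ 3) \<partial>lborel) \<partial>lborel) \<partial>lborel)"

definition energy_fun :: "real \<Rightarrow> real \<Rightarrow> (real \<Rightarrow> real \<Rightarrow> real) \<Rightarrow> ennreal" where
  "energy_fun \<gamma> T m =
     (SUP t\<in>{0..T}. L2_sq (m t)) + (\<integral>\<^sup>+t\<in>{0..T}. Hs_sq (\<gamma> / 2) (fc (m t)) \<partial>lborel)"

definition initial_bounds :: "(real \<Rightarrow> real \<Rightarrow> real) \<Rightarrow> real \<Rightarrow> real \<Rightarrow> bool" where
  "initial_bounds m M1 M2 \<longleftrightarrow> L1_norm (m 0) \<le> ennreal M1 \<and> L2_sq (m 0) \<le> ennreal (M2\<^sup>2)"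

end

(* Along every increasing eta' the operator is coercive, the pairing of eta'(m) with A m being bounded
below by the homogeneous norm of eta'(m): in the original variable x, finite differences in place of
the Fourier symbol turn this into a pointwise inequality between Bregman distances, and integrating
in h recovers the symbol. With eta = chi the fluxes chi''(m) m^i m_y are derivatives of functions of m
whose increments are dominated by those of chi'(m); they are absorbed by coercivity at the cost of the
Sobolev norms of the coefficients, which gives the L1 bound, the corrector costing only the integral
of |J - 1|.

The L2 balance contains the integrals of a_y m^3 and Q_y m^2 with merely Hoelder continuous a and Q.
A sewing argument bounds them by L1 moduli of m^3 and m^2, which the energy does not control alone.
The balance for the integral of |d| d, d = m(y + h) - m(y), has the good term a |d|^3 (Karman,
Howarth, Monin); integrated against h^(-1-3s) and combined with the L1 bound it controls an L^q norm
with q > 3. Both balances then become linear inequalities in the energy, the dissipation and this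
norm with small coefficients, and they close by absorption. *)
theory Submission
  imports Defs
begin

subsection \<open>Integrals over a period\<close>

text \<open>The assumed coercivity pairs A f with f itself, whereas the entropy balance pairs A m
  with a nonlinear function of m; that calls for the structure of D. The L1 bound is derived twice:
  N_T contains \<lambda> ||J - 1||, which the given constants do not control, so the bounds uniform
  in \<lambda> rest on a second version where a and Q_\<lambda> enter by their Hoelder bounds.
  Exponents: an \<alpha> below \<beta> and \<rho> with \<alpha> + \<gamma>/2 > 1 leaves an excess,
  half of which is spent on \<kappa>. Trading a power \<kappa> of the increments for size lowers the
  order of the moduli to \<sigma> = (1 - \<kappa>) \<gamma>/2, still with \<alpha> + \<sigma> > 1,
  and makes all products strictly subcritical for energy, dissipation and an L^q norm with q < 4; q
  = 4 would mean s = 1/3, where h^(-3s) stops being integrable. Subcriticality supplies small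
  factors, chosen in order: \<epsilon> absorbs the L^q norm in its own inequality, then \<delta>,
  depending on \<epsilon>, closes the energy inequality. Absorption is legitimate since smooth
  solutions have finite norms.\<close>

definition cper :: "(real \<Rightarrow> 'a::banach) \<Rightarrow> bool" where
  "cper f \<longleftrightarrow> periodic1 f \<and> continuous_on UNIV f"

text \<open>The derivative is carried as an explicit function instead of \<open>deriv f\<close>, so
  that sums, products, shifts and compositions deliver it in closed form, ready for integration by
  parts.\<close>

definition c1per :: "(real \<Rightarrow> real) \<Rightarrow> (real \<Rightarrow> real) \<Rightarrow> bool" where
  "c1per f f' \<longleftrightarrow> periodic1 f \<and> cper f' \<and> (\<forall>x. (f has_real_derivative f' x) (at x))"

abbreviation pint :: "(real \<Rightarrow> 'a::banach) \<Rightarrow> 'a" where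
  "pint f \<equiv> integral {0..1} f"

lemma cperI: "\<lbrakk>\<And>x. f (x + 1) = f x; continuous_on UNIV f\<rbrakk> \<Longrightarrow> cper f"
  by (simp add: cper_def periodic1_def)

lemma cper_periodic: "cper f \<Longrightarrow> f (x + 1) = f x"
  by (simp add: cper_def periodic1_def)

lemma cper_cont: "cper f \<Longrightarrow> continuous_on A f"
  unfolding cper_def using continuous_on_subset by blast

lemma cper_isCont: "cper f \<Longrightarrow> isCont f x"
  unfolding cper_def by (simp add: continuous_on_eq_continuous_at)

lemma cper_const [simp]: "cper (\<lambda>x. c)"
  by (simp add: cper_def periodic1_def)

lemma cper_add: "cper f \<Longrightarrow> cper g \<Longrightarrow> cper (\<lambda>x. f x + g x)"
  by (auto simp: cper_def periodic1_def intro: continuous_intros)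

lemma cper_diff: "cper f \<Longrightarrow> cper g \<Longrightarrow> cper (\<lambda>x. f x - g x)"
  by (auto simp: cper_def periodic1_def intro: continuous_intros)

lemma cper_minus: "cper f \<Longrightarrow> cper (\<lambda>x. - f x)"
  by (auto simp: cper_def periodic1_def intro: continuous_intros)

lemma cper_mult:
  fixes f g :: "real \<Rightarrow> 'a::{banach, real_normed_algebra}"
  shows "cper f \<Longrightarrow> cper g \<Longrightarrow> cper (\<lambda>x. f x * g x)"
  by (auto simp: cper_def periodic1_def intro: continuous_intros)

lemma cper_power:
  fixes f :: "real \<Rightarrow> 'a::{banach, real_normed_algebra_1}"
  shows "cper f \<Longrightarrow> cper (\<lambda>x. f x ^ n)"
  by (auto simp: cper_def periodic1_def intro: continuous_intros)

lemma cper_compose: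
  "cper f \<Longrightarrow> continuous_on UNIV F \<Longrightarrow> cper (\<lambda>x. F (f x))"
  by (auto simp: cper_def periodic1_def intro: continuous_on_compose2)

lemma cper_abs: "cper (f :: real \<Rightarrow> real) \<Longrightarrow> cper (\<lambda>x. \<bar>f x\<bar>)"
  by (auto simp: cper_def periodic1_def intro: continuous_intros)

lemma cper_norm: "cper f \<Longrightarrow> cper (\<lambda>x. norm (f x))"
  by (auto simp: cper_def periodic1_def intro: continuous_intros)

lemma cper_of_real: "cper f \<Longrightarrow> cper (\<lambda>x. complex_of_real (f x))"
  by (auto simp: cper_def periodic1_def intro: continuous_intros)

lemma cper_shift: "cper f \<Longrightarrow> cper (\<lambda>x. f (x + h))"
  unfolding cper_def periodic1_def
  by (auto intro!: continuous_on_compose2[of UNIV f] continuous_intros simp: algebra_simps)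
     (metis add.assoc add.commute)

lemmas cper_intros = cper_const cper_add cper_diff cper_minus cper_mult cper_power cper_abs
  cper_norm cper_of_real cper_shift

lemma c1per_cper: "c1per f f' \<Longrightarrow> cper f"
  unfolding c1per_def cper_def
  by (meson DERIV_isCont continuous_at_imp_continuous_on)

lemma c1per_cper': "c1per f f' \<Longrightarrow> cper f'"
  by (simp add: c1per_def)

lemma c1per_deriv: "c1per f f' \<Longrightarrow> (f has_real_derivative f' x) (at x)"
  by (simp add: c1per_def)

text \<open>Periodicity of the derivative is inherited: \<open>f\<close> shifted by one period is
  \<open>f\<close> again, and derivatives are unique.\<close>

lemma c1perI:
  assumes "\<And>x. f (x + 1) = f x" "\<And>x. (f has_real_derivative f' x) (at x)"
    and "continuous_on UNIV f'"
  shows "c1per f f'"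
proof -
  have "f' (x + 1) = f' x" for x
  proof -
    have "((\<lambda>x. f (x + 1)) has_real_derivative f' (x + 1)) (at x)"
      using assms(2)[of "x + 1"] by (simp add: DERIV_shift)
    then show ?thesis using assms(1) assms(2)[of x] DERIV_unique by force
  qed
  then show ?thesis using assms by (auto simp: c1per_def cper_def periodic1_def)
qed

lemma c1per_const: "c1per (\<lambda>x. c) (\<lambda>x. 0)"
  by (auto simp: c1per_def periodic1_def)

lemma c1per_add: "c1per f f' \<Longrightarrow> c1per g g' \<Longrightarrow> c1per (\<lambda>x. f x + g x) (\<lambda>x. f' x + g' x)"
  unfolding c1per_def by (auto intro!: cper_intros derivative_eq_intros simp: periodic1_def)

lemma c1per_diff: "c1per f f' \<Longrightarrow> c1per g g' \<Longrightarrow> c1per (\<lambda>x. f x - g x) (\<lambda>x. f' x - g' x)"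
  unfolding c1per_def by (auto intro!: cper_intros derivative_eq_intros simp: periodic1_def)

lemma c1per_mult:
  assumes "c1per f f'" "c1per g g'" shows "c1per (\<lambda>x. f x * g x) (\<lambda>x. f' x * g x + f x * g' x)"
  using assms c1per_cper[OF assms(1)] c1per_cper[OF assms(2)]
  unfolding c1per_def
  by (auto intro!: cper_intros simp: periodic1_def) (auto intro!: derivative_eq_intros)

lemma c1per_cmult: "c1per f f' \<Longrightarrow> c1per (\<lambda>x. c * f x) (\<lambda>x. c * f' x)"
  unfolding c1per_def by (auto intro!: cper_intros derivative_eq_intros simp: periodic1_def)

lemma c1per_shift: "c1per f f' \<Longrightarrow> c1per (\<lambda>x. f (x + h)) (\<lambda>x. f' (x + h))"
  using cper_shift[of f h] cper_shift[of f' h] c1per_cper[of f f']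
  unfolding c1per_def by (auto simp: cper_def) (metis DERIV_shift)

lemma c1per_compose:
  assumes "c1per f f'" "\<And>z. (F has_real_derivative F' z) (at z)" "continuous_on UNIV F'"
  shows "c1per (\<lambda>x. F (f x)) (\<lambda>x. F' (f x) * f' x)"
  using assms(1) cper_compose[OF c1per_cper[OF assms(1)] assms(3)]
  unfolding c1per_def
  by (auto simp: periodic1_def intro!: cper_mult DERIV_chain2[where f = F] assms(2))

lemma cper_integrable [intro]: "cper (f :: real \<Rightarrow> 'a::euclidean_space) \<Longrightarrow> f integrable_on {a..b}"
  by (intro integrable_continuous_real cper_cont)

lemma periodic1_add_int: "periodic1 f \<Longrightarrow> f (x + of_int n) = f x"
proof (induction n arbitrary: x rule: int_induct[where k = 0])
  case (step1 i)
  then show ?case by (metis add.assoc of_int_1 of_int_add periodic1_def)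
next
  case (step2 i)
  have "f (x + of_int (i - 1) + 1) = f (x + of_int i)" by (simp add: algebra_simps)
  then show ?case using step2 by (metis periodic1_def)
qed simp

lemma cper_frac: "cper f \<Longrightarrow> f (frac x) = f x"
  using periodic1_add_int[of f x "- \<lfloor>x\<rfloor>"] by (simp add: cper_def frac_def)

text \<open>For a shift in {0..1} the part of the interval beyond 1 is folded back by periodicity; a
  general shift is first reduced to its fractional part.\<close>

lemma pint_shift:
  fixes f :: "real \<Rightarrow> 'a::euclidean_space"
  assumes "cper f" shows "pint (\<lambda>x. f (x + h)) = pint f"
proof -
  have frac_case: "pint (\<lambda>x. f (x + h)) = pint f" if "0 \<le> h" "h \<le> 1" for h
  proof -
    have "integral {0..1} (\<lambda>x. f (x + h)) = integral {h..1 + h} f"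
      using integral_shift_real_ivl[of h h "1 + h" f] by simp
    also have "\<dots> = integral {h..1} f + integral {1..1 + h} f"
      using Henstock_Kurzweil_Integration.integral_combine[of h 1 "1 + h" f] that
        cper_integrable[OF assms, of h "1 + h"] by auto
    also have "integral {1..1 + h} f = integral {0..h} (\<lambda>x. f (x + 1))"
      using integral_shift_real_ivl[of 1 1 "1 + h" f] by simp
    also have "\<dots> = integral {0..h} f" using assms by (simp add: cper_periodic)
    also have "integral {h..1} f + integral {0..h} f = integral {0..1} f"
      using Henstock_Kurzweil_Integration.integral_combine[of 0 h 1 f] that assms by (auto simp: add.commute)
    finally show ?thesis .
  qed
  have "f (x + h) = f (x + frac h)" for x
    using periodic1_add_int[of f "x + frac h" "\<lfloor>h\<rfloor>"] assms by (simp add: cper_def frac_def)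
  then show ?thesis using frac_case[of "frac h"] by (simp add: frac_ge_0 frac_lt_1 less_imp_le)
qed

lemma pint_deriv_0: "c1per f f' \<Longrightarrow> pint f' = 0"
proof -
  assume f: "c1per f f'"
  have "(f' has_integral (f 1 - f 0)) {0..1}"
    by (rule fundamental_theorem_of_calculus)
       (use f in \<open>auto simp: c1per_def has_real_derivative_iff_has_vector_derivative
          intro: has_vector_derivative_at_within\<close>)
  moreover have "f 1 = f 0" using cper_periodic[OF c1per_cper[OF f], of 0] by simp
  ultimately show ?thesis by (simp add: integral_unique)
qed

lemma pint_add:
  fixes f :: "real \<Rightarrow> 'a::euclidean_space"
  shows "cper f \<Longrightarrow> cper g \<Longrightarrow> pint (\<lambda>x. f x + g x) = pint f + pint g"
  by (intro Henstock_Kurzweil_Integration.integral_add cper_integrable)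

lemma pint_diff:
  fixes f :: "real \<Rightarrow> 'a::euclidean_space"
  shows "cper f \<Longrightarrow> cper g \<Longrightarrow> pint (\<lambda>x. f x - g x) = pint f - pint g"
  by (intro Henstock_Kurzweil_Integration.integral_diff cper_integrable)

lemma pint_cmult: "pint (\<lambda>x. c * f x) = c * pint f" for c :: real
  by simp

lemma pint_mono:
  fixes f g :: "real \<Rightarrow> real"
  shows "cper f \<Longrightarrow> cper g \<Longrightarrow> (\<And>x. f x \<le> g x) \<Longrightarrow> pint f \<le> pint g"
  by (intro integral_le cper_integrable) auto

lemma pint_nonneg: "cper f \<Longrightarrow> (\<And>x. 0 \<le> f x) \<Longrightarrow> 0 \<le> pint (f :: real \<Rightarrow> real)"
  by (intro Henstock_Kurzweil_Integration.integral_nonneg cper_integrable) auto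

lemma pint_abs_le: "cper f \<Longrightarrow> \<bar>pint f\<bar> \<le> pint (\<lambda>x. \<bar>f x\<bar> :: real)"
  using integral_norm_bound_integral[of f "{0..1}" "\<lambda>x. \<bar>f x\<bar>"] cper_integrable cper_abs by force

lemma pint_by_parts:
  assumes f: "c1per f f'" and g: "c1per g g'"
  shows "pint (\<lambda>x. f x * g' x) = - pint (\<lambda>x. f' x * g x)"
proof -
  have "0 = pint (\<lambda>x. f' x * g x + f x * g' x)"
    using pint_deriv_0[OF c1per_mult[OF f g]] by simp
  also have "\<dots> = pint (\<lambda>x. f' x * g x) + pint (\<lambda>x. f x * g' x)"
    by (intro pint_add cper_intros c1per_cper[OF f] c1per_cper[OF g] c1per_cper'[OF f] c1per_cper'[OF g])
  finally show ?thesis by simp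
qed

lemma cper_bounded:
  fixes f :: "real \<Rightarrow> real"
  assumes "cper f" obtains B where "0 \<le> B" "\<And>x. \<bar>f x\<bar> \<le> B"
proof -
  have "compact (f ` {0..1})" by (intro compact_continuous_image cper_cont assms) simp
  then obtain B where B: "\<And>x. x \<in> {0..1} \<Longrightarrow> \<bar>f x\<bar> \<le> B"
    by (force simp: bounded_iff dest: compact_imp_bounded)
  have "\<bar>f x\<bar> \<le> B" for x
    using B[of "frac x"] cper_frac[OF assms, of x] by (simp add: frac_ge_0 frac_lt_1 less_imp_le)
  moreover have "0 \<le> B" using B[of 0] by fastforce
  ultimately show ?thesis using that by blast
qed

lemma pint_LINT:
  fixes f :: "real \<Rightarrow> 'a::euclidean_space"
  assumes "cper f" shows "(LINT x:{0..1}|lborel. f x) = pint f"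
  by (intro set_borel_integral_eq_integral(2) borel_integrable_atLeastAtMost'  cper_cont assms)

lemma pint_nn:
  fixes f :: "real \<Rightarrow> real"
  assumes "cper f" "\<And>x. 0 \<le> f x"
  shows "(\<integral>\<^sup>+x\<in>{0..1}. ennreal (f x) \<partial>lborel) = ennreal (pint f)"
  using cper_integrable[OF assms(1)] assms(2)
  by (intro nn_integral_has_integral_lebesgue') (auto simp: has_integral_integral)

subsection \<open>Fourier coefficients and Parseval's identity\<close>

abbreviation ek :: "int \<Rightarrow> real \<Rightarrow> complex" where
  "ek k x \<equiv> cis (2 * pi * of_int k * x)"

text \<open>The symbol of the squared L2 norm of the increment by \<open>h\<close>, equal to 2 - 2
  cos (2 pi k h). Fractional seminorms are reached through it, because pointwise inequalities
  between increments become inequalities for this symbol after Parseval.\<close>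

definition fsym :: "real \<Rightarrow> int \<Rightarrow> real" where
  "fsym h k = (cmod (ek k h - 1))\<^sup>2"

lemma fsym_nonneg: "0 \<le> fsym h k" by (simp add: fsym_def)

lemma cis_int [simp]: "ek k (of_int n) = 1"
proof -
  have "2 * pi * of_int k * of_int n = 2 * pi * (of_int (k * n) :: real)" by simp
  then show ?thesis by (metis Ints_of_int cis_multiple_2pi)
qed

lemma ek_1 [simp]: "ek k 1 = 1"
  using cis_int[of k 1] by simp

lemma cis_neg_int [simp]: "cis (- (2 * pi * of_int k)) = 1"
  using ek_1[of "-k"] by simp

lemma ek_add: "ek k (x + y) = ek k x * ek k y"
  by (simp add: cis_mult algebra_simps)

lemma cper_ek: "cper (ek k)"
  by (rule cperI) (simp_all add: ek_add, auto intro!: continuous_intros)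

lemma cper_ekm: "cper (\<lambda>x. cis (- 2 * pi * of_int k * x))"
  using cper_ek[of "- k"] by simp

lemma fc_pint: "cper f \<Longrightarrow> fc f k = pint (\<lambda>x. complex_of_real (f x) * cis (- 2 * pi * of_int k * x))"
  unfolding fc_def by (rule pint_LINT) (intro cper_mult cper_of_real cper_ekm)

lemma cper_fc: "cper f \<Longrightarrow> cper (\<lambda>x. complex_of_real (f x) * cis (- 2 * pi * of_int k * x))"
  by (intro cper_mult cper_of_real cper_ekm)

lemma fc_add: "cper f \<Longrightarrow> cper g \<Longrightarrow> fc (\<lambda>x. f x + g x) k = fc f k + fc g k"
  by (simp add: fc_pint cper_add distrib_right pint_add cper_fc[simplified])

lemma fc_diff: "cper f \<Longrightarrow> cper g \<Longrightarrow> fc (\<lambda>x. f x - g x) k = fc f k - fc g k"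
  by (simp add: fc_pint cper_diff left_diff_distrib pint_diff cper_fc[simplified])

lemma fc_shift: "cper f \<Longrightarrow> fc (\<lambda>x. f (x + h)) k = ek k h * fc f k"
proof -
  assume f: "cper f"
  have "fc (\<lambda>x. f (x + h)) k
      = pint (\<lambda>x. ek k h * (complex_of_real (f (x + h)) * cis (- 2 * pi * of_int k * (x + h))))"
    by (simp add: fc_pint[OF cper_shift[OF f]] algebra_simps cis_mult)
  also have "\<dots> = ek k h * pint (\<lambda>x. complex_of_real (f x) * cis (- 2 * pi * of_int k * x))"
    using pint_shift[OF cper_fc[OF f, of k], of h] by simp
  finally show ?thesis by (simp add: fc_pint f)
qed

lemma fc_delta: "cper f \<Longrightarrow> fc (\<lambda>x. f (x + h) - f x) k = (ek k h - 1) * fc f k"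
  by (simp add: fc_diff fc_shift cper_shift algebra_simps)

lemma norm_fc_le: "cper f \<Longrightarrow> cmod (fc f k) \<le> pint (\<lambda>x. \<bar>f x\<bar>)"
  unfolding fc_pint
  by (rule integral_norm_bound_integral)
     (use cper_integrable[OF cper_fc[of f k], of 0 1] cper_integrable[OF cper_abs[of f], of 0 1]
      in \<open>auto simp: norm_mult\<close>)

lemma pint_complex_Re: "cper f \<Longrightarrow> Re (pint f) = pint (\<lambda>x. Re (f x))"
  using integral_linear[OF cper_integrable[of f 0 1] bounded_linear_Re] by (simp add: o_def)

lemma fc_deriv: assumes "c1per f f'" shows "fc f' k = 2 * pi * \<i> * of_int k * fc f k"
proof -
  have c: "cper f" "cper f'" using assms c1per_cper c1per_cper' by auto
  let ?E = "\<lambda>x. cis (- 2 * pi * of_int k * x)"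
  let ?H = "\<lambda>x. complex_of_real (f' x) * ?E x + complex_of_real (f x) * (- (2 * pi * of_int k) * \<i> * ?E x)"
  have "((\<lambda>x. complex_of_real (f x) * ?E x) has_vector_derivative ?H x) (at x)" for x
  proof -
    have 1: "((\<lambda>x. complex_of_real (f x)) has_vector_derivative complex_of_real (f' x)) (at x)"
      using c1per_deriv[OF assms, of x] has_vector_derivative_of_real by blast
    have 2: "(?E has_vector_derivative (- (2 * pi * of_int k) * \<i> * ?E x)) (at x)"
      unfolding has_vector_derivative_def
      by (auto intro!: derivative_eq_intros simp: scaleR_conv_of_real algebra_simps)
    show ?thesis using has_vector_derivative_mult[OF 1 2] by (simp add: add.commute)
  qed
  then have "(?H has_integral (complex_of_real (f 1) * ?E 1 - complex_of_real (f 0) * ?E 0)) {0..1}"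
    by (intro fundamental_theorem_of_calculus) (auto intro: has_vector_derivative_at_within)
  moreover have "f 1 = f 0" using cper_periodic[OF c(1), of 0] by simp
  ultimately have "pint ?H = 0" by (simp add: integral_unique)
  moreover have "pint ?H = fc f' k - 2 * pi * of_int k * \<i> * fc f k"
  proof -
    have "pint ?H = pint (\<lambda>x. complex_of_real (f' x) * ?E x)
       + pint (\<lambda>x. - (2 * pi * of_int k * \<i>) * (complex_of_real (f x) * ?E x))"
      using pint_add[OF cper_fc[OF c(2), of k]
          cper_mult[OF cper_const cper_fc[OF c(1), of k], of "- (2 * pi * of_int k * \<i>)"]]
      by (simp add: algebra_simps)
    then show ?thesis by (simp only: integral_mult_right fc_pint c) simp
  qed
  ultimately show ?thesis by (simp add: algebra_simps)
qed

lemma fc_const: "fc (\<lambda>x. c) k = (if k = 0 then of_real c else 0)"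
proof (cases "k = 0")
  case True
  then show ?thesis by (simp add: fc_pint)
next
  case False
  have "0 = fc (\<lambda>x. 0 :: real) k" by (simp add: fc_pint)
  also have "\<dots> = 2 * pi * \<i> * of_int k * fc (\<lambda>x. c) k"
    by (rule fc_deriv) (rule c1per_const)
  finally show ?thesis using False by simp
qed

text \<open>The squared modulus makes nonnegativity evident; expanding it as a double sum over
  \<open>i - j\<close> yields the Fourier coefficients.\<close>

definition fejer :: "nat \<Rightarrow> real \<Rightarrow> real" where
  "fejer n t = (cmod (\<Sum>j<n. ek (int j) t))\<^sup>2 / real n"

lemma fejer_nonneg: "0 \<le> fejer n t" by (simp add: fejer_def)

lemma cper_fejer: "cper (fejer n)"
proof -
  have "cper (\<lambda>t. \<Sum>j<n. ek (int j) t)"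
    by (induction n) (auto intro: cper_add cper_ek[of "int _", simplified])
  then have "cper (\<lambda>t. (cmod (\<Sum>j<n. ek (int j) t))\<^sup>2 * (1 / real n))"
    by (intro cper_intros)
  then show ?thesis by (simp add: fejer_def[abs_def])
qed

lemma fejer_expand:
  "complex_of_real (fejer n t) = (\<Sum>i<n. \<Sum>j<n. cis (- 2 * pi * of_int (int i - int j) * t)) / of_nat n"
proof -
  have "complex_of_real ((cmod (\<Sum>j<n. ek (int j) t))\<^sup>2)
      = (\<Sum>j<n. ek (int j) t) * cnj (\<Sum>j<n. ek (int j) t)"
    by (rule complex_norm_square)
  also have "\<dots> = (\<Sum>j<n. \<Sum>i<n. ek (int j) t * cnj (ek (int i) t))"
    by (simp add: sum_product)
  also have "\<dots> = (\<Sum>i<n. \<Sum>j<n. ek (int j) t * cnj (ek (int i) t))"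
    by (rule sum.swap)
  also have "\<dots> = (\<Sum>i<n. \<Sum>j<n. cis (- 2 * pi * of_int (int i - int j) * t))"
    by (simp add: cis_cnj cis_mult algebra_simps)
  finally show ?thesis by (simp add: fejer_def)
qed

lemma pint_sum:
  fixes f :: "'i \<Rightarrow> real \<Rightarrow> 'a::euclidean_space"
  shows "finite I \<Longrightarrow> (\<And>i. i \<in> I \<Longrightarrow> cper (f i)) \<Longrightarrow> pint (\<lambda>x. \<Sum>i\<in>I. f i x) = (\<Sum>i\<in>I. pint (f i))"
  by (intro Henstock_Kurzweil_Integration.integral_sum) auto

lemma cper_sum:
  "(\<And>i. i \<in> I \<Longrightarrow> cper (f i)) \<Longrightarrow> cper (\<lambda>x. \<Sum>i\<in>I. f i x)"
  by (auto simp: cper_def periodic1_def intro: continuous_intros)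

lemma pint_fejer:
  assumes A: "cper A"
  shows "complex_of_real (pint (\<lambda>t. A t * fejer n t)) = (\<Sum>i<n. \<Sum>j<n. fc A (int i - int j)) / of_nat n"
proof -
  have "complex_of_real (pint (\<lambda>t. A t * fejer n t)) = pint (\<lambda>t. complex_of_real (A t * fejer n t))"
    using integral_linear[OF cper_integrable[OF cper_mult[OF A cper_fejer[of n]], of 0 1] bounded_linear_of_real[where 'a = complex]]
    by (simp add: o_def)
  also have "\<dots> = pint (\<lambda>t. (1 / of_nat n) * (\<Sum>i<n. \<Sum>j<n.
      complex_of_real (A t) * cis (- 2 * pi * of_int (int i - int j) * t)))"
    by (simp only: of_real_mult fejer_expand) (simp add: sum_distrib_left sum_divide_distrib)
  also have "\<dots> = (1 / of_nat n) * (\<Sum>i<n. \<Sum>j<n.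
      pint (\<lambda>t. complex_of_real (A t) * cis (- 2 * pi * of_int (int i - int j) * t)))"
    by (subst integral_mult_right, subst pint_sum, simp, intro cper_sum cper_fc A)
       (subst pint_sum, simp, intro cper_sum cper_fc A, simp)
  also have "\<dots> = (\<Sum>i<n. \<Sum>j<n. fc A (int i - int j)) / of_nat n"
    by (simp add: fc_pint A)
  finally show ?thesis .
qed

lemma pint_fejer_1: "n > 0 \<Longrightarrow> pint (fejer n) = 1"
proof -
  assume n: "n > 0"
  have "complex_of_real (pint (\<lambda>t. 1 * fejer n t))
      = (\<Sum>i<n. \<Sum>j<n. if int i - int j = 0 then 1 else 0) / of_nat n"
    by (subst pint_fejer) (simp_all add: fc_const)
  also have "\<dots> = (\<Sum>i<n. \<Sum>j<n. if j = i then 1 else 0) / of_nat n"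
    by (intro arg_cong2[where f = "(/)"] sum.cong) auto
  also have "\<dots> = 1" using n by simp
  finally show ?thesis by simp
qed

text \<open>Summing the geometric series bounds its modulus times |e^(2 pi i t) - 1| by 2. Hence the
  kernel is of size 1/n away from the integers, with \<open>fsym t 1\<close> measuring the distance
  to them.\<close>

lemma fejer_bound: "n > 0 \<Longrightarrow> fejer n t * fsym t 1 \<le> 4 / n"
proof -
  assume n: "n > 0"
  have ek_pow: "ek (int j) t = ek 1 t ^ j" for j
    by (subst Complex.DeMoivre) (simp add: algebra_simps)
  have "(ek 1 t - 1) * (\<Sum>j<n. ek (int j) t) = ek 1 t ^ n - 1"
    unfolding ek_pow by (rule power_diff_1_eq[symmetric])
  then have "cmod (\<Sum>j<n. ek (int j) t) * cmod (ek 1 t - 1) = cmod (ek 1 t ^ n - 1)"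
    by (metis mult.commute norm_mult)
  also have "\<dots> \<le> 2" using norm_triangle_ineq4[of "ek 1 t ^ n" 1] by (simp add: norm_power)
  finally have "(cmod (\<Sum>j<n. ek (int j) t) * cmod (ek 1 t - 1))\<^sup>2 \<le> 2\<^sup>2"
    by (intro power_mono) auto
  then show ?thesis using n by (simp add: fejer_def fsym_def field_simps)
qed

lemma sin_ge_quarter: "0 \<le> x \<Longrightarrow> x \<le> pi / 2 \<Longrightarrow> x / 4 \<le> sin x" for x :: real
proof -
  assume x: "0 \<le> x" "x \<le> pi / 2"
  have c: "1/2 \<le> cos z" if "0 \<le> z" "z \<le> 1" for z :: real
  proof -
    have "cos (pi / 3) \<le> cos z" using that pi_gt3 by (intro cos_monotone_0_pi_le) auto
    then show ?thesis by (simp add: cos_60)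
  qed
  have small: "z / 2 \<le> sin z" if z: "0 \<le> z" "z \<le> 1" for z :: real
  proof (cases "z = 0")
    case False
    then obtain w where "0 < w" "w < z" "sin z - sin 0 = (z - 0) * cos w"
      using MVT2[of 0 z sin cos] z by force
    moreover from this have "z * (1/2) \<le> z * cos w" using c[of w] z by (intro mult_left_mono) auto
    ultimately show ?thesis by simp
  qed simp
  show ?thesis
  proof (cases "x \<le> 1")
    case True
    then show ?thesis using small[of x] x by linarith
  next
    case False
    then have "sin 1 \<le> sin x" using x pi_gt3 by (intro sin_monotone_2pi_le) auto
    moreover have "x / 4 \<le> 1 / 2" using x pi_less_4 by linarith
    ultimately show ?thesis using small[of 1] by linarith
  qed
qed

text \<open>As \<open>fsym t 1\<close> = 4 sin^2 (pi t) is symmetric about 1/2, the crude bound sin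
  x >= x / 4 suffices: (pi / 2)^2 >= 1.\<close>

lemma fsym_lower: "0 \<le> t \<Longrightarrow> t \<le> 1 \<Longrightarrow> (min t (1 - t))\<^sup>2 \<le> fsym t 1"
proof -
  assume t: "0 \<le> t" "t \<le> 1"
  define r where "r = min t (1 - t)"
  have r: "0 \<le> r" "r \<le> 1/2" using t by (auto simp: r_def min_def)
  have "fsym t 1 = 2 - 2 * cos (2 * (pi * t))"
    using sin_cos_squared_add[of "2 * (pi * t)"]
    by (simp only: fsym_def cmod_power2) (simp add: power2_eq_square algebra_simps)
  also have "\<dots> = 4 * (sin (pi * t))\<^sup>2" unfolding cos_double_sin by simp
  also have "sin (pi * t) = sin (pi * r)"
  proof (cases "t \<le> 1 - t")
    case False
    have "sin (pi * (1 - t)) = sin (pi - pi * t)" by (simp add: algebra_simps)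
    then show ?thesis using False by (simp add: r_def min_def)
  qed (simp add: r_def min_def)
  finally have "fsym t 1 = 4 * (sin (pi * r))\<^sup>2" .
  moreover have "pi * r / 4 \<le> sin (pi * r)" using r by (intro sin_ge_quarter) auto
  then have "(pi * r / 4)\<^sup>2 \<le> (sin (pi * r))\<^sup>2" using r by (intro power_mono) auto
  moreover have "r\<^sup>2 \<le> 4 * (pi * r / 4)\<^sup>2"
  proof -
    have "(2 * r)\<^sup>2 \<le> (pi * r)\<^sup>2" using r pi_gt3 by (intro power_mono mult_right_mono) auto
    then show ?thesis by (simp add: power_mult_distrib power_divide)
  qed
  ultimately show ?thesis unfolding r_def by linarith
qed

lemma fejer_tendsto:
  assumes A: "cper A"
  shows "(\<lambda>n. pint (\<lambda>t. A t * fejer n t)) \<longlonglongrightarrow> A 0"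
proof -
  obtain B where B: "\<And>t. \<bar>A t\<bar> \<le> B" using cper_bounded[OF A] by blast
  \<comment> \<open>Continuity at the two copies 0 and 1 of the same point, put as a single
    inequality whose second term the kernel sends to zero by \<open>fejer_bound\<close>.\<close>
  have key: "\<exists>C\<ge>0. \<forall>t\<in>{0..1}. \<bar>A t - A 0\<bar> \<le> \<epsilon> + C * fsym t 1" if "\<epsilon> > 0" for \<epsilon>
  proof -
    have "\<exists>d>0. \<forall>t. \<bar>t - x\<bar> < d \<longrightarrow> \<bar>A t - A x\<bar> < \<epsilon>" for x
      using cper_isCont[OF A, of x] that unfolding continuous_at_eps_delta dist_real_def by blast
    from this[of 0] this[of 1] obtain d0 d1 where d01: "d0 > 0" "d1 > 0"
      "\<And>t. \<bar>t\<bar> < d0 \<Longrightarrow> \<bar>A t - A 0\<bar> < \<epsilon>" "\<And>t. \<bar>t - 1\<bar> < d1 \<Longrightarrow> \<bar>A t - A 1\<bar> < \<epsilon>"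
      by auto
    define d where "d = min d0 d1"
    have d: "0 < d" "0 \<le> 2 * B / d\<^sup>2" using d01 B[of 0] by (auto simp: d_def)
    have A1: "A 1 = A 0" using cper_periodic[OF A, of 0] by simp
    have "\<bar>A t - A 0\<bar> \<le> \<epsilon> + (2 * B / d\<^sup>2) * fsym t 1" if t: "t \<in> {0..1}" for t
    proof (cases "min t (1 - t) < d")
      case True
      then have "\<bar>t\<bar> < d0 \<or> \<bar>t - 1\<bar> < d1" using t by (auto simp: d_def)
      then have "\<bar>A t - A 0\<bar> < \<epsilon>" using d01 A1 by auto
      moreover have "0 \<le> (2 * B / d\<^sup>2) * fsym t 1" using d by (intro mult_nonneg_nonneg fsym_nonneg)
      ultimately show ?thesis by linarith
    next
      case False
      then have "d\<^sup>2 \<le> (min t (1 - t))\<^sup>2" using d by (intro power_mono) auto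
      also have "\<dots> \<le> fsym t 1" using t by (intro fsym_lower) auto
      finally have "(2 * B / d\<^sup>2) * d\<^sup>2 \<le> (2 * B / d\<^sup>2) * fsym t 1" by (rule mult_left_mono[OF _ d(2)])
      then have "2 * B \<le> (2 * B / d\<^sup>2) * fsym t 1" using d by simp
      then show ?thesis using B[of t] B[of 0] \<open>\<epsilon> > 0\<close> by linarith
    qed
    then show ?thesis using d(2) by blast
  qed
  show ?thesis
  proof (rule LIMSEQ_I)
    fix r :: real assume r: "r > 0"
    obtain C where C: "C \<ge> 0" "\<And>t. t \<in> {0..1} \<Longrightarrow> \<bar>A t - A 0\<bar> \<le> r / 2 + C * fsym t 1"
      using key[of "r / 2"] r by auto
    obtain N :: nat where N: "N > 0" "8 * C / r < N"
      using reals_Archimedean2[of "max (8 * C / r) 0"] by auto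
    have "\<bar>pint (\<lambda>t. A t * fejer n t) - A 0\<bar> < r" if n: "n \<ge> N" for n
    proof -
      have n0: "n > 0" using n N by simp
      have "pint (\<lambda>t. A t * fejer n t) - A 0 = pint (\<lambda>t. A t * fejer n t) - pint (\<lambda>t. A 0 * fejer n t)"
        using pint_fejer_1[OF n0] by simp
      also have "\<dots> = pint (\<lambda>t. (A t - A 0) * fejer n t)"
        by (subst pint_diff[symmetric]) (auto intro!: cper_intros cper_fejer A simp: algebra_simps)
      finally have "\<bar>pint (\<lambda>t. A t * fejer n t) - A 0\<bar> = \<bar>pint (\<lambda>t. (A t - A 0) * fejer n t)\<bar>" by simp
      also have "\<dots> \<le> pint (\<lambda>t. r / 2 * fejer n t + C * (4 / n))"
      proof (subst real_norm_def[symmetric], rule integral_norm_bound_integral, unfold real_norm_def)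
        show "(\<lambda>t. (A t - A 0) * fejer n t) integrable_on {0..1}"
          by (intro cper_integrable cper_intros cper_fejer A)
        show "(\<lambda>t. r / 2 * fejer n t + C * (4 / n)) integrable_on {0..1}"
          by (intro cper_integrable cper_intros cper_fejer A)
        fix t :: real assume t: "t \<in> {0..1}"
        have "\<bar>(A t - A 0) * fejer n t\<bar> = \<bar>A t - A 0\<bar> * fejer n t"
          using fejer_nonneg[of n t] by (simp add: abs_mult)
        also have "\<dots> \<le> (r / 2 + C * fsym t 1) * fejer n t"
          by (rule mult_right_mono[OF C(2)[OF t] fejer_nonneg])
        also have "\<dots> = r / 2 * fejer n t + C * (fejer n t * fsym t 1)" by (simp add: algebra_simps)
        also have "\<dots> \<le> r / 2 * fejer n t + C * (4 / n)"
          using fejer_bound[OF n0] C(1) by (intro add_left_mono mult_left_mono) auto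
        finally show "\<bar>(A t - A 0) * fejer n t\<bar> \<le> r / 2 * fejer n t + C * (4 / n)" .
      qed
      also have "\<dots> = pint (\<lambda>t. r / 2 * fejer n t) + pint (\<lambda>t. C * (4 / n))"
        by (intro pint_add cper_intros cper_fejer)
      also have "\<dots> = r / 2 + C * (4 / n)"
        using pint_fejer_1[OF n0] by simp
      also have "\<dots> < r"
      proof -
        have "8 * C / r < n" using N n by (meson less_le_trans of_nat_mono)
        then show ?thesis using n0 r by (simp add: field_simps)
      qed
      finally show ?thesis .
    qed
    then show "\<exists>no. \<forall>n\<ge>no. norm (pint (\<lambda>t. A t * fejer n t) - A 0) < r" by auto
  qed
qed

lemma integral_swap2:
  fixes f :: "real \<Rightarrow> real \<Rightarrow> 'a::banach"
  assumes "continuous_on ({a..b} \<times> {c..d}) (\<lambda>(x, y). f x y)"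
  shows "integral {a..b} (\<lambda>x. integral {c..d} (f x)) = integral {c..d} (\<lambda>y. integral {a..b} (\<lambda>x. f x y))"
  using integral_swap_continuous[of a c b d f] assms
  by (simp add: cbox_Pair_eq)

lemma continuous_on_integral2:
  fixes f :: "'b::topological_space \<Rightarrow> real \<Rightarrow> 'a::banach"
  assumes "continuous_on (U \<times> {a..b}) (\<lambda>(x, y). f x y)"
  shows "continuous_on U (\<lambda>x. integral {a..b} (f x))"
  using integral_continuous_on_param[of U a b f] assms by simp

text \<open>Its Fourier coefficients are the nonnegative numbers |fc f k|^2 and its value at 0 is
  the squared L2 norm, so Parseval's identity becomes Fejer summation at the point 0.\<close>

definition autocorr :: "(real \<Rightarrow> real) \<Rightarrow> real \<Rightarrow> real" where
  "autocorr f t = pint (\<lambda>x. f x * f (x + t))"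

lemma cper_autocorr: assumes "cper f" shows "cper (autocorr f)"
proof (rule cperI)
  show "autocorr f (t + 1) = autocorr f t" for t
    using cper_periodic[OF assms] by (simp add: autocorr_def flip: add.assoc)
  have c: "continuous_on UNIV f" using assms by (simp add: cper_def)
  show "continuous_on UNIV (autocorr f)"
    unfolding autocorr_def
    by (rule continuous_on_integral2)
       (auto simp: case_prod_unfold intro!: continuous_intros continuous_on_compose2[OF c])
qed

text \<open>After exchanging the integrals, the inner one is the coefficient of a translate of
  \<open>f\<close>, which is \<open>fc f k\<close> times a character; the outer one then produces
  the conjugate coefficient.\<close>

lemma fc_autocorr: assumes f: "cper f" shows "fc (autocorr f) k = of_real ((cmod (fc f k))\<^sup>2)"
proof -
  have c: "continuous_on UNIV f" using assms by (simp add: cper_def)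
  let ?e = "\<lambda>t. cis (- 2 * pi * of_int k * t)"
  have shift: "pint (\<lambda>t. complex_of_real (f (x + t)) * ?e t) = ek k x * fc f k" for x
    using fc_shift[OF f, of x k] fc_pint[OF cper_shift[OF f, of x], of k]
    by (simp add: add.commute)
  have "fc (autocorr f) k = pint (\<lambda>t. pint (\<lambda>x. complex_of_real (f x) * complex_of_real (f (x + t)) * ?e t))"
  proof -
    have "complex_of_real (autocorr f t) * ?e t
        = pint (\<lambda>x. complex_of_real (f x) * complex_of_real (f (x + t)) * ?e t)" for t
    proof -
      have "cper (\<lambda>x. f x * f (x + t))" by (intro cper_intros f)
      from integral_linear[OF cper_integrable[OF this, of 0 1] bounded_linear_of_real[where 'a=complex]]
      show ?thesis by (simp add: o_def autocorr_def)
    qed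
    then show ?thesis by (simp add: fc_pint[OF cper_autocorr[OF f]])
  qed
  also have "\<dots> = pint (\<lambda>x. pint (\<lambda>t. complex_of_real (f x) * complex_of_real (f (x + t)) * ?e t))"
    by (rule integral_swap2)
       (auto simp: case_prod_unfold intro!: continuous_intros continuous_on_compose2[OF c])
  also have "\<dots> = pint (\<lambda>x. complex_of_real (f x) * ek k x * fc f k)"
    using shift by (simp add: mult.assoc)
  also have "\<dots> = pint (\<lambda>x. complex_of_real (f x) * ek k x) * fc f k" by simp
  also have "pint (\<lambda>x. complex_of_real (f x) * ek k x) = cnj (fc f k)"
    unfolding fc_pint[OF f]
    using integral_linear[OF cper_integrable[OF cper_fc[OF f, of k], of 0 1] bounded_linear_cnj]
    by (simp add: o_def cis_cnj)
  finally show ?thesis by (metis complex_norm_square mult.commute)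
qed

text \<open>Cesaro means of a series with nonnegative terms stay below its sum and dominate nearly
  all of any finite part, so their convergence forces summability to the same limit.\<close>

lemma parseval_sq:
  assumes f: "cper f"
  shows "((\<lambda>k. (cmod (fc f k))\<^sup>2) has_sum pint (\<lambda>x. (f x)\<^sup>2)) UNIV"
proof -
  define g where "g k = (cmod (fc f k))\<^sup>2" for k
  define P where "P = pint (\<lambda>x. (f x)\<^sup>2)"
  define a where "a n = pint (\<lambda>t. autocorr f t * fejer n t)" for n
  have g0: "0 \<le> g k" for k by (simp add: g_def)
  have lim: "a \<longlonglongrightarrow> P"
    unfolding a_def P_def
    using fejer_tendsto[OF cper_autocorr[OF f]] by (simp add: autocorr_def power2_eq_square)
  have a_eq: "a n = (\<Sum>i<n. \<Sum>j<n. g (int i - int j)) / real n" for n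
  proof -
    have "complex_of_real (a n) = complex_of_real ((\<Sum>i<n. \<Sum>j<n. g (int i - int j)) / real n)"
      unfolding a_def pint_fejer[OF cper_autocorr[OF f]] by (simp add: fc_autocorr[OF f] g_def)
    then show ?thesis using of_real_eq_iff by blast
  qed
  have inj: "inj_on (\<lambda>j::nat. int i - int j) A" for i A by (auto simp: inj_on_def)
  have fin: "sum g K \<le> P" if K: "finite K" for K
  proof -
    obtain N :: nat where N: "K \<subseteq> {- int N..int N}"
    proof -
      have "K \<subseteq> {- int (nat (\<Sum>k\<in>K. \<bar>k\<bar>))..int (nat (\<Sum>k\<in>K. \<bar>k\<bar>))}"
      proof
        fix k assume "k \<in> K"
        then have "\<bar>k\<bar> \<le> (\<Sum>k\<in>K. \<bar>k\<bar>)" using member_le_sum[of k K abs] K by auto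
        then show "k \<in> {- int (nat (\<Sum>k\<in>K. \<bar>k\<bar>))..int (nat (\<Sum>k\<in>K. \<bar>k\<bar>))}" by auto
      qed
      then show ?thesis using that by blast
    qed
    \<comment> \<open>For \<open>i\<close> between N and n - N every k of K occurs as
      \<open>i - j\<close> with j < n; only 2 N of the n rows are lost.\<close>
    have le: "(1 - 2 * real N * inverse (real n)) * sum g K \<le> a n" if n: "n > 2 * N" for n
    proof -
      have "real (n - 2 * N) * sum g K = (\<Sum>i\<in>{N..<n - N}. sum g K)"
        by (simp add: mult_2)
      also have "\<dots> \<le> (\<Sum>i\<in>{N..<n - N}. \<Sum>j<n. g (int i - int j))"
      proof (rule sum_mono)
        fix i assume i: "i \<in> {N..<n - N}"
        have "K \<subseteq> (\<lambda>j. int i - int j) ` {..<n}"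
        proof
          fix k assume "k \<in> K"
          then have "- int N \<le> k" "k \<le> int N" using N by auto
          then have "k = int i - int (nat (int i - k))" "nat (int i - k) < n" using i by auto
          then show "k \<in> (\<lambda>j. int i - int j) ` {..<n}" by blast
        qed
        then have "sum g K \<le> sum g ((\<lambda>j. int i - int j) ` {..<n})"
          by (intro sum_mono2) (auto simp: g0)
        also have "\<dots> = (\<Sum>j<n. g (int i - int j))" by (simp add: sum.reindex[OF inj])
        finally show "sum g K \<le> (\<Sum>j<n. g (int i - int j))" .
      qed
      also have "\<dots> \<le> (\<Sum>i<n. \<Sum>j<n. g (int i - int j))"
        by (rule sum_mono2) (auto intro: sum_nonneg g0)
      also have "\<dots> = real n * a n" using n by (simp add: a_eq)
      finally have "real (n - 2 * N) * sum g K \<le> real n * a n" .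
      moreover have "real (n - 2 * N) = real n * (1 - 2 * real N * inverse (real n))"
        using n by (simp add: of_nat_diff right_diff_distrib)
      ultimately have "real n * ((1 - 2 * real N * inverse (real n)) * sum g K) \<le> real n * a n"
        by (simp add: mult.assoc)
      then show ?thesis using n by (simp add: mult_le_cancel_left_pos)
    qed
    have "(\<lambda>n. (1 - 2 * real N * inverse (real n)) * sum g K) \<longlonglongrightarrow> (1 - 2 * real N * 0) * sum g K"
      by (intro tendsto_intros lim_inverse_n)
    then have "(1 - 2 * real N * 0) * sum g K \<le> P"
      by (rule LIMSEQ_le[OF _ lim]) (use le in \<open>intro exI[of _ "2 * N + 1"], auto\<close>)
    then show ?thesis by simp
  qed
  have summ: "g summable_on UNIV"
    by (rule nonneg_bdd_above_summable_on) (auto intro!: bdd_aboveI2[where M = P] fin simp: g0)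
  have "infsum g UNIV \<le> P"
    by (rule infsum_le_finite_sums[OF summ]) (use fin in auto)
  moreover have "P \<le> infsum g UNIV"
  proof (rule LIMSEQ_le_const2[OF lim], intro exI[of _ 1] allI impI)
    fix n :: nat assume n: "n \<ge> 1"
    have "(\<Sum>i<n. \<Sum>j<n. g (int i - int j)) \<le> (\<Sum>i<n. infsum g UNIV)"
    proof (rule sum_mono)
      fix i :: nat
      have "(\<Sum>j<n. g (int i - int j)) = sum g ((\<lambda>j. int i - int j) ` {..<n})"
        by (simp add: sum.reindex[OF inj])
      also have "\<dots> \<le> infsum g UNIV" by (rule finite_sum_le_infsum[OF summ]) (auto simp: g0)
      finally show "(\<Sum>j<n. g (int i - int j)) \<le> infsum g UNIV" .
    qed
    then show "a n \<le> infsum g UNIV" using n by (simp add: a_eq field_simps)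
  qed
  ultimately have "infsum g UNIV = P" by simp
  then show ?thesis using summ unfolding g_def P_def by (metis has_sum_infsum)
qed

lemma has_sum_diff:
  fixes f g :: "'a \<Rightarrow> real"
  shows "(f has_sum a) A \<Longrightarrow> (g has_sum b) A \<Longrightarrow> ((\<lambda>x. f x - g x) has_sum (a - b)) A"
  using has_sum_add[of f A a "\<lambda>x. - g x" "- b"] has_sum_uminusI[of g A b] by simp

lemma parseval:
  assumes f: "cper f" and g: "cper g"
  shows "((\<lambda>k. Re (fc f k * cnj (fc g k))) has_sum pint (\<lambda>x. f x * g x)) UNIV"
proof -
  have "((\<lambda>k. 1/4 * ((cmod (fc (\<lambda>x. f x + g x) k))\<^sup>2 - (cmod (fc (\<lambda>x. f x - g x) k))\<^sup>2)) has_sum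
     1/4 * (pint (\<lambda>x. (f x + g x)\<^sup>2) - pint (\<lambda>x. (f x - g x)\<^sup>2))) UNIV"
    by (intro has_sum_cmult_right has_sum_diff parseval_sq cper_intros f g)
  moreover have "1/4 * ((cmod (fc (\<lambda>x. f x + g x) k))\<^sup>2 - (cmod (fc (\<lambda>x. f x - g x) k))\<^sup>2)
      = Re (fc f k * cnj (fc g k))" for k
    by (simp only: fc_add[OF f g] fc_diff[OF f g] cmod_power2) (simp add: power2_eq_square algebra_simps)
  moreover have "1/4 * (pint (\<lambda>x. (f x + g x)\<^sup>2) - pint (\<lambda>x. (f x - g x)\<^sup>2))
      = pint (\<lambda>x. f x * g x)"
  proof -
    have "pint (\<lambda>x. (f x + g x)\<^sup>2) - pint (\<lambda>x. (f x - g x)\<^sup>2)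
        = pint (\<lambda>x. (f x + g x)\<^sup>2 - (f x - g x)\<^sup>2)"
      by (rule pint_diff[symmetric]; intro cper_intros f g)
    also have "\<dots> = pint (\<lambda>x. 4 * (f x * g x))"
      by (simp add: power2_eq_square algebra_simps)
    finally show ?thesis by simp
  qed
  ultimately show ?thesis by (simp only:)
qed

lemma nn_infsum:
  fixes f :: "'a \<Rightarrow> real"
  assumes "\<And>k. 0 \<le> f k" "f summable_on UNIV"
  shows "(\<integral>\<^sup>+k. ennreal (f k) \<partial>count_space UNIV) = ennreal (\<Sum>\<^sub>\<infinity>k. f k)"
proof -
  have a: "Infinite_Set_Sum.abs_summable_on f UNIV"
    using assms by (simp add: abs_summable_equivalent[symmetric])
  then have i: "integrable (count_space UNIV) f" by (simp add: abs_summable_on_def)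
  then have "(\<integral>\<^sup>+k. ennreal (f k) \<partial>count_space UNIV) = ennreal (lebesgue_integral (count_space UNIV) f)"
    using assms by (intro nn_integral_eq_integral) auto
  also have "lebesgue_integral (count_space UNIV) f = infsum f UNIV"
    using infsetsum_infsum[OF a] by (simp add: infsetsum_def)
  finally show ?thesis .
qed

subsection \<open>Homogeneous Sobolev seminorms and finite differences\<close>

definition lam :: "int \<Rightarrow> real" where
  "lam k = \<bar>2 * pi * of_int k\<bar>"

text \<open>The parameter is twice the order: \<open>hom2 g\<close> is the squared seminorm of order
  g/2, so the dual pair of orders g/2 and 1 - g/2 reads g and 2 - g. As \<open>0 powr g = 0\<close>,
  the zero mode is dropped for every g, also for g = 0.\<close>

definition hom2 :: "real \<Rightarrow> (real \<Rightarrow> real) \<Rightarrow> real" where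
  "hom2 g u = (\<Sum>\<^sub>\<infinity>k. lam k powr g * (cmod (fc u k))\<^sup>2)"

text \<open>Kept apart from \<open>hom2\<close>, whose infinite sum takes the value 0 by default
  where it does not converge.\<close>

definition fin_hom :: "real \<Rightarrow> (real \<Rightarrow> real) \<Rightarrow> bool" where
  "fin_hom g u \<longleftrightarrow> (\<lambda>k. lam k powr g * (cmod (fc u k))\<^sup>2) summable_on UNIV"

lemma lam_0 [simp]: "lam 0 = 0" by (simp add: lam_def)

lemma lam_nonneg [simp]: "0 \<le> lam k" by (simp add: lam_def)

lemma lam_ge: assumes "k \<noteq> 0" shows "2 * pi \<le> lam k"
proof -
  have "1 \<le> \<bar>k\<bar>" using assms by simp
  then have "(1::real) \<le> \<bar>of_int k\<bar>" by (metis of_int_1_le_iff of_int_abs)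
  then show ?thesis by (simp add: lam_def abs_mult)
qed

lemma lam_ge1: assumes "k \<noteq> 0" shows "1 \<le> lam k"
  using lam_ge[OF assms] pi_gt3 by linarith

lemma lam_powr_mono: assumes "a \<le> b" shows "lam k powr a \<le> lam k powr b"
proof (cases "k = 0")
  case False
  then show ?thesis using lam_ge1[OF False] assms by (intro powr_mono) auto
qed simp

lemma summable_dom:
  fixes f g :: "'a \<Rightarrow> real"
  assumes "f summable_on A" "\<And>k. \<bar>g k\<bar> \<le> f k"
  shows "g summable_on A"
proof -
  have "(\<lambda>k. norm (g k)) summable_on A"
    by (rule summable_on_comparison_test[OF assms(1)]) (use assms(2) in auto)
  then show ?thesis using summable_on_iff_abs_summable_on_real by blast
qed

lemma infsum_LINT:
  fixes f :: "'a \<Rightarrow> real"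
  assumes "f summable_on UNIV"
  shows "integrable (count_space UNIV) f" "lebesgue_integral (count_space UNIV) f = infsum f UNIV"
proof -
  have a: "Infinite_Set_Sum.abs_summable_on f UNIV"
    using assms summable_on_iff_abs_summable_on_real[of f UNIV]
    by (simp add: abs_summable_equivalent[symmetric])
  then show "integrable (count_space UNIV) f" by (simp add: abs_summable_on_def)
  show "lebesgue_integral (count_space UNIV) f = infsum f UNIV"
    using infsetsum_infsum[OF a] by (simp add: infsetsum_def)
qed

lemma fin_hom_has_sum:
  "fin_hom g u \<Longrightarrow> ((\<lambda>k. lam k powr g * (cmod (fc u k))\<^sup>2) has_sum hom2 g u) UNIV"
  unfolding fin_hom_def hom2_def by (rule has_sum_infsum)

lemma hom2_nonneg: "0 \<le> hom2 g u"
  unfolding hom2_def by (intro infsum_nonneg) auto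

lemma fin_hom_mono: "fin_hom b u \<Longrightarrow> a \<le> b \<Longrightarrow> fin_hom a u"
  unfolding fin_hom_def
  by (erule summable_dom) (auto intro!: mult_right_mono lam_powr_mono simp: abs_mult)

lemma hom2_mono: "fin_hom b u \<Longrightarrow> a \<le> b \<Longrightarrow> hom2 a u \<le> hom2 b u"
  unfolding hom2_def using fin_hom_mono[of b u a]
  by (intro infsum_mono) (auto intro!: mult_right_mono lam_powr_mono simp: fin_hom_def)

lemma Hs_hom_sq_hom2: "fin_hom (2 * s) u \<Longrightarrow> Hs_hom_sq s (fc u) = ennreal (hom2 (2 * s) u)"
  unfolding Hs_hom_sq_def hom2_def fin_hom_def lam_def by (rule nn_infsum) auto

lemma pint_delta:
  assumes "cper u" "cper v"
  shows "((\<lambda>k. fsym h k * Re (fc u k * cnj (fc v k))) has_sum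
     pint (\<lambda>x. (u (x + h) - u x) * (v (x + h) - v x))) UNIV"
proof -
  have "((\<lambda>k. Re (fc (\<lambda>x. u (x + h) - u x) k * cnj (fc (\<lambda>x. v (x + h) - v x) k))) has_sum
     pint (\<lambda>x. (u (x + h) - u x) * (v (x + h) - v x))) UNIV"
    by (intro parseval cper_diff cper_shift assms)
  moreover have "Re (fc (\<lambda>x. u (x + h) - u x) k * cnj (fc (\<lambda>x. v (x + h) - v x) k))
      = fsym h k * Re (fc u k * cnj (fc v k))" for k
  proof -
    have "fc (\<lambda>x. u (x + h) - u x) k * cnj (fc (\<lambda>x. v (x + h) - v x) k)
       = ((ek k h - 1) * cnj (ek k h - 1)) * (fc u k * cnj (fc v k))"
      by (simp add: fc_delta assms)
    also have "(ek k h - 1) * cnj (ek k h - 1) = of_real (fsym h k)"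
      unfolding fsym_def by (simp only: complex_norm_square[symmetric] of_real_power)
    finally show ?thesis by simp
  qed
  ultimately show ?thesis by simp
qed

lemma Re_mult_cnj [simp]: "Re (z * cnj z) = (cmod z)\<^sup>2"
  by (metis Re_complex_of_real complex_norm_square of_real_power)

lemma pint_delta_sq:
  assumes "cper u"
  shows "((\<lambda>k. fsym h k * (cmod (fc u k))\<^sup>2) has_sum pint (\<lambda>x. (u (x + h) - u x)\<^sup>2)) UNIV"
  using pint_delta[OF assms assms, of h] by (simp only: Re_mult_cnj power2_eq_square)

lemma fsym_0 [simp]: "fsym h 0 = 0" by (simp add: fsym_def)

lemma fsym_cos: "fsym h k = 2 - 2 * cos (lam k * h)"
proof -
  have "fsym h k = 2 - 2 * cos (2 * pi * of_int k * h)"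
    using sin_cos_squared_add[of "2 * pi * of_int k * h"]
    by (simp only: fsym_def cmod_power2) (simp add: power2_eq_square algebra_simps)
  also have "cos (2 * pi * of_int k * h) = cos (lam k * h)"
    by (cases "k \<ge> 0") (auto simp: lam_def abs_mult)
  finally show ?thesis .
qed

lemma two_minus_cos_le: "2 - 2 * cos x \<le> x\<^sup>2" for x :: real
proof -
  have "2 - 2 * cos x = 4 * (sin (x / 2))\<^sup>2"
    using cos_double_sin[of "x/2"] by simp
  also have "\<dots> \<le> 4 * (x / 2)\<^sup>2"
    using abs_sin_x_le_abs_x[of "x/2"] unfolding abs_le_square_iff by simp
  finally show ?thesis by (simp add: power2_eq_square)
qed

text \<open>The symbol is at most min(4, x^2) with x = lam k * h, and this minimum lies below 4 x^g
  for every g between 0 and 2.\<close>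

lemma fsym_le: "0 \<le> h \<Longrightarrow> 0 \<le> g \<Longrightarrow> g \<le> 2 \<Longrightarrow> fsym h k \<le> 4 * h powr g * lam k powr g"
proof -
  assume h: "0 \<le> h" and g: "0 \<le> g" "g \<le> 2"
  define x where "x = lam k * h"
  have x: "0 \<le> x" using h by (simp add: x_def)
  have "2 - 2 * cos x \<le> 4 * x powr g"
  proof (cases "x \<ge> 1")
    case True
    then have "1 \<le> x powr g" using g by (simp add: ge_one_powr_ge_zero)
    then show ?thesis using cos_ge_minus_one[of x] by linarith
  next
    case False
    show ?thesis
    proof (cases "x = 0")
      case False
      have "x\<^sup>2 = x powr 2" using x False by (simp add: powr_numeral)
      also have "\<dots> \<le> x powr g" using x \<open>\<not> x \<ge> 1\<close> False g by (intro powr_mono') auto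
      finally show ?thesis using two_minus_cos_le[of x] powr_ge_zero[of x g] by linarith
    qed simp
  qed
  then show ?thesis using h by (simp add: fsym_cos x_def powr_mult mult_ac)
qed

lemma delta_sq_le:
  assumes "cper u" "fin_hom g u" "0 \<le> h" "0 \<le> g" "g \<le> 2"
  shows "pint (\<lambda>x. (u (x + h) - u x)\<^sup>2) \<le> 4 * h powr g * hom2 g u"
proof (rule has_sum_mono[OF pint_delta_sq[OF assms(1)] has_sum_cmult_right[OF fin_hom_has_sum[OF assms(2)]]])
  fix k
  show "fsym h k * (cmod (fc u k))\<^sup>2 \<le> 4 * h powr g * (lam k powr g * (cmod (fc u k))\<^sup>2)"
    using mult_right_mono[OF fsym_le[OF assms(3-5), of k], of "(cmod (fc u k))\<^sup>2"]
    by (simp add: mult.assoc)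
qed

lemma fsym_quot_tendsto: "((\<lambda>n. fsym (inverse (real (Suc n))) k / (inverse (real (Suc n)))\<^sup>2) \<longlonglongrightarrow> (lam k)\<^sup>2)"
proof -
  have "((\<lambda>h. (2 - 2 * cos (lam k * h)) / h\<^sup>2) \<longlongrightarrow> (lam k)\<^sup>2) (at 0)"
  proof (cases "lam k = 0")
    case False
    have s: "((\<lambda>x. sin x / x) \<longlongrightarrow> (1::real)) (at 0)"
      using DERIV_sin[of "0::real"] by (simp add: has_field_derivative_iff)
    have "filterlim (\<lambda>h. lam k * h / 2) (at 0) (at 0)"
      using False by (auto simp: filterlim_at intro!: tendsto_eq_intros eventually_at_filter[THEN iffD2])
    from filterlim_compose[OF s this]
    have "((\<lambda>h. (lam k)\<^sup>2 * (sin (lam k * h / 2) / (lam k * h / 2))\<^sup>2) \<longlongrightarrow> (lam k)\<^sup>2 * 1\<^sup>2) (at 0)"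
      by (intro tendsto_intros)
    moreover have "(lam k)\<^sup>2 * (sin (lam k * h / 2) / (lam k * h / 2))\<^sup>2 = (2 - 2 * cos (lam k * h)) / h\<^sup>2" for h
    proof -
      have "2 - 2 * cos (lam k * h) = 4 * (sin (lam k * h / 2))\<^sup>2"
        using cos_double_sin[of "lam k * h / 2"] by simp
      then show ?thesis using False by (simp add: power2_eq_square)
    qed
    ultimately show ?thesis by simp
  qed simp
  moreover have "filterlim (\<lambda>n. inverse (real (Suc n))) (at 0) sequentially"
    using LIMSEQ_inverse_real_of_nat by (auto simp: filterlim_at)
  ultimately show ?thesis unfolding fsym_cos by (rule filterlim_compose)
qed

text \<open>Finite partial sums are bounded through difference quotients, whose symbols tend to the
  square of \<open>lam k\<close> as the step tends to 0. This serves for |m (y + h) - m y|, which is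
  Lipschitz but not differentiable.\<close>

lemma lipschitz_fin_hom:
  assumes u: "cper u" and L: "\<And>x h. 0 \<le> h \<Longrightarrow> \<bar>u (x + h) - u x\<bar> \<le> L * h"
  shows "fin_hom 2 u" "hom2 2 u \<le> L\<^sup>2"
proof -
  have fin: "(\<Sum>k\<in>F. lam k powr 2 * (cmod (fc u k))\<^sup>2) \<le> L\<^sup>2" if F: "finite F" for F
  proof -
    let ?h = "\<lambda>n. inverse (real (Suc n))"
    have "(\<Sum>k\<in>F. fsym (?h n) k / (?h n)\<^sup>2 * (cmod (fc u k))\<^sup>2) \<le> L\<^sup>2" for n
    proof -
      have "(\<Sum>k\<in>F. fsym (?h n) k * (cmod (fc u k))\<^sup>2) \<le> pint (\<lambda>x. (u (x + ?h n) - u x)\<^sup>2)"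
        using has_sum_mono2[OF has_sum_finite[OF F] pint_delta_sq[OF u]] by (auto simp: fsym_nonneg)
      also have "\<dots> \<le> pint (\<lambda>x. (L * ?h n)\<^sup>2)"
      proof (intro pint_mono cper_intros u)
        fix x
        have "\<bar>u (x + ?h n) - u x\<bar> \<le> \<bar>L * ?h n\<bar>" using L[of "?h n" x] by auto
        then show "(u (x + ?h n) - u x)\<^sup>2 \<le> (L * ?h n)\<^sup>2" by (simp only: abs_le_square_iff)
      qed
      finally have "(\<Sum>k\<in>F. fsym (?h n) k * (cmod (fc u k))\<^sup>2) / (?h n)\<^sup>2 \<le> (L * ?h n)\<^sup>2 / (?h n)\<^sup>2"
        by (intro divide_right_mono) auto
      then show ?thesis by (simp add: sum_divide_distrib power_mult_distrib)
    qed
    moreover have "(\<lambda>n. \<Sum>k\<in>F. fsym (?h n) k / (?h n)\<^sup>2 * (cmod (fc u k))\<^sup>2)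
        \<longlonglongrightarrow> (\<Sum>k\<in>F. (lam k)\<^sup>2 * (cmod (fc u k))\<^sup>2)"
      by (intro tendsto_intros fsym_quot_tendsto)
    ultimately have "(\<Sum>k\<in>F. (lam k)\<^sup>2 * (cmod (fc u k))\<^sup>2) \<le> L\<^sup>2"
      using LIMSEQ_le_const2 by blast
    then show ?thesis by (simp add: powr_numeral)
  qed
  show *: "fin_hom 2 u" unfolding fin_hom_def
  proof (rule nonneg_bdd_above_summable_on)
    show "bdd_above (sum (\<lambda>k. lam k powr 2 * (cmod (fc u k))\<^sup>2) ` {F. F \<subseteq> UNIV \<and> finite F})"
      by (rule bdd_aboveI2[where M = "L\<^sup>2"]) (rule fin, simp)
  qed simp
  show "hom2 2 u \<le> L\<^sup>2" unfolding hom2_def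
    by (rule infsum_le_finite_sums[OF *[unfolded fin_hom_def]]) (use fin in auto)
qed

lemma c1per_lipschitz:
  assumes "c1per u u'" obtains L where "0 \<le> L" "\<And>x y. \<bar>u x - u y\<bar> \<le> L * \<bar>x - y\<bar>"
proof -
  obtain B where B: "0 \<le> B" "\<And>x. \<bar>u' x\<bar> \<le> B" using cper_bounded[OF c1per_cper'[OF assms]] by blast
  have "\<bar>u x - u y\<bar> \<le> B * \<bar>x - y\<bar>" for x y
    using field_differentiable_bound[of UNIV u u' B y x] B assms
    by (auto simp: c1per_def abs_minus_commute intro: has_field_derivative_at_within)
  then show ?thesis using that B by blast
qed

lemma c1per_hom2:
  assumes "c1per u u'" shows "fin_hom 2 u" "hom2 2 u = pint (\<lambda>x. (u' x)\<^sup>2)"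
proof -
  have "((\<lambda>k. (cmod (fc u' k))\<^sup>2) has_sum pint (\<lambda>x. (u' x)\<^sup>2)) UNIV"
    by (rule parseval_sq[OF c1per_cper'[OF assms]])
  moreover have "(cmod (fc u' k))\<^sup>2 = lam k powr 2 * (cmod (fc u k))\<^sup>2" for k
    by (simp add: fc_deriv[OF assms] norm_mult lam_def powr_numeral power_mult_distrib abs_mult)
  ultimately have "((\<lambda>k. lam k powr 2 * (cmod (fc u k))\<^sup>2) has_sum pint (\<lambda>x. (u' x)\<^sup>2)) UNIV"
    by simp
  then show "fin_hom 2 u" "hom2 2 u = pint (\<lambda>x. (u' x)\<^sup>2)"
    by (auto simp: fin_hom_def hom2_def has_sum_iff)
qed

lemma young_mult: "0 < e \<Longrightarrow> a * b \<le> (e * a\<^sup>2 + b\<^sup>2 / e) / 2" for a b e :: real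
proof -
  assume e: "0 < e"
  have "0 \<le> (e * a - b)\<^sup>2" by simp
  then have "2 * (e * (a * b)) \<le> e * (e * a\<^sup>2) + b\<^sup>2" by (simp add: power2_eq_square algebra_simps)
  then show ?thesis using e by (simp add: field_simps power2_eq_square)
qed

text \<open>The weights lam^(g/2) and lam^(1 - g/2) share out the derivative, and Young's inequality
  with the free parameter \<open>e\<close> prepares the absorption of the first seminorm into the
  dissipation.\<close>

lemma sobolev_pair:
  assumes u: "cper u" "fin_hom g u" and V: "c1per V V'" and g: "0 \<le> g" and e: "0 < e"
  shows "\<bar>pint (\<lambda>x. u x * V' x)\<bar> \<le> (e * hom2 g u + hom2 (2 - g) V / e) / 2"
proof -
  have fV: "fin_hom (2 - g) V" using c1per_hom2(1)[OF V] fin_hom_mono g by auto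
  let ?c = "\<lambda>k. Re (fc u k * cnj (fc V' k))"
  let ?d = "\<lambda>k. (e * (lam k powr g * (cmod (fc u k))\<^sup>2) + (lam k powr (2 - g) * (cmod (fc V k))\<^sup>2) * inverse e) * (1/2)"
  have c: "(?c has_sum pint (\<lambda>x. u x * V' x)) UNIV"
    by (rule parseval[OF u(1) c1per_cper'[OF V]])
  have d: "(?d has_sum (e * hom2 g u + hom2 (2 - g) V * inverse e) * (1/2)) UNIV"
    by (intro has_sum_cmult_left has_sum_add has_sum_cmult_right fin_hom_has_sum u fV)
  have le: "\<bar>?c k\<bar> \<le> ?d k" for k
  proof (cases "k = 0")
    case True
    then show ?thesis using e by (simp add: fc_deriv[OF V])
  next
    case False
    have "\<bar>?c k\<bar> \<le> cmod (fc u k * cnj (fc V' k))" by (rule abs_Re_le_cmod)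
    also have "\<dots> = (lam k powr (g/2) * cmod (fc u k)) * (lam k powr (1 - g/2) * cmod (fc V k))"
    proof -
      have "lam k powr (g/2) * lam k powr (1 - g/2) = lam k"
        using lam_ge1[OF False] by (simp flip: powr_add)
      moreover have "cmod (fc V' k) = lam k * cmod (fc V k)"
        by (simp add: fc_deriv[OF V] norm_mult lam_def abs_mult)
      ultimately show ?thesis by (simp add: norm_mult)
    qed
    also have "\<dots> \<le> ?d k"
    proof -
      have "(lam k powr (g/2))\<^sup>2 = lam k powr g" "(lam k powr (1 - g/2))\<^sup>2 = lam k powr (2 - g)"
        by (simp_all add: power2_eq_square flip: powr_add)
      note sq = this
      have aux: "(e * A + B * inverse e) * (1/2) = (e * A + B / e) / 2" for A B
        using e by (simp add: field_simps)
      show ?thesis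
        using young_mult[OF e, of "lam k powr (g/2) * cmod (fc u k)" "lam k powr (1 - g/2) * cmod (fc V k)"]
        unfolding aux by (simp only: power_mult_distrib sq)
    qed
    finally show ?thesis .
  qed
  have "pint (\<lambda>x. u x * V' x) \<le> (e * hom2 g u + hom2 (2 - g) V * inverse e) * (1/2)"
    by (rule has_sum_mono[OF c d]) (use le abs_le_iff in blast)
  moreover have "- pint (\<lambda>x. u x * V' x) \<le> (e * hom2 g u + hom2 (2 - g) V * inverse e) * (1/2)"
    by (rule has_sum_mono[OF has_sum_uminusI[OF c] d]) (use le abs_le_iff in blast)
  ultimately show ?thesis using e by (simp add: field_simps abs_le_iff)
qed

section \<open>Fractional symbols as superpositions of bounded profiles\<close>

context
  fixes \<Phi> :: "real \<Rightarrow> real" and g b :: real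
  assumes \<Phi>: "continuous_on UNIV \<Phi>" "\<And>u. 0 \<le> \<Phi> u" "\<And>u. \<Phi> u \<le> 4" "\<And>u. \<Phi> u \<le> u\<^sup>2" "0 < b" "\<And>u. 1 \<le> u \<Longrightarrow> u \<le> 2 \<Longrightarrow> b \<le> \<Phi> u"
    and g: "0 < g" "g < 2"
begin

lemma measurable_symbol: "\<Phi> \<in> borel_measurable borel"
  by (rule borel_measurable_continuous_onI[OF \<Phi>(1)])

text \<open>The substitution u = L h turns the integral of h^(-1-g) \<Phi> (L h) into
  \<open>L powr g\<close> times this number. It converges at 0 since \<Phi> u <= u^2 and g < 2, and
  at infinity since \<Phi> is bounded and g > 0; the lower bound on {1..2} makes it positive, so
  that it can be cancelled.\<close>

definition "symbol_const = (\<integral>\<^sup>+u\<in>{0..}. ennreal (u powr (- 1 - g) * \<Phi> u) \<partial>lborel)"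

lemma symbol_const_finite: "symbol_const < \<infinity>"
proof -
  note measurable_symbol [measurable]
  have "symbol_const \<le> (\<integral>\<^sup>+u. (ennreal (u powr (1 - g)) * indicator {0..1} u
       + ennreal (4 * u powr (- 1 - g)) * indicator {1..} u) \<partial>lborel)"
    unfolding symbol_const_def
  proof (intro nn_integral_mono)
    fix u :: real
    show "ennreal (u powr (- 1 - g) * \<Phi> u) * indicator {0..} u
      \<le> ennreal (u powr (1 - g)) * indicator {0..1} u + ennreal (4 * u powr (- 1 - g)) * indicator {1..} u"
    proof (cases "u \<ge> 1")
      case True
      have "u powr (- 1 - g) * \<Phi> u \<le> u powr (- 1 - g) * 4" by (rule mult_left_mono[OF \<Phi>(3)]) simp
      then have "ennreal (u powr (- 1 - g) * \<Phi> u) \<le> ennreal (4 * u powr (- 1 - g))" by (intro ennreal_leI) simp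
      also have "\<dots> \<le> ennreal (u powr (1 - g)) * indicator {0..1} u + ennreal (4 * u powr (- 1 - g))" by simp
      finally show ?thesis using True by (simp add: indicator_def)
    next
      case False
      show ?thesis
      proof (cases "u > 0")
        case True
        have "u powr (- 1 - g) * \<Phi> u \<le> u powr (- 1 - g) * u powr 2"
          using \<Phi>(4)[of u] True by (intro mult_left_mono) (auto simp: powr_numeral)
        also have "\<dots> = u powr (1 - g)" by (simp flip: powr_add)
        finally show ?thesis using True False by (simp add: indicator_def ennreal_leI)
      qed (auto simp: indicator_def)
    qed
  qed
  also have "\<dots> = (\<integral>\<^sup>+u\<in>{0..1}. ennreal (u powr (1 - g)) \<partial>lborel)
      + (\<integral>\<^sup>+u\<in>{1..}. ennreal (4 * u powr (- 1 - g)) \<partial>lborel)"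
    by (rule nn_integral_add) auto
  also have "(\<integral>\<^sup>+u\<in>{0..1}. ennreal (u powr (1 - g)) \<partial>lborel) = ennreal (1 powr (1 - g + 1) / (1 - g + 1))"
    by (rule nn_integral_has_integral_lebesgue'[OF _ has_integral_powr_from_0]) (use g in auto)
  also have "(\<integral>\<^sup>+u\<in>{1..}. ennreal (4 * u powr (- 1 - g)) \<partial>lborel)
      = ennreal (4 * (- (1 powr (- 1 - g + 1)) / (- 1 - g + 1)))"
    by (rule nn_integral_has_integral_lebesgue'[OF _ has_integral_mult_right[OF has_integral_powr_to_inf]])
       (use g in auto)
  finally show ?thesis by (rule le_less_trans) simp
qed

lemma symbol_const_pos: "0 < symbol_const"
proof -
  note measurable_symbol [measurable]
  let ?c = "2 powr (- 1 - g) * b"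
  have "0 < ennreal ?c * emeasure lborel {1..2::real}" using \<Phi>(5) by (simp add: ennreal_zero_less_mult_iff)
  also have "\<dots> = (\<integral>\<^sup>+u\<in>{1..2::real}. ennreal ?c \<partial>lborel)" by (simp add: nn_integral_cmult_indicator)
  also have "\<dots> \<le> symbol_const" unfolding symbol_const_def
  proof (intro nn_integral_mono)
    fix u :: real
    have "?c \<le> u powr (- 1 - g) * \<Phi> u" if "1 \<le> u" "u \<le> 2"
      using that g \<Phi>(5,6) by (intro mult_mono powr_mono2') auto
    then show "ennreal ?c * indicator {1..2} u \<le> ennreal (u powr (- 1 - g) * \<Phi> u) * indicator {0..} u"
      by (auto simp: indicator_def intro: ennreal_leI)
  qed
  finally show ?thesis .
qed

lemma symbol_const_scale:
  assumes "0 \<le> L"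
  shows "(\<integral>\<^sup>+h\<in>{0..}. ennreal (h powr (- 1 - g) * \<Phi> (L * h)) \<partial>lborel) = ennreal (L powr g) * symbol_const"
proof (cases "L = 0")
  case True
  then show ?thesis using \<Phi>(2,4)[of 0] by simp
next
  case False
  then have L: "0 < L" using assms by simp
  note measurable_symbol [measurable]
  have "symbol_const = ennreal \<bar>L\<bar> * (\<integral>\<^sup>+h. ennreal ((0 + L * h) powr (- 1 - g) * \<Phi> (0 + L * h)) * indicator {0..} (0 + L * h) \<partial>lborel)"
    unfolding symbol_const_def by (rule nn_integral_real_affine) (use L in auto)
  also have "\<dots> = ennreal L * (\<integral>\<^sup>+h. ennreal (L powr (- 1 - g)) * (ennreal (h powr (- 1 - g) * \<Phi> (L * h)) * indicator {0..} h) \<partial>lborel)"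
    by (rule arg_cong2[where f = "(*)"], simp add: L less_imp_le, rule nn_integral_cong)
       (use L \<Phi>(2) in \<open>auto simp: indicator_def zero_le_mult_iff powr_mult ennreal_mult[symmetric] mult.assoc\<close>)
  also have "\<dots> = ennreal (L powr (- g)) * (\<integral>\<^sup>+h\<in>{0..}. ennreal (h powr (- 1 - g) * \<Phi> (L * h)) \<partial>lborel)"
    using L by (subst nn_integral_cmult) (auto simp: ennreal_mult[symmetric] powr_diff powr_minus field_simps simp flip: mult.assoc)
  finally have "ennreal (L powr g) * symbol_const = (ennreal (L powr g) * ennreal (L powr (- g))) * (\<integral>\<^sup>+h\<in>{0..}. ennreal (h powr (- 1 - g) * \<Phi> (L * h)) \<partial>lborel)"
    by (simp only: mult.assoc)
  also have "ennreal (L powr g) * ennreal (L powr (- g)) = 1" using L by (simp add: ennreal_mult[symmetric] flip: powr_add)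
  finally show ?thesis by simp
qed

lemma symbol_const_weight:
  fixes w :: "int \<Rightarrow> real"
  assumes w: "\<And>k. 0 \<le> w k" "(\<lambda>k. lam k powr g * w k) summable_on UNIV"
  shows "(\<integral>\<^sup>+h\<in>{0..}. (\<integral>\<^sup>+k. ennreal (h powr (- 1 - g)) * ennreal (\<Phi> (lam k * h) * w k) \<partial>count_space UNIV) \<partial>lborel)
     = symbol_const * ennreal (\<Sum>\<^sub>\<infinity>k. lam k powr g * w k)"
proof -
  note measurable_symbol [measurable]
  have "(\<integral>\<^sup>+h\<in>{0..}. (\<integral>\<^sup>+k. ennreal (h powr (- 1 - g)) * ennreal (\<Phi> (lam k * h) * w k) \<partial>count_space UNIV) \<partial>lborel)
     = (\<integral>\<^sup>+h. (\<integral>\<^sup>+k. ennreal (w k) * (ennreal (h powr (- 1 - g) * \<Phi> (lam k * h)) * indicator {0..} h) \<partial>count_space UNIV) \<partial>lborel)"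
    by (subst nn_integral_multc[symmetric], simp, intro nn_integral_cong)
       (auto simp: ennreal_mult[symmetric] w \<Phi>(2) indicator_def mult_ac)
  also have "\<dots> = (\<integral>\<^sup>+k. (\<integral>\<^sup>+h. ennreal (w k) * (ennreal (h powr (- 1 - g) * \<Phi> (lam k * h)) * indicator {0..} h) \<partial>lborel) \<partial>count_space UNIV)"
    by (rule nn_integral_count_space_nn_integral) auto
  also have "\<dots> = (\<integral>\<^sup>+k. symbol_const * ennreal (lam k powr g * w k) \<partial>count_space UNIV)"
    by (intro nn_integral_cong, subst nn_integral_cmult, measurable)
       (simp only: symbol_const_scale[OF lam_nonneg], simp add: ennreal_mult w mult_ac)
  also have "\<dots> = symbol_const * ennreal (\<Sum>\<^sub>\<infinity>k. lam k powr g * w k)"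
    using nn_infsum[of "\<lambda>k. lam k powr g * w k"] w by (simp add: nn_integral_cmult)
  finally show ?thesis .
qed

text \<open>Integration of the hypothesis against \<open>h powr (-1-g)\<close>.\<close>
lemma symbol_comparison_lt:
  fixes c :: "int \<Rightarrow> real"
  assumes summ: "(\<lambda>k. lam k powr g * c k) summable_on UNIV"
    and nonneg: "\<And>h. 0 < h \<Longrightarrow> ((\<lambda>k. \<Phi> (lam k * h) * c k) has_sum D h) UNIV" "\<And>h. 0 < h \<Longrightarrow> 0 \<le> D h"
  shows "0 \<le> (\<Sum>\<^sub>\<infinity>k. lam k powr g * c k)"
proof -
  note measurable_symbol [measurable]
  \<comment> \<open>Positive and negative parts of \<open>c\<close>: both sides become sums of
    nonnegative terms, to which Tonelli's theorem applies in the extended reals.\<close>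
  define p where "p k = max (c k) 0" for k
  define n where "n k = max (- c k) 0" for k
  have pn: "c k = p k - n k" "0 \<le> p k" "0 \<le> n k" "\<bar>p k\<bar> \<le> \<bar>c k\<bar>" "\<bar>n k\<bar> \<le> \<bar>c k\<bar>" for k
    by (auto simp: p_def n_def)
  have sabs: "(\<lambda>k. \<bar>lam k powr g * c k\<bar>) summable_on UNIV"
    using summ summable_on_iff_abs_summable_on_real by force
  have sp: "(\<lambda>k. lam k powr g * p k) summable_on UNIV" and sn: "(\<lambda>k. lam k powr g * n k) summable_on UNIV"
    by (rule summable_dom[OF sabs], use pn in \<open>auto simp: abs_mult intro: mult_left_mono\<close>)+
  have le: "(\<integral>\<^sup>+k. ennreal (\<Phi> (lam k * h) * n k) \<partial>count_space UNIV) \<le> (\<integral>\<^sup>+k. ennreal (\<Phi> (lam k * h) * p k) \<partial>count_space UNIV)"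
    if h: "0 < h" for h
  proof -
    have s: "(\<lambda>k. \<bar>\<Phi> (lam k * h) * c k\<bar>) summable_on UNIV"
      using nonneg(1)[OF h] has_sum_imp_summable summable_on_iff_abs_summable_on_real by force
    have s1: "(\<lambda>k. \<Phi> (lam k * h) * p k) summable_on UNIV" and s2: "(\<lambda>k. \<Phi> (lam k * h) * n k) summable_on UNIV"
      by (rule summable_dom[OF s], use pn in \<open>auto simp: abs_mult \<Phi>(2) intro: mult_left_mono\<close>)+
    have "((\<lambda>k. \<Phi> (lam k * h) * p k - \<Phi> (lam k * h) * n k) has_sum
        ((\<Sum>\<^sub>\<infinity>k. \<Phi> (lam k * h) * p k) - (\<Sum>\<^sub>\<infinity>k. \<Phi> (lam k * h) * n k))) UNIV"
      by (intro has_sum_diff has_sum_infsum s1 s2)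
    moreover have "(\<lambda>k. \<Phi> (lam k * h) * p k - \<Phi> (lam k * h) * n k) = (\<lambda>k. \<Phi> (lam k * h) * c k)"
      by (simp add: pn(1) right_diff_distrib)
    ultimately have "(\<Sum>\<^sub>\<infinity>k. \<Phi> (lam k * h) * n k) \<le> (\<Sum>\<^sub>\<infinity>k. \<Phi> (lam k * h) * p k)"
      using nonneg[OF h] has_sum_unique by fastforce
    then show ?thesis
      using nn_infsum[OF _ s1] nn_infsum[OF _ s2] pn by (simp add: \<Phi>(2) ennreal_leI)
  qed
  have "symbol_const * ennreal (\<Sum>\<^sub>\<infinity>k. lam k powr g * n k) \<le> symbol_const * ennreal (\<Sum>\<^sub>\<infinity>k. lam k powr g * p k)"
    unfolding symbol_const_weight[OF pn(2) sp, symmetric] symbol_const_weight[OF pn(3) sn, symmetric]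
  proof (intro nn_integral_mono)
    fix h :: real
    show "(\<integral>\<^sup>+k. ennreal (h powr (- 1 - g)) * ennreal (\<Phi> (lam k * h) * n k) \<partial>count_space UNIV) * indicator {0..} h
       \<le> (\<integral>\<^sup>+k. ennreal (h powr (- 1 - g)) * ennreal (\<Phi> (lam k * h) * p k) \<partial>count_space UNIV) * indicator {0..} h"
      using le[of h] by (cases "h > 0") (auto simp: nn_integral_cmult indicator_def intro: mult_left_mono)
  qed
  then have "ennreal (\<Sum>\<^sub>\<infinity>k. lam k powr g * n k) \<le> ennreal (\<Sum>\<^sub>\<infinity>k. lam k powr g * p k)"
    using symbol_const_finite symbol_const_pos
    by (subst (asm) ennreal_mult_le_mult_iff) (auto simp: less_top[symmetric])
  then have "(\<Sum>\<^sub>\<infinity>k. lam k powr g * n k) \<le> (\<Sum>\<^sub>\<infinity>k. lam k powr g * p k)"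
    by (subst (asm) ennreal_le_iff) (auto intro!: infsum_nonneg simp: pn)
  moreover have "((\<lambda>k. lam k powr g * p k - lam k powr g * n k) has_sum
      ((\<Sum>\<^sub>\<infinity>k. lam k powr g * p k) - (\<Sum>\<^sub>\<infinity>k. lam k powr g * n k))) UNIV"
    by (intro has_sum_diff has_sum_infsum sp sn)
  ultimately show ?thesis
    by (simp add: pn(1) right_diff_distrib infsumI)
qed

end

text \<open>Up to a constant, lam^g is for g < 2 the integral of \<open>fsym h\<close> against
  h^(-1-g), so a form that is nonnegative with every increment symbol stays so with the fractional
  one. This is how pointwise inequalities between increments reach the fractional operator.\<close>

lemma symbol_comparison:
  fixes c :: "int \<Rightarrow> real"
  assumes g: "0 < g" "g \<le> 2"
    and summ: "(\<lambda>k. lam k powr g * c k) summable_on UNIV"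
    and nonneg: "\<And>h. 0 < h \<Longrightarrow> ((\<lambda>k. fsym h k * c k) has_sum D h) UNIV" "\<And>h. 0 < h \<Longrightarrow> 0 \<le> D h"
  shows "0 \<le> (\<Sum>\<^sub>\<infinity>k. lam k powr g * c k)"
proof (cases "g = 2")
  case False
  have "cos 1 < (1::real)" using cos_monotone_0_pi[of 0 1] pi_gt3 by simp
  moreover have "cos u \<le> cos 1" if "1 \<le> u" "u \<le> 2" for u :: real
    using that pi_gt3 by (intro cos_monotone_0_pi_le) auto
  moreover have "- 1 \<le> cos u" for u :: real by simp
  then have "2 - 2 * cos u \<le> 4" for u :: real by (smt (verit))
  ultimately show ?thesis
    using g False two_minus_cos_le nonneg
    by (intro symbol_comparison_lt[of "\<lambda>u. 2 - 2 * cos u" "2 - 2 * cos 1", OF _ _ _ _ _ _ _ _ summ]) (auto simp: fsym_cos intro!: continuous_intros)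
next
  text \<open>Here one divides by \<open>h\<^sup>2\<close> and lets \<open>h\<close> tend to zero.\<close>
  case True
  let ?h = "\<lambda>n. inverse (real (Suc n))"
  let ?s = "\<lambda>n k. fsym (?h n) k / (?h n)\<^sup>2 * c k"
  have i: "integrable (count_space UNIV) (\<lambda>k. lam k powr g * c k)" by (rule infsum_LINT[OF summ])
  have "(\<lambda>n. LINT k|count_space UNIV. ?s n k) \<longlonglongrightarrow> (LINT k|count_space UNIV. lam k powr g * c k)"
  proof (rule integral_dominated_convergence[where w = "\<lambda>k. norm (lam k powr g * c k)"])
    show "AE k in count_space UNIV. (\<lambda>n. ?s n k) \<longlonglongrightarrow> lam k powr g * c k"
      using tendsto_mult_right[OF fsym_quot_tendsto] True by (intro AE_I2) (simp add: powr_numeral del: of_nat_Suc)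
    show "AE k in count_space UNIV. norm (?s n k) \<le> norm (lam k powr g * c k)" for n
    proof (intro AE_I2)
      fix k
      have "fsym (?h n) k \<le> (lam k * ?h n)\<^sup>2"
        unfolding fsym_cos by (rule two_minus_cos_le)
      then have "fsym (?h n) k / (?h n)\<^sup>2 \<le> lam k powr g"
        using True by (simp add: power_mult_distrib powr_numeral divide_le_eq)
      then show "norm (?s n k) \<le> norm (lam k powr g * c k)"
        using fsym_nonneg[of "?h n" k] unfolding real_norm_def abs_mult
        by (intro mult_right_mono) auto
    qed
  qed (use i in auto)
  then have "(\<lambda>n. LINT k|count_space UNIV. ?s n k) \<longlonglongrightarrow> (\<Sum>\<^sub>\<infinity>k. lam k powr g * c k)"
    using infsum_LINT(2)[OF summ] by simp
  moreover have "0 \<le> (LINT k|count_space UNIV. ?s n k)" for n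
  proof -
    have h: "?h n > 0" by simp
    have hs: "((\<lambda>k. inverse ((?h n)\<^sup>2) * (fsym (?h n) k * c k)) has_sum inverse ((?h n)\<^sup>2) * D (?h n)) UNIV"
      by (rule has_sum_cmult_right[OF nonneg(1)[OF h]])
    have eq: "(\<lambda>k. inverse ((?h n)\<^sup>2) * (fsym (?h n) k * c k)) = ?s n"
      by (auto simp: field_simps)
    have "(LINT k|count_space UNIV. ?s n k) = inverse ((?h n)\<^sup>2) * D (?h n)"
      using infsum_LINT(2)[OF has_sum_imp_summable[OF hs]] infsumI[OF hs] unfolding eq by simp
    then show ?thesis using nonneg(2)[OF h] by simp
  qed
  ultimately show ?thesis using LIMSEQ_le_const by blast
qed

subsection \<open>The K-functional between L2 and H1\<close>

lemma cper_borel: "cper w \<Longrightarrow> w \<in> borel_measurable borel"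
  by (intro borel_measurable_continuous_onI) (simp add: cper_def)

text \<open>For one Fourier mode, the infimum over v of |c - v|^2 + u^2 |v|^2 is
  \<open>ksym u\<close> times |c|^2; with u = lam k * t this is the symbol of the quadratic
  K-functional at scale \<open>t\<close>. It is made for the change of variable, which does not
  preserve Fourier modes but keeps L2 and H1 norms comparable.\<close>

definition ksym :: "real \<Rightarrow> real" where "ksym u = u\<^sup>2 / (1 + u\<^sup>2)"

lemma ksym_bounds: "0 \<le> ksym u" "ksym u \<le> 1" "ksym u \<le> u\<^sup>2"
  unfolding ksym_def using zero_le_power2[of u] by (simp_all add: divide_le_eq add_pos_nonneg algebra_simps)

lemma ksym_has_sum:
  assumes u: "cper u"
  shows "((\<lambda>k. ksym (lam k * t) * (cmod (fc u k))\<^sup>2) has_sum (\<Sum>\<^sub>\<infinity>k. ksym (lam k * t) * (cmod (fc u k))\<^sup>2)) UNIV"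
  by (rule has_sum_infsum[OF summable_dom[OF has_sum_imp_summable[OF parseval_sq[OF u]]]])
     (use ksym_bounds in \<open>simp add: abs_mult mult_left_le_one_le\<close>)

lemma ksym_lower:
  assumes u: "cper u" and v: "c1per v v'"
  shows "(\<Sum>\<^sub>\<infinity>k. ksym (lam k * t) * (cmod (fc u k))\<^sup>2) \<le> pint (\<lambda>x. (u x - v x)\<^sup>2) + t\<^sup>2 * pint (\<lambda>x. (v' x)\<^sup>2)"
proof (rule has_sum_mono[OF ksym_has_sum[OF u] has_sum_add[OF parseval_sq[OF cper_diff[OF u c1per_cper[OF v]]] has_sum_cmult_right[OF parseval_sq[OF c1per_cper'[OF v]]]]])
  fix k
  let ?p = "cmod (fc u k - fc v k)" and ?r = "cmod (fc v k)" and ?x = "lam k * t"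
  \<comment> \<open>With the denominator 1 + x^2 cleared, the defect of a competitor from the
    modewise minimum is a perfect square.\<close>
  have "(?p\<^sup>2 + ?x\<^sup>2 * ?r\<^sup>2) * (1 + ?x\<^sup>2) - (?p + ?r)\<^sup>2 * ?x\<^sup>2 = (?p - ?x\<^sup>2 * ?r)\<^sup>2" by algebra
  then have "(?p + ?r)\<^sup>2 * ?x\<^sup>2 \<le> (?p\<^sup>2 + ?x\<^sup>2 * ?r\<^sup>2) * (1 + ?x\<^sup>2)" using zero_le_power2[of "?p - ?x\<^sup>2 * ?r"] by linarith
  moreover have "(cmod (fc u k))\<^sup>2 \<le> (?p + ?r)\<^sup>2" using norm_triangle_ineq[of "fc u k - fc v k" "fc v k"] by (intro power_mono) auto
  then have "(cmod (fc u k))\<^sup>2 * ?x\<^sup>2 \<le> (?p + ?r)\<^sup>2 * ?x\<^sup>2" by (rule mult_right_mono) simp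
  ultimately have "ksym ?x * (cmod (fc u k))\<^sup>2 \<le> ?p\<^sup>2 + ?x\<^sup>2 * ?r\<^sup>2"
    unfolding ksym_def by (simp add: divide_le_eq add_pos_nonneg mult.commute)
  then show "ksym ?x * (cmod (fc u k))\<^sup>2 \<le> (cmod (fc (\<lambda>x. u x - v x) k))\<^sup>2 + t\<^sup>2 * (cmod (fc v' k))\<^sup>2"
    by (simp add: fc_diff[OF u c1per_cper[OF v]] fc_deriv[OF v] lam_def norm_mult power_mult_distrib mult_ac)
qed

text \<open>Both min(4, x^2) and x^2 / (1 + x^2) change regime at x = 1; the factor 8 covers the two
  cases.\<close>

lemma delta_sq_le_ksym:
  assumes u: "cper u" and h: "0 \<le> h" "h \<le> t"
  shows "pint (\<lambda>x. (u (x + h) - u x)\<^sup>2) \<le> 8 * (\<Sum>\<^sub>\<infinity>k. ksym (lam k * t) * (cmod (fc u k))\<^sup>2)"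
proof (rule has_sum_mono[OF pint_delta_sq[OF u] has_sum_cmult_right[OF ksym_has_sum[OF u]]])
  fix k
  let ?x = "lam k * t"
  have x: "(lam k * h)\<^sup>2 \<le> ?x\<^sup>2" using h by (intro power_mono mult_left_mono) auto
  have "fsym h k \<le> 8 * ksym ?x"
  proof (cases "?x\<^sup>2 \<le> 1")
    case True
    have "fsym h k \<le> ?x\<^sup>2" unfolding fsym_cos by (rule order_trans[OF two_minus_cos_le x])
    also have "y \<le> 8 * (y / (1 + y))" if "0 \<le> y" "y \<le> 1" for y :: real
      using that mult_right_mono[of y 7 y] by (simp add: field_simps)
    from this[OF _ True] have "?x\<^sup>2 \<le> 8 * ksym ?x" by (simp add: ksym_def)
    finally show ?thesis .
  next
    case False
    have "fsym h k \<le> 4" using cos_ge_minus_one[of "lam k * h"] unfolding fsym_cos by linarith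
    also have "\<dots> \<le> 8 * ksym ?x" using False by (simp add: ksym_def le_divide_eq add_pos_nonneg)
    finally show ?thesis .
  qed
  then show "fsym h k * (cmod (fc u k))\<^sup>2 \<le> 8 * (ksym ?x * (cmod (fc u k))\<^sup>2)"
    using mult_right_mono[of "fsym h k" "8 * ksym ?x" "(cmod (fc u k))\<^sup>2"] by simp
qed

text \<open>The Steklov mean of \<open>u\<close> over \<open>{x..x + t}\<close> almost attains the K-functional.\<close>
lemma ksym_upper:
  assumes u: "c1per u u'" and t: "0 < t"
  shows "\<exists>v v'. c1per v v' \<and> pint (\<lambda>x. (u x - v x)\<^sup>2) + t\<^sup>2 * pint (\<lambda>x. (v' x)\<^sup>2) \<le> 16 * (\<Sum>\<^sub>\<infinity>k. ksym (lam k * t) * (cmod (fc u k))\<^sup>2)"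
proof -
  let ?S = "\<Sum>\<^sub>\<infinity>k. ksym (lam k * t) * (cmod (fc u k))\<^sup>2"
  define v where "v x = integral {0..1} (\<lambda>s. u (x + t * s))" for x
  define v' where "v' x = (u (x + t) - u x) / t" for x
  note cu = c1per_cper[OF u] and cu' = c1per_cper'[OF u]
  note ct = continuous_on_compose2[OF cper_cont[OF cu, of UNIV]] continuous_on_compose2[OF cper_cont[OF cu', of UNIV]]
  have v: "c1per v v'"
  proof (rule c1perI)
    show "v (x + 1) = v x" for x using cper_periodic[OF cu, of "x + t * _"] by (simp add: v_def add_ac)
    show "continuous_on UNIV v'" unfolding v'_def using t by (intro continuous_intros ct) auto
    fix x
    have "(v has_field_derivative integral (cbox 0 1) (\<lambda>s. u' (x + t * s))) (at x within UNIV)"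
      unfolding v_def[abs_def] cbox_interval[symmetric]
    proof (rule leibniz_rule_field_derivative)
      show "((\<lambda>x. u (x + t * s)) has_field_derivative u' (x + t * s)) (at x within UNIV)" for x s
        using c1per_deriv[OF c1per_shift[OF u, of "t * s"]] by simp
      show "continuous_on (UNIV \<times> cbox 0 1) (\<lambda>(x, s). u' (x + t * s))"
        unfolding case_prod_unfold by (intro continuous_intros ct) auto
      show "(\<lambda>s. u (x + t * s)) integrable_on cbox 0 1" for x
        unfolding cbox_interval by (intro integrable_continuous_real continuous_intros ct) auto
    qed auto
    moreover have "((\<lambda>s. u' (x + t * s)) has_integral (u (x + t * 1) / t - u (x + t * 0) / t)) {0..1}"
    proof (rule fundamental_theorem_of_calculus)
      fix s
      have "((\<lambda>s. u (x + t * s) / t) has_real_derivative u' (x + t * s)) (at s)"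
        using t by (auto intro!: derivative_eq_intros DERIV_chain2[OF c1per_deriv[OF u]])
      then show "((\<lambda>s. u (x + t * s) / t) has_vector_derivative u' (x + t * s)) (at s within {0..1})"
        by (simp add: has_real_derivative_iff_has_vector_derivative[symmetric] has_field_derivative_at_within)
    qed simp
    ultimately show "(v has_real_derivative v' x) (at x)"
      by (simp add: integral_unique v'_def diff_divide_distrib cbox_interval)
  qed
  \<comment> \<open>The derivative of the mean is a difference quotient, so the H1 part is exactly
    the squared increment by \<open>t\<close>.\<close>
  have "t\<^sup>2 * pint (\<lambda>x. (v' x)\<^sup>2) = pint (\<lambda>x. (u (x + t) - u x)\<^sup>2)"
    unfolding pint_cmult[symmetric] v'_def using t by (simp add: power_divide)
  also have "\<dots> \<le> 8 * ?S" using t by (intro delta_sq_le_ksym cu) auto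
  finally have 1: "t\<^sup>2 * pint (\<lambda>x. (v' x)\<^sup>2) \<le> 8 * ?S" .
  let ?d = "\<lambda>x s. u (x + t * s) - u x"
  \<comment> \<open>Jensen's inequality on the unit interval, from 2 m d - m^2 <= d^2 with m the
    mean of d.\<close>
  have jensen: "(u x - v x)\<^sup>2 \<le> integral {0..1} (\<lambda>s. (?d x s)\<^sup>2)" for x
  proof -
    let ?m = "v x - u x"
    have i: "?d x integrable_on {0..1}" "(\<lambda>s. (?d x s)\<^sup>2) integrable_on {0..1}" "(\<lambda>s. 2 * ?m * ?d x s) integrable_on {0..1}"
      by (intro integrable_continuous_real continuous_intros ct; simp)+
    have m: "integral {0..1} (?d x) = ?m"
      unfolding v_def using Henstock_Kurzweil_Integration.integral_diff[of "\<lambda>s. u (x + t * s)" "{0..1}" "\<lambda>s. u x"]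
      by (simp add: integrable_continuous_real continuous_intros ct)
    have "((\<lambda>s::real. y) has_integral y) {0..1}" for y :: real using has_integral_const_real[of y 0 1] by simp
    note c = integral_unique[OF this]
    have "?m\<^sup>2 = integral {0..1} (\<lambda>s. 2 * ?m * ?d x s) - integral {0..1} (\<lambda>s::real. ?m\<^sup>2)"
      unfolding c integral_mult_right m by (simp add: power2_eq_square)
    also have "\<dots> = integral {0..1} (\<lambda>s. 2 * ?m * ?d x s - ?m\<^sup>2)"
      by (rule Henstock_Kurzweil_Integration.integral_diff[symmetric]) (use i in auto)
    also have "\<dots> \<le> integral {0..1} (\<lambda>s. (?d x s)\<^sup>2)"
    proof (intro integral_le integrable_diff i integrable_const_ivl)
      show "2 * ?m * ?d x s - ?m\<^sup>2 \<le> (?d x s)\<^sup>2" for s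
        using sum_squares_bound[of ?m "?d x s"] by linarith
    qed
    finally show ?thesis by (simp add: power2_commute)
  qed
  have c2: "continuous_on ({0..1} \<times> {0..1}) (\<lambda>(x, s). (?d x s)\<^sup>2)" "continuous_on ({0..1} \<times> {0..1}) (\<lambda>(s, x). (?d x s)\<^sup>2)"
    unfolding case_prod_unfold by (intro continuous_intros ct; simp)+
  have "pint (\<lambda>x. (u x - v x)\<^sup>2) \<le> pint (\<lambda>x. integral {0..1} (\<lambda>s. (?d x s)\<^sup>2))"
    by (intro integral_le cper_integrable cper_power cper_diff cu c1per_cper[OF v] integrable_continuous_real continuous_on_integral2[OF c2(1)] jensen)
  also have "\<dots> = integral {0..1} (\<lambda>s. pint (\<lambda>x. (?d x s)\<^sup>2))" by (rule integral_swap2[OF c2(1)])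
  also have "\<dots> \<le> integral {0..1} (\<lambda>s::real. 8 * ?S)"
  proof (intro integral_le integrable_continuous_real continuous_on_integral2[OF c2(2)] continuous_on_const)
    fix s :: real assume "s \<in> {0..1}"
    then show "pint (\<lambda>x. (?d x s)\<^sup>2) \<le> 8 * ?S" using t by (intro delta_sq_le_ksym cu) (auto simp: mult_left_le)
  qed
  finally show ?thesis using 1 v by (intro exI[of _ v] exI[of _ v']) simp
qed

subsection \<open>Fourier multipliers on smooth functions\<close>

text \<open>Only finitely many derivatives matter: a multiplier of order s needs s + 2 of them for
  absolute summability, hence four for s = \<gamma>. The derivative is hidden by a quantifier so
  that products and compositions go by induction on the order.\<close>

fun ckper :: "nat \<Rightarrow> (real \<Rightarrow> real) \<Rightarrow> bool" where
  "ckper 0 f = cper f"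
| "ckper (Suc n) f = (\<exists>f'. c1per f f' \<and> ckper n f')"

lemma ckper_Suc_imp: "ckper (Suc n) f \<Longrightarrow> ckper n f"
proof (induction n arbitrary: f)
  case 0
  then show ?case using c1per_cper by auto
next
  case (Suc n)
  then show ?case by (meson ckper.simps(2))
qed

lemma ckper_cper: "ckper n f \<Longrightarrow> cper f"
  by (cases n) (auto dest: c1per_cper)

lemma ckper_add: "ckper n f \<Longrightarrow> ckper n g \<Longrightarrow> ckper n (\<lambda>x. f x + g x)"
proof (induction n arbitrary: f g)
  case (Suc n)
  then show ?case using c1per_add by (meson ckper.simps(2))
qed (simp add: cper_add)

lemma ckper_mult: "ckper n f \<Longrightarrow> ckper n g \<Longrightarrow> ckper n (\<lambda>x. f x * g x)"
proof (induction n arbitrary: f g)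
  case (Suc n)
  then obtain f' g' where fg: "c1per f f'" "ckper n f'" "c1per g g'" "ckper n g'" by auto
  have "ckper n (\<lambda>x. f' x * g x + f x * g' x)"
    using Suc fg ckper_Suc_imp by (intro ckper_add Suc.IH) auto
  then show ?case using c1per_mult[OF fg(1,3)] by auto
qed (simp add: cper_mult)

lemma ckper_compose:
  assumes d: "\<And>x. (\<Psi> has_real_derivative J x) (at x)" and per: "\<And>x. \<Psi> (x + 1) = \<Psi> x + 1"
  shows "ckper n f \<Longrightarrow> ckper n J \<Longrightarrow> ckper n (\<lambda>x. f (\<Psi> x))"
proof (induction n arbitrary: f)
  case 0
  have "continuous_on UNIV \<Psi>" using d by (meson DERIV_isCont continuous_at_imp_continuous_on)
  then show ?case using 0 per by (auto simp: cper_def periodic1_def intro: continuous_on_compose2)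
next
  case (Suc n)
  then obtain f' where f': "c1per f f'" "ckper n f'" by auto
  have c: "ckper n (\<lambda>x. f' (\<Psi> x) * J x)"
    using Suc f' ckper_Suc_imp by (intro ckper_mult Suc.IH) auto
  have "c1per (\<lambda>x. f (\<Psi> x)) (\<lambda>x. f' (\<Psi> x) * J x)"
  proof (rule c1perI)
    show "((\<lambda>x. f (\<Psi> x)) has_real_derivative f' (\<Psi> x) * J x) (at x)" for x
      by (rule DERIV_chain2[OF c1per_deriv[OF f'(1)] d])
    show "f (\<Psi> (x + 1)) = f (\<Psi> x)" for x
      using cper_periodic[OF c1per_cper[OF f'(1)]] by (simp add: per)
    show "continuous_on UNIV (\<lambda>x. f' (\<Psi> x) * J x)" by (rule cper_cont[OF ckper_cper[OF c]])
  qed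
  then show ?case using c by auto
qed

lemma ckper_fc_decay: "ckper n f \<Longrightarrow> \<exists>B\<ge>0. \<forall>k. lam k ^ n * cmod (fc f k) \<le> B"
proof (induction n arbitrary: f)
  case 0
  then have f: "cper f" by simp
  show ?case using norm_fc_le[OF f] pint_nonneg[OF cper_abs[OF f]] by auto
next
  case (Suc n)
  then obtain f' where f': "c1per f f'" "ckper n f'" by auto
  obtain B where B: "B \<ge> 0" "\<And>k. lam k ^ n * cmod (fc f' k) \<le> B" using Suc.IH[OF f'(2)] by auto
  have "lam k ^ Suc n * cmod (fc f k) = lam k ^ n * cmod (fc f' k)" for k
    by (simp add: fc_deriv[OF f'(1)] norm_mult lam_def abs_mult)
  then show ?case using B by (intro exI[of _ B]) (simp only: simp_thms)
qed

lemma summable_lam: "(\<lambda>k. lam k powr - 2) summable_on UNIV"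
proof -
  have b: "bij_betw int_decode UNIV UNIV" by (simp add: bij_int_decode)
  have s: "summable (\<lambda>n. 4 * (1 / real (Suc n) ^ 2))"
    using inverse_power_summable[of 2, where 'a = real] summable_Suc_iff[of "\<lambda>n. inverse (real n ^ 2)"]
    by (intro summable_mult) (simp add: inverse_eq_divide)
  have le: "lam (int_decode n) powr - 2 \<le> 4 * (1 / real (Suc n) ^ 2)" for n
  proof (cases "int_decode n = 0")
    case False
    have "real (Suc n) \<le> 2 * lam (int_decode n)"
    proof -
      \<comment> \<open>The enumeration alternates signs, so the integer k stands at a position not
        beyond 2 |k|.\<close>
      have "int (Suc n) \<le> 2 * \<bar>int_decode n\<bar> + 1"
        by (auto simp: int_decode_def sum_decode_def elim!: evenE oddE)
      then have "real (Suc n) \<le> 2 * \<bar>of_int (int_decode n)\<bar> + 1" by linarith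
      moreover have "\<bar>of_int (int_decode n)\<bar> + 1 \<le> lam (int_decode n)"
      proof -
        have "(1::real) \<le> \<bar>of_int (int_decode n)\<bar>" using False
          by (metis of_int_1_le_iff of_int_abs int_one_le_iff_zero_less zero_less_abs_iff)
        then have "\<bar>of_int (int_decode n)\<bar> + 1 \<le> 2 * \<bar>of_int (int_decode n) :: real\<bar>" by simp
        also have "\<dots> \<le> 2 * pi * \<bar>of_int (int_decode n)\<bar>"
          using pi_gt3 by (intro mult_right_mono) auto
        finally show ?thesis by (simp add: lam_def abs_mult)
      qed
      ultimately show ?thesis by linarith
    qed
    then have "(real (Suc n))\<^sup>2 \<le> (2 * lam (int_decode n))\<^sup>2" by (intro power_mono) auto
    moreover have "0 < lam (int_decode n)" using lam_ge1[OF False] by simp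
    ultimately show ?thesis
      by (simp add: powr_minus powr_numeral field_simps del: of_nat_Suc)
  qed simp
  have "summable (\<lambda>n. lam (int_decode n) powr - 2)"
    by (rule summable_comparison_test'[OF s, of 0]) (use le in auto)
  then have "(\<lambda>n. lam (int_decode n) powr - 2) summable_on UNIV"
    by (intro norm_summable_imp_summable_on) simp
  then show ?thesis using summable_on_reindex_bij_betw[OF b, of "\<lambda>k. lam k powr - 2"] by simp
qed

lemma ckper_summable:
  assumes f: "ckper n f" and s: "s + 2 \<le> real n"
  shows "(\<lambda>k. lam k powr s * cmod (fc f k)) summable_on UNIV"
proof -
  obtain B where B: "B \<ge> 0" "\<And>k. lam k ^ n * cmod (fc f k) \<le> B" using ckper_fc_decay[OF f] by auto
  have "(\<lambda>k. B * lam k powr - 2) summable_on UNIV" by (intro summable_on_cmult_right summable_lam)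
  then show ?thesis
  proof (rule summable_dom)
    fix k
    show "\<bar>lam k powr s * cmod (fc f k)\<bar> \<le> B * lam k powr - 2"
    proof (cases "k = 0")
      case False
      have pos: "lam k > 0" using lam_ge1[OF False] by simp
      have "lam k powr s * cmod (fc f k) \<le> lam k powr (real n - 2) * cmod (fc f k)"
        using s by (intro mult_right_mono lam_powr_mono) auto
      also have "\<dots> = lam k powr - 2 * (lam k ^ n * cmod (fc f k))"
        using pos by (simp add: powr_diff powr_minus powr_realpow field_simps)
      also have "\<dots> \<le> lam k powr - 2 * B" using B by (intro mult_left_mono) auto
      finally show ?thesis by (simp add: abs_mult mult.commute)
    qed simp
  qed
qed

text \<open>The integers are enumerated by \<open>int_decode\<close> so that the Weierstrass test
  and termwise differentiation, which speak of sequences, apply; under absolute summability the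
  order is immaterial.\<close>

definition fser :: "(int \<Rightarrow> complex) \<Rightarrow> real \<Rightarrow> real" where
  "fser c x = (\<Sum>n. Re (c (int_decode n) * ek (int_decode n) x))"

lemma cper_fterm: "cper (\<lambda>x. Re (c * ek k x))"
  using cper_mult[OF cper_const cper_ek, of c k]
  by (rule cper_compose) (intro continuous_intros)

context
  fixes c :: "int \<Rightarrow> complex"
  assumes c: "(\<lambda>k. cmod (c k)) summable_on UNIV"
begin

lemma summable_norm_decode: "summable (\<lambda>n. cmod (c (int_decode n)))"
proof -
  have "(\<lambda>n. cmod (c (int_decode n))) summable_on UNIV"
    using summable_on_reindex_bij_betw[of int_decode UNIV UNIV "\<lambda>k. cmod (c k)"] c
    by (simp add: bij_int_decode)
  then show ?thesis by (rule summable_on_imp_summable)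
qed

lemma fser_term_le: "\<bar>Re (c k * ek k x)\<bar> \<le> cmod (c k)"
  using abs_Re_le_cmod[of "c k * ek k x"] by (simp add: norm_mult)

lemma fser_uniform: "uniform_limit UNIV (\<lambda>n x. \<Sum>i<n. Re (c (int_decode i) * ek (int_decode i) x)) (fser c) sequentially"
  unfolding fser_def using fser_term_le
  by (intro Weierstrass_m_test[OF _ summable_norm_decode]) auto

lemma cper_fser: "cper (fser c)"
proof (rule cperI)
  show "fser c (x + 1) = fser c x" for x by (simp add: fser_def ek_add)
  show "continuous_on UNIV (fser c)"
    by (rule uniform_limit_theorem[OF _ fser_uniform])
       (auto intro!: always_eventually continuous_intros)
qed

lemma fser_has_sum: "((\<lambda>k. Re (c k * ek k x)) has_sum fser c x) UNIV"
proof -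
  have b: "bij_betw int_decode UNIV UNIV" by (simp add: bij_int_decode)
  have s: "summable (\<lambda>n. norm (Re (c (int_decode n) * ek (int_decode n) x)))"
    by (rule summable_comparison_test'[OF summable_norm_decode, of 0]) (use fser_term_le in auto)
  have "((\<lambda>n. Re (c (int_decode n) * ek (int_decode n) x)) has_sum fser c x) UNIV"
    unfolding fser_def using s summable_norm_cancel[OF s] by (intro norm_summable_imp_has_sum) (auto simp: summable_sums)
  then show ?thesis using has_sum_reindex_bij_betw[OF b, of "\<lambda>k. Re (c k * ek k x)" "fser c x"] by simp
qed

text \<open>Uniform convergence permits termwise integration against a continuous function, which
  gives Parseval's identity for coefficients that are prescribed rather than computed from a
  function.\<close>

lemma fser_pint:
  assumes p: "cper p"
  shows "((\<lambda>k. Re (c k * cnj (fc p k))) has_sum pint (\<lambda>x. p x * fser c x)) UNIV"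
proof -
  have b: "bij_betw int_decode UNIV UNIV" by (simp add: bij_int_decode)
  obtain B where B: "\<And>x. \<bar>p x\<bar> \<le> B" using cper_bounded[OF p] by blast
  let ?S = "\<lambda>n x. \<Sum>i<n. Re (c (int_decode i) * ek (int_decode i) x)"
  let ?t = "\<lambda>k. Re (c k * cnj (fc p k))"
  have tm: "pint (\<lambda>x. p x * Re (c k * ek k x)) = ?t k" for k
  proof -
    have "pint (\<lambda>x. p x * Re (c k * ek k x)) = pint (\<lambda>x. Re (c k * cnj (of_real (p x) * cis (- 2 * pi * of_int k * x))))"
      by (simp add: cis_cnj algebra_simps)
    also have "\<dots> = Re (pint (\<lambda>x. c k * cnj (of_real (p x) * cis (- 2 * pi * of_int k * x))))"
    proof (rule pint_complex_Re[symmetric])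
      have "cper (\<lambda>x. c k * (of_real (p x) * ek k x))" by (intro cper_mult cper_of_real p cper_ek cper_const)
      then show "cper (\<lambda>x. c k * cnj (of_real (p x) * cis (- 2 * pi * of_int k * x)))" by (simp add: cis_cnj)
    qed
    also have "\<dots> = Re (c k * pint (\<lambda>x. cnj (of_real (p x) * cis (- 2 * pi * of_int k * x))))" by simp
    also have "pint (\<lambda>x. cnj (of_real (p x) * cis (- 2 * pi * of_int k * x))) = cnj (fc p k)"
      unfolding fc_pint[OF p]
      using integral_linear[OF cper_integrable[OF cper_fc[OF p, of k], of 0 1] bounded_linear_cnj]
      by (simp add: o_def)
    finally show ?thesis .
  qed
  have ul: "uniform_limit {0..1} (\<lambda>n x. p x * ?S n x) (\<lambda>x. p x * fser c x) sequentially"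
  proof (rule uniform_lim_mult[OF uniform_limit_const uniform_limit_on_subset[OF fser_uniform]])
    show "bounded (p ` {0..1})" using B by (auto simp: bounded_iff)
    show "bounded (fser c ` {0..1})"
      using compact_continuous_image[OF cper_cont[OF cper_fser] compact_Icc] by (rule compact_imp_bounded)
  qed auto
  obtain I J where IJ: "\<And>n. ((\<lambda>x. p x * ?S n x) has_integral I n) {0..1}"
      "((\<lambda>x. p x * fser c x) has_integral J) {0..1}" "I \<longlonglongrightarrow> J"
  proof (rule uniform_limit_integral[OF ul])
    show "continuous_on {0..1} (\<lambda>x. p x * ?S n x)" for n
      by (intro continuous_on_mult cper_cont[OF p] continuous_on_sum cper_cont[OF cper_fterm])
  qed auto
  have "I n = (\<Sum>i<n. ?t (int_decode i))" for n
  proof -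
    have "I n = pint (\<lambda>x. \<Sum>i<n. p x * Re (c (int_decode i) * ek (int_decode i) x))"
      using integral_unique[OF IJ(1)[of n]] by (simp add: sum_distrib_left)
    also have "\<dots> = (\<Sum>i<n. ?t (int_decode i))"
      unfolding tm[symmetric] by (rule pint_sum, simp) (intro cper_mult p cper_fterm)
    finally show ?thesis .
  qed
  then have "I = (\<lambda>n. \<Sum>i<n. ?t (int_decode i))" by (rule ext)
  then have sums: "(\<lambda>i. ?t (int_decode i)) sums J" using IJ(3) by (simp only: sums_def)
  have "summable (\<lambda>n. norm (?t (int_decode n)))"
  proof (rule summable_comparison_test'[of "\<lambda>n. pint (\<lambda>x. \<bar>p x\<bar>) * cmod (c (int_decode n))" 0])
    show "summable (\<lambda>n. pint (\<lambda>x. \<bar>p x\<bar>) * cmod (c (int_decode n)))"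
      by (intro summable_mult summable_norm_decode)
    fix n
    have "\<bar>?t k\<bar> \<le> cmod (c k) * cmod (fc p k)" for k
      using abs_Re_le_cmod[of "c k * cnj (fc p k)"] by (simp add: norm_mult)
    also have "\<dots> k \<le> cmod (c k) * pint (\<lambda>x. \<bar>p x\<bar>)" for k
      using norm_fc_le[OF p, of k] by (intro mult_left_mono) auto
    finally show "norm (norm (?t (int_decode n))) \<le> pint (\<lambda>x. \<bar>p x\<bar>) * cmod (c (int_decode n))"
      by (simp add: mult.commute)
  qed
  then have "((\<lambda>i. ?t (int_decode i)) has_sum J) UNIV" using sums by (rule norm_summable_imp_has_sum)
  then show ?thesis
    using has_sum_reindex_bij_betw[OF b, of ?t J] integral_unique[OF IJ(2)] by simp
qed

text \<open>The symmetric intervals are cofinal among finite sets of frequencies, so for summable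
  coefficients the pointwise limit in \<open>fmult\<close> is the unordered sum.\<close>

lemma fmult_fser:
  assumes "\<And>k. \<sigma> k * fc f k = c k"
  shows "fmult \<sigma> f x = fser c x"
proof -
  have "(\<lambda>N::nat. \<Sum>k\<in>{- int N..int N}. Re (c k * ek k x)) \<longlonglongrightarrow> fser c x"
  proof (rule filterlim_compose[OF fser_has_sum[unfolded has_sum_def]])
    show "filterlim (\<lambda>N::nat. {- int N..int N}) (finite_subsets_at_top UNIV) sequentially"
    proof (rule filterlim_finite_subsets_at_top[THEN iffD2], intro allI impI)
      fix X :: "int set" assume "finite X \<and> X \<subseteq> UNIV"
      then obtain M where M: "\<And>k. k \<in> X \<Longrightarrow> \<bar>k\<bar> \<le> M"
        using finite_imageI[of X abs] by (meson Max_ge finite_imageI imageI)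
      show "\<forall>\<^sub>F N in sequentially. finite {- int N..int N} \<and> X \<subseteq> {- int N..int N} \<and> {- int N..int N} \<subseteq> UNIV"
        using eventually_ge_at_top[of "nat M"]
      proof eventually_elim
        case (elim N)
        then show ?case using M by fastforce
      qed
    qed
  qed
  then show ?thesis unfolding fmult_def by (simp add: assms limI)
qed

end

lemma c1per_fser:
  assumes c: "(\<lambda>k. cmod (c k)) summable_on UNIV" and d: "(\<lambda>k. lam k * cmod (c k)) summable_on UNIV"
  shows "c1per (fser c) (fser (\<lambda>k. 2 * pi * \<i> * of_int k * c k))"
proof (rule c1perI)
  let ?d = "\<lambda>k. 2 * pi * \<i> * of_int k * c k"
  have nd: "cmod (?d k) = lam k * cmod (c k)" for k by (simp add: norm_mult lam_def abs_mult)
  have d': "(\<lambda>k. cmod (?d k)) summable_on UNIV" using d by (simp only: nd)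
  show "fser c (x + 1) = fser c x" for x by (rule cper_periodic[OF cper_fser[OF c]])
  show "continuous_on UNIV (fser ?d)" by (rule cper_cont[OF cper_fser[OF d']])
  fix x
  show "(fser c has_real_derivative fser ?d x) (at x)"
    unfolding fser_def
  proof (rule has_field_derivative_series'(2)[where S = UNIV and ?x0.0 = x])
    fix n and y :: real
    have "((\<lambda>y. c k * ek k y) has_vector_derivative ?d k * ek k y) (at y)" for k
      unfolding has_vector_derivative_def
      by (auto intro!: derivative_eq_intros simp: scaleR_conv_of_real algebra_simps)
    from bounded_linear.has_vector_derivative[OF bounded_linear_Re this]
    show "((\<lambda>y. Re (c (int_decode n) * ek (int_decode n) y)) has_field_derivative
        Re (?d (int_decode n) * ek (int_decode n) y)) (at y within UNIV)"
      by (simp add: has_real_derivative_iff_has_vector_derivative)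
  next
    show "uniformly_convergent_on UNIV (\<lambda>n x. \<Sum>i<n. Re (?d (int_decode i) * ek (int_decode i) x))"
      using fser_uniform[OF d'] by (auto simp: uniformly_convergent_on_def)
    show "summable (\<lambda>n. Re (c (int_decode n) * ek (int_decode n) x))"
      by (rule summable_comparison_test'[OF summable_norm_decode[OF c], of 0]) (use fser_term_le[OF c] in auto)
  qed auto
qed

lemma Lam_fser:
  assumes f: "ckper n f" and s: "s + 2 \<le> real n"
  shows "Lam s f = fser (\<lambda>k. of_real (lam k powr s) * fc f k)"
    "(\<lambda>k. cmod (of_real (lam k powr s) * fc f k)) summable_on UNIV"
proof -
  show *: "(\<lambda>k. cmod (of_real (lam k powr s) * fc f k)) summable_on UNIV"
    using ckper_summable[OF f s] by (simp add: norm_mult)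
  show "Lam s f = fser (\<lambda>k. of_real (lam k powr s) * fc f k)"
    unfolding Lam_def by (rule ext, rule fmult_fser[OF *]) (simp add: lam_def)
qed

lemma lam_powr_Suc: "lam k powr s * lam k = lam k powr (s + 1)"
  by (cases "k = 0") (use lam_ge1[of k] in \<open>auto simp: powr_add\<close>)

lemma c1per_Lam:
  assumes f: "ckper (Suc n) f" "c1per f f'" and s: "s + 2 \<le> real n"
  shows "c1per (Lam s f) (Lam s f')"
proof -
  have f0: "ckper n f" and f': "ckper n f'"
  proof -
    show "ckper n f" using f(1) by (rule ckper_Suc_imp)
    obtain f1 where f1: "c1per f f1" "ckper n f1" using f(1) by auto
    have "f1 = f'" using c1per_deriv[OF f1(1)] c1per_deriv[OF f(2)] DERIV_unique by blast
    then show "ckper n f'" using f1 by simp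
  qed
  have "(\<lambda>k. lam k * cmod (of_real (lam k powr s) * fc f k)) summable_on UNIV"
  proof -
    have "(\<lambda>k. lam k powr (s + 1) * cmod (fc f k)) summable_on UNIV"
      by (rule ckper_summable[OF f(1)]) (use s in simp)
    moreover have "lam k powr (s + 1) * cmod (fc f k) = lam k * cmod (of_real (lam k powr s) * fc f k)" for k
      unfolding lam_powr_Suc[symmetric] by (simp add: norm_mult mult_ac)
    ultimately show ?thesis by simp
  qed
  from c1per_fser[OF Lam_fser(2)[OF f0 s] this]
  show ?thesis unfolding Lam_fser(1)[OF f0 s] Lam_fser(1)[OF f' s]
    by (simp add: fc_deriv[OF f(2)] mult_ac)
qed

text \<open>On the Fourier side (2 pi i k)^2 lam^(s-2) = - lam^s: one more derivative turns the
  first-order operator into minus \<open>Lam s\<close>.\<close>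

lemma c1per_Riesz:
  assumes f: "ckper n f" and s: "s + 2 \<le> real n" "1 \<le> s"
  shows "c1per (Riesz s f) (\<lambda>x. - Lam s f x)"
proof -
  let ?c = "\<lambda>k. of_real (lam k powr (s - 2)) * (2 * pi * \<i> * of_int k) * fc f k"
  have nc: "cmod (?c k) = lam k powr (s - 1) * cmod (fc f k)" for k
    using lam_powr_Suc[of k "s - 2"] by (simp add: norm_mult lam_def abs_mult)
  have s1: "(\<lambda>k. cmod (?c k)) summable_on UNIV"
    unfolding nc by (rule ckper_summable[OF f]) (use s in simp)
  have s2: "(\<lambda>k. lam k * cmod (?c k)) summable_on UNIV"
  proof -
    have "lam k * cmod (?c k) = lam k powr s * cmod (fc f k)" for k
      unfolding nc using lam_powr_Suc[of k "s - 1"] by (simp flip: mult.assoc) (simp add: mult.commute)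
    then show ?thesis using ckper_summable[OF f s(1)] by simp
  qed
  have R: "Riesz s f = fser ?c"
    unfolding Riesz_def by (rule ext, rule fmult_fser[OF s1]) (simp add: lam_def)
  have eq: "2 * pi * \<i> * of_int k * ?c k = - (of_real (lam k powr s) * fc f k)" for k
  proof -
    have sq: "(2 * pi * \<i> * of_int k) * (2 * pi * \<i> * of_int k) = - (complex_of_real (lam k * lam k))"
      by (simp add: lam_def algebra_simps)
    have pw: "lam k powr (s - 2) * (lam k * lam k) = lam k powr s"
      using lam_powr_Suc[of k "s - 2"] lam_powr_Suc[of k "s - 1"] by (simp add: mult.assoc[symmetric])
    have "2 * pi * \<i> * of_int k * ?c k
        = of_real (lam k powr (s - 2)) * ((2 * pi * \<i> * of_int k) * (2 * pi * \<i> * of_int k)) * fc f k"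
      by (simp only: mult_ac)
    also have "\<dots> = - (of_real (lam k powr (s - 2) * (lam k * lam k)) * fc f k)"
      unfolding sq by (simp only: of_real_mult mult_minus_left mult_minus_right)
    finally show ?thesis by (simp only: pw)
  qed
  have neg: "fser (\<lambda>k. - c k) x = - fser c x" if "(\<lambda>k. cmod (c k)) summable_on UNIV" for c x
  proof -
    have "((\<lambda>k. Re (- c k * ek k x)) has_sum fser (\<lambda>k. - c k) x) UNIV"
      by (rule fser_has_sum) (use that in simp)
    moreover have "((\<lambda>k. - Re (c k * ek k x)) has_sum - fser c x) UNIV"
      by (rule has_sum_uminusI[OF fser_has_sum[OF that]])
    ultimately show ?thesis using has_sum_unique by fastforce
  qed
  show ?thesis using c1per_fser[OF s1 s2]
    unfolding R eq neg[OF Lam_fser(2)[OF f s(1)]] Lam_fser(1)[OF f s(1)]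
    by (simp add: neg[OF Lam_fser(2)[OF f s(1)]] fun_eq_iff)
qed

lemma pint_Lam:
  assumes f: "ckper n f" and s: "s + 2 \<le> real n" and p: "cper p"
  shows "((\<lambda>k. lam k powr s * Re (fc p k * cnj (fc f k))) has_sum pint (\<lambda>x. p x * Lam s f x)) UNIV"
proof -
  have "((\<lambda>k. Re (of_real (lam k powr s) * fc f k * cnj (fc p k))) has_sum pint (\<lambda>x. p x * Lam s f x)) UNIV"
    unfolding Lam_fser(1)[OF f s] by (rule fser_pint[OF Lam_fser(2)[OF f s] p])
  moreover have "Re (of_real (lam k powr s) * fc f k * cnj (fc p k)) = lam k powr s * Re (fc p k * cnj (fc f k))" for k
    by (simp add: algebra_simps)
  ultimately show ?thesis by simp
qed

subsection \<open>The transformed operator\<close>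

definition smper :: "(real \<Rightarrow> real) \<Rightarrow> bool" where
  "smper f \<longleftrightarrow> (\<forall>n. ckper n f)"

lemma smper_cper: "smper f \<Longrightarrow> cper f"
  by (auto simp: smper_def intro: ckper_cper)

lemma smper_c1per: assumes "smper f" shows "c1per f (deriv f)" "smper (deriv f)"
proof -
  have *: "c1per f (deriv f) \<and> ckper n (deriv f)" for n
  proof -
    obtain f' where f': "c1per f f'" "ckper n f'" using assms unfolding smper_def by (metis ckper.simps(2))
    then have "f' = deriv f" by (intro ext DERIV_imp_deriv[symmetric]) (simp add: c1per_def)
    then show ?thesis using f' by simp
  qed
  show "c1per f (deriv f)" using * by blast
  show "smper (deriv f)" using * by (simp add: smper_def)
qed

text \<open>The family of mixed derivatives whose existence \<open>smooth_strip\<close> asserts,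
  given a name.\<close>

definition strip_derivs :: "real \<Rightarrow> (real \<Rightarrow> real \<Rightarrow> real) \<Rightarrow> (nat \<Rightarrow> nat \<Rightarrow> real \<Rightarrow> real \<Rightarrow> real) \<Rightarrow> bool" where
  "strip_derivs T f d \<longleftrightarrow>
     (\<forall>t\<in>{0..T}. periodic1 (f t)) \<and> (\<forall>t\<in>{0..T}. \<forall>x. d 0 0 t x = f t x) \<and>
     (\<forall>i j. continuous_on ({0..T} \<times> UNIV) (\<lambda>(t, x). d i j t x)) \<and>
     (\<forall>i j. \<forall>t\<in>{0..T}. \<forall>x.
        ((\<lambda>s. d i j s x) has_real_derivative d (Suc i) j t x) (at t within {0..T}) \<and>
        ((\<lambda>z. d i j t z) has_real_derivative d i (Suc j) t x) (at x))"

lemma smooth_strip_derivs: "smooth_strip T f \<longleftrightarrow> (\<exists>d. strip_derivs T f d)"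
  unfolding smooth_strip_def strip_derivs_def by blast

lemma strip_derivsD:
  assumes "strip_derivs T f d" "t \<in> {0..T}"
  shows "periodic1 (f t)" "d 0 0 t = f t"
    "((\<lambda>s. d i j s x) has_real_derivative d (Suc i) j t x) (at t within {0..T})"
    "(d i j t has_real_derivative d i (Suc j) t x) (at x)"
  using assms by (auto simp: strip_derivs_def)

lemma strip_derivs_cont:
  "strip_derivs T f d \<Longrightarrow> continuous_on ({0..T} \<times> UNIV) (\<lambda>(t, x). d i j t x)"
  by (simp add: strip_derivs_def)

lemma smooth_strip_smper: assumes "smooth_strip T f" "t \<in> {0..T}" shows "smper (f t)"
proof -
  obtain d where d: "strip_derivs T f d" using assms(1) smooth_strip_derivs by blast
  note d2 = strip_derivsD(4)[OF d assms(2)]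
  have per0: "d 0 0 t (x + 1) = d 0 0 t x" for x
    using strip_derivsD(1,2)[OF d assms(2)] by (simp add: periodic1_def)
  have cont: "continuous_on UNIV (d 0 j t)" for j
    using d2[of 0 j] by (meson DERIV_isCont continuous_at_imp_continuous_on)
  have c1: "c1per (d 0 j t) (d 0 (Suc j) t)" for j
  proof (induction j)
    case 0
    show ?case by (rule c1perI) (use per0 d2 assms(2) cont in auto)
  next
    case (Suc j)
    show ?case
      by (rule c1perI) (use cper_periodic[OF c1per_cper'[OF Suc]] d2 assms(2) cont in auto)
  qed
  have "ckper n (d 0 j t)" for n j
  proof (induction n arbitrary: j)
    case 0
    show ?case using c1per_cper[OF c1[of j]] by simp
  next
    case (Suc n)
    then show ?case using c1[of j] by auto
  qed
  moreover have "d 0 0 t = f t" by (rule strip_derivsD(2)[OF d assms(2)])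
  ultimately show ?thesis by (metis smper_def)
qed

section \<open>The change of variable at a fixed time\<close>

locale diffeo =
  fixes \<psi> :: "real \<Rightarrow> real \<Rightarrow> real" and t J0 J1 :: real
  assumes smper_psi: "smper (\<psi> t)"
    and J0: "0 < J0" and J_ge: "\<And>x. J0 \<le> Jac \<psi> t x" and J_le: "\<And>x. Jac \<psi> t x \<le> J1"
begin

lemma psi_deriv: "(\<psi> t has_real_derivative deriv (\<psi> t) x) (at x)"
  using smper_c1per(1)[OF smper_psi] by (rule c1per_deriv)

lemma Jac_eq: "Jac \<psi> t = (\<lambda>x. 1 + deriv (\<psi> t) x)"
proof
  fix x
  have "((\<lambda>x. x + \<psi> t x) has_real_derivative 1 + deriv (\<psi> t) x) (at x)"
    by (intro derivative_intros psi_deriv)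
  then show "Jac \<psi> t x = 1 + deriv (\<psi> t) x"
    by (simp add: Jac_def Psi_def[abs_def] DERIV_imp_deriv)
qed

lemma Psi_deriv: "(Psi \<psi> t has_real_derivative Jac \<psi> t x) (at x)"
  unfolding Psi_def[abs_def] Jac_eq by (intro derivative_intros psi_deriv)

lemma smper_Jac: "smper (Jac \<psi> t)"
proof -
  have "ckper n (\<lambda>x. 1 :: real)" for n
  proof (induction n)
    case (Suc n)
    have "ckper n (\<lambda>x. 0)" for n
      by (induction n) (auto intro: c1per_const)
    then show ?case using c1per_const by auto
  qed simp
  then show ?thesis using smper_c1per(2)[OF smper_psi]
    unfolding Jac_eq smper_def by (auto intro: ckper_add)
qed

lemma cper_Jac: "cper (Jac \<psi> t)"
  by (rule smper_cper[OF smper_Jac])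

lemma Jac_pos: "0 < Jac \<psi> t x"
  using J0 J_ge[of x] by linarith

lemma Psi_per: "Psi \<psi> t (x + 1) = Psi \<psi> t x + 1"
  using cper_periodic[OF smper_cper[OF smper_psi], of x] by (simp add: Psi_def)

lemma Psi_cont: "continuous_on A (Psi \<psi> t)"
  using Psi_deriv by (meson DERIV_isCont continuous_at_imp_continuous_on)

lemma Psi_expand: "x \<le> y \<Longrightarrow> J0 * (y - x) \<le> Psi \<psi> t y - Psi \<psi> t x"
proof (cases "x = y")
  case False
  moreover assume "x \<le> y"
  ultimately have "x < y" by simp
  then obtain z where "Psi \<psi> t y - Psi \<psi> t x = (y - x) * Jac \<psi> t z"
    using MVT2[of x y "Psi \<psi> t" "Jac \<psi> t"] Psi_deriv by blast
  then show ?thesis using J_ge[of z] \<open>x < y\<close> by (simp add: mult.commute mult_right_mono)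
qed simp

lemma Psi_inj: "Psi \<psi> t x = Psi \<psi> t y \<Longrightarrow> x = y"
proof (induction x y rule: linorder_wlog)
  case (le x y)
  then show ?case using Psi_expand[of x y] J0 by (simp add: mult_le_0_iff)
qed simp

lemma Psi_surj: "\<exists>x. Psi \<psi> t x = y"
proof -
  obtain B where B: "\<And>x. \<bar>\<psi> t x\<bar> \<le> B" using cper_bounded[OF smper_cper[OF smper_psi]] by blast
  have "\<exists>x\<ge>y - B. x \<le> y + B \<and> Psi \<psi> t x = y"
  proof (rule IVT')
    show "Psi \<psi> t (y - B) \<le> y" "y \<le> Psi \<psi> t (y + B)"
      using B[of "y - B"] B[of "y + B"] by (auto simp: Psi_def abs_le_iff)
    show "y - B \<le> y + B" using B[of 0] by linarith
  qed (rule Psi_cont)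
  then show ?thesis by blast
qed

lemma Psi_Phi [simp]: "Psi \<psi> t (Phi \<psi> t y) = y"
  unfolding Phi_def using Psi_surj[of y] by (metis f_inv_into_f rangeI)

lemma Phi_Psi [simp]: "Phi \<psi> t (Psi \<psi> t x) = x"
  by (rule Psi_inj) simp

lemma Phi_per: "Phi \<psi> t (y + 1) = Phi \<psi> t y + 1"
  by (rule Psi_inj) (simp add: Psi_per)

lemma Phi_lipschitz: "\<bar>Phi \<psi> t y - Phi \<psi> t z\<bar> \<le> \<bar>y - z\<bar> / J0"
proof (cases "Phi \<psi> t y \<le> Phi \<psi> t z")
  case True
  show ?thesis using Psi_expand[OF True] True J0 by (simp add: field_simps)
next
  case False
  then have "Phi \<psi> t z \<le> Phi \<psi> t y" by simp
  from Psi_expand[OF this] show ?thesis using False J0 by (simp add: field_simps)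
qed

lemma Phi_cont: "continuous_on A (Phi \<psi> t)"
proof (rule continuous_onI)
  fix x e :: real
  assume "e > 0"
  then show "\<exists>d>0. \<forall>x'\<in>A. dist x' x < d \<longrightarrow> dist (Phi \<psi> t x') (Phi \<psi> t x) \<le> e"
  proof (intro exI[of _ "e * J0"] conjI ballI impI)
    fix x' assume "dist x' x < e * J0"
    then have "\<bar>x' - x\<bar> / J0 \<le> e" using J0 by (simp add: dist_real_def field_simps)
    then show "dist (Phi \<psi> t x') (Phi \<psi> t x) \<le> e"
      using Phi_lipschitz[of x' x] by (simp add: dist_real_def)
  qed (use J0 in simp)
qed

lemma Phi_deriv: "(Phi \<psi> t has_real_derivative inverse (Jac \<psi> t (Phi \<psi> t y))) (at y)"
proof (rule DERIV_inverse_function[where f = "Psi \<psi> t" and a = "y - 1" and b = "y + 1"])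
  show "(Psi \<psi> t has_real_derivative Jac \<psi> t (Phi \<psi> t y)) (at (Phi \<psi> t y))" by (rule Psi_deriv)
  show "Jac \<psi> t (Phi \<psi> t y) \<noteq> 0" using Jac_pos[of "Phi \<psi> t y"] by simp
  show "isCont (Phi \<psi> t) y" using Phi_cont[of UNIV] by (simp add: continuous_on_eq_continuous_at)
qed auto

lemma cper_Phi: "cper f \<Longrightarrow> cper (\<lambda>y. f (Phi \<psi> t y))"
  by (auto simp: cper_def periodic1_def Phi_per intro: continuous_on_compose2[OF _ Phi_cont])

lemma cper_Psi: "cper f \<Longrightarrow> cper (\<lambda>x. f (Psi \<psi> t x))"
  by (auto simp: cper_def periodic1_def Psi_per intro: continuous_on_compose2[OF _ Psi_cont])

lemma c1per_Phi:
  assumes "c1per f f'"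
  shows "c1per (\<lambda>y. f (Phi \<psi> t y)) (\<lambda>y. f' (Phi \<psi> t y) * inverse (Jac \<psi> t (Phi \<psi> t y)))"
proof (rule c1perI)
  show "f (Phi \<psi> t (y + 1)) = f (Phi \<psi> t y)" for y
    using cper_periodic[OF cper_Phi[OF c1per_cper[OF assms]]] .
  show "((\<lambda>y. f (Phi \<psi> t y)) has_real_derivative f' (Phi \<psi> t y) * inverse (Jac \<psi> t (Phi \<psi> t y))) (at y)" for y
    by (rule DERIV_chain2[OF c1per_deriv[OF assms] Phi_deriv])
  show "continuous_on UNIV (\<lambda>y. f' (Phi \<psi> t y) * inverse (Jac \<psi> t (Phi \<psi> t y)))"
    using Jac_pos
    by (intro continuous_intros cper_cont[OF cper_Phi] c1per_cper'[OF assms] cper_Jac) (metis less_irrefl)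
qed

lemma c1per_Psi:
  assumes "c1per f f'"
  shows "c1per (\<lambda>x. f (Psi \<psi> t x)) (\<lambda>x. f' (Psi \<psi> t x) * Jac \<psi> t x)"
proof (rule c1perI)
  show "f (Psi \<psi> t (y + 1)) = f (Psi \<psi> t y)" for y
    using cper_periodic[OF cper_Psi[OF c1per_cper[OF assms]]] .
  show "((\<lambda>y. f (Psi \<psi> t y)) has_real_derivative f' (Psi \<psi> t y) * Jac \<psi> t y) (at y)" for y
    by (rule DERIV_chain2[OF c1per_deriv[OF assms] Psi_deriv])
  show "continuous_on UNIV (\<lambda>y. f' (Psi \<psi> t y) * Jac \<psi> t y)"
    by (intro continuous_intros cper_cont[OF cper_Psi] cper_cont[OF cper_Jac] c1per_cper'[OF assms])
qed

text \<open>A period is mapped to an interval of length one, over which a periodic function has the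
  same integral as over {0..1}.\<close>

lemma pint_Psi:
  fixes f :: "real \<Rightarrow> real"
  assumes "cper f" shows "pint (\<lambda>x. f (Psi \<psi> t x) * Jac \<psi> t x) = pint f"
proof -
  let ?P = "Psi \<psi> t"
  have mono: "?P x \<le> ?P y" if "x \<le> y" for x y using Psi_expand[OF that] that J0
    by (smt (verit) mult_nonneg_nonneg)
  have "((\<lambda>x. Jac \<psi> t x *\<^sub>R f (?P x)) has_integral (integral {?P 0..?P 1} f)) {0..1}"
    by (rule has_integral_substitution[where c = "?P 0" and d = "?P 1"])
       (auto intro: mono cper_cont assms has_field_derivative_at_within Psi_deriv)
  then have "pint (\<lambda>x. f (?P x) * Jac \<psi> t x) = integral {?P 0..?P 0 + 1} f"
    using Psi_per[of 0] by (simp add: integral_unique mult.commute)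
  also have "\<dots> = pint (\<lambda>x. f (x + ?P 0))"
    using integral_shift_real_ivl[of "?P 0" "?P 0" "?P 0 + 1" f] by simp
  finally show ?thesis using pint_shift[OF assms] by simp
qed

text \<open>The seminorm is defined by Fourier modes, which \<Psi> does not respect, so the
  K-functionals are compared at each scale \<open>h\<close>: a near-optimal competitor v for w o
  \<Psi> is transported to v o \<Phi>, at the cost of a factor |J1| in L2 and 1 / J0 in H1.
  Integrating in \<open>h\<close> restores the fractional symbol; 16 is the loss in
  \<open>ksym_upper\<close>.\<close>

lemma hom2_Psi:
  assumes w: "c1per w w'" and g: "0 < g" "g < 2"
  shows "hom2 g w \<le> 16 * (\<bar>J1\<bar> + 1 / J0) * hom2 g (\<lambda>x. w (Psi \<psi> t x))"
proof -
  let ?u = "\<lambda>x. w (Psi \<psi> t x)" and ?C = "16 * (\<bar>J1\<bar> + 1 / J0)"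
  let ?S = "\<lambda>w h. \<Sum>\<^sub>\<infinity>k. ksym (lam k * h) * (cmod (fc w k))\<^sup>2"
  let ?c = "\<lambda>k. ?C * (cmod (fc ?u k))\<^sup>2 - (cmod (fc w k))\<^sup>2"
  note u = c1per_Psi[OF w] and cw = c1per_cper[OF w] and cu = c1per_cper[OF c1per_Psi[OF w]]
  have hs: "((\<lambda>k. lam k powr g * ?c k) has_sum (?C * hom2 g ?u - hom2 g w)) UNIV"
    using has_sum_diff[OF has_sum_cmult_right[OF fin_hom_has_sum, of g ?u ?C] fin_hom_has_sum[of g w]]
      fin_hom_mono[OF c1per_hom2(1)[OF u], of g] fin_hom_mono[OF c1per_hom2(1)[OF w], of g] g
    by (simp add: right_diff_distrib mult.left_commute)
  have "0 \<le> (\<Sum>\<^sub>\<infinity>k. lam k powr g * ?c k)"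
  proof (rule symbol_comparison_lt[of ksym "1 / 2", OF _ _ _ _ _ _ g has_sum_imp_summable[OF hs]])
    show "continuous_on UNIV ksym" unfolding ksym_def by (intro continuous_intros) (simp add: add_pos_nonneg less_imp_neq[THEN not_sym])
    show "1 / 2 \<le> ksym x" if "1 \<le> x" for x
      using power_mono[OF that, of 2] by (simp add: ksym_def le_divide_eq add_pos_nonneg)
    fix h :: real assume h: "0 < h"
    show "((\<lambda>k. ksym (lam k * h) * ?c k) has_sum (?C * ?S ?u h - ?S w h)) UNIV"
      using has_sum_diff[OF has_sum_cmult_right[OF ksym_has_sum[OF cu], of ?C h] ksym_has_sum[OF cw, of h]]
      by (simp add: right_diff_distrib mult.left_commute)
    obtain v v' where v: "c1per v v'" "pint (\<lambda>x. (?u x - v x)\<^sup>2) + h\<^sup>2 * pint (\<lambda>x. (v' x)\<^sup>2) \<le> 16 * ?S ?u h"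
      using ksym_upper[OF u h] by blast
    note W = c1per_Phi[OF v(1)] and cv = c1per_cper[OF v(1)] and cv' = c1per_cper'[OF v(1)]
    let ?W' = "\<lambda>y. v' (Phi \<psi> t y) * inverse (Jac \<psi> t (Phi \<psi> t y))"
    note d = cper_power[OF cper_diff[OF cw c1per_cper[OF W]], of 2] and d' = cper_power[OF c1per_cper'[OF W], of 2]
    have "pint (\<lambda>y. (w y - v (Phi \<psi> t y))\<^sup>2) \<le> pint (\<lambda>x. \<bar>J1\<bar> * (?u x - v x)\<^sup>2)"
      unfolding pint_Psi[OF d, symmetric] Phi_Psi
      by (rule pint_mono[OF cper_mult[OF cper_power[OF cper_diff[OF cu cv]] cper_Jac] cper_mult[OF cper_const cper_power[OF cper_diff[OF cu cv]]]])
         (use J_le in \<open>simp add: mult.commute mult_right_mono order_trans[OF J_le abs_ge_self]\<close>)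
    moreover have "pint (\<lambda>y. (?W' y)\<^sup>2) \<le> pint (\<lambda>x. 1 / J0 * (v' x)\<^sup>2)"
      unfolding pint_Psi[OF d', symmetric] Phi_Psi
    proof (rule pint_mono[OF _ cper_mult[OF cper_const cper_power[OF cv']]])
      show "cper (\<lambda>x. (v' x * inverse (Jac \<psi> t x))\<^sup>2 * Jac \<psi> t x)"
        using cper_mult[OF cper_Psi[OF d'] cper_Jac] by simp
      fix x
      have "(v' x * inverse (Jac \<psi> t x))\<^sup>2 * Jac \<psi> t x = 1 / Jac \<psi> t x * (v' x)\<^sup>2"
        using Jac_pos[of x] by (simp add: power2_eq_square field_simps)
      also have "\<dots> \<le> 1 / J0 * (v' x)\<^sup>2" using J_ge[of x] J0 Jac_pos[of x] by (intro mult_right_mono divide_left_mono) auto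
      finally show "(v' x * inverse (Jac \<psi> t x))\<^sup>2 * Jac \<psi> t x \<le> 1 / J0 * (v' x)\<^sup>2" .
    qed
    ultimately have "?S w h \<le> \<bar>J1\<bar> * pint (\<lambda>x. (?u x - v x)\<^sup>2) + h\<^sup>2 * (1 / J0 * pint (\<lambda>x. (v' x)\<^sup>2))"
      unfolding pint_cmult by (intro order_trans[OF ksym_lower[OF cw W]] add_mono mult_left_mono) auto
    also have "\<dots> \<le> (\<bar>J1\<bar> + 1 / J0) * pint (\<lambda>x. (?u x - v x)\<^sup>2) + (\<bar>J1\<bar> + 1 / J0) * (h\<^sup>2 * pint (\<lambda>x. (v' x)\<^sup>2))"
      unfolding mult.left_commute[of "h\<^sup>2"] using J0
      by (intro add_mono mult_right_mono mult_nonneg_nonneg pint_nonneg cper_power cper_diff cu cv cv') auto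
    also have "\<dots> \<le> (\<bar>J1\<bar> + 1 / J0) * (16 * ?S ?u h)"
      unfolding distrib_left[symmetric] using J0 by (intro mult_left_mono v) auto
    finally show "0 \<le> ?C * ?S ?u h - ?S w h" by (simp only: mult.assoc mult.left_commute[of "\<bar>J1\<bar> + 1 / J0" 16])
  qed (use ksym_bounds in \<open>auto intro: order_trans[OF ksym_bounds(2)]\<close>)
  then show ?thesis unfolding infsumI[OF hs] by (simp only: diff_ge_0_iff_ge)
qed

lemma c1per_coef_a: "\<exists>a'. c1per (coef_a \<psi> t) a'"
proof -
  have j: "c1per (Jac \<psi> t) (deriv (Jac \<psi> t))" by (rule smper_c1per(1)[OF smper_Jac])
  have "c1per (\<lambda>y. Jac \<psi> t (Phi \<psi> t y) * Jac \<psi> t (Phi \<psi> t y)) (\<lambda>y. deriv (Jac \<psi> t) (Phi \<psi> t y) * inverse (Jac \<psi> t (Phi \<psi> t y)) * Jac \<psi> t (Phi \<psi> t y)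
     + Jac \<psi> t (Phi \<psi> t y) * (deriv (Jac \<psi> t) (Phi \<psi> t y) * inverse (Jac \<psi> t (Phi \<psi> t y))))"
    by (intro c1per_mult c1per_Phi j)
  then show ?thesis unfolding coef_a_def[abs_def] power2_eq_square by blast
qed

lemma coef_a_bounds: "J0\<^sup>2 \<le> coef_a \<psi> t y" "coef_a \<psi> t y \<le> J1\<^sup>2"
  unfolding coef_a_def using J_ge J_le J0 Jac_pos by (auto intro!: power_mono simp: less_imp_le)

text \<open>Derivatives along \<open>\<Psi>\<close>: the Fourier multipliers act in the original variable \<open>x\<close>.\<close>
lemma Dop_c1per:
  assumes m: "smper m" and g: "1 < \<gamma>" "\<gamma> < 2"
  defines "u \<equiv> \<lambda>x. Jac \<psi> t x * m (Psi \<psi> t x)"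
  shows "\<exists>V'. c1per (Dop \<gamma> \<psi> t m) V'"
    and "c1per (Riesz \<gamma> u) (\<lambda>x. - Lam \<gamma> u x)" "ckper 4 u"
    and "Dop \<gamma> \<psi> t m (Psi \<psi> t x) = Riesz \<gamma> u x + m (Psi \<psi> t x) * Lam \<gamma> (\<psi> t) x"
proof -
  have ck: "ckper n (Jac \<psi> t)" for n using smper_Jac by (simp add: smper_def)
  show u4: "ckper 4 u" unfolding u_def
    by (intro ckper_mult ck ckper_compose[OF Psi_deriv Psi_per]) (use m in \<open>auto simp: smper_def\<close>)
  show R: "c1per (Riesz \<gamma> u) (\<lambda>x. - Lam \<gamma> u x)"
    by (rule c1per_Riesz[OF u4]) (use g in auto)
  have L: "c1per (Lam \<gamma> (\<psi> t)) (Lam \<gamma> (deriv (\<psi> t)))"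
    by (rule c1per_Lam[where n = 4, OF _ smper_c1per(1)[OF smper_psi]])
       (use g smper_psi[unfolded smper_def, rule_format, of "Suc 4"] in auto)
  have D: "Dop \<gamma> \<psi> t m = (\<lambda>y. Riesz \<gamma> u (Phi \<psi> t y) + m y * Lam \<gamma> (\<psi> t) (Phi \<psi> t y))"
    unfolding Dop_def[abs_def] u_def using g by simp
  show "Dop \<gamma> \<psi> t m (Psi \<psi> t x) = Riesz \<gamma> u x + m (Psi \<psi> t x) * Lam \<gamma> (\<psi> t) x"
    unfolding D by simp
  show "\<exists>V'. c1per (Dop \<gamma> \<psi> t m) V'" unfolding D
    using c1per_add[OF c1per_Phi[OF R] c1per_mult[OF smper_c1per(1)[OF m] c1per_Phi[OF L]]] by blast
qed

end

text \<open>The right-hand side is J' times the Bregman distance E g' - E g - e g (g' - g) plus J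
  times the one with g and g' exchanged. Both distances are nonnegative, so the weights may be
  lowered to J0, leaving the symmetric sum (e g' - e g) (g' - g), which is at least (e g' - e g)^2 /
  K since e has slope at most K.\<close>

lemma bregman_pointwise:
  fixes E e :: "real \<Rightarrow> real"
  assumes E: "\<And>z. (E has_real_derivative e z) (at z)" and e: "\<And>z. (e has_real_derivative e1 z) (at z)"
    and e1: "\<And>z. 0 \<le> e1 z" "\<And>z. e1 z \<le> K" and K: "0 < K"
    and J: "0 < J0" "J0 \<le> J" "J0 \<le> J'"
  shows "J0 / K * (e g' - e g)\<^sup>2
    \<le> (e g' - e g) * (J' * g' - J * g) - ((g' * e g' - E g') - (g * e g - E g)) * (J' - J)"
proof -
  have mono: "e x \<le> e y" if "x \<le> y" for x y
    using DERIV_nonneg_imp_nondecreasing[OF that, of e] e e1 by blast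
  have lower: "0 \<le> E y - E x - e x * (y - x)" for x y
  proof -
    consider "x < y" | "x = y" | "y < x" by linarith
    then show ?thesis
    proof cases
      case 1
      then obtain z where z: "x < z" "E y - E x = (y - x) * e z" using MVT2[of x y E e] E by blast
      then have "(y - x) * e x \<le> (y - x) * e z" using mono[of x z] 1 by (intro mult_left_mono) auto
      then show ?thesis using z by (simp add: mult.commute)
    next
      case 3
      then obtain z where z: "z < x" "E x - E y = (x - y) * e z" using MVT2[of y x E e] E by blast
      then have "(x - y) * e z \<le> (x - y) * e x" using mono[of z x] 3 by (intro mult_left_mono) auto
      then show ?thesis using z by (simp add: algebra_simps)
    qed simp
  qed
  have sq: "(e y - e x)\<^sup>2 \<le> K * ((e y - e x) * (y - x))" for x y
  proof (induction x y rule: linorder_wlog)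
    case (le x y)
    show ?case
    proof (cases "x = y")
      case False
      then obtain z where z: "e y - e x = (y - x) * e1 z" using MVT2[of x y e e1] e le by force
      have "(e y - e x)\<^sup>2 = (e y - e x) * ((y - x) * e1 z)" using z by (simp add: power2_eq_square)
      also have "\<dots> \<le> (e y - e x) * ((y - x) * K)"
        using mono[OF le] le e1 by (intro mult_left_mono) auto
      finally show ?thesis by (simp add: mult_ac)
    qed simp
  next
    case (sym x y)
    then show ?case by (simp add: power2_commute algebra_simps)
  qed
  have "J0 / K * (e g' - e g)\<^sup>2 \<le> J0 / K * (K * ((e g' - e g) * (g' - g)))"
    using sq[of g' g] J K by (intro mult_left_mono) auto
  also have "\<dots> = J0 * (E g' - E g - e g * (g' - g)) + J0 * (E g - E g' - e g' * (g - g'))"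
    using K by (simp add: algebra_simps)
  also have "\<dots> \<le> J' * (E g' - E g - e g * (g' - g)) + J * (E g - E g' - e g' * (g - g'))"
    by (intro add_mono mult_right_mono J lower)
  finally show ?thesis by (simp add: algebra_simps)
qed

text \<open>One constant for all slices, functions and entropies with e' <= K. The two uses are E =
  z^2 / 2, with e' = 1, and the convex cutoff, hence the bound \<open>max K 1\<close> later on. The
  C1 regularity of the flux is part of the conclusion because the pairing is with its
  derivative.\<close>

definition coercive :: "real \<Rightarrow> real \<Rightarrow> real \<Rightarrow> real \<Rightarrow> real \<Rightarrow> bool" where
  "coercive \<gamma> J0 J1 K c \<longleftrightarrow> 0 < c \<and> (\<forall>\<psi> t m E e e1. diffeo \<psi> t J0 J1 \<longrightarrow> smper m \<longrightarrow>
     (\<forall>z. (E has_real_derivative e z) (at z)) \<longrightarrow> (\<forall>z. (e has_real_derivative e1 z) (at z)) \<longrightarrow>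
     continuous_on UNIV e1 \<longrightarrow> (\<forall>z. 0 \<le> e1 z \<and> e1 z \<le> K) \<longrightarrow>
     (\<exists>V'. c1per (Dop \<gamma> \<psi> t m) V' \<and> pint (\<lambda>y. e (m y) * V' y) \<le> - c * hom2 \<gamma> (\<lambda>y. e (m y))))"

lemma coerciveD:
  assumes "coercive \<gamma> J0 J1 K c" "diffeo \<psi> t J0 J1" "smper m" "\<And>z. (E has_real_derivative e z) (at z)"
    "\<And>z. (e has_real_derivative e1 z) (at z)" "continuous_on UNIV e1" "\<And>z. 0 \<le> e1 z" "\<And>z. e1 z \<le> K"
  shows "\<exists>V'. c1per (Dop \<gamma> \<psi> t m) V' \<and> pint (\<lambda>y. e (m y) * V' y) \<le> - c * hom2 \<gamma> (\<lambda>y. e (m y))"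
  using assms unfolding coercive_def by blast

text \<open>For \<gamma> = 2 integration by parts gives a e'(m) |m_y|^2, at least J0^2 / K times the
  square of the derivative of e (m). For \<gamma> < 2 the pairing is written in x as a form with
  symbol lam^\<gamma>; with the symbol of an increment in its place it is an integral of the
  expression in \<open>bregman_pointwise\<close>, and \<open>hom2_Psi\<close> carries the result
  back to y.\<close>

lemma coercivity:
  assumes g: "1 < \<gamma>" "\<gamma> \<le> 2" and K: "0 < K" and J0: "0 < J0"
  shows "\<exists>c. coercive \<gamma> J0 J1 K c"
proof (cases "\<gamma> = 2")
  case True
  have "\<exists>V'. c1per (Dop \<gamma> \<psi> t m) V' \<and> pint (\<lambda>y. e (m y) * V' y) \<le> - (J0\<^sup>2 / K) * hom2 \<gamma> (\<lambda>y. e (m y))"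
    if D: "diffeo \<psi> t J0 J1" and m: "smper m" and E: "\<And>z. (E has_real_derivative e z) (at z)"
      and e: "\<And>z. (e has_real_derivative e1 z) (at z)" and c1: "continuous_on UNIV e1"
      and e1: "\<And>z. 0 \<le> e1 z" "\<And>z. e1 z \<le> K" for \<psi> t m E e e1
  proof -
    interpret diffeo \<psi> t J0 J1 by (rule D)
    obtain a' where a: "c1per (coef_a \<psi> t) a'" using c1per_coef_a by blast
    have m1: "c1per m (deriv m)" and m2: "c1per (deriv m) (deriv (deriv m))"
      using smper_c1per m by blast+
    have V: "c1per (Dop \<gamma> \<psi> t m) (\<lambda>y. a' y * deriv m y + coef_a \<psi> t y * deriv (deriv m) y)"
      unfolding Dop_def[abs_def] using True c1per_mult[OF a m2] by simp
    have w: "c1per (\<lambda>y. e (m y)) (\<lambda>y. e1 (m y) * deriv m y)" by (rule c1per_compose[OF m1 e c1])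
    have c: "cper (\<lambda>y. e1 (m y))" by (rule cper_compose[OF c1per_cper[OF m1] c1])
    note cs = c c1per_cper[OF m1] c1per_cper'[OF m1] c1per_cper[OF a]
    have "pint (\<lambda>y. e (m y) * (a' y * deriv m y + coef_a \<psi> t y * deriv (deriv m) y))
        = - pint (\<lambda>y. (e1 (m y) * deriv m y) * (coef_a \<psi> t y * deriv m y))"
      using pint_by_parts[OF w V] True by (simp add: Dop_def)
    also have "\<dots> \<le> - pint (\<lambda>y. J0\<^sup>2 / K * (e1 (m y) * deriv m y)\<^sup>2)"
    proof -
      have "pint (\<lambda>y. J0\<^sup>2 / K * (e1 (m y) * deriv m y)\<^sup>2) \<le> pint (\<lambda>y. (e1 (m y) * deriv m y) * (coef_a \<psi> t y * deriv m y))"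
      proof (intro pint_mono cper_intros cs)
        fix y
        have "J0\<^sup>2 / K * (e1 (m y) * deriv m y)\<^sup>2 = (e1 (m y) * (deriv m y)\<^sup>2) * (J0\<^sup>2 * (e1 (m y) / K))"
          by (simp add: power2_eq_square)
        also have "\<dots> \<le> (e1 (m y) * (deriv m y)\<^sup>2) * (coef_a \<psi> t y * 1)"
          using e1 K coef_a_bounds[of y]
          by (intro mult_left_mono mult_mono) (auto intro: order_trans[OF zero_le_power2])
        finally show "J0\<^sup>2 / K * (e1 (m y) * deriv m y)\<^sup>2 \<le> (e1 (m y) * deriv m y) * (coef_a \<psi> t y * deriv m y)"
          by (simp add: power2_eq_square mult_ac)
      qed
      then show ?thesis by simp
    qed
    also have "\<dots> = - (J0\<^sup>2 / K) * hom2 \<gamma> (\<lambda>y. e (m y))"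
      using c1per_hom2(2)[OF w] True by simp
    finally show ?thesis using V by blast
  qed
  moreover have "0 < J0\<^sup>2 / K" using K J0 by simp
  ultimately show ?thesis unfolding coercive_def by blast
next
  case False
  then have g2: "\<gamma> < 2" using g by simp
  define C where "C = 16 * (\<bar>J1\<bar> + 1 / J0)"
  have C: "0 < C" unfolding C_def using J0 by (simp add: add_nonneg_pos)
  have "\<exists>V'. c1per (Dop \<gamma> \<psi> t m) V' \<and> pint (\<lambda>y. e (m y) * V' y) \<le> - (J0 / K / C) * hom2 \<gamma> (\<lambda>y. e (m y))"
    if D: "diffeo \<psi> t J0 J1" and m: "smper m" and E: "\<And>z. (E has_real_derivative e z) (at z)"
      and e: "\<And>z. (e has_real_derivative e1 z) (at z)" and c1: "continuous_on UNIV e1"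
      and e1: "\<And>z. 0 \<le> e1 z" "\<And>z. e1 z \<le> K" for \<psi> t m E e e1
  proof -
    interpret diffeo \<psi> t J0 J1 by (rule D)
    let ?\<Psi> = "Psi \<psi> t" and ?J = "Jac \<psi> t"
    define gg where "gg x = m (?\<Psi> x)" for x
    define u where "u = (\<lambda>x. ?J x * gg x)"
    define p where "p x = e (gg x)" for x
    \<comment> \<open>The Legendre transform of E at e (gg). Its derivative is gg times that of p,
      so the zero-order term of the operator can be integrated by parts as well.\<close>
    define q where "q x = gg x * p x - E (gg x)" for x
    obtain V' where V: "c1per (Dop \<gamma> \<psi> t m) V'" using Dop_c1per(1)[OF m g(1) g2] by blast
    have m1: "c1per m (deriv m)" using smper_c1per m by blast
    have g1: "c1per gg (\<lambda>x. deriv m (?\<Psi> x) * ?J x)" unfolding gg_def by (rule c1per_Psi[OF m1])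
    obtain g' where g': "c1per gg g'" using g1 by blast
    have p': "c1per p (\<lambda>x. e1 (gg x) * g' x)" unfolding p_def by (rule c1per_compose[OF g' e c1])
    have ec: "continuous_on UNIV e" using e by (meson DERIV_isCont continuous_at_imp_continuous_on)
    have q': "c1per q (\<lambda>x. (e1 (gg x) * g' x) * gg x)"
      using c1per_diff[OF c1per_mult[OF g' p'] c1per_compose[OF g' E ec]]
      unfolding q_def p_def by (simp add: algebra_simps)
    have w1: "c1per (\<lambda>y. e (m y)) (\<lambda>y. e1 (m y) * deriv m y)" by (rule c1per_compose[OF m1 e c1])
    have R: "c1per (Riesz \<gamma> u) (\<lambda>x. - Lam \<gamma> u x)" and u4: "ckper 4 u"
      using Dop_c1per(2,3)[OF m g(1) g2] by (simp_all add: u_def gg_def)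
    have psi4: "ckper (Suc 4) (\<psi> t)" using smper_psi by (simp add: smper_def)
    have dpsi4: "ckper 4 (deriv (\<psi> t))" using smper_c1per(2)[OF smper_psi] by (simp add: smper_def)
    have Lp: "c1per (Lam \<gamma> (\<psi> t)) (Lam \<gamma> (deriv (\<psi> t)))"
      by (rule c1per_Lam[OF psi4 smper_c1per(1)[OF smper_psi]]) (use g in auto)
    have W: "Dop \<gamma> \<psi> t m (?\<Psi> x) = Riesz \<gamma> u x + gg x * Lam \<gamma> (\<psi> t) x" for x
      using Dop_c1per(4)[OF m g(1) g2, of x] by (simp add: u_def gg_def)
    \<comment> \<open>Composition with \<Psi> makes the y-derivative an x-derivative; the factor J
      that it costs is the Jacobian of the substitution.\<close>
    have W': "c1per (\<lambda>x. Riesz \<gamma> u x + gg x * Lam \<gamma> (\<psi> t) x) (\<lambda>x. V' (?\<Psi> x) * ?J x)"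
      using c1per_Psi[OF V] unfolding W .
    note cs = c1per_cper[OF p'] c1per_cper'[OF p'] c1per_cper[OF R] c1per_cper[OF g'] c1per_cper[OF Lp]
      c1per_cper'[OF V] c1per_cper[OF q'] c1per_cper'[OF q']
    have "pint (\<lambda>y. e (m y) * V' y) = pint (\<lambda>x. (e (m (?\<Psi> x)) * V' (?\<Psi> x)) * ?J x)"
      using pint_Psi[OF cper_mult[OF c1per_cper[OF w1] c1per_cper'[OF V]]] by simp
    also have "\<dots> = pint (\<lambda>x. p x * (V' (?\<Psi> x) * ?J x))"
      by (simp add: p_def gg_def mult.assoc)
    also have "\<dots> = - pint (\<lambda>x. (e1 (gg x) * g' x) * (Riesz \<gamma> u x + gg x * Lam \<gamma> (\<psi> t) x))"
      by (rule pint_by_parts[OF p' W'])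
    also have "\<dots> = - pint (\<lambda>x. (e1 (gg x) * g' x) * Riesz \<gamma> u x)
         - pint (\<lambda>x. ((e1 (gg x) * g' x) * gg x) * Lam \<gamma> (\<psi> t) x)"
    proof -
      have "pint (\<lambda>x. (e1 (gg x) * g' x) * (Riesz \<gamma> u x + gg x * Lam \<gamma> (\<psi> t) x))
        = pint (\<lambda>x. (e1 (gg x) * g' x) * Riesz \<gamma> u x + ((e1 (gg x) * g' x) * gg x) * Lam \<gamma> (\<psi> t) x)"
        by (simp add: algebra_simps)
      also have "\<dots> = pint (\<lambda>x. (e1 (gg x) * g' x) * Riesz \<gamma> u x)
         + pint (\<lambda>x. ((e1 (gg x) * g' x) * gg x) * Lam \<gamma> (\<psi> t) x)"
        by (rule pint_add[OF cper_mult[OF cs(2,3)] cper_mult[OF cs(8,5)]])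
      finally show ?thesis by simp
    qed
    finally have main: "pint (\<lambda>y. e (m y) * V' y)
        = pint (\<lambda>x. q x * Lam \<gamma> (deriv (\<psi> t)) x) - pint (\<lambda>x. p x * Lam \<gamma> u x)"
      using pint_by_parts[OF p' R] pint_by_parts[OF q' Lp] by simp
    \<comment> \<open>The form minus its claimed lower bound, mode by mode.\<close>
    define ck where "ck k = Re (fc p k * cnj (fc u k)) - Re (fc q k * cnj (fc (deriv (\<psi> t)) k))
        - J0 / K * (cmod (fc p k))\<^sup>2" for k
    have fp: "fin_hom \<gamma> p" using c1per_hom2(1)[OF p'] fin_hom_mono g by blast
    have hs: "((\<lambda>k. lam k powr \<gamma> * ck k) has_sum (pint (\<lambda>x. p x * Lam \<gamma> u x)
        - pint (\<lambda>x. q x * Lam \<gamma> (deriv (\<psi> t)) x) - J0 / K * hom2 \<gamma> p)) UNIV"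
    proof -
      have "((\<lambda>k. lam k powr \<gamma> * Re (fc p k * cnj (fc u k)) - lam k powr \<gamma> * Re (fc q k * cnj (fc (deriv (\<psi> t)) k))
          - J0 / K * (lam k powr \<gamma> * (cmod (fc p k))\<^sup>2)) has_sum (pint (\<lambda>x. p x * Lam \<gamma> u x)
        - pint (\<lambda>x. q x * Lam \<gamma> (deriv (\<psi> t)) x) - J0 / K * hom2 \<gamma> p)) UNIV"
        by (intro has_sum_diff has_sum_cmult_right fin_hom_has_sum[OF fp] pint_Lam[OF u4 _ cs(1)] pint_Lam[OF dpsi4 _ cs(7)])
           (use g in auto)
      then show ?thesis by (simp add: ck_def algebra_simps)
    qed
    have "0 \<le> (\<Sum>\<^sub>\<infinity>k. lam k powr \<gamma> * ck k)"
    proof (rule symbol_comparison[OF _ g(2) has_sum_imp_summable[OF hs]])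
      fix h :: real
      let ?D = "\<lambda>f x. f (x + h) - f x :: real"
      let ?S = "pint (\<lambda>x. ?D p x * ?D u x) - pint (\<lambda>x. ?D q x * ?D (deriv (\<psi> t)) x) - J0 / K * pint (\<lambda>x. (?D p x)\<^sup>2)"
      have "((\<lambda>k. fsym h k * Re (fc p k * cnj (fc u k)) - fsym h k * Re (fc q k * cnj (fc (deriv (\<psi> t)) k))
          - J0 / K * (fsym h k * (cmod (fc p k))\<^sup>2)) has_sum ?S) UNIV"
        by (intro has_sum_diff has_sum_cmult_right pint_delta pint_delta_sq cs ckper_cper[OF u4] ckper_cper[OF dpsi4])
      then show "((\<lambda>k. fsym h k * ck k) has_sum ?S) UNIV"
        by (simp add: ck_def algebra_simps)
      note dd = cper_diff[OF cper_shift[OF cs(1)] cs(1)] cper_diff[OF cper_shift[OF cs(7)] cs(7)]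
        cper_diff[OF cper_shift[OF ckper_cper[OF u4]] ckper_cper[OF u4]]
        cper_diff[OF cper_shift[OF ckper_cper[OF dpsi4]] ckper_cper[OF dpsi4]]
      note ii = cper_mult[OF dd(1,3)] cper_mult[OF dd(2,4)] cper_mult[OF cper_const cper_power[OF dd(1)]]
      have "0 \<le> pint (\<lambda>x. ?D p x * ?D u x - ?D q x * ?D (deriv (\<psi> t)) x - J0 / K * (?D p x)\<^sup>2)"
      proof (rule pint_nonneg)
        show "cper (\<lambda>x. ?D p x * ?D u x - ?D q x * ?D (deriv (\<psi> t)) x - J0 / K * (?D p x)\<^sup>2)"
          by (rule cper_diff[OF cper_diff[OF ii(1,2)] ii(3)])
        fix x
        \<comment> \<open>J and the derivative of \<psi> differ by the constant 1, so the increments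
          of the latter supply J' - J in the Bregman inequality.\<close>
        have "?D (deriv (\<psi> t)) x = ?D ?J x" by (simp add: Jac_eq)
        then show "0 \<le> ?D p x * ?D u x - ?D q x * ?D (deriv (\<psi> t)) x - J0 / K * (?D p x)\<^sup>2"
          using bregman_pointwise[OF E e e1 K J0 J_ge[of x] J_ge[of "x + h"], of "gg (x + h)" "gg x"]
          by (simp add: u_def q_def p_def)
      qed
      also have "\<dots> = ?S"
        by (simp only: pint_diff[OF cper_diff[OF ii(1,2)] ii(3)] pint_diff[OF ii(1,2)] pint_cmult)
      finally show "0 \<le> ?S" .
    qed (use g in simp)
    then have "pint (\<lambda>y. e (m y) * V' y) \<le> - (J0 / K * hom2 \<gamma> p)"
      unfolding infsumI[OF hs] main by simp
    also have "\<dots> \<le> - (J0 / K / C) * hom2 \<gamma> (\<lambda>y. e (m y))"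
    proof -
      have "hom2 \<gamma> (\<lambda>y. e (m y)) \<le> C * hom2 \<gamma> p"
        unfolding p_def gg_def C_def by (rule hom2_Psi[OF w1]) (use g g2 in auto)
      then have "J0 / K / C * hom2 \<gamma> (\<lambda>y. e (m y)) \<le> J0 / K / C * (C * hom2 \<gamma> p)"
        using J0 K C by (intro mult_left_mono) auto
      then show ?thesis using C by simp
    qed
    finally show ?thesis using V by blast
  qed
  moreover have "0 < J0 / K / C" using K J0 C by simp
  ultimately show ?thesis unfolding coercive_def by blast
qed

subsection \<open>Pairing with a Hoelder continuous derivative\<close>

definition holder :: "real \<Rightarrow> real \<Rightarrow> (real \<Rightarrow> real) \<Rightarrow> bool" where
  "holder \<alpha> A a \<longleftrightarrow> 0 \<le> A \<and> (\<forall>y h. 0 < h \<and> h \<le> 1 \<longrightarrow> \<bar>a (y + h) - a y\<bar> \<le> A * h powr \<alpha>)"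

text \<open>The Nikolskii seminorm of order \<sigma> in L1. It sees increments only; the mean of
  \<open>G\<close> is not controlled.\<close>

definition l1mod :: "real \<Rightarrow> real \<Rightarrow> (real \<Rightarrow> real) \<Rightarrow> bool" where
  "l1mod \<sigma> B G \<longleftrightarrow> 0 \<le> B \<and> (\<forall>r. 0 < r \<and> r \<le> 1 \<longrightarrow> pint (\<lambda>y. \<bar>G (y + r) - G y\<bar>) \<le> B * r powr \<sigma>)"

text \<open>Halving the step r multiplies the telescoping terms r^(s-1) by 2^(1-s); this bounds the
  resulting geometric series for s > 1.\<close>

definition sew_const :: "real \<Rightarrow> real" where
  "sew_const s = 1 / (1 - 2 powr (1 - s))"

lemma sew_const_pos: "1 < s \<Longrightarrow> 0 < sew_const s"
  by (simp add: sew_const_def powr_less_one)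

text \<open>Dyadic telescoping of the difference quotients of \<open>a\<close>: halving the step changes the pairing
  by a mixed difference of \<open>a\<close> and \<open>G\<close>, and at step \<open>1\<close> the quotient vanishes by periodicity.\<close>
lemma sewing:
  assumes a: "c1per a a'" and G: "cper G" and A: "holder \<alpha> A a" and B: "l1mod \<sigma> B G" and s: "1 < \<alpha> + \<sigma>"
  shows "\<bar>pint (\<lambda>y. a' y * G y)\<bar> \<le> sew_const (\<alpha> + \<sigma>) * A * B"
proof -
  note ca = c1per_cper[OF a]
  define \<Phi> where "\<Phi> r = pint (\<lambda>y. a (y + r) * G y)" for r
  define b where "b n = (\<Phi> ((1/2) ^ n) - \<Phi> 0) / (1/2) ^ n" for n :: nat
  define q where "q = (2::real) powr (1 - (\<alpha> + \<sigma>))"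
  have q: "0 < q" "q < 1" using s by (auto simp: q_def powr_less_one)
  have AB: "0 \<le> A" "0 \<le> B" using A B by (auto simp: holder_def l1mod_def)
  have lim: "b \<longlonglongrightarrow> pint (\<lambda>y. a' y * G y)"
  proof -
    have "(\<Phi> has_field_derivative integral (cbox 0 1) (\<lambda>y. a' (y + 0) * G y)) (at 0 within UNIV)"
      unfolding \<Phi>_def cbox_interval[symmetric]
    proof (rule leibniz_rule_field_derivative)
      show "((\<lambda>r. a (y + r) * G y) has_field_derivative a' (y + r) * G y) (at r within UNIV)" for r y
      proof -
        have "((\<lambda>r. a (y + r)) has_real_derivative a' (y + r)) (at r)"
          using c1per_deriv[OF a, of "y + r"] DERIV_shift[of a "a' (y + r)" r y] by (simp add: add.commute)
        then show ?thesis by (auto intro!: derivative_eq_intros)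
      qed
      show "(\<lambda>y. a (y + r) * G y) integrable_on cbox 0 1" for r
        unfolding cbox_interval by (rule cper_integrable[OF cper_mult[OF cper_shift[OF ca] G]])
      show "continuous_on (UNIV \<times> cbox 0 1) (\<lambda>(r, y). a' (y + r) * G y)"
        unfolding case_prod_unfold
        by (intro continuous_intros continuous_on_compose2[OF cper_cont[OF c1per_cper'[OF a], of UNIV]]
              continuous_on_compose2[OF cper_cont[OF G, of UNIV]]) auto
    qed auto
    then have "((\<lambda>h. (\<Phi> (0 + h) - \<Phi> 0) / h) \<longlongrightarrow> pint (\<lambda>y. a' y * G y)) (at 0)"
      by (simp add: DERIV_def)
    moreover have "filterlim (\<lambda>n. (1/2::real) ^ n) (at 0) sequentially"
      by (auto simp: filterlim_at intro!: LIMSEQ_realpow_zero)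
    ultimately have "((\<lambda>n. (\<Phi> (0 + (1/2) ^ n) - \<Phi> 0) / (1/2) ^ n) \<longlonglongrightarrow> pint (\<lambda>y. a' y * G y))"
      by (rule filterlim_compose)
    then show ?thesis by (simp add: b_def[abs_def])
  qed
  have b0: "b 0 = 0"
    using cper_periodic[OF ca] by (simp add: b_def \<Phi>_def)
  have step: "\<bar>b n - b (Suc n)\<bar> \<le> A * B * q ^ Suc n" for n
  proof -
    define r :: real where "r = (1/2) ^ Suc n"
    have "r \<le> 1" unfolding r_def by (intro power_le_one) auto
    then have r: "0 < r" "(1/2) ^ n = 2 * r" "r \<le> 1" by (auto simp: r_def)
    define D where "D y = a (y + r) - a y" for y
    have D: "cper D" unfolding D_def by (rule cper_diff[OF cper_shift[OF ca] ca])
    have GD: "cper (\<lambda>y. G (y - r) - G y)"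
      using cper_diff[OF cper_shift[OF G, of "- r"] G] by simp
    have \<Phi>: "\<Phi> (r + s) - \<Phi> s = pint (\<lambda>y. D (y + s) * G y)" for s
      unfolding \<Phi>_def D_def left_diff_distrib
      using pint_diff[OF cper_mult[OF cper_shift[OF ca, of "r + s"] G] cper_mult[OF cper_shift[OF ca, of s] G]]
      by (simp add: add_ac)
    \<comment> \<open>Passing from step 2 r to step r leaves a second difference of \<Phi>;
      translating its first half by r moves one of the two differences from \<open>a\<close> onto
      \<open>G\<close>.\<close>
    have "2 * r * (b n - b (Suc n)) = (\<Phi> (r + r) - \<Phi> r) - (\<Phi> (r + 0) - \<Phi> 0)"
      unfolding b_def r(2) r_def[symmetric] using r(1) by (simp add: field_simps)
    also have "\<dots> = pint (\<lambda>y. D (y + r) * G y) - pint (\<lambda>y. D y * G y)" unfolding \<Phi> by simp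
    also have "pint (\<lambda>y. D (y + r) * G y) = pint (\<lambda>y. D y * G (y - r))"
      using pint_shift[OF cper_mult[OF D cper_shift[OF G, of "- r"]], of r] by simp
    also have "\<dots> - pint (\<lambda>y. D y * G y) = pint (\<lambda>y. D y * (G (y - r) - G y))"
      using pint_diff[OF cper_mult[OF D cper_shift[OF G, of "- r"]] cper_mult[OF D G]]
      by (simp add: right_diff_distrib)
    also have "\<bar>\<dots>\<bar> \<le> pint (\<lambda>y. \<bar>D y * (G (y - r) - G y)\<bar>)"
      by (rule pint_abs_le[OF cper_mult[OF D GD]])
    also have "\<dots> \<le> pint (\<lambda>y. A * r powr \<alpha> * \<bar>G (y - r) - G y\<bar>)"
      by (rule pint_mono[OF cper_abs[OF cper_mult[OF D GD]] cper_mult[OF cper_const cper_abs[OF GD]]])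
         (use A r in \<open>auto simp: abs_mult D_def holder_def intro!: mult_right_mono\<close>)
    also have "\<dots> = A * r powr \<alpha> * pint (\<lambda>y. \<bar>G (y + r) - G y\<bar>)"
      using pint_shift[OF cper_abs[OF GD], of r] by (simp add: abs_minus_commute)
    also have "\<dots> \<le> A * r powr \<alpha> * (B * r powr \<sigma>)"
      using B r AB unfolding l1mod_def by (intro mult_left_mono) auto
    also have "\<dots> = r * (A * B * r powr (\<alpha> + \<sigma> - 1))"
      using r by (simp add: powr_diff powr_add)
    finally have "2 * r * \<bar>b n - b (Suc n)\<bar> \<le> r * (A * B * r powr (\<alpha> + \<sigma> - 1))"
      using r by (simp add: abs_mult)
    then have le: "2 * \<bar>b n - b (Suc n)\<bar> \<le> A * B * r powr (\<alpha> + \<sigma> - 1)" using r by (simp add: mult.assoc)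
    have pw: "r powr (\<alpha> + \<sigma> - 1) = q ^ Suc n"
    proof -
      have "r = 2 powr (- real (Suc n))"
        unfolding r_def by (simp add: powr_minus powr_realpow power_one_over inverse_eq_divide del: of_nat_Suc)
      then have "r powr (\<alpha> + \<sigma> - 1) = 2 powr (- real (Suc n) * (\<alpha> + \<sigma> - 1))" by (simp add: powr_powr)
      also have "- real (Suc n) * (\<alpha> + \<sigma> - 1) = (1 - (\<alpha> + \<sigma>)) * real (Suc n)" by (simp add: algebra_simps)
      also have "2 powr \<dots> = q ^ Suc n" unfolding q_def by (simp only: powr_powr[symmetric] powr_realpow powr_gt_zero)
      finally show ?thesis .
    qed
    show ?thesis by (rule order_trans[rotated, OF le[unfolded pw]]) simp
  qed
  have "\<bar>b n\<bar> \<le> A * B * (\<Sum>i<n. q ^ Suc i)" for n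
  proof (induction n)
    case (Suc n)
    have "\<bar>b (Suc n)\<bar> \<le> \<bar>b n\<bar> + \<bar>b n - b (Suc n)\<bar>" by linarith
    also have "\<dots> \<le> A * B * (\<Sum>i<n. q ^ Suc i) + A * B * q ^ Suc n" by (intro add_mono Suc step)
    finally show ?case by (simp add: distrib_left)
  qed (simp add: b0)
  moreover have "A * B * (\<Sum>i<n. q ^ Suc i) \<le> sew_const (\<alpha> + \<sigma>) * A * B" for n
  proof -
    have "(\<Sum>i<n. q ^ Suc i) = q * (\<Sum>i<n. q ^ i)" by (simp add: sum_distrib_left)
    also have "\<dots> = q * ((1 - q ^ n) / (1 - q))" using q by (simp add: sum_gp_strict)
    also have "\<dots> \<le> 1 * (1 / (1 - q))"
      using q by (intro mult_mono divide_right_mono) (auto simp: power_le_one)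
    finally have "(\<Sum>i<n. q ^ Suc i) \<le> sew_const (\<alpha> + \<sigma>)" by (simp add: sew_const_def q_def)
    from mult_left_mono[OF this mult_nonneg_nonneg[OF AB]] show ?thesis by (simp add: mult_ac)
  qed
  ultimately have "\<bar>b n\<bar> \<le> sew_const (\<alpha> + \<sigma>) * A * B" for n by (meson order_trans)
  then show ?thesis using LIMSEQ_le_const2[OF tendsto_rabs[OF lim]] by blast
qed

subsection \<open>Littlewood--Paley blocks\<close>

text \<open>Away from k = 0 the coefficient is the product of lam |c| and 1 / lam, and both are
  square summable.\<close>

lemma fourier_summable:
  assumes "c1per f f'" shows "(\<lambda>k. cmod (fc f k)) summable_on UNIV"
proof -
  have "(\<lambda>k. lam k powr 2 * (cmod (fc f k))\<^sup>2 + lam k powr - 2 + (if k = 0 then cmod (fc f 0) else 0)) summable_on UNIV"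
  proof (intro summable_on_add summable_lam)
    show "(\<lambda>k. lam k powr 2 * (cmod (fc f k))\<^sup>2) summable_on UNIV"
      using c1per_hom2(1)[OF assms] by (simp add: fin_hom_def)
    show "(\<lambda>k. if k = 0 then cmod (fc f 0) else 0) summable_on UNIV"
      by (rule finite_nonzero_values_imp_summable_on) (auto intro: finite_subset[of _ "{0}"])
  qed
  then show ?thesis
  proof (rule summable_dom)
    fix k
    show "\<bar>cmod (fc f k)\<bar> \<le> lam k powr 2 * (cmod (fc f k))\<^sup>2 + lam k powr - 2 + (if k = 0 then cmod (fc f 0) else 0)"
    proof (cases "k = 0")
      case False
      define x where "x = lam k * cmod (fc f k)"
      define y where "y = inverse (lam k)"
      have l: "lam k > 0" using lam_ge1[OF False] by simp
      have "cmod (fc f k) = x * y" using l by (simp add: x_def y_def)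
      also have "\<dots> \<le> x\<^sup>2 + y\<^sup>2" using sum_squares_bound[of x y] zero_le_power2[of x] zero_le_power2[of y] by linarith
      finally show ?thesis using False l
        by (simp add: x_def y_def powr_minus powr_numeral power_mult_distrib power_inverse)
    qed simp
  qed
qed

text \<open>Parseval evaluates the pairings of the sum F with f and with itself; both equal the
  squared norm of f, so f - F has norm zero, and continuity makes this pointwise.\<close>

lemma fourier_series:
  assumes f: "c1per f f'" shows "fser (fc f) = f"
proof -
  note cf = c1per_cper[OF f] and s = fourier_summable[OF f]
  let ?F = "fser (fc f)"
  have cF: "cper ?F" by (rule cper_fser[OF s])
  have "pint (\<lambda>x. f x * ?F x) = pint (\<lambda>x. (f x)\<^sup>2)"
    using has_sum_unique[OF fser_pint[OF s cf, unfolded Re_mult_cnj] parseval_sq[OF cf]] .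
  moreover have "pint (\<lambda>x. ?F x * ?F x) = pint (\<lambda>x. f x * ?F x)"
    by (rule has_sum_unique[OF fser_pint[OF s cF] parseval[OF cf cF]])
  moreover have "pint (\<lambda>x. (f x - ?F x)\<^sup>2) = pint (\<lambda>x. (f x)\<^sup>2) - 2 * pint (\<lambda>x. f x * ?F x) + pint (\<lambda>x. ?F x * ?F x)"
  proof -
    have "pint (\<lambda>x. (f x - ?F x)\<^sup>2) = pint (\<lambda>x. ((f x)\<^sup>2 - 2 * (f x * ?F x)) + ?F x * ?F x)"
      by (simp add: power2_eq_square algebra_simps)
    also have "\<dots> = pint (\<lambda>x. (f x)\<^sup>2) - 2 * pint (\<lambda>x. f x * ?F x) + pint (\<lambda>x. ?F x * ?F x)"
      by (simp only: pint_add[OF cper_diff[OF cper_power[OF cf] cper_mult[OF cper_const cper_mult[OF cf cF]]] cper_mult[OF cF cF]]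
          pint_diff[OF cper_power[OF cf] cper_mult[OF cper_const cper_mult[OF cf cF]]] pint_cmult)
    finally show ?thesis .
  qed
  ultimately have z: "pint (\<lambda>x. (f x - ?F x)\<^sup>2) = 0" by simp
  have eq01: "f x = ?F x" if "x \<in> {0..1}" for x
  proof -
    have int: "(\<lambda>x. (f x - ?F x)\<^sup>2) integrable_on {0..1}"
      by (intro cper_integrable cper_power cper_diff cf cF)
    have "(f x - ?F x)\<^sup>2 = 0"
      by (rule has_integral_0_cbox_imp_0[where f = "\<lambda>x. (f x - ?F x)\<^sup>2" and a = 0 and b = 1])
         (use z that int cper_cont[OF cper_power[OF cper_diff[OF cf cF]]] in \<open>auto simp: has_integral_iff\<close>)
    then show ?thesis by simp
  qed
  show ?thesis
  proof
    fix x :: real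
    have "frac x \<in> {0..1}" by (simp add: frac_ge_0 frac_lt_1 less_imp_le)
    then show "?F x = f x" using eq01[of "frac x"] cper_frac[OF cf, of x] cper_frac[OF cF, of x] by simp
  qed
qed

text \<open>Counting the pairs i, j < n with i - j = l gives n - |l|.\<close>

lemma fejer_coeff:
  assumes n: "n > 0"
  shows "pint (\<lambda>t. ek l t * complex_of_real (fejer n t)) = (if \<bar>l\<bar> \<le> int n then 1 - of_int \<bar>l\<bar> / of_nat n else 0)"
proof -
  have one: "pint (\<lambda>t. ek l t * cis (- 2 * pi * of_int m * t)) = (if l = m then 1 else 0)" for m
  proof -
    have "ek l t * cis (- 2 * pi * of_int m * t) = cis (- 2 * pi * of_int (m - l) * t)" for t
      by (simp add: cis_mult algebra_simps)
    then have "pint (\<lambda>t. ek l t * cis (- 2 * pi * of_int m * t)) = fc (\<lambda>x. 1) (m - l)"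
      by (simp add: fc_pint)
    then show ?thesis by (simp add: fc_const)
  qed
  have "pint (\<lambda>t. ek l t * complex_of_real (fejer n t))
      = pint (\<lambda>t. (1 / of_nat n) * (\<Sum>i<n. \<Sum>j<n. ek l t * cis (- 2 * pi * of_int (int i - int j) * t)))"
    unfolding fejer_expand by (simp add: sum_distrib_left sum_divide_distrib)
  also have "\<dots> = (1 / of_nat n) * (\<Sum>i<n. \<Sum>j<n. pint (\<lambda>t. ek l t * cis (- 2 * pi * of_int (int i - int j) * t)))"
    by (subst integral_mult_right, subst pint_sum, simp, intro cper_sum cper_mult cper_ek cper_ekm)
       (subst pint_sum, simp, intro cper_mult cper_ek cper_ekm, simp)
  also have "\<dots> = (1 / of_nat n) * (\<Sum>i<n. \<Sum>j<n. if l = int i - int j then 1 else 0)"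
    unfolding one ..
  also have "(\<Sum>i<n. \<Sum>j<n. if l = int i - int j then (1::complex) else 0) = of_nat (n - nat \<bar>l\<bar>)"
  proof -
    have pos: "(\<Sum>i<n. \<Sum>j<n. if i = j + m then (1::complex) else 0) = of_nat (n - m)" for m
    proof -
      have "(\<Sum>i<n. \<Sum>j<n. if i = j + m then (1::complex) else 0) = (\<Sum>j<n. \<Sum>i<n. if i = j + m then 1 else 0)"
        by (rule sum.swap)
      also have "\<dots> = (\<Sum>j<n. if j + m < n then 1 else 0)" by (simp add: sum.delta')
      also have "\<dots> = of_nat (card {j. j < n \<and> j + m < n})" by (simp add: sum.If_cases Collect_conj_eq lessThan_def)
      also have "{j. j < n \<and> j + m < n} = {..<n - m}" by auto
      finally show ?thesis by simp
    qed
    show ?thesis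
    proof (cases "l \<ge> 0")
      case True
      have "(l = int i - int j) = (i = j + nat l)" for i j using True by auto
      then show ?thesis using pos[of "nat l"] True by simp
    next
      case False
      have "(l = int i - int j) = (j = i + nat (- l))" for i j using False by auto
      then show ?thesis using pos[of "nat (- l)"] False by (subst sum.swap) simp
    qed
  qed
  also have "(1 / of_nat n) * of_nat (n - nat \<bar>l\<bar>) = (if \<bar>l\<bar> \<le> int n then 1 - of_int \<bar>l\<bar> / of_nat n else (0::complex))"
  proof (cases "\<bar>l\<bar> \<le> int n")
    case True
    then have "of_nat (n - nat \<bar>l\<bar>) = (of_nat n - of_int \<bar>l\<bar> :: complex)"
      by (simp add: of_nat_diff nat_le_iff)
    then show ?thesis using n True by (simp add: field_simps)
  qed auto
  finally show ?thesis .
qed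

text \<open>The derivative of a trigonometric polynomial of degree at most \<open>n\<close> is its convolution with
  \<open>4 \<pi> n sin (2 \<pi> n t)\<close> times the Fejer kernel.\<close>
lemma bernstein:
  fixes c :: "int \<Rightarrow> complex"
  assumes S: "finite S" "\<And>k. k \<in> S \<Longrightarrow> \<bar>k\<bar> \<le> int n" and n: "n > 0"
  defines "P \<equiv> \<lambda>x. Re (\<Sum>k\<in>S. c k * ek k x)"
  assumes M: "\<And>x. \<bar>P x\<bar> \<le> M"
  shows "c1per P (\<lambda>x. Re (\<Sum>k\<in>S. 2 * pi * \<i> * of_int k * c k * ek k x))"
    and "\<bar>Re (\<Sum>k\<in>S. 2 * pi * \<i> * of_int k * c k * ek k x)\<bar> \<le> 4 * pi * real n * M"
proof -
  let ?P' = "\<lambda>x. Re (\<Sum>k\<in>S. 2 * pi * \<i> * of_int k * c k * ek k x)"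
  have "((\<lambda>x. \<Sum>k\<in>S. c k * ek k x) has_vector_derivative (\<Sum>k\<in>S. 2 * pi * \<i> * of_int k * c k * ek k x)) (at x)" for x
  proof (rule has_vector_derivative_sum)
    show "((\<lambda>x. c k * ek k x) has_vector_derivative 2 * pi * \<i> * of_int k * c k * ek k x) (at x)" for k
      unfolding has_vector_derivative_def
      by (auto intro!: derivative_eq_intros simp: scaleR_conv_of_real algebra_simps)
  qed
  from bounded_linear.has_vector_derivative[OF bounded_linear_Re this]
  have d: "(P has_real_derivative ?P' x) (at x)" for x
    by (simp add: P_def has_real_derivative_iff_has_vector_derivative)
  show c1: "c1per P ?P'"
  proof (rule c1perI[OF _ d])
    show "P (x + 1) = P x" for x unfolding P_def by (simp only: cper_periodic[OF cper_ek])
  qed (intro continuous_intros)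
  \<comment> \<open>Translated by n, the triangular coefficients are linear in k on {-n..n}, which
    reproduces the symbol of the derivative.\<close>
  have W: "pint (\<lambda>t. ek k t * of_real (sin (2 * pi * real n * t) * fejer n t)) = \<i> * of_int k / (2 * of_nat n)"
    if k: "\<bar>k\<bar> \<le> int n" for k
  proof -
    have s: "complex_of_real (sin (2 * pi * real n * t)) = (ek (int n) t - ek (- int n) t) * (- \<i> / 2)" for t
      by (simp add: complex_eq_iff)
    have "ek k t * of_real (sin (2 * pi * real n * t) * fejer n t)
        = (- \<i> / 2) * (ek (k + int n) t * of_real (fejer n t) - ek (k - int n) t * of_real (fejer n t))" for t
    proof -
      have "ek (k + int n) t = ek k t * ek (int n) t" "ek (k - int n) t = ek k t * ek (- int n) t"
        by (simp_all add: cis_mult algebra_simps)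
      then show ?thesis by (simp only: of_real_mult s) (simp add: algebra_simps)
    qed
    then have "pint (\<lambda>t. ek k t * of_real (sin (2 * pi * real n * t) * fejer n t))
        = (- \<i> / 2) * pint (\<lambda>t. ek (k + int n) t * of_real (fejer n t) - ek (k - int n) t * of_real (fejer n t))"
      by (simp only: integral_mult_right)
    also have "\<dots> = (- \<i> / 2) * (pint (\<lambda>t. ek (k + int n) t * of_real (fejer n t)) - pint (\<lambda>t. ek (k - int n) t * of_real (fejer n t)))"
      by (simp only: pint_diff[OF cper_mult[OF cper_ek cper_of_real[OF cper_fejer]] cper_mult[OF cper_ek cper_of_real[OF cper_fejer]]])
    also have "\<dots> = \<i> * of_int k / (2 * of_nat n)"
      unfolding fejer_coeff[OF n] using k n by (cases "k \<ge> 0") (auto simp: field_simps abs_if)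
    finally show ?thesis .
  qed
  have cP: "cper P" by (rule c1per_cper[OF c1])
  have csin: "cper (\<lambda>t. sin (2 * pi * real n * t))"
  proof (rule cperI)
    show "sin (2 * pi * real n * (t + 1)) = sin (2 * pi * real n * t)" for t
      using sin.plus_of_nat[of "2 * pi * real n * t" n] by (simp add: algebra_simps)
  qed (intro continuous_intros)
  have csF: "cper (\<lambda>t. sin (2 * pi * real n * t) * fejer n t)" by (intro cper_mult csin cper_fejer)
  have P': "?P' x = 4 * pi * real n * pint (\<lambda>t. P (t + x) * (sin (2 * pi * real n * t) * fejer n t))"
  proof -
    let ?w = "\<lambda>t. sin (2 * pi * real n * t) * fejer n t"
    have "pint (\<lambda>t. P (t + x) * ?w t) = pint (\<lambda>t. Re (\<Sum>k\<in>S. c k * ek k x * (ek k t * of_real (?w t))))"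
    proof (intro arg_cong[where f = pint] ext)
      fix t
      have "Re z * w = Re (z * complex_of_real w)" for z w by simp
      then have "P (t + x) * ?w t = Re ((\<Sum>k\<in>S. c k * (ek k t * ek k x)) * complex_of_real (?w t))"
        unfolding P_def ek_add .
      also have "(\<Sum>k\<in>S. c k * (ek k t * ek k x)) * complex_of_real (?w t)
          = (\<Sum>k\<in>S. c k * ek k x * (ek k t * complex_of_real (?w t)))"
        unfolding sum_distrib_right by (intro sum.cong refl) (simp only: mult_ac)
      finally show "P (t + x) * ?w t = Re (\<Sum>k\<in>S. c k * ek k x * (ek k t * complex_of_real (?w t)))" .
    qed
    also have "\<dots> = Re (pint (\<lambda>t. \<Sum>k\<in>S. c k * ek k x * (ek k t * of_real (?w t))))"
      by (rule pint_complex_Re[symmetric]) (intro cper_sum cper_mult cper_const cper_ek cper_of_real csF)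
    also have "pint (\<lambda>t. \<Sum>k\<in>S. c k * ek k x * (ek k t * of_real (?w t)))
        = (\<Sum>k\<in>S. pint (\<lambda>t. c k * ek k x * (ek k t * of_real (?w t))))"
      by (rule pint_sum[OF S(1)]) (intro cper_mult cper_const cper_ek cper_of_real csF)
    also have "\<dots> = (\<Sum>k\<in>S. c k * ek k x * (\<i> * of_int k / (2 * of_nat n)))"
      by (rule sum.cong[OF refl]) (simp only: integral_mult_right W[OF S(2)])
    also have "\<dots> = of_real (1 / (4 * pi * real n)) * (\<Sum>k\<in>S. 2 * pi * \<i> * of_int k * c k * ek k x)"
      unfolding sum_distrib_left using n by (intro sum.cong refl) (simp add: field_simps)
    also have "Re \<dots> = 1 / (4 * pi * real n) * ?P' x"
    proof -
      have "Re (complex_of_real r * z) = r * Re z" for r z by simp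
      then show ?thesis .
    qed
    finally have eq: "pint (\<lambda>t. P (t + x) * ?w t) = 1 / (4 * pi * real n) * ?P' x" .
    show ?thesis unfolding eq using n by (simp only: mult.assoc[symmetric]) simp
  qed
  have "\<bar>pint (\<lambda>t. P (t + x) * (sin (2 * pi * real n * t) * fejer n t))\<bar>
      \<le> pint (\<lambda>t. \<bar>P (t + x) * (sin (2 * pi * real n * t) * fejer n t)\<bar>)"
    by (rule pint_abs_le[OF cper_mult[OF cper_shift[OF cP] csF]])
  also have "\<dots> \<le> pint (\<lambda>t. M * fejer n t)"
  proof (rule pint_mono[OF cper_abs[OF cper_mult[OF cper_shift[OF cP] csF]] cper_mult[OF cper_const cper_fejer]])
    fix t
    have "\<bar>P (t + x)\<bar> * (\<bar>sin (2 * pi * real n * t)\<bar> * \<bar>fejer n t\<bar>) \<le> M * (1 * \<bar>fejer n t\<bar>)"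
      using M[of "t + x"] M[of 0] by (intro mult_mono mult_right_mono) auto
    then show "\<bar>P (t + x) * (sin (2 * pi * real n * t) * fejer n t)\<bar> \<le> M * fejer n t"
      by (simp add: abs_mult fejer_nonneg)
  qed
  also have "\<dots> = M" using pint_fejer_1[OF n] by simp
  finally have "\<bar>pint (\<lambda>t. P (t + x) * (sin (2 * pi * real n * t) * fejer n t))\<bar> \<le> M" .
  then have "4 * pi * real n * \<bar>pint (\<lambda>t. P (t + x) * (sin (2 * pi * real n * t) * fejer n t))\<bar> \<le> 4 * pi * real n * M"
    by (intro mult_left_mono) auto
  then show "\<bar>?P' x\<bar> \<le> 4 * pi * real n * M" unfolding P' by (simp add: abs_mult)
qed

text \<open>Two applications of the mean value theorem, with the second derivative bounded on a
  neighbourhood of the support; farther out all three values vanish. Applied to the dyadic symbols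
  in \<open>lpker_decay\<close>.\<close>

lemma second_difference_bound:
  fixes f :: "real \<Rightarrow> real"
  assumes f: "smooth f" and supp: "\<And>x. f x \<noteq> 0 \<Longrightarrow> \<bar>x\<bar> \<le> R"
  shows "\<exists>M\<ge>0. \<forall>x h. 0 < h \<longrightarrow> h \<le> 1 \<longrightarrow> \<bar>f (x + h) - 2 * f x + f (x - h)\<bar> \<le> M * h\<^sup>2"
proof -
  have d: "((deriv ^^ n) f has_real_derivative (deriv ^^ Suc n) f x) (at x)" for n x
    using f by (simp add: smooth_def DERIV_deriv_iff_real_differentiable)
  have d1: "(f has_real_derivative deriv f x) (at x)" for x using d[of 0 x] by simp
  have d2: "(deriv f has_real_derivative deriv (deriv f) x) (at x)" for x using d[of 1 x] by simp
  have c2: "continuous_on {- (\<bar>R\<bar> + 2)..\<bar>R\<bar> + 2} (deriv (deriv f))"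
    using d[of 2] by (auto simp: numeral_2_eq_2 intro!: continuous_at_imp_continuous_on DERIV_isCont)
  then have "bounded (deriv (deriv f) ` {- (\<bar>R\<bar> + 2)..\<bar>R\<bar> + 2})"
    by (intro compact_imp_bounded compact_continuous_image) auto
  then obtain M where "\<forall>y\<in>deriv (deriv f) ` {- (\<bar>R\<bar> + 2)..\<bar>R\<bar> + 2}. norm y \<le> M" unfolding bounded_iff by blast
  then have M: "\<bar>deriv (deriv f) x\<bar> \<le> M" if "\<bar>x\<bar> \<le> \<bar>R\<bar> + 2" for x
    using that by (force simp: abs_le_iff)
  have M0: "0 \<le> M" using M[of 0] by force
  have "\<bar>f (x + h) - 2 * f x + f (x - h)\<bar> \<le> 2 * M * h\<^sup>2" if h: "0 < h" "h \<le> 1" for x h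
  proof (cases "\<bar>x\<bar> \<le> \<bar>R\<bar> + 1")
    case True
    define g where "g s = f (x + s) + f (x - s)" for s
    have "(g has_real_derivative (deriv f (x + s) - deriv f (x - s))) (at s)" for s
    proof -
      have "((\<lambda>s. f (x + s)) has_real_derivative deriv f (x + s) * 1) (at s)"
        by (rule DERIV_chain2[OF d1]) (auto intro!: derivative_eq_intros)
      moreover have "((\<lambda>s. f (x - s)) has_real_derivative deriv f (x - s) * (-1)) (at s)"
        by (rule DERIV_chain2[OF d1]) (auto intro!: derivative_eq_intros)
      ultimately show ?thesis unfolding g_def by (auto dest: DERIV_add)
    qed
    then obtain s where s: "0 < s" "s < h" "g h - g 0 = (h - 0) * (deriv f (x + s) - deriv f (x - s))"
      using MVT2[of 0 h g "\<lambda>s. deriv f (x + s) - deriv f (x - s)"] h by blast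
    obtain z where z: "x - s < z" "z < x + s"
        "deriv f (x + s) - deriv f (x - s) = ((x + s) - (x - s)) * deriv (deriv f) z"
      using MVT2[of "x - s" "x + s" "deriv f" "deriv (deriv f)"] d2 s by force
    have "\<bar>deriv (deriv f) z\<bar> \<le> M" using z s h True by (intro M) auto
    have "\<bar>f (x + h) - 2 * f x + f (x - h)\<bar> = \<bar>g h - g 0\<bar>" by (simp add: g_def)
    also have "\<dots> = h * (2 * s * \<bar>deriv (deriv f) z\<bar>)" using s z h by (simp add: abs_mult)
    also have "\<dots> \<le> h * (2 * h * M)"
      using s h \<open>\<bar>deriv (deriv f) z\<bar> \<le> M\<close> by (intro mult_mono) auto
    finally show ?thesis by (simp add: power2_eq_square mult_ac)
  next
    case False
    have "f y = 0" if "\<bar>y - x\<bar> \<le> h" for y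
    proof (rule ccontr)
      assume "f y \<noteq> 0"
      then have "\<bar>y\<bar> \<le> R" by (rule supp)
      then show False using False that h by linarith
    qed
    from this[of x] this[of "x + h"] this[of "x - h"] have "f x = 0" "f (x + h) = 0" "f (x - h) = 0"
      using h by auto
    then show ?thesis using M0 by simp
  qed
  then show ?thesis using M0 by (intro exI[of _ "2 * M"]) auto
qed

lemma min_interp: "\<lbrakk>0 \<le> x; x \<le> a; x \<le> b; 0 \<le> \<theta>; \<theta> \<le> 1; 0 < a; 0 < b\<rbrakk> \<Longrightarrow> x \<le> a powr (1 - \<theta>) * b powr \<theta>" for x a b \<theta> :: real
proof (cases "x = 0")
  case False
  assume *: "0 \<le> x" "x \<le> a" "x \<le> b" "0 \<le> \<theta>" "\<theta> \<le> 1" "0 < a" "0 < b"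
  then have "x = x powr (1 - \<theta>) * x powr \<theta>" using False by (simp flip: powr_add)
  also have "\<dots> \<le> a powr (1 - \<theta>) * b powr \<theta>" using * by (intro mult_mono powr_mono2) auto
  finally show ?thesis .
qed simp

section \<open>Blocks of a dyadic partition of unity: Hoelder bounds, kernels, Besov norms\<close>

locale dyadic =
  fixes \<theta> \<phi> :: "real \<Rightarrow> real"
  assumes dyad: "dyadic_partition \<theta> \<phi>"
begin

abbreviation sy :: "nat \<Rightarrow> int \<Rightarrow> real" where
  "sy J k \<equiv> lp_symbol \<theta> \<phi> J (of_int k)"

definition lpsupp :: "nat \<Rightarrow> int set" where
  "lpsupp J = {k. sy J k \<noteq> 0}"

lemma sy_bounds: "0 \<le> sy J k" "sy J k \<le> 1"
  using dyad by (cases J; simp add: dyadic_partition_def)+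

lemma sy_supp: "sy J k \<noteq> 0 \<Longrightarrow> \<bar>k\<bar> \<le> 2 ^ Suc J"
proof -
  assume k: "sy J k \<noteq> 0"
  have "\<bar>of_int k\<bar> \<le> (4/3 :: real) * 2 ^ J"
  proof (cases J)
    case 0
    then show ?thesis using k dyad by (auto simp: dyadic_partition_def)
  next
    case (Suc j)
    then have "\<phi> (of_int k / 2 ^ j) \<noteq> 0" using k by simp
    then have "\<bar>of_int k / 2 ^ j\<bar> \<le> (8/3 :: real)" using dyad unfolding dyadic_partition_def by blast
    then show ?thesis using Suc by (simp add: abs_divide field_simps)
  qed
  also have "\<dots> \<le> 2 * 2 ^ J" by (intro mult_right_mono) auto
  finally have "of_int \<bar>k\<bar> \<le> (of_int (2 ^ Suc J) :: real)" by simp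
  then show ?thesis by (simp only: of_int_le_iff)
qed

lemma finite_lpsupp: "finite (lpsupp J)" and lpsupp_subset: "lpsupp J \<subseteq> {- (2 ^ Suc J)..2 ^ Suc J}"
proof -
  show "lpsupp J \<subseteq> {- (2 ^ Suc J)..2 ^ Suc J}"
    using sy_supp[of J] by (auto simp: lpsupp_def abs_le_iff simp del: power_Suc)
       (metis minus_le_iff)
  then show "finite (lpsupp J)" by (rule finite_subset) simp
qed

lemma sy_Suc_0 [simp]: "sy (Suc j) 0 = 0"
  using dyad by (force simp: dyadic_partition_def)

lemma sy_sum: "(\<lambda>J. sy J k) sums 1"
proof -
  have "(\<lambda>j. \<phi> (of_int k / 2 ^ j)) sums (1 - \<theta> (of_int k))" using dyad by (simp add: dyadic_partition_def)
  then have "(\<lambda>j. sy (Suc j) k) sums (1 - sy 0 k)" by simp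
  then show ?thesis using sums_Suc_iff[of "\<lambda>J. sy J k" "1 - sy 0 k"] by simp
qed

abbreviation blk :: "nat \<Rightarrow> (real \<Rightarrow> real) \<Rightarrow> real \<Rightarrow> real" where
  "blk \<equiv> lp_block \<theta> \<phi>"

lemma blk_eq: "blk J f x = Re (\<Sum>k\<in>lpsupp J. (of_real (sy J k) * fc f k) * ek k x)"
  by (simp add: lp_block_def lpsupp_def)

lemma cper_blk: "cper (blk J f)"
proof -
  have "cper (\<lambda>x. \<Sum>k\<in>lpsupp J. (of_real (sy J k) * fc f k) * ek k x)"
    by (intro cper_sum cper_mult cper_const cper_ek)
  from cper_compose[OF this, of Re] show ?thesis
    unfolding blk_eq[abs_def] by (simp only: continuous_on_Re continuous_on_id)
qed

text \<open>The partial sums of the symbols stay between 0 and 1 and tend to 1, so dominated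
  convergence against the summable Fourier coefficients applies.\<close>

lemma blk_sums:
  assumes f: "c1per f f'" shows "(\<lambda>N. \<Sum>J<N. blk J f x) \<longlonglongrightarrow> f x"
proof -
  note s = fourier_summable[OF f]
  define r where "r k = Re (fc f k * ek k x)" for k
  have rle: "\<bar>r k\<bar> \<le> cmod (fc f k)" for k unfolding r_def by (rule fser_term_le[OF s])
  have rs: "r summable_on UNIV" by (rule summable_dom[OF s rle])
  have blk: "blk J f x = (LINT k|count_space UNIV. sy J k * r k)" and bi: "integrable (count_space UNIV) (\<lambda>k. sy J k * r k)" for J
  proof -
    have fin: "finite {k. sy J k * r k \<noteq> 0}" by (rule finite_subset[OF _ finite_lpsupp[of J]]) (auto simp: lpsupp_def)
    have "(LINT k|count_space UNIV. sy J k * r k) = (\<Sum>k | sy J k * r k \<noteq> 0. sy J k * r k)"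
      using lebesgue_integral_count_space_finite_support[of UNIV "\<lambda>k. sy J k * r k"] fin by simp
    also have "\<dots> = (\<Sum>k\<in>lpsupp J. sy J k * r k)"
      by (rule sum.mono_neutral_left[OF finite_lpsupp]) (auto simp: lpsupp_def)
    also have "\<dots> = blk J f x" unfolding blk_eq r_def Re_sum
      by (intro sum.cong refl) (simp only: mult.assoc, simp)
    finally show "blk J f x = (LINT k|count_space UNIV. sy J k * r k)" by simp
    show "integrable (count_space UNIV) (\<lambda>k. sy J k * r k)"
    proof (rule infsum_LINT(1)[OF summable_dom[OF s]])
      fix k
      have "\<bar>sy J k\<bar> * \<bar>r k\<bar> \<le> 1 * cmod (fc f k)"
        using sy_bounds[of J k] rle[of k] by (intro mult_mono) auto
      then show "\<bar>sy J k * r k\<bar> \<le> cmod (fc f k)" by (simp add: abs_mult)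
    qed
  qed
  have "(\<lambda>N. LINT k|count_space UNIV. (\<Sum>J<N. sy J k) * r k) \<longlonglongrightarrow> (LINT k|count_space UNIV. r k)"
  proof (rule integral_dominated_convergence[where w = "\<lambda>k. \<bar>r k\<bar>"])
    show "AE k in count_space UNIV. (\<lambda>N. (\<Sum>J<N. sy J k) * r k) \<longlonglongrightarrow> r k"
      using tendsto_mult_right[OF sy_sum[unfolded sums_def]] by (intro AE_I2) fastforce
    show "AE k in count_space UNIV. norm ((\<Sum>J<N. sy J k) * r k) \<le> \<bar>r k\<bar>" for N
    proof (intro AE_I2)
      fix k
      have "(\<Sum>J<N. sy J k) \<le> 1"
        using sum_le_suminf[OF sums_summable[OF sy_sum[of k]], of "{..<N}"] sums_unique[OF sy_sum[of k]] sy_bounds by simp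
      then show "norm ((\<Sum>J<N. sy J k) * r k) \<le> \<bar>r k\<bar>"
        using sum_nonneg[of "{..<N}" "\<lambda>J. sy J k"] sy_bounds
        by (simp add: abs_mult mult_left_le_one_le)
    qed
    show "integrable (count_space UNIV) (\<lambda>k. \<bar>r k\<bar>)" using infsum_LINT(1)[OF rs] by simp
  qed auto
  moreover have "(LINT k|count_space UNIV. (\<Sum>J<N. sy J k) * r k) = (\<Sum>J<N. blk J f x)" for N
    unfolding sum_distrib_right blk by (rule Bochner_Integration.integral_sum) (rule bi)
  moreover have "(LINT k|count_space UNIV. r k) = f x"
  proof -
    have "infsum r UNIV = fser (fc f) x" unfolding r_def by (rule infsumI[OF fser_has_sum[OF s]])
    then show ?thesis by (simp only: infsum_LINT(2)[OF rs] fourier_series[OF f])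
  qed
  ultimately show ?thesis by simp
qed

lemma C_norm_blk:
  assumes C: "C_norm \<theta> \<phi> s f \<le> ennreal M" and M: "0 \<le> M"
  shows "\<bar>blk J f x\<bar> \<le> M * 2 powr (- (real J - 1) * s)"
proof -
  have "ennreal (2 powr ((real J - 1) * s)) * ennreal \<bar>blk J f x\<bar> \<le> ennreal (2 powr ((real J - 1) * s)) * (SUP x. ennreal \<bar>blk J f x\<bar>)"
    by (intro mult_left_mono SUP_upper) auto
  also have "\<dots> \<le> C_norm \<theta> \<phi> s f" unfolding C_norm_def by (rule SUP_upper) simp
  also note C
  finally have "2 powr ((real J - 1) * s) * \<bar>blk J f x\<bar> \<le> M" using M by (simp add: ennreal_mult[symmetric])
  then show ?thesis
    unfolding mult_minus_left powr_minus_divide by (simp add: pos_le_divide_eq mult.commute)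
qed

text \<open>By Bernstein's inequality block J is Lipschitz with a constant of order 2^J times its
  supremum. Interpolating this with the trivial bound on its increments gives 2^(J (\<alpha> - s))
  h^\<alpha>, summable thanks to the loss \<alpha> < s; the loss spares a splitting of the sum at
  the scale of h.\<close>

lemma C_norm_holder:
  assumes \<alpha>: "0 < \<alpha>" "\<alpha> < 1" "\<alpha> < s"
  obtains C where "0 < C" "\<And>f f' M. \<lbrakk>c1per f f'; 0 \<le> M; C_norm \<theta> \<phi> s f \<le> ennreal M\<rbrakk> \<Longrightarrow> holder \<alpha> (C * M) f"
proof -
  define c where "c J = 2 powr (- (real J - 1) * s) * (2 * (4 * pi * 2 ^ Suc J) powr \<alpha>)" for J :: nat
  have c_eq: "c J = (2 powr s * (2 * (8 * pi) powr \<alpha>)) * (2 powr (\<alpha> - s)) ^ J" for J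
  proof -
    have "(4 * pi * 2 ^ Suc J) powr \<alpha> = ((8 * pi) * 2 powr real J) powr \<alpha>"
      by (simp add: powr_realpow mult.assoc)
    also have "\<dots> = (8 * pi) powr \<alpha> * 2 powr (real J * \<alpha>)"
      by (simp add: powr_mult powr_powr)
    finally have "c J = (2 * (8 * pi) powr \<alpha>) * (2 powr (- (real J - 1) * s) * 2 powr (real J * \<alpha>))"
      by (simp add: c_def)
    also have "2 powr (- (real J - 1) * s) * 2 powr (real J * \<alpha>) = 2 powr s * 2 powr ((\<alpha> - s) * real J)"
      unfolding powr_add[symmetric] by (simp add: algebra_simps)
    also have "2 powr ((\<alpha> - s) * real J) = (2 powr (\<alpha> - s)) ^ J"
      by (simp only: powr_powr[symmetric] powr_realpow powr_gt_zero)
    finally show ?thesis by simp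
  qed
  have q: "0 < 2 powr (\<alpha> - s)" "2 powr (\<alpha> - s) < 1" using \<alpha> by (auto simp: powr_less_one)
  have summ: "summable c" unfolding c_eq using q by (intro summable_mult summable_geometric) simp
  have c0: "0 \<le> c J" for J by (simp add: c_def)
  define C where "C = suminf c + 1"
  have C: "0 < C" using suminf_nonneg[OF summ c0] by (simp add: C_def)
  have "holder \<alpha> (C * M) f" if f: "c1per f f'" and M: "0 \<le> M" "C_norm \<theta> \<phi> s f \<le> ennreal M" for f f' M
    unfolding holder_def
  proof (intro conjI allI impI)
    show "0 \<le> C * M" using C M by simp
    fix y h :: real assume h: "0 < h \<and> h \<le> 1"
    have b: "\<bar>blk J f (y + h) - blk J f y\<bar> \<le> M * h powr \<alpha> * c J" for J
    proof -
      define MJ where "MJ = M * 2 powr (- (real J - 1) * s)"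
      define n :: nat where "n = 2 ^ Suc J"
      have le: "\<bar>blk J f x\<bar> \<le> MJ" for x unfolding MJ_def by (rule C_norm_blk[OF M(2,1)])
      have n: "n > 0" "\<And>k. k \<in> lpsupp J \<Longrightarrow> \<bar>k\<bar> \<le> int n"
        using sy_supp[of J] by (auto simp: n_def lpsupp_def)
      have le': "\<bar>Re (\<Sum>k\<in>lpsupp J. (of_real (sy J k) * fc f k) * ek k x)\<bar> \<le> MJ" for x
        using le[of x] unfolding blk_eq .
      note B = bernstein[OF finite_lpsupp n(2) n(1) le']
      have blk_fun: "blk J f = (\<lambda>x. Re (\<Sum>k\<in>lpsupp J. (of_real (sy J k) * fc f k) * ek k x))"
        by (rule ext) (rule blk_eq)
      have MJ0: "0 \<le> MJ" using le[of 0] by linarith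
      show ?thesis
      proof (cases "MJ = 0")
        case True
        then have "blk J f x = 0" for x using le[of x] by simp
        then show ?thesis using M c0[of J] by simp
      next
        case False
        then have MJ: "0 < MJ" using MJ0 by simp
        have "\<bar>blk J f (y + h) - blk J f y\<bar> \<le> 4 * pi * real n * MJ * \<bar>(y + h) - y\<bar>"
        proof -
          have "norm (blk J f (y + h) - blk J f y) \<le> (4 * pi * real n * MJ) * norm ((y + h) - y)"
            unfolding blk_fun
            by (rule field_differentiable_bound[of UNIV, OF _ has_field_derivative_at_within[OF c1per_deriv[OF B(1)]]])
               (use B(2) in auto)
          then show ?thesis by simp
        qed
        also have "\<dots> \<le> 2 * MJ * (4 * pi * real n * h)" using h MJ by simp
        finally have 1: "\<bar>blk J f (y + h) - blk J f y\<bar> \<le> 2 * MJ * (4 * pi * real n * h)" .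
        have 2: "\<bar>blk J f (y + h) - blk J f y\<bar> \<le> 2 * MJ" using le[of "y + h"] le[of y] by linarith
        have "\<bar>blk J f (y + h) - blk J f y\<bar> \<le> (2 * MJ) powr (1 - \<alpha>) * (2 * MJ * (4 * pi * real n * h)) powr \<alpha>"
          by (rule min_interp[OF _ 2 1]) (use \<alpha> MJ h n in auto)
        also have "\<dots> = 2 * MJ * (4 * pi * real n * h) powr \<alpha>"
        proof -
          have "(2 * MJ * (4 * pi * real n * h)) powr \<alpha> = (2 * MJ) powr \<alpha> * (4 * pi * real n * h) powr \<alpha>"
            by (rule powr_mult)
          moreover have "(2 * MJ) powr (1 - \<alpha>) * (2 * MJ) powr \<alpha> = 2 * MJ" using MJ by (simp flip: powr_add)
          ultimately show ?thesis by (simp only: mult.assoc[symmetric])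
        qed
        also have "(4 * pi * real n * h) powr \<alpha> = (4 * pi * real n) powr \<alpha> * h powr \<alpha>"
          by (rule powr_mult)
        also have "2 * MJ * \<dots> = M * h powr \<alpha> * c J" by (simp add: MJ_def c_def n_def)
        finally show ?thesis .
      qed
    qed
    have "(\<lambda>N. \<bar>(\<Sum>J<N. blk J f (y + h)) - (\<Sum>J<N. blk J f y)\<bar>) \<longlonglongrightarrow> \<bar>f (y + h) - f y\<bar>"
      by (intro tendsto_intros blk_sums[OF f])
    moreover have "\<bar>(\<Sum>J<N. blk J f (y + h)) - (\<Sum>J<N. blk J f y)\<bar> \<le> C * M * h powr \<alpha>" for N
    proof -
      have "\<bar>(\<Sum>J<N. blk J f (y + h)) - (\<Sum>J<N. blk J f y)\<bar> \<le> (\<Sum>J<N. \<bar>blk J f (y + h) - blk J f y\<bar>)"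
        unfolding sum_subtractf[symmetric] by (rule sum_abs)
      also have "\<dots> \<le> (\<Sum>J<N. M * h powr \<alpha> * c J)" by (rule sum_mono) (rule b)
      also have "\<dots> = M * h powr \<alpha> * (\<Sum>J<N. c J)" by (simp add: sum_distrib_left)
      also have "\<dots> \<le> M * h powr \<alpha> * C"
        using sum_le_suminf[OF summ, of "{..<N}"] c0 M unfolding C_def by (intro mult_left_mono) auto
      finally show ?thesis by (simp add: mult_ac)
    qed
    ultimately show "\<bar>f (y + h) - f y\<bar> \<le> C * M * h powr \<alpha>"
      using LIMSEQ_le_const2 by blast
  qed
  then show ?thesis using that C by blast
qed

text \<open>The convolution kernel of a block; only cosines remain because \<open>lp_block\<close>
  takes the real part and acts on real functions.\<close>

definition lpker :: "nat \<Rightarrow> real \<Rightarrow> real" where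
  "lpker J t = (\<Sum>k\<in>lpsupp J. sy J k * cos (2 * pi * of_int k * t))"

lemma cper_cos: "cper (\<lambda>t. cos (2 * pi * of_int k * t))"
  using cper_compose[OF cper_ek[of k], of Re] by (simp add: continuous_on_Re)

lemma cper_lpker: "cper (lpker J)"
  unfolding lpker_def by (intro cper_sum cper_mult cper_const cper_cos)

lemma blk_lpker:
  assumes G: "cper G" shows "blk J G x = pint (\<lambda>t. G (t + x) * lpker J t)"
proof -
  have "blk J G x = (\<Sum>k\<in>lpsupp J. Re (of_real (sy J k) * fc (\<lambda>t. G (t + x)) k))"
    unfolding blk_eq Re_sum by (intro sum.cong refl) (simp only: fc_shift[OF G] mult_ac)
  also have "\<dots> = (\<Sum>k\<in>lpsupp J. pint (\<lambda>t. G (t + x) * (sy J k * cos (2 * pi * of_int k * t))))"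
  proof (intro sum.cong refl)
    fix k
    have "Re (fc (\<lambda>t. G (t + x)) k) = pint (\<lambda>t. Re (complex_of_real (G (t + x)) * cis (- 2 * pi * of_int k * t)))"
      unfolding fc_pint[OF cper_shift[OF G]] by (rule pint_complex_Re[OF cper_fc[OF cper_shift[OF G]]])
    then have "Re (of_real (sy J k) * fc (\<lambda>t. G (t + x)) k) = sy J k * pint (\<lambda>t. G (t + x) * cos (2 * pi * of_int k * t))"
      by simp
    also have "\<dots> = pint (\<lambda>t. sy J k * (G (t + x) * cos (2 * pi * of_int k * t)))" by (rule pint_cmult[symmetric])
    finally show "Re (of_real (sy J k) * fc (\<lambda>t. G (t + x)) k) = pint (\<lambda>t. G (t + x) * (sy J k * cos (2 * pi * of_int k * t)))"
      by (simp only: mult_ac)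
  qed
  also have "\<dots> = pint (\<lambda>t. \<Sum>k\<in>lpsupp J. G (t + x) * (sy J k * cos (2 * pi * of_int k * t)))"
    by (rule pint_sum[symmetric, OF finite_lpsupp]) (intro cper_mult cper_shift[OF G] cper_const cper_cos)
  finally show ?thesis by (simp add: lpker_def sum_distrib_left)
qed

lemma lpker_le: "\<bar>lpker J t\<bar> \<le> 8 * 2 ^ J"
proof -
  have "\<bar>lpker J t\<bar> \<le> (\<Sum>k\<in>lpsupp J. \<bar>sy J k * cos (2 * pi * of_int k * t)\<bar>)"
    unfolding lpker_def by (rule sum_abs)
  also have "\<dots> \<le> (\<Sum>k\<in>lpsupp J. 1)"
    using sy_bounds by (intro sum_mono) (auto simp: abs_mult intro!: mult_le_one)
  also have "\<dots> \<le> 2 * 2 ^ Suc J + 1"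
  proof -
    have "card (lpsupp J) \<le> card {- (2 ^ Suc J)..2 ^ Suc J :: int}"
      by (rule card_mono[OF _ lpsupp_subset]) simp
    also have "\<dots> = 2 ^ Suc J + 2 ^ Suc J + 1"
      unfolding card_atLeastAtMost_int by (simp add: nat_add_distrib nat_power_eq nat_mult_distrib)
    finally have "real (card (lpsupp J)) \<le> real (2 ^ Suc J + 2 ^ Suc J + 1)" by (simp only: of_nat_le_iff)
    then show ?thesis by simp
  qed
  also have "\<dots> \<le> 8 * 2 ^ J" using one_le_power[of "2::real" J] unfolding power_Suc by linarith
  finally show ?thesis .
qed

text \<open>Blocks of positive index annihilate constants; in \<open>B11_bound\<close> this replaces
  values of G by increments.\<close>

lemma lpker_pint: "pint (lpker (Suc j)) = 0"
proof -
  have "pint (lpker (Suc j)) = blk (Suc j) (\<lambda>x. 1) 0" by (simp add: blk_lpker)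
  also have "\<dots> = 0"
  proof -
    have "of_real (sy (Suc j) k) * fc (\<lambda>x. 1) k = 0" for k
      using sy_Suc_0[of j] by (simp add: fc_const del: lp_symbol.simps sy_Suc_0)
    note z = this
    show ?thesis unfolding blk_eq by (simp only: z mult_zero_left sum.neutral_const zero_complex.simps)
  qed
  finally show ?thesis .
qed

text \<open>Multiplying by \<open>fsym t 1\<close> = 2 - 2 cos (2 pi t) and summing by parts puts a
  second difference on the symbol. It is of size 4^(-J) and lives on O(2^J) frequencies, which
  leaves 2^(-J).\<close>

lemma lpker_decay:
  obtains M where "0 < M" "\<And>J t. \<bar>lpker J t\<bar> * fsym t 1 \<le> M / 2 ^ J"
proof -
  have ph: "smooth \<phi>" "\<And>x. \<phi> x \<noteq> 0 \<Longrightarrow> \<bar>x\<bar> \<le> 8/3" and th: "smooth \<theta>" "\<And>x. \<theta> x \<noteq> 0 \<Longrightarrow> \<bar>x\<bar> \<le> 4/3"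
    using dyad by (auto simp: dyadic_partition_def)
  obtain M1 where M1: "0 \<le> M1" "\<And>x h. \<lbrakk>0 < h; h \<le> 1\<rbrakk> \<Longrightarrow> \<bar>\<phi> (x + h) - 2 * \<phi> x + \<phi> (x - h)\<bar> \<le> M1 * h\<^sup>2"
    using second_difference_bound[OF ph] by auto
  obtain M2 where M2: "0 \<le> M2" "\<And>x h. \<lbrakk>0 < h; h \<le> 1\<rbrakk> \<Longrightarrow> \<bar>\<theta> (x + h) - 2 * \<theta> x + \<theta> (x - h)\<bar> \<le> M2 * h\<^sup>2"
    using second_difference_bound[OF th] by auto
  define M0 where "M0 = 4 * (M1 + M2)"
  have sd: "\<bar>sy J (k + 1) - 2 * sy J k + sy J (k - 1)\<bar> \<le> M0 / 4 ^ J" for J k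
  proof (cases J)
    case 0
    have "\<bar>\<theta> (of_int k + 1) - 2 * \<theta> (of_int k) + \<theta> (of_int k - 1)\<bar> \<le> M2 * 1\<^sup>2" by (rule M2) auto
    also have "\<dots> \<le> M0" using M1(1) M2(1) by (simp add: M0_def)
    finally show ?thesis using 0 by simp
  next
    case (Suc j)
    let ?h = "1 / 2 ^ j :: real"
    have "\<bar>\<phi> (of_int k / 2 ^ j + ?h) - 2 * \<phi> (of_int k / 2 ^ j) + \<phi> (of_int k / 2 ^ j - ?h)\<bar> \<le> M1 * ?h\<^sup>2"
      by (rule M1) auto
    also have "M1 * ?h\<^sup>2 = 4 * M1 / 4 ^ J"
      using Suc power_mult_distrib[of "2::real" 2 j] by (simp add: power2_eq_square)
    also have "\<dots> \<le> M0 / 4 ^ J" using M2(1) by (intro divide_right_mono) (simp_all add: M0_def)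
    finally show ?thesis using Suc by (simp add: add_divide_distrib diff_divide_distrib)
  qed
  have "\<bar>lpker J t\<bar> * fsym t 1 \<le> 16 * M0 / 2 ^ J" for J t
  proof -
    \<comment> \<open>One more than the largest possible frequency of the block, so that index
      shifts by one produce no boundary terms.\<close>
    define N :: int where "N = 2 ^ Suc J + 1"
    define c where "c k = cos (2 * pi * of_int k * t)" for k :: int
    have z: "sy J k = 0" if "\<bar>k\<bar> \<ge> N" for k using sy_supp[of J k] that by (fastforce simp: N_def)
    have K: "lpker J t = (\<Sum>k\<in>{-N..N}. sy J k * c k)"
      unfolding lpker_def c_def
      by (rule sum.mono_neutral_left) (use lpsupp_subset[of J] in \<open>auto simp: N_def lpsupp_def\<close>)
    have cc: "c k * fsym t 1 = 2 * c k - c (k + 1) - c (k - 1)" for k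
    proof -
      have f1: "fsym t 1 = 2 - 2 * cos (2 * pi * t)" by (simp add: fsym_cos lam_def)
      have "c k * fsym t 1 = 2 * c k - 2 * c k * cos (2 * pi * t)" unfolding f1 right_diff_distrib by simp
      moreover have "c (k + 1) + c (k - 1) = 2 * c k * cos (2 * pi * t)"
        unfolding c_def by (simp add: cos_add cos_diff distrib_left distrib_right left_diff_distrib right_diff_distrib)
      ultimately show ?thesis by linarith
    qed
    have sh: "(\<Sum>k\<in>{-N..N}. sy J k * c (k + e)) = (\<Sum>k\<in>{-N..N}. sy J (k - e) * c k)" if e: "e = 1 \<or> e = -1" for e
    proof -
      have "(\<Sum>k\<in>{-N..N}. sy J k * c (k + e)) = (\<Sum>k\<in>{-N+e..N+e}. sy J (k - e) * c k)"
        by (rule sum.reindex_bij_witness[of _ "\<lambda>k. k - e" "\<lambda>k. k + e"]) auto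
      also have "\<dots> = (\<Sum>k\<in>{-N-1..N+1}. sy J (k - e) * c k)"
        by (rule sum.mono_neutral_left) (use e in \<open>auto simp: z simp del: of_int_diff of_int_add\<close>)
      also have "\<dots> = (\<Sum>k\<in>{-N..N}. sy J (k - e) * c k)"
        by (rule sum.mono_neutral_right) (use e in \<open>auto simp: z simp del: of_int_diff of_int_add\<close>)
      finally show ?thesis .
    qed
    note sh1 = sh[of 1, OF disjI1[OF refl]]
      and sh2 = sh[of "- 1", OF disjI2[OF refl], unfolded add_uminus_conv_diff diff_minus_eq_add]
    have "lpker J t * fsym t 1 = (\<Sum>k\<in>{-N..N}. sy J k * (2 * c k - c (k + 1) - c (k - 1)))"
      unfolding K sum_distrib_right cc[symmetric] by (simp only: mult.assoc)
    also have "\<dots> = 2 * (\<Sum>k\<in>{-N..N}. sy J k * c k) - (\<Sum>k\<in>{-N..N}. sy J k * c (k + 1)) - (\<Sum>k\<in>{-N..N}. sy J k * c (k - 1))"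
      unfolding sum_distrib_left sum_subtractf[symmetric] by (intro sum.cong refl) (simp only: algebra_simps)
    also have "\<dots> = - (\<Sum>k\<in>{-N..N}. (sy J (k + 1) - 2 * sy J k + sy J (k - 1)) * c k)"
      unfolding sh1 sh2 sum_distrib_left sum_subtractf[symmetric] sum_negf[symmetric]
      by (intro sum.cong refl) (simp only: algebra_simps)
    finally have "\<bar>lpker J t * fsym t 1\<bar> = \<bar>\<Sum>k\<in>{-N..N}. (sy J (k + 1) - 2 * sy J k + sy J (k - 1)) * c k\<bar>"
      by (simp only: abs_minus_cancel)
    also have "\<dots> \<le> (\<Sum>k\<in>{-N..N}. \<bar>(sy J (k + 1) - 2 * sy J k + sy J (k - 1)) * c k\<bar>)" by (rule sum_abs)
    also have "\<dots> \<le> (\<Sum>k\<in>{-N..N}. M0 / 4 ^ J * 1)"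
      unfolding abs_mult by (intro sum_mono mult_mono sd) (auto simp: c_def M0_def M1 M2)
    also have "\<dots> = of_int (2 * N + 1) * (M0 / 4 ^ J)" by (simp add: N_def)
    also have "\<dots> \<le> (16 * 2 ^ J) * (M0 / 4 ^ J)"
    proof (intro mult_right_mono)
      have "of_int (2 * N + 1) = 4 * 2 ^ J + (3::real)" by (simp add: N_def)
      also have "\<dots> \<le> 16 * 2 ^ J" using one_le_power[of "2::real" J] by linarith
      finally show "of_int (2 * N + 1) \<le> (16 * 2 ^ J :: real)" .
    qed (use M1 M2 in \<open>simp add: M0_def\<close>)
    also have "\<dots> = 16 * M0 / 2 ^ J"
      using power_mult_distrib[of "2::real" 2 J] by simp
    finally show ?thesis by (simp add: abs_mult fsym_nonneg)
  qed
  then have "\<bar>lpker J t\<bar> * fsym t 1 \<le> (16 * M0 + 1) / 2 ^ J" for J t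
    by (rule order_trans) (simp add: divide_right_mono)
  moreover have "0 < 16 * M0 + 1" using M1 M2 by (simp add: M0_def add_nonneg_pos)
  ultimately show ?thesis using that by blast
qed

text \<open>For blocks of positive index the kernel acts on increments of G. Interpolating the two
  kernel bounds gives 2^(-J \<sigma>') times the power -1-\<sigma>' of the distance of t to the
  integers; against a modulus of order \<sigma> this is integrable as \<sigma>' < \<sigma>, and the
  sum over J converges as \<sigma>0 < \<sigma>'.\<close>

lemma B11_bound:
  assumes s: "0 < \<sigma>0" "\<sigma>0 < \<sigma>" "\<sigma> < 1"
  shows "\<exists>C>0. \<forall>G B. cper G \<longrightarrow> l1mod \<sigma> B G \<longrightarrow>
     B11_norm \<theta> \<phi> \<sigma>0 G \<le> ennreal (C * (B + pint (\<lambda>x. \<bar>G x\<bar>)))"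
proof -
  define \<sigma>' where "\<sigma>' = (\<sigma>0 + \<sigma>) / 2"
  define \<mu> where "\<mu> = 1 + \<sigma>'"
  have sm: "\<sigma>0 < \<sigma>'" "\<sigma>' < \<sigma>" "0 < \<mu>" "\<mu> < 2"
    unfolding \<sigma>'_def \<mu>_def using s by (simp_all add: field_simps)
  obtain M where M: "0 < M" "\<And>J t. \<bar>lpker J t\<bar> * fsym t 1 \<le> M / 2 ^ J"
    by (rule lpker_decay) blast
  define C1 where "C1 = 8 powr (1 - \<mu> / 2) * M powr (\<mu> / 2)"
  have C1: "0 < C1" using M by (simp add: C1_def)
  let ?\<rho> = "\<lambda>t::real. min t (1 - t)"
  have ker: "\<bar>lpker J t\<bar> \<le> C1 * 2 powr (- real J * \<sigma>') * ?\<rho> t powr (- \<mu>)" if t: "0 < t" "t < 1" for J t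
  proof -
    have r: "0 < ?\<rho> t" using t by simp
    have "\<bar>lpker J t\<bar> * (?\<rho> t)\<^sup>2 \<le> \<bar>lpker J t\<bar> * fsym t 1" using t by (intro mult_left_mono fsym_lower) auto
    also note M(2)
    finally have "\<bar>lpker J t\<bar> \<le> M / 2 ^ J / (?\<rho> t)\<^sup>2"
      using zero_less_power[OF r, of 2] by (simp only: pos_le_divide_eq)
    then have "\<bar>lpker J t\<bar> \<le> (8 * 2 ^ J) powr (1 - \<mu> / 2) * (M / 2 ^ J / (?\<rho> t)\<^sup>2) powr (\<mu> / 2)"
      using r M sm by (intro min_interp[OF abs_ge_zero lpker_le]) auto
    also have "(8 * 2 ^ J) powr (1 - \<mu> / 2) = 8 powr (1 - \<mu> / 2) * 2 powr (real J * (1 - \<mu> / 2))"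
      by (simp add: powr_mult powr_powr flip: powr_realpow)
    also have "(M / 2 ^ J / (?\<rho> t)\<^sup>2) powr (\<mu> / 2) = M powr (\<mu> / 2) * (2 powr (- real J * (\<mu> / 2)) * ?\<rho> t powr (- \<mu>))"
    proof -
      have "M / 2 ^ J / (?\<rho> t)\<^sup>2 = M * (2 powr (- real J) * ?\<rho> t powr (- 2))"
        using r by (simp add: powr_minus powr_realpow powr_numeral divide_inverse)
      then show ?thesis by (simp add: powr_mult powr_powr)
    qed
    also have "8 powr (1 - \<mu> / 2) * 2 powr (real J * (1 - \<mu> / 2)) * (M powr (\<mu> / 2) * (2 powr (- real J * (\<mu> / 2)) * ?\<rho> t powr (- \<mu>)))
        = C1 * (2 powr (real J * (1 - \<mu> / 2)) * 2 powr (- real J * (\<mu> / 2))) * ?\<rho> t powr (- \<mu>)"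
      by (simp only: C1_def mult_ac)
    also have "2 powr (real J * (1 - \<mu> / 2)) * 2 powr (- real J * (\<mu> / 2)) = 2 powr (- real J * \<sigma>')"
      unfolding powr_add[symmetric] by (rule arg_cong[where f = "\<lambda>z. 2 powr z"]) (simp add: \<mu>_def field_simps)
    finally show ?thesis .
  qed
  define C2 where "C2 = C1 * (2 / (\<sigma> - \<sigma>'))"
  have C2: "0 < C2" using C1 sm by (simp add: C2_def)
  have hi: "pint (\<lambda>x. \<bar>blk (Suc j) G x\<bar>) \<le> C2 * 2 powr (- real (Suc j) * \<sigma>') * B"
    if G: "cper G" and B: "l1mod \<sigma> B G" for G B j
  proof -
    let ?E = "C1 * 2 powr (- real (Suc j) * \<sigma>') * B"
    let ?p = "\<lambda>t. pint (\<lambda>x. \<bar>G (t + x) - G x\<bar>)"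
    define K where "K = lpker (Suc j)"
    have cK: "cper K" unfolding K_def by (rule cper_lpker)
    have B0: "0 \<le> B" using B by (simp add: l1mod_def)
    have cD: "cper (\<lambda>t. G (t + x) - G x)" for x by (rule cper_diff[OF cper_shift[OF G] cper_const])
    have cD': "cper (\<lambda>x. G (t + x) - G x)" for t
      using cper_diff[OF cper_shift[OF G, of t] G] by (simp add: add.commute)
    have blk: "blk (Suc j) G x = pint (\<lambda>t. (G (t + x) - G x) * K t)" for x
    proof -
      have "pint (\<lambda>t. (G (t + x) - G x) * K t) = pint (\<lambda>t. G (t + x) * K t - G x * K t)"
        by (simp only: left_diff_distrib)
      also have "\<dots> = pint (\<lambda>t. G (t + x) * K t) - pint (\<lambda>t. G x * K t)"
        by (rule pint_diff[OF cper_mult[OF cper_shift[OF G] cK] cper_mult[OF cper_const cK]])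
      also have "pint (\<lambda>t. G x * K t) = 0" using lpker_pint[of j] by (simp add: K_def)
      finally show ?thesis by (simp add: blk_lpker[OF G] K_def)
    qed
    have cG: "continuous_on UNIV G" and cKc: "continuous_on UNIV K" using G cK by (auto simp: cper_def)
    have cont2: "continuous_on ({0..1} \<times> {0..1}) (\<lambda>(x, t). \<bar>G (t + x) - G x\<bar> * \<bar>K t\<bar>)"
      and cont2': "continuous_on ({0..1} \<times> {0..1}) (\<lambda>(t, x). \<bar>G (t + x) - G x\<bar> * \<bar>K t\<bar>)"
      unfolding case_prod_unfold
      by (intro continuous_intros continuous_on_compose2[OF cG] continuous_on_compose2[OF cKc]; auto)+
    have cI: "continuous_on {0..1} (\<lambda>x. pint (\<lambda>t. \<bar>G (t + x) - G x\<bar> * \<bar>K t\<bar>))"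
      by (rule continuous_on_integral2[OF cont2])
    have "pint (\<lambda>x. \<bar>blk (Suc j) G x\<bar>) \<le> pint (\<lambda>x. pint (\<lambda>t. \<bar>G (t + x) - G x\<bar> * \<bar>K t\<bar>))"
    proof (rule integral_le)
      show "(\<lambda>x. \<bar>blk (Suc j) G x\<bar>) integrable_on {0..1}" by (rule cper_integrable[OF cper_abs[OF cper_blk]])
      show "(\<lambda>x. pint (\<lambda>t. \<bar>G (t + x) - G x\<bar> * \<bar>K t\<bar>)) integrable_on {0..1}"
        by (rule integrable_continuous_real[OF cI])
      show "\<bar>blk (Suc j) G x\<bar> \<le> pint (\<lambda>t. \<bar>G (t + x) - G x\<bar> * \<bar>K t\<bar>)" for x
        unfolding blk using pint_abs_le[OF cper_mult[OF cD cK], of x] by (simp add: abs_mult)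
    qed
    also have "\<dots> = pint (\<lambda>t. pint (\<lambda>x. \<bar>G (t + x) - G x\<bar> * \<bar>K t\<bar>))"
      by (rule integral_swap2[OF cont2])
    also have "\<dots> = pint (\<lambda>t. ?p t * \<bar>K t\<bar>)" by simp
    also have "\<dots> \<le> ?E * (2 / (\<sigma> - \<sigma>'))"
    proof -
      let ?e = "\<sigma> - \<mu>"
      have e: "?e > -1" "?e < 0" using sm s by (auto simp: \<mu>_def)
      have i1: "((\<lambda>t. t powr ?e) has_integral (1 / (\<sigma> - \<sigma>'))) {0..1}"
        using has_integral_powr_from_0[OF e(1), of 1] by (simp add: \<mu>_def)
      have i2: "((\<lambda>t. (1 - t) powr ?e) has_integral (1 / (\<sigma> - \<sigma>'))) {0..1}"
        using has_integral_affinity[of "\<lambda>t. t powr ?e" "1 / (\<sigma> - \<sigma>')" 0 1 "-1" 1] i1 by simp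
      have i3: "((\<lambda>t. ?E * (t powr ?e + (1 - t) powr ?e)) has_integral
          (?E * (1 / (\<sigma> - \<sigma>') + 1 / (\<sigma> - \<sigma>')))) {0..1}"
        by (intro has_integral_mult_right has_integral_add i1 i2)
      have bd: "?p t * \<bar>K t\<bar> \<le> ?E * (t powr ?e + (1 - t) powr ?e)"
        if t: "t \<in> {0..1}" for t
      proof (cases "t = 0 \<or> t = 1")
        case True
        have "G (1 + x) - G x = 0" for x using cper_periodic[OF G, of x] by (simp add: add.commute)
        then have "?p t = 0" using True by auto
        then show ?thesis using C1 B0 by simp
      next
        case False
        then have t: "0 < t" "t < 1" using t by auto
        have "?p t \<le> B * ?\<rho> t powr \<sigma>"
        proof (cases "t \<le> 1 - t")
          case True
          then have "min t (1 - t) = t" by simp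
          moreover have "pint (\<lambda>x. \<bar>G (x + t) - G x\<bar>) \<le> B * t powr \<sigma>" using B t unfolding l1mod_def by simp
          ultimately show ?thesis by (simp only: add.commute[of t])
        next
          case False
          \<comment> \<open>By periodicity a step t beyond 1/2 is the backward step 1 - t.\<close>
          have "pint (\<lambda>x. \<bar>G (x + (1 - t)) - G x\<bar>) = pint (\<lambda>x. \<bar>G ((x + t) + (1 - t)) - G (x + t)\<bar>)"
            using pint_shift[OF cper_abs[OF cD'[of "1 - t"]], of t] by (simp add: algebra_simps)
          also have "\<dots> = ?p t"
            using cper_periodic[OF G] by (simp add: abs_minus_commute add.commute)
          finally have "pint (\<lambda>x. \<bar>G (x + (1 - t)) - G x\<bar>) = ?p t" .
          moreover have "pint (\<lambda>x. \<bar>G (x + (1 - t)) - G x\<bar>) \<le> B * (1 - t) powr \<sigma>"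
            using B t unfolding l1mod_def by (elim conjE allE[of _ "1 - t"]) simp
          moreover have "min t (1 - t) = 1 - t" using False by simp
          ultimately show ?thesis by (simp only:)
        qed
        then have "?p t * \<bar>K t\<bar>
            \<le> (B * ?\<rho> t powr \<sigma>) * (C1 * 2 powr (- real (Suc j) * \<sigma>') * ?\<rho> t powr (- \<mu>))"
          unfolding K_def by (intro mult_mono ker t) (use B0 in auto)
        also have "\<dots> = ?E * (?\<rho> t powr \<sigma> * ?\<rho> t powr (- \<mu>))"
          by (simp only: mult_ac)
        also have "?\<rho> t powr \<sigma> * ?\<rho> t powr (- \<mu>) = ?\<rho> t powr ?e" by (simp flip: powr_add)
        also have "?E * ?\<rho> t powr ?e \<le> ?E * (t powr ?e + (1 - t) powr ?e)"
          using C1 B0 by (intro mult_left_mono) (auto simp: min_def)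
        finally show ?thesis .
      qed
      have "continuous_on {0..1} (\<lambda>t. pint (\<lambda>x. \<bar>G (t + x) - G x\<bar> * \<bar>K t\<bar>))"
        by (rule continuous_on_integral2[OF cont2'])
      then have "(\<lambda>t. ?p t * \<bar>K t\<bar>) integrable_on {0..1}"
        by (intro integrable_continuous_real) simp
      from has_integral_le[OF integrable_integral[OF this] i3 bd] show ?thesis by simp
    qed
    also have "\<dots> = C2 * 2 powr (- real (Suc j) * \<sigma>') * B" by (simp only: C2_def mult_ac)
    finally show ?thesis .
  qed
  let ?N = "\<lambda>G. pint (\<lambda>x. \<bar>G x\<bar>)"
  \<comment> \<open>The lowest block sees the mean, which the modulus does not control; hence the L1
    norm in the final bound.\<close>
  have lo: "pint (\<lambda>x. \<bar>blk 0 G x\<bar>) \<le> 8 * ?N G" if G: "cper G" for G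
  proof -
    have "\<bar>blk 0 G x\<bar> \<le> 8 * ?N G" for x
    proof -
      have "\<bar>blk 0 G x\<bar> \<le> pint (\<lambda>t. \<bar>G (t + x) * lpker 0 t\<bar>)"
        unfolding blk_lpker[OF G] by (rule pint_abs_le[OF cper_mult[OF cper_shift[OF G] cper_lpker]])
      also have "\<dots> \<le> pint (\<lambda>t. 8 * \<bar>G (t + x)\<bar>)"
      proof (rule pint_mono[OF cper_abs[OF cper_mult[OF cper_shift[OF G] cper_lpker]] cper_mult[OF cper_const cper_abs[OF cper_shift[OF G]]]])
        fix t
        show "\<bar>G (t + x) * lpker 0 t\<bar> \<le> 8 * \<bar>G (t + x)\<bar>"
          using mult_left_mono[OF lpker_le[of 0 t], of "\<bar>G (t + x)\<bar>"] by (simp add: abs_mult mult.commute)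
      qed
      also have "\<dots> = 8 * ?N G" using pint_shift[OF cper_abs[OF G], of x] by simp
      finally show ?thesis .
    qed
    then have "pint (\<lambda>x. \<bar>blk 0 G x\<bar>) \<le> pint (\<lambda>x. 8 * ?N G)"
      by (intro pint_mono cper_abs cper_blk cper_const)
    then show ?thesis by simp
  qed
  define c where "c J = (8 + C2) * 2 powr (- \<sigma>0) * (2 powr (\<sigma>0 - \<sigma>')) ^ J" for J :: nat
  have c0: "0 \<le> c J" for J using C2 by (simp add: c_def)
  have q: "0 < 2 powr (\<sigma>0 - \<sigma>')" "2 powr (\<sigma>0 - \<sigma>') < 1" using sm by (auto simp: powr_less_one)
  have summ: "summable c" unfolding c_def using q by (intro summable_mult summable_geometric) simp
  have each: "ennreal (2 powr ((real J - 1) * \<sigma>0)) * L1_norm (blk J G) \<le> ennreal (c J * (B + ?N G))"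
    if G: "cper G" and B: "l1mod \<sigma> B G" for G B J
  proof -
    have B0: "0 \<le> B" using B by (simp add: l1mod_def)
    have p0: "0 \<le> ?N G" by (rule pint_nonneg[OF cper_abs[OF G]]) simp
    have pw: "2 powr ((real J - 1) * \<sigma>0) * 2 powr (- real J * \<sigma>') = 2 powr (- \<sigma>0) * (2 powr (\<sigma>0 - \<sigma>')) ^ J"
    proof -
      have "(2 powr (\<sigma>0 - \<sigma>')) ^ J = 2 powr ((\<sigma>0 - \<sigma>') * real J)"
        by (simp only: powr_powr[symmetric] powr_realpow powr_gt_zero)
      then show ?thesis by (simp only: powr_add[symmetric]) (simp add: algebra_simps)
    qed
    have "2 powr ((real J - 1) * \<sigma>0) * pint (\<lambda>x. \<bar>blk J G x\<bar>) \<le> c J * (B + ?N G)"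
    proof (cases J)
      case 0
      have "2 powr (- \<sigma>0) * pint (\<lambda>x. \<bar>blk 0 G x\<bar>) \<le> 2 powr (- \<sigma>0) * (8 * ?N G)"
        by (intro mult_left_mono lo[OF G]) simp
      also have "\<dots> \<le> 2 powr (- \<sigma>0) * ((8 + C2) * (B + ?N G))"
        using C2 B0 p0 by (intro mult_left_mono mult_mono) auto
      finally show ?thesis using 0 by (simp add: c_def mult_ac)
    next
      case (Suc j)
      have "2 powr ((real J - 1) * \<sigma>0) * pint (\<lambda>x. \<bar>blk J G x\<bar>) \<le> 2 powr ((real J - 1) * \<sigma>0) * (C2 * 2 powr (- real J * \<sigma>') * B)"
        unfolding Suc by (intro mult_left_mono hi[OF G B]) simp
      also have "\<dots> = C2 * (2 powr ((real J - 1) * \<sigma>0) * 2 powr (- real J * \<sigma>')) * B" by (simp only: mult_ac)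
      also have "\<dots> = (2 powr (- \<sigma>0) * (2 powr (\<sigma>0 - \<sigma>')) ^ J) * (C2 * B)" unfolding pw by (simp only: mult_ac)
      also have "\<dots> \<le> (2 powr (- \<sigma>0) * (2 powr (\<sigma>0 - \<sigma>')) ^ J) * ((8 + C2) * (B + ?N G))"
        using C2 B0 p0 by (intro mult_left_mono mult_mono) auto
      finally show ?thesis by (simp add: c_def mult_ac)
    qed
    then have "ennreal (2 powr ((real J - 1) * \<sigma>0) * pint (\<lambda>x. \<bar>blk J G x\<bar>)) \<le> ennreal (c J * (B + ?N G))"
      by (rule ennreal_leI)
    moreover have "L1_norm (blk J G) = ennreal (pint (\<lambda>x. \<bar>blk J G x\<bar>))"
      unfolding L1_norm_def by (rule pint_nn) (auto intro: cper_abs cper_blk)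
    ultimately show ?thesis by (simp add: ennreal_mult pint_nonneg[OF cper_abs[OF cper_blk]])
  qed
  have "B11_norm \<theta> \<phi> \<sigma>0 G \<le> ennreal ((suminf c + 1) * (B + ?N G))" if G: "cper G" and B: "l1mod \<sigma> B G" for G B
  proof -
    have B0: "0 \<le> B" using B by (simp add: l1mod_def)
    have p0: "0 \<le> ?N G" by (rule pint_nonneg[OF cper_abs[OF G]]) simp
    have "B11_norm \<theta> \<phi> \<sigma>0 G \<le> (\<Sum>J. ennreal (c J * (B + ?N G)))"
      unfolding B11_norm_def by (rule suminf_le[OF each[OF G B]]) auto
    also have "\<dots> = ennreal (\<Sum>J. c J * (B + ?N G))"
      using c0 B0 p0 summable_mult2[OF summ] by (intro suminf_ennreal2) auto
    also have "(\<Sum>J. c J * (B + ?N G)) = suminf c * (B + ?N G)"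
      by (rule suminf_mult2[symmetric, OF summ])
    also have "ennreal \<dots> \<le> ennreal ((suminf c + 1) * (B + ?N G))"
      using B0 p0 by (intro ennreal_leI mult_right_mono) auto
    finally show ?thesis .
  qed
  moreover have "0 < suminf c + 1" using suminf_nonneg[OF summ c0] by simp
  ultimately show ?thesis by blast
qed

end

subsection \<open>Interpolation at a fixed time\<close>

lemma powr_absorb:
  fixes \<theta> \<epsilon> :: real
  assumes "0 \<le> \<theta>" "\<theta> < 1" "0 < \<epsilon>"
  shows "\<exists>C\<ge>0. \<forall>w\<ge>0. w powr \<theta> \<le> \<epsilon> * w + C"
proof -
  \<comment> \<open>The threshold at which w^\<theta> and \<epsilon> w cross.\<close>
  define W where "W = \<epsilon> powr (- 1 / (1 - \<theta>))"
  have W: "0 < W" using assms by (simp add: W_def)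
  have "w powr \<theta> \<le> \<epsilon> * w + W powr \<theta>" if w: "0 \<le> w" for w
  proof (cases "w \<ge> W")
    case True
    then have w0: "0 < w" using W by simp
    have "w powr \<theta> = w * w powr (\<theta> - 1)" using w0 by (simp add: powr_mult_base)
    also have "\<dots> \<le> w * W powr (\<theta> - 1)"
      using True W assms w by (intro mult_left_mono powr_mono2') auto
    also have "W powr (\<theta> - 1) = \<epsilon>"
    proof -
      have "- 1 / (1 - \<theta>) * (\<theta> - 1) = 1" using assms by (simp add: field_simps)
      then show ?thesis using assms by (simp add: W_def powr_powr)
    qed
    finally show ?thesis using W by (simp add: mult.commute add_increasing2)
  next
    case False
    then have "w powr \<theta> \<le> W powr \<theta>" using w assms by (intro powr_mono2) auto
    then show ?thesis using assms w by (simp add: add_increasing)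
  qed
  then show ?thesis by (intro exI[of _ "W powr \<theta>"]) simp
qed

text \<open>Each factor is at most a power of the total w of the three terms on the right, so the
  product is at most w^\<theta> with \<theta> < 1, and such a power is absorbed with an arbitrarily
  small factor.\<close>

lemma young3:
  fixes a1 a2 a3 p1 p2 p3 \<epsilon> :: real
  assumes p: "0 < p1" "0 < p2" "0 < p3" and a: "0 \<le> a1" "0 \<le> a2" "0 \<le> a3"
    and th: "a1 / p1 + a2 / p2 + a3 / p3 < 1" and e: "0 < \<epsilon>"
  shows "\<exists>C\<ge>0. \<forall>x\<ge>0. \<forall>y\<ge>0. \<forall>z\<ge>0.
     x powr a1 * y powr a2 * z powr a3 \<le> \<epsilon> * (x powr p1 + y powr p2 + z powr p3) + C"
proof -
  define \<theta> where "\<theta> = a1 / p1 + a2 / p2 + a3 / p3"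
  have "0 \<le> \<theta>" using a p by (simp add: \<theta>_def)
  then obtain C where C: "0 \<le> C" "\<And>w. 0 \<le> w \<Longrightarrow> w powr \<theta> \<le> \<epsilon> * w + C"
    using powr_absorb[of \<theta> \<epsilon>] th e by (auto simp: \<theta>_def)
  have "x powr a1 * y powr a2 * z powr a3 \<le> \<epsilon> * (x powr p1 + y powr p2 + z powr p3) + C"
    if xyz: "0 \<le> x" "0 \<le> y" "0 \<le> z" for x y z
  proof -
    define w where "w = x powr p1 + y powr p2 + z powr p3"
    have w0: "0 \<le> w" by (simp add: w_def)
    have le: "v powr b \<le> w powr (b / p)" if "0 \<le> v" "v powr p \<le> w" "0 < p" "0 \<le> b" for v b p
    proof -
      have "v powr b = (v powr p) powr (b / p)" using that by (simp add: powr_powr)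
      also have "\<dots> \<le> w powr (b / p)" using that by (intro powr_mono2) auto
      finally show ?thesis .
    qed
    have "x powr a1 * y powr a2 * z powr a3 \<le> w powr (a1 / p1) * w powr (a2 / p2) * w powr (a3 / p3)"
      using p a xyz by (intro mult_mono le) (auto simp: w_def)
    also have "\<dots> = w powr \<theta>" by (simp add: \<theta>_def powr_add)
    also have "\<dots> \<le> \<epsilon> * w + C" by (rule C(2)[OF w0])
    finally show ?thesis by (simp add: w_def)
  qed
  then show ?thesis using C(1) by blast
qed

lemma pint_cauchy_schwarz:
  assumes u: "cper u" shows "pint (\<lambda>x. \<bar>u x\<bar>) \<le> sqrt (pint (\<lambda>x. (u x)\<^sup>2))"
proof -
  define I where "I = pint (\<lambda>x. \<bar>u x\<bar>)"
  have "0 \<le> pint (\<lambda>x. (\<bar>u x\<bar> - I)\<^sup>2)"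
    by (rule pint_nonneg[OF cper_power[OF cper_diff[OF cper_abs[OF u] cper_const]]]) simp
  also have "\<dots> = pint (\<lambda>x. ((u x)\<^sup>2 - 2 * I * \<bar>u x\<bar>) + I\<^sup>2)"
    by (simp add: power2_diff algebra_simps)
  also have "\<dots> = pint (\<lambda>x. (u x)\<^sup>2) - 2 * I * I + I\<^sup>2"
    using pint_add[OF cper_diff[OF cper_power[OF u, of 2] cper_mult[OF cper_const cper_abs[OF u], of "2 * I"]] cper_const, of "I\<^sup>2"]
      pint_diff[OF cper_power[OF u, of 2] cper_mult[OF cper_const cper_abs[OF u], of "2 * I"]]
    by (simp add: I_def)
  finally have "I\<^sup>2 \<le> pint (\<lambda>x. (u x)\<^sup>2)" by (simp add: power2_eq_square)
  then show ?thesis unfolding I_def by (rule real_le_rsqrt)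
qed

text \<open>Pointwise domination of increments is domination of their L2 norms for every step, and
  \<open>symbol_comparison\<close> passes from steps to the fractional seminorm.\<close>

lemma hom2_contraction:
  assumes g: "0 < g" "g \<le> 2" and u: "cper u" "fin_hom g u" and v: "cper v" "fin_hom g v"
    and le: "\<And>x y. \<bar>u x - u y\<bar> \<le> \<bar>v x - v y\<bar>"
  shows "hom2 g u \<le> hom2 g v"
proof -
  let ?c = "\<lambda>k. (cmod (fc v k))\<^sup>2 - (cmod (fc u k))\<^sup>2"
  have hs: "((\<lambda>k. lam k powr g * ?c k) has_sum (hom2 g v - hom2 g u)) UNIV"
    using has_sum_diff[OF fin_hom_has_sum[OF v(2)] fin_hom_has_sum[OF u(2)]] by (simp add: right_diff_distrib)
  have "0 \<le> (\<Sum>\<^sub>\<infinity>k. lam k powr g * ?c k)"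
  proof (rule symbol_comparison[OF g has_sum_imp_summable[OF hs]])
    fix h :: real
    show "((\<lambda>k. fsym h k * ?c k) has_sum (pint (\<lambda>x. (v (x + h) - v x)\<^sup>2) - pint (\<lambda>x. (u (x + h) - u x)\<^sup>2))) UNIV"
      using has_sum_diff[OF pint_delta_sq[OF v(1)] pint_delta_sq[OF u(1)]] by (simp add: right_diff_distrib)
    have "pint (\<lambda>x. (u (x + h) - u x)\<^sup>2) \<le> pint (\<lambda>x. (v (x + h) - v x)\<^sup>2)"
      by (intro pint_mono cper_power cper_diff[OF cper_shift[OF u(1)] u(1)] cper_diff[OF cper_shift[OF v(1)] v(1)])
         (use le in \<open>simp only: abs_le_square_iff\<close>)
    then show "0 \<le> pint (\<lambda>x. (v (x + h) - v x)\<^sup>2) - pint (\<lambda>x. (u (x + h) - u x)\<^sup>2)" by simp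
  qed
  then show ?thesis by (simp add: infsumI[OF hs])
qed

lemma fsym_le4: "fsym h k \<le> 4"
  unfolding fsym_cos using cos_ge_minus_one[of "lam k * h"] by linarith

lemma hom2_delta:
  assumes "cper u" "fin_hom g u"
  shows "fin_hom g (\<lambda>x. u (x + h) - u x)" "hom2 g (\<lambda>x. u (x + h) - u x) \<le> 4 * hom2 g u"
proof -
  have eq: "(cmod (fc (\<lambda>x. u (x + h) - u x) k))\<^sup>2 = fsym h k * (cmod (fc u k))\<^sup>2" for k
    by (simp add: fc_delta[OF assms(1)] norm_mult fsym_def power_mult_distrib)
  have s: "(\<lambda>k. 4 * (lam k powr g * (cmod (fc u k))\<^sup>2)) summable_on UNIV"
    using assms(2) by (intro summable_on_cmult_right) (simp add: fin_hom_def)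
  have le: "lam k powr g * (fsym h k * (cmod (fc u k))\<^sup>2) \<le> 4 * (lam k powr g * (cmod (fc u k))\<^sup>2)" for k
    using mult_right_mono[OF fsym_le4[of h k], of "lam k powr g * (cmod (fc u k))\<^sup>2"] by (simp add: mult_ac)
  have s': "(\<lambda>k. lam k powr g * (fsym h k * (cmod (fc u k))\<^sup>2)) summable_on UNIV"
    by (rule summable_dom[OF s]) (use le fsym_nonneg in auto)
  then show "fin_hom g (\<lambda>x. u (x + h) - u x)" by (simp add: fin_hom_def eq)
  have "infsum (\<lambda>k. lam k powr g * (fsym h k * (cmod (fc u k))\<^sup>2)) UNIV \<le> infsum (\<lambda>k. 4 * (lam k powr g * (cmod (fc u k))\<^sup>2)) UNIV"
    by (rule infsum_mono[OF s' s le])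
  then show "hom2 g (\<lambda>x. u (x + h) - u x) \<le> 4 * hom2 g u"
    by (simp add: hom2_def eq infsum_cmult_right')
qed

lemma c1per_fin_hom: "c1per u u' \<Longrightarrow> g \<le> 2 \<Longrightarrow> fin_hom g u"
  using c1per_hom2(1) fin_hom_mono by blast

lemma lipschitz_fin_hom':
  assumes "cper u" "\<And>x y. \<bar>u x - u y\<bar> \<le> L * \<bar>x - y\<bar>" "g \<le> 2"
  shows "fin_hom g u"
proof -
  have "fin_hom 2 u"
  proof (rule lipschitz_fin_hom(1)[OF assms(1), of L])
    show "\<bar>u (x + h) - u x\<bar> \<le> L * h" if "0 \<le> h" for x h using assms(2)[of "x + h" x] that by simp
  qed
  then show ?thesis using fin_hom_mono assms(3) by blast
qed

text \<open>\<alpha> is the Hoelder exponent available for the coefficients and \<kappa> the power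
  of the increments that is given up; \<open>sub\<close> says that the order left over still allows
  sewing.\<close>

locale expo =
  fixes \<gamma> \<alpha> \<kappa> :: real
  assumes \<gamma>: "1 < \<gamma>" "\<gamma> \<le> 2" and \<alpha>: "0 < \<alpha>" "\<alpha> < 1" and \<kappa>: "0 < \<kappa>" "\<kappa> < 1"
    and sub: "1 < \<alpha> + (1 - \<kappa>) * \<gamma> / 2"
begin

definition "\<sigma> = (1 - \<kappa>) * \<gamma> / 2"
definition "s1 = 1 / (3 * (1 + \<kappa>))"
text \<open>q = (4 + 3 \<kappa>) / (1 + \<kappa>) lies strictly between (4 + 2 \<kappa>) / (1 +
  \<kappa>), where the cubic terms are critical, and 4, where s1 would be 1/3. The relation q = 3 +
  3 s1 is the scaling of \<open>gn_integrated\<close>, which bounds L^q by L1 and the cubic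
  increments of order s1.\<close>

definition "q = 3 + 3 * s1"

definition Nq :: "(real \<Rightarrow> real) \<Rightarrow> real" where "Nq m = pint (\<lambda>x. \<bar>m x\<bar> powr q)"
definition L2 :: "(real \<Rightarrow> real) \<Rightarrow> real" where "L2 m = pint (\<lambda>x. (m x)\<^sup>2)"

lemma sigma: "0 < \<sigma>" "\<sigma> < 1" "1 < \<alpha> + \<sigma>"
proof -
  have "(1 - \<kappa>) * \<gamma> < 1 * 2" using \<gamma> \<kappa> by (intro mult_less_le_imp_less) auto
  then show "\<sigma> < 1" by (simp add: \<sigma>_def)
qed (use \<gamma> \<kappa> sub in \<open>auto simp: \<sigma>_def\<close>)

lemma s1: "0 < s1" "s1 < 1/3" using \<kappa> by (auto simp: s1_def field_simps)

lemma q_eq: "q = (4 + 3 * \<kappa>) / (1 + \<kappa>)" using \<kappa> by (simp add: q_def s1_def field_simps)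

lemma q_gt: "3 < q" "q < 4" using s1 by (auto simp: q_def)

lemma cper_powr: "cper (u :: real \<Rightarrow> real) \<Longrightarrow> 0 < p \<Longrightarrow> cper (\<lambda>x. \<bar>u x\<bar> powr p)"
proof -
  assume u: "cper u" and p: "0 < p"
  have "continuous_on UNIV (\<lambda>z::real. \<bar>z\<bar> powr p)"
    by (rule continuous_on_powr') (use p in \<open>auto intro: continuous_intros\<close>)
  then show ?thesis by (rule cper_compose[OF u])
qed

lemma Nq_nonneg: "cper m \<Longrightarrow> 0 \<le> Nq m"
  unfolding Nq_def using q_gt by (intro pint_nonneg cper_powr) auto

lemma L2_nonneg: "cper m \<Longrightarrow> 0 \<le> L2 m"
  unfolding L2_def by (intro pint_nonneg cper_power) auto

definition "osc r h m y = \<bar>m (y + r) - m y\<bar> + \<bar>m (y + h + r) - m (y + h)\<bar>" for m :: "real \<Rightarrow> real"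
definition "amp r h m y = \<bar>m y\<bar> + \<bar>m (y + r)\<bar> + \<bar>m (y + h)\<bar> + \<bar>m (y + h + r)\<bar>" for m :: "real \<Rightarrow> real"
text \<open>Small multiples of dissipation, energy and L^q norm, plus a constant. The energy carries
  Q^2 because it stems from terms linear in Q and quadratic in m.\<close>

definition "mod_bd \<epsilon> C Q m = \<epsilon> * hom2 \<gamma> m + \<epsilon> * (Q\<^sup>2 * L2 m) + \<epsilon> * Nq m + C"

text \<open>All increments that occur in the energy and in the third-order balance are dominated by
  \<open>osc * amp * (amp + Q)\<close>; as \<open>osc \<le> amp\<close>, a power \<open>\<kappa>\<close> of \<open>osc\<close> can be traded for
  integrability, which makes the remaining product subcritical.\<close>
definition "moduli \<epsilon> C \<longleftrightarrow> 0 < \<epsilon> \<and> 0 \<le> C \<and>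
  (\<forall>m r h Q W. cper m \<longrightarrow> fin_hom \<gamma> m \<longrightarrow> 0 < r \<longrightarrow> r \<le> 1 \<longrightarrow> 0 \<le> Q \<longrightarrow> cper W \<longrightarrow>
     (\<forall>y. W y \<le> osc r h m y * (amp r h m y * (amp r h m y + Q))) \<longrightarrow> pint W \<le> r powr \<sigma> * mod_bd \<epsilon> C Q m)"

lemma moduli_exists:
  assumes e: "0 < \<epsilon>" shows "\<exists>C. moduli \<epsilon> C"
proof -
  \<comment> \<open>The summands are the constants with which dissipation, energy and L^q norm are
    collected at the end.\<close>
  define D where "D = 32 + 64 + 8 * 4 powr q"
  define e' where "e' = \<epsilon> / D"
  have D: "0 < D" by (simp add: D_def add_pos_nonneg)
  have e': "0 < e'" using e D by (simp add: e'_def)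
  have q0: "0 < q" using q_gt by simp
  \<comment> \<open>Here and in \<open>ex2\<close> the exponents of Young's inequality must add up
    to less than 1: the first condition says q > (4 + 2 \<kappa>) / (1 + \<kappa>), the second q >
    2.\<close>
  have ex1: "(1 - \<kappa>) / 2 + 0 / 1 + (2 + \<kappa>) / q < 1"
    unfolding q_eq using \<kappa> by (simp add: field_simps add_pos_pos)
  have ex2: "(1 - \<kappa>) / 2 + 1 / 2 + \<kappa> / q < 1"
    unfolding q_eq using \<kappa> by (simp add: field_simps add_pos_pos)
  obtain C1 where C1: "0 \<le> C1" "\<And>x y z. 0 \<le> x \<Longrightarrow> 0 \<le> y \<Longrightarrow> 0 \<le> z \<Longrightarrow>
     x powr (1 - \<kappa>) * y powr 0 * z powr (2 + \<kappa>) \<le> e' * (x powr 2 + y powr 1 + z powr q) + C1"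
    using young3[OF _ _ q0 _ _ _ ex1 e'] \<kappa> by auto
  obtain C2 where C2: "0 \<le> C2" "\<And>x y z. 0 \<le> x \<Longrightarrow> 0 \<le> y \<Longrightarrow> 0 \<le> z \<Longrightarrow>
     x powr (1 - \<kappa>) * y powr 1 * z powr \<kappa> \<le> e' * (x powr 2 + y powr 2 + z powr q) + C2"
    using young3[OF _ _ q0 _ _ _ ex2 e'] \<kappa> by auto
  have main: "pint W \<le> r powr \<sigma> * mod_bd \<epsilon> (C1 + C2 + e') Q m"
    if m: "cper m" "fin_hom \<gamma> m" and r: "0 < r" "r \<le> 1" and Q: "0 \<le> Q" and W: "cper W"
      and le: "\<And>y. W y \<le> osc r h m y * (amp r h m y * (amp r h m y + Q))" for m r h Q W
  proof -
    \<comment> \<open>\<open>?U\<close> is the oscillation normalised so that its square has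
      integral at most 16 times \<open>hom2 \<gamma> m\<close>, uniformly in r.\<close>
    let ?d = "osc r h m" and ?P = "amp r h m" and ?d1 = "\<lambda>y. m (y + r) - m y"
    let ?U = "\<lambda>y. r powr (- \<gamma> / 2) * ?d y"
    have cd: "cper ?d1" by (rule cper_diff[OF cper_shift[OF m(1)] m(1)])
    have cU: "cper (\<lambda>y. (?U y)\<^sup>2)" unfolding osc_def
      by (rule cper_power[OF cper_mult[OF cper_const cper_add[OF cper_abs[OF cd] cper_shift[OF cper_abs[OF cd]]]]])
    have cP: "cper ?P" unfolding amp_def[abs_def]
      by (intro cper_add cper_abs m(1) cper_shift[OF m(1)] cper_shift[OF cper_shift[OF m(1), of r], of h])
    have P0: "0 \<le> ?P y" "0 \<le> ?d y" "?d y \<le> ?P y" for y by (auto simp: amp_def osc_def)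
    have cPp: "cper (\<lambda>y. ?P y powr p)" if "0 < p" for p
      using cper_powr[OF cP that] P0 by simp
    have U2: "pint (\<lambda>y. (?U y)\<^sup>2) \<le> 16 * hom2 \<gamma> m"
    proof -
      have rr: "(r powr (- \<gamma> / 2))\<^sup>2 = r powr (- \<gamma>)" by (simp add: power2_eq_square flip: powr_add)
      note c2 = cper_power[OF cd, of 2]
      have "pint (\<lambda>y. (?U y)\<^sup>2) \<le> pint (\<lambda>y. r powr (- \<gamma>) * (2 * ((?d1 y)\<^sup>2 + (?d1 (y + h))\<^sup>2)))"
      proof (rule pint_mono[OF cU cper_mult[OF cper_const cper_mult[OF cper_const cper_add[OF c2 cper_shift[OF c2]]]]])
        fix y
        have "(\<bar>u\<bar> + \<bar>v\<bar>)\<^sup>2 \<le> 2 * (u\<^sup>2 + v\<^sup>2)" for u v :: real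
          using sum_squares_bound[of "\<bar>u\<bar>" "\<bar>v\<bar>"] by (simp add: power2_sum)
        then show "(?U y)\<^sup>2 \<le> r powr (- \<gamma>) * (2 * ((?d1 y)\<^sup>2 + (?d1 (y + h))\<^sup>2))"
          unfolding power_mult_distrib rr osc_def by (intro mult_left_mono) (simp_all add: add_ac)
      qed
      also have "\<dots> = r powr (- \<gamma>) * (4 * pint (\<lambda>y. (?d1 y)\<^sup>2))"
        unfolding pint_cmult pint_add[OF c2 cper_shift[OF c2]] pint_shift[OF c2] by simp
      also have "\<dots> \<le> r powr (- \<gamma>) * (4 * (4 * r powr \<gamma> * hom2 \<gamma> m))"
        using r \<gamma> by (intro mult_left_mono delta_sq_le m) auto
      also have "\<dots> = 16 * (r powr (- \<gamma>) * r powr \<gamma>) * hom2 \<gamma> m" by simp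
      also have "r powr (- \<gamma>) * r powr \<gamma> = 1" using r by (simp flip: powr_add)
      finally show ?thesis by simp
    qed
    have gen: "pint (\<lambda>y. ?P y powr p) \<le> 4 powr p * (4 * pint (\<lambda>y. \<bar>m y\<bar> powr p))" if p: "0 < p" for p
    proof -
      have cs: "cper (\<lambda>y. \<bar>m y\<bar> powr p)" by (rule cper_powr[OF m(1) p])
      let ?S = "\<lambda>y. \<bar>m y\<bar> powr p + \<bar>m (y + r)\<bar> powr p + \<bar>m (y + h)\<bar> powr p + \<bar>m (y + (h + r))\<bar> powr p"
      note cS = cs cper_shift[OF cs] cper_add[OF cs cper_shift[OF cs]] cper_add[OF cper_add[OF cs cper_shift[OF cs]] cper_shift[OF cs]]
      have "pint (\<lambda>y. ?P y powr p) \<le> pint (\<lambda>y. 4 powr p * ?S y)"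
      proof (rule pint_mono[OF cPp[OF p] cper_mult[OF cper_const cper_add[OF cS(4) cS(2)]]])
        fix y
        have "\<exists>z\<in>{m y, m (y + r), m (y + h), m (y + (h + r))}. ?P y \<le> 4 * \<bar>z\<bar>"
          unfolding amp_def by (simp add: add.assoc) linarith
        then obtain z where z: "z \<in> {m y, m (y + r), m (y + h), m (y + (h + r))}" "?P y \<le> 4 * \<bar>z\<bar>" by blast
        have "?P y powr p \<le> (4 * \<bar>z\<bar>) powr p" using z P0 p by (intro powr_mono2) auto
        also have "\<dots> = 4 powr p * \<bar>z\<bar> powr p" by (rule powr_mult)
        also have "\<dots> \<le> 4 powr p * ?S y" using z(1) by (intro mult_left_mono) auto
        finally show "?P y powr p \<le> 4 powr p * ?S y" .
      qed
      also have "\<dots> = 4 powr p * (4 * pint (\<lambda>y. \<bar>m y\<bar> powr p))"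
        unfolding pint_cmult pint_add[OF cS(4) cS(2)] pint_add[OF cS(3) cS(2)] pint_add[OF cS(1,2)] pint_shift[OF cs] by simp
      finally show ?thesis .
    qed
    have P2: "pint (\<lambda>y. ?P y powr 2) \<le> 64 * L2 m" and Pq: "pint (\<lambda>y. ?P y powr q) \<le> 4 * 4 powr q * Nq m"
      using gen[of 2] gen[OF q0] by (simp_all add: L2_def Nq_def powr_numeral)
    have pw: "W y \<le> r powr \<sigma> * (e' * (2 * (?U y)\<^sup>2 + Q\<^sup>2 * ?P y powr 2 + 2 * ?P y powr q) + (C1 + C2 + e'))" for y
    proof -
      \<comment> \<open>A power \<kappa> of the oscillation is traded for amplitude; what is left of
        it carries the factor r^\<sigma>.\<close>
      have dU: "?d y \<le> r powr \<sigma> * (?U y powr (1 - \<kappa>) * ?P y powr \<kappa>)"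
      proof (cases "?d y = 0")
        case False
        have "?d y = ?d y powr (1 - \<kappa>) * ?d y powr \<kappa>" using False P0 by (simp flip: powr_add)
        also have "\<dots> \<le> ?d y powr (1 - \<kappa>) * ?P y powr \<kappa>" using P0 \<kappa> by (intro mult_left_mono powr_mono2) auto
        also have "?d y powr (1 - \<kappa>) = r powr \<sigma> * ?U y powr (1 - \<kappa>)"
        proof -
          have "?U y powr (1 - \<kappa>) = r powr (- \<sigma>) * ?d y powr (1 - \<kappa>)"
            by (simp add: powr_mult powr_powr \<sigma>_def algebra_simps)
          moreover have "r powr \<sigma> * r powr (- \<sigma>) = 1" using r by (simp flip: powr_add)
          ultimately show ?thesis by (simp flip: mult.assoc)
        qed
        finally show ?thesis by (simp only: mult.assoc)
      qed (use P0 in simp)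
      have "W y \<le> ?d y * (?P y * (?P y + Q))" by (rule le)
      also have "\<dots> \<le> r powr \<sigma> * (?U y powr (1 - \<kappa>) * ?P y powr \<kappa>) * (?P y * (?P y + Q))"
        using P0 Q by (intro mult_right_mono dU) auto
      also have "\<dots> = r powr \<sigma> * (?U y powr (1 - \<kappa>) * 1 powr 0 * ?P y powr (2 + \<kappa>) + ?U y powr (1 - \<kappa>) * (Q * ?P y) powr 1 * ?P y powr \<kappa>)"
        using P0 Q by (simp add: powr_add powr_numeral power2_eq_square algebra_simps)
      also have "\<dots> \<le> r powr \<sigma> * ((e' * (?U y powr 2 + 1 powr 1 + ?P y powr q) + C1) + (e' * (?U y powr 2 + (Q * ?P y) powr 2 + ?P y powr q) + C2))"
        using P0 Q by (intro mult_left_mono add_mono C1 C2) auto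
      also have "\<dots> = r powr \<sigma> * (e' * (2 * (?U y)\<^sup>2 + Q\<^sup>2 * ?P y powr 2 + 2 * ?P y powr q) + (C1 + C2 + e'))"
        using P0 Q by (simp add: powr_numeral power_mult_distrib algebra_simps)
      finally show ?thesis .
    qed
    note cc = cper_mult[OF cper_const[of 2] cU] cper_mult[OF cper_const[of "Q\<^sup>2"] cPp[of 2]] cper_mult[OF cper_const[of 2] cPp[OF q0]]
    have "pint W \<le> r powr \<sigma> * (e' * (2 * pint (\<lambda>y. (?U y)\<^sup>2) + Q\<^sup>2 * pint (\<lambda>y. ?P y powr 2) + 2 * pint (\<lambda>y. ?P y powr q)) + (C1 + C2 + e'))"
      using pint_mono[OF W _ pw] cc
      by (simp add: pint_cmult pint_add cper_add cper_mult)
    also have "\<dots> \<le> r powr \<sigma> * (e' * (D * hom2 \<gamma> m + Q\<^sup>2 * (D * L2 m) + D * Nq m) + (C1 + C2 + e'))"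
    proof (intro mult_left_mono add_mono order_refl)
      have "32 * hom2 \<gamma> m \<le> D * hom2 \<gamma> m" "64 * L2 m \<le> D * L2 m" "8 * 4 powr q * Nq m \<le> D * Nq m"
        using L2_nonneg Nq_nonneg m by (intro mult_right_mono; simp add: D_def hom2_nonneg)+
      then show "2 * pint (\<lambda>y. (?U y)\<^sup>2) \<le> D * hom2 \<gamma> m" "pint (\<lambda>y. ?P y powr 2) \<le> D * L2 m" "2 * pint (\<lambda>y. ?P y powr q) \<le> D * Nq m"
        using U2 P2 Pq by linarith+
    qed (use e' in auto)
    also have "\<dots> = r powr \<sigma> * mod_bd \<epsilon> (C1 + C2 + e') Q m"
      using D by (simp add: e'_def mod_bd_def algebra_simps)
    finally show ?thesis .
  qed
  show ?thesis unfolding moduli_def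
    by (intro exI[of _ "C1 + C2 + e'"] conjI allI impI main) (use e C1(1) C2(1) e' in auto)
qed

context
  fixes \<epsilon> C :: real and m :: "real \<Rightarrow> real"
  assumes M: "moduli \<epsilon> C" and m: "cper m" "fin_hom \<gamma> m"
begin

lemma mod_bd_nonneg: "0 \<le> mod_bd \<epsilon> C P m"
  using M by (simp add: moduli_def mod_bd_def hom2_nonneg Nq_nonneg L2_nonneg m)

lemma moduli_pint:
  "\<lbrakk>0 < r; r \<le> 1; 0 \<le> P; cper W; \<And>y. W y \<le> osc r h m y * (amp r h m y * (amp r h m y + P))\<rbrakk>
    \<Longrightarrow> pint W \<le> r powr \<sigma> * mod_bd \<epsilon> C P m"
  using M m unfolding moduli_def by blast

lemma moduli_l1mod:
  assumes "cper G" "0 \<le> P" "\<And>r y. \<bar>G (y + r) - G y\<bar> \<le> osc r h m y * (amp r h m y * (amp r h m y + P))"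
  shows "l1mod \<sigma> (mod_bd \<epsilon> C P m) G"
  unfolding l1mod_def
proof (intro conjI allI impI mod_bd_nonneg)
  fix r :: real assume "0 < r \<and> r \<le> 1"
  then show "pint (\<lambda>y. \<bar>G (y + r) - G y\<bar>) \<le> mod_bd \<epsilon> C P m * r powr \<sigma>"
    using moduli_pint[OF _ _ assms(2) cper_abs[OF cper_diff[OF cper_shift[OF assms(1)] assms(1)]] assms(3)]
    by (simp add: mult.commute)
qed

lemma cube_le: "\<bar>a ^ 3 - b ^ 3\<bar> \<le> \<bar>a - b\<bar> * (\<bar>a\<bar> + \<bar>b\<bar>)\<^sup>2" for a b :: real
proof -
  have "a ^ 3 - b ^ 3 = (a - b) * (a\<^sup>2 + a * b + b\<^sup>2)" by algebra
  then have "\<bar>a ^ 3 - b ^ 3\<bar> = \<bar>a - b\<bar> * \<bar>a\<^sup>2 + a * b + b\<^sup>2\<bar>" by (simp only: abs_mult)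
  moreover have "\<bar>a\<^sup>2 + a * b + b\<^sup>2\<bar> \<le> \<bar>a\<bar>\<^sup>2 + \<bar>a\<bar> * \<bar>b\<bar> + \<bar>b\<bar>\<^sup>2"
    by (intro order_trans[OF abs_triangle_ineq] add_mono) (auto simp: abs_mult)
  then have "\<bar>a\<^sup>2 + a * b + b\<^sup>2\<bar> \<le> (\<bar>a\<bar> + \<bar>b\<bar>)\<^sup>2" 
    unfolding power2_sum using mult_nonneg_nonneg[OF abs_ge_zero[of a] abs_ge_zero[of b]] by linarith
  ultimately show ?thesis by (simp add: mult_left_mono)
qed

lemma cube_inc: "\<bar>m (y + r) ^ 3 - m y ^ 3\<bar> + \<bar>m (y + h + r) ^ 3 - m (y + h) ^ 3\<bar> \<le> osc r h m y * (amp r h m y * (amp r h m y + 0))"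
proof -
  have "\<bar>m (y + r) ^ 3 - m y ^ 3\<bar> \<le> \<bar>m (y + r) - m y\<bar> * (amp r h m y)\<^sup>2"
    and "\<bar>m (y + h + r) ^ 3 - m (y + h) ^ 3\<bar> \<le> \<bar>m (y + h + r) - m (y + h)\<bar> * (amp r h m y)\<^sup>2"
    by (rule order_trans[OF cube_le], intro mult_left_mono power_mono, auto simp: amp_def)+
  then show ?thesis by (simp add: osc_def power2_eq_square distrib_right)
qed

lemma modulus_cube: "l1mod \<sigma> (mod_bd \<epsilon> C 0 m) (\<lambda>y. m y ^ 3)"
proof (rule moduli_l1mod[where P = 0 and h = 0, OF cper_power[OF m(1)]])
  show "\<bar>m (y + r) ^ 3 - m y ^ 3\<bar> \<le> osc r 0 m y * (amp r 0 m y * (amp r 0 m y + 0))" for r y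
    by (rule order_trans[OF _ cube_inc]) simp
qed simp

text \<open>This density is what \<open>burgers_algebra\<close> leaves against increments of a'; its
  absolute value is harmless by the reverse triangle inequality.\<close>

lemma modulus_abs_cube: "l1mod \<sigma> (mod_bd \<epsilon> C 0 m) (\<lambda>y. \<bar>m (y + h) ^ 3 - m y ^ 3\<bar> / 3)"
proof (rule moduli_l1mod[where P = 0 and h = h])
  show "cper (\<lambda>y. \<bar>m (y + h) ^ 3 - m y ^ 3\<bar> / 3)"
    using cper_mult[OF cper_const[of "1 / 3"] cper_abs[OF cper_diff[OF cper_power[OF cper_shift[OF m(1)]] cper_power[OF m(1)]]]] by simp
  show "\<bar>\<bar>m (y + r + h) ^ 3 - m (y + r) ^ 3\<bar> / 3 - \<bar>m (y + h) ^ 3 - m y ^ 3\<bar> / 3\<bar> \<le> osc r h m y * (amp r h m y * (amp r h m y + 0))" for r y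
  proof (rule order_trans[OF _ cube_inc])
    have "\<bar>\<bar>A - A'\<bar> / 3 - \<bar>B - B'\<bar> / 3\<bar> \<le> \<bar>A' - B'\<bar> + \<bar>A - B\<bar>" for A B A' B' :: real
    proof -
      have "(A - B) - (A' - B') = (A - A') - (B - B')" by simp
      then have le: "\<bar>\<bar>A - A'\<bar> - \<bar>B - B'\<bar>\<bar> \<le> \<bar>A' - B'\<bar> + \<bar>A - B\<bar>"
        using abs_triangle_ineq3[of "A - A'" "B - B'"] abs_triangle_ineq4[of "A - B" "A' - B'"] by (simp only:)
      have "x / 3 \<le> u + v" if "x \<le> u + v" "0 \<le> u" "0 \<le> v" for x u v :: real using that by simp
      from this[OF le] show ?thesis unfolding diff_divide_distrib[symmetric] abs_divide by simp
    qed
    then show "\<bar>\<bar>m (y + r + h) ^ 3 - m (y + r) ^ 3\<bar> / 3 - \<bar>m (y + h) ^ 3 - m y ^ 3\<bar> / 3\<bar>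
      \<le> \<bar>m (y + r) ^ 3 - m y ^ 3\<bar> + \<bar>m (y + h + r) ^ 3 - m (y + h) ^ 3\<bar>" by (simp only: add.assoc add.commute[of r h])
  qed
qed simp

text \<open>Together with \<open>quadratic_increment\<close> this bounds the error terms in
  \<open>kPhi h\<close>, whereas the \<open>modulus_\<close> lemmas serve for sewing.\<close>

lemma cubic_increment:
  assumes "0 < h" "h \<le> 1"
  shows "pint (\<lambda>y. \<bar>m (y + h) + m y\<bar> * (m (y + h) - m y)\<^sup>2) \<le> h powr \<sigma> * mod_bd \<epsilon> C 0 m"
proof (rule moduli_pint[OF assms order_refl, where h = 0])
  show "cper (\<lambda>y. \<bar>m (y + h) + m y\<bar> * (m (y + h) - m y)\<^sup>2)"
    by (rule cper_mult[OF cper_abs[OF cper_add[OF cper_shift[OF m(1)] m(1)]] cper_power[OF cper_diff[OF cper_shift[OF m(1)] m(1)]]])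
  fix y
  have "\<bar>m (y + h) + m y\<bar> * (m (y + h) - m y)\<^sup>2 = \<bar>m (y + h) - m y\<bar> * (\<bar>m (y + h) + m y\<bar> * \<bar>m (y + h) - m y\<bar>)"
    unfolding power2_abs[of "m (y + h) - m y", symmetric] by algebra
  also have "\<dots> \<le> osc h 0 m y * (amp h 0 m y * (amp h 0 m y + 0))"
    by (intro mult_mono) (auto simp: osc_def amp_def)
  finally show "\<bar>m (y + h) + m y\<bar> * (m (y + h) - m y)\<^sup>2 \<le> osc h 0 m y * (amp h 0 m y * (amp h 0 m y + 0))" .
qed

lemma quad_le:
  assumes Q: "0 \<le> Q" and "w \<le> osc r h m y * amp r h m y" shows "Q * w \<le> osc r h m y * (amp r h m y * (amp r h m y + Q))"
proof -
  have nn: "0 \<le> osc r h m y" "0 \<le> amp r h m y" by (auto simp: osc_def amp_def)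
  have "Q * w \<le> Q * (osc r h m y * amp r h m y)" using assms(2,1) by (rule mult_left_mono)
  also have "\<dots> \<le> \<dots> + osc r h m y * (amp r h m y * amp r h m y)" using nn by simp
  finally show ?thesis by (simp add: algebra_simps)
qed

text \<open>Q is kept inside the function so that the product is covered by \<open>mod_bd\<close>
  with its term Q^2 L2; \<open>scaled_sewing\<close> divides the coefficient by the same
  number.\<close>

lemma modulus_square:
  assumes Q: "0 \<le> Q" shows "l1mod \<sigma> (mod_bd \<epsilon> C Q m) (\<lambda>y. Q * (m y)\<^sup>2)"
proof (rule moduli_l1mod[OF cper_mult[OF cper_const cper_power[OF m(1)]] Q])
  fix r y
  have "(m (y + r))\<^sup>2 - (m y)\<^sup>2 = (m (y + r) - m y) * (m (y + r) + m y)" by algebra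
  then have "\<bar>(m (y + r))\<^sup>2 - (m y)\<^sup>2\<bar> \<le> osc r 0 m y * amp r 0 m y"
    unfolding osc_def amp_def by (simp only: abs_mult) (intro mult_mono; simp)
  from quad_le[OF Q this] show "\<bar>Q * (m (y + r))\<^sup>2 - Q * (m y)\<^sup>2\<bar> \<le> osc r 0 m y * (amp r 0 m y * (amp r 0 m y + Q))"
    using Q by (simp add: abs_mult flip: right_diff_distrib)
qed

lemma modulus_square_delta:
  assumes Q: "0 \<le> Q" shows "l1mod \<sigma> (mod_bd \<epsilon> C Q m) (\<lambda>y. Q * ((m (y + h) + m y) * \<bar>m (y + h) - m y\<bar>))"
proof (rule moduli_l1mod[OF _ Q])
  show "cper (\<lambda>y. Q * ((m (y + h) + m y) * \<bar>m (y + h) - m y\<bar>))"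
    by (rule cper_mult[OF cper_const cper_mult[OF cper_add[OF cper_shift[OF m(1)] m(1)] cper_abs[OF cper_diff[OF cper_shift[OF m(1)] m(1)]]]])
  fix r y
  have "\<bar>(b' + a') * \<bar>b' - a'\<bar> - (b + a) * \<bar>b - a\<bar>\<bar> \<le> (\<bar>a' - a\<bar> + \<bar>b' - b\<bar>) * (\<bar>a\<bar> + \<bar>a'\<bar> + \<bar>b\<bar> + \<bar>b'\<bar>)" for a b a' b' :: real
  proof -
    have "(b' + a') * \<bar>b' - a'\<bar> - (b + a) * \<bar>b - a\<bar> = (\<bar>b' - a'\<bar> - \<bar>b - a\<bar>) * (a' + b') + ((a' - a) + (b' - b)) * \<bar>b - a\<bar>" by algebra
    also have "\<bar>\<dots>\<bar> \<le> (\<bar>a' - a\<bar> + \<bar>b' - b\<bar>) * (\<bar>a'\<bar> + \<bar>b'\<bar>) + (\<bar>a' - a\<bar> + \<bar>b' - b\<bar>) * (\<bar>a\<bar> + \<bar>b\<bar>)"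
      by (intro order_trans[OF abs_triangle_ineq] add_mono; unfold abs_mult; intro mult_mono; linarith)
    finally show ?thesis by (simp add: algebra_simps)
  qed
  from this[of "m (y + r + h)" "m (y + r)" "m (y + h)" "m y"]
  have "\<bar>(m (y + r + h) + m (y + r)) * \<bar>m (y + r + h) - m (y + r)\<bar> - (m (y + h) + m y) * \<bar>m (y + h) - m y\<bar>\<bar> \<le> osc r h m y * amp r h m y"
    unfolding osc_def amp_def by (simp only: add.assoc add.commute[of r h])
  from quad_le[OF Q this] show "\<bar>Q * ((m (y + r + h) + m (y + r)) * \<bar>m (y + r + h) - m (y + r)\<bar>) - Q * ((m (y + h) + m y) * \<bar>m (y + h) - m y\<bar>)\<bar>
      \<le> osc r h m y * (amp r h m y * (amp r h m y + Q))"
    unfolding right_diff_distrib[symmetric] abs_mult[of Q] abs_of_nonneg[OF Q] .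
qed

lemma quadratic_increment:
  assumes Q: "0 \<le> Q" and "0 < h" "h \<le> 1"
  shows "Q * pint (\<lambda>y. (m (y + h) - m y)\<^sup>2) \<le> h powr \<sigma> * mod_bd \<epsilon> C Q m"
  unfolding pint_cmult[symmetric]
proof (rule moduli_pint[OF assms(2,3) Q])
  show "cper (\<lambda>y. Q * (m (y + h) - m y)\<^sup>2)"
    by (rule cper_mult[OF cper_const cper_power[OF cper_diff[OF cper_shift[OF m(1)] m(1)]]])
  show "Q * (m (y + h) - m y)\<^sup>2 \<le> osc h 0 m y * (amp h 0 m y * (amp h 0 m y + Q))" for y
    unfolding power2_abs[of "m (y + h) - m y", symmetric] power2_eq_square[of "\<bar>_\<bar>"]
    by (intro quad_le Q mult_mono) (auto simp: osc_def amp_def)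
qed

end

end

context expo
begin

definition Kh :: "real \<Rightarrow> (real \<Rightarrow> real) \<Rightarrow> real" where "Kh h m = pint (\<lambda>y. \<bar>m (y + h) - m y\<bar> ^ 3)"

text \<open>If M = |m y| is at least 2 A, set r = 2 A / M. The L1 bound allows |m| an average of at
  most M / 2 over (y, y + r), so the increments from y average at least M / 2 there, and their cubes
  at least a multiple of M^3. On (0, r) the weight h^(-1-3 s1) is at least r^(-1-3 s1), and r = 2 A
  / M converts this into the missing power of M.\<close>

lemma gn_pointwise:
  assumes m: "cper m" and A: "0 < A" "pint (\<lambda>x. \<bar>m x\<bar>) \<le> A"
  shows "ennreal (\<bar>m y\<bar> powr q) \<le> ennreal (64 * (2 * A) powr (3 * s1)) *
      (\<integral>\<^sup>+h\<in>{0..1}. ennreal (h powr (- 1 - 3 * s1)) * ennreal (\<bar>m (y + h) - m y\<bar> ^ 3) \<partial>lborel)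
      + ennreal ((2 * A) powr q)"
proof (cases "\<bar>m y\<bar> < 2 * A")
  case True
  then have "\<bar>m y\<bar> powr q \<le> (2 * A) powr q" using q_gt by (intro powr_mono2) auto
  then have "ennreal (\<bar>m y\<bar> powr q) \<le> ennreal ((2 * A) powr q)" by (rule ennreal_leI)
  also have "\<dots> \<le> x + ennreal ((2 * A) powr q)" for x by simp
  finally show ?thesis .
next
  case False
  define M where "M = \<bar>m y\<bar>"
  define r where "r = 2 * A / M"
  let ?s = "3 * s1"
  define g where "g = (\<integral>\<^sup>+h\<in>{0..1}. ennreal (h powr (- 1 - ?s)) * ennreal (\<bar>m (y + h) - m y\<bar> ^ 3) \<partial>lborel)"
  have M: "2 * A \<le> M" "0 < M" using False A by (auto simp: M_def)
  have r: "0 < r" "r \<le> 1" "r * M = 2 * A" using M A by (auto simp: r_def)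
  have cd: "continuous_on S (\<lambda>h. m (y + h) - m y)" for S
    by (intro continuous_intros continuous_on_compose2[OF cper_cont[OF m, of UNIV]]) auto
  have cs: "cper (\<lambda>h. \<bar>m (y + h)\<bar>)"
    using cper_abs[OF cper_shift[OF m, of y]] by (simp add: add.commute)
  have i1: "(\<lambda>h. \<bar>m (y + h) - m y\<bar>) integrable_on {0..r}" and i3: "(\<lambda>h. \<bar>m (y + h) - m y\<bar> ^ 3) integrable_on {0..r}"
    by (intro integrable_continuous_real continuous_intros cd)+
  have "r * M = integral {0..r} (\<lambda>h. M)" using r by simp
  also have "\<dots> \<le> integral {0..r} (\<lambda>h. \<bar>m (y + h) - m y\<bar> + \<bar>m (y + h)\<bar>)"
    by (intro integral_le integrable_add i1 cper_integrable[OF cs]) (auto simp: M_def)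
  also have "\<dots> = integral {0..r} (\<lambda>h. \<bar>m (y + h) - m y\<bar>) + integral {0..r} (\<lambda>h. \<bar>m (y + h)\<bar>)"
    by (intro Henstock_Kurzweil_Integration.integral_add i1 cper_integrable[OF cs])
  also have "integral {0..r} (\<lambda>h. \<bar>m (y + h)\<bar>) \<le> integral {0..1} (\<lambda>h. \<bar>m (y + h)\<bar>)"
    by (intro integral_subset_le cper_integrable[OF cs]) (use r in auto)
  also have "\<dots> = pint (\<lambda>x. \<bar>m x\<bar>)" using pint_shift[OF cper_abs[OF m], of y] by (simp add: add.commute)
  also note A(2)
  finally have low: "r * M / 2 \<le> integral {0..r} (\<lambda>h. \<bar>m (y + h) - m y\<bar>)" using r by simp
  have "integral {0..r} (\<lambda>h. \<bar>m (y + h) - m y\<bar>) \<le> integral {0..r} (\<lambda>h. M / 4 + 16 / M\<^sup>2 * \<bar>m (y + h) - m y\<bar> ^ 3)"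
  proof (intro integral_le i1 integrable_add integrable_on_mult_right i3)
    fix h
    \<comment> \<open>Increments below M / 4 account for at most half of the required average;
      larger ones are compared with their cubes.\<close>
    have "x \<le> M / 4 + 16 / M\<^sup>2 * x ^ 3" if x: "0 \<le> x" for x
    proof (cases "x \<le> M / 4")
      case True
      then show ?thesis using x M by (simp add: add_increasing2)
    next
      case False
      then have "(M / 4)\<^sup>2 \<le> x\<^sup>2" using M by (intro power_mono) auto
      then have "1 \<le> 16 / M\<^sup>2 * x\<^sup>2" using M by (simp add: field_simps power2_eq_square)
      from mult_right_mono[OF this x] have "x \<le> 16 / M\<^sup>2 * x ^ 3" by (simp add: power2_eq_square power3_eq_cube)
      then show ?thesis using M by linarith
    qed
    then show "\<bar>m (y + h) - m y\<bar> \<le> M / 4 + 16 / M\<^sup>2 * \<bar>m (y + h) - m y\<bar> ^ 3" by simp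
  qed auto
  also have "\<dots> = r * M / 4 + 16 / M\<^sup>2 * integral {0..r} (\<lambda>h. \<bar>m (y + h) - m y\<bar> ^ 3)"
    using r Henstock_Kurzweil_Integration.integral_add[OF integrable_const_ivl[of "M / 4" 0 r] integrable_on_mult_right[OF i3, of "16 / M\<^sup>2"]]
    by simp
  finally have "r * M / 4 \<le> 16 / M\<^sup>2 * integral {0..r} (\<lambda>h. \<bar>m (y + h) - m y\<bar> ^ 3)" using low by linarith
  then have low3: "r * M ^ 3 / 64 \<le> integral {0..r} (\<lambda>h. \<bar>m (y + h) - m y\<bar> ^ 3)"
    using M by (simp add: field_simps power2_eq_square power3_eq_cube)
  let ?c = "64 * (2 * A) powr ?s"
  have "M powr q = M ^ 3 * M powr ?s" using M by (simp add: q_def powr_add powr_numeral)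
  also have "\<dots> = ?c * r powr (- 1 - ?s) * (r * M ^ 3 / 64)"
  proof -
    have "M = 2 * A * r powr (- 1)" using r M by (simp add: powr_minus field_simps)
    then have "M powr ?s = (2 * A * r powr (- 1)) powr ?s" by simp
    also have "\<dots> = (2 * A) powr ?s * r powr (- ?s)" by (simp only: powr_mult powr_powr mult_minus1)
    also have "r powr (- ?s) = r powr (- 1 - ?s) * r" using r powr_add[of r "- 1 - ?s" 1] by simp
    finally show ?thesis by simp
  qed
  also have "\<dots> \<le> ?c * r powr (- 1 - ?s) * integral {0..r} (\<lambda>h. \<bar>m (y + h) - m y\<bar> ^ 3)"
    by (intro mult_left_mono low3) simp
  finally have "ennreal (M powr q) \<le> ennreal (?c * r powr (- 1 - ?s) * integral {0..r} (\<lambda>h. \<bar>m (y + h) - m y\<bar> ^ 3))"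
    by (rule ennreal_leI)
  also have "\<dots> = (\<integral>\<^sup>+h. ennreal (?c * r powr (- 1 - ?s) * \<bar>m (y + h) - m y\<bar> ^ 3) * indicator {0..r} h \<partial>lborel)"
    by (rule nn_integral_has_integral_lebesgue'[symmetric, OF _ has_integral_mult_right[OF integrable_integral[OF i3]]]) simp
  also have "\<dots> \<le> (\<integral>\<^sup>+h. ennreal ?c * (ennreal (h powr (- 1 - ?s)) * ennreal (\<bar>m (y + h) - m y\<bar> ^ 3) * indicator {0..1} h) \<partial>lborel)"
  proof (rule nn_integral_mono_AE, rule AE_mp[OF AE_lborel_singleton[of 0]], intro AE_I2 impI)
    fix h :: real assume "h \<noteq> 0"
    show "ennreal (?c * r powr (- 1 - ?s) * \<bar>m (y + h) - m y\<bar> ^ 3) * indicator {0..r} h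
      \<le> ennreal ?c * (ennreal (h powr (- 1 - ?s)) * ennreal (\<bar>m (y + h) - m y\<bar> ^ 3) * indicator {0..1} h)"
    proof (cases "0 < h \<and> h \<le> r")
      case True
      then have "r powr (- 1 - ?s) \<le> h powr (- 1 - ?s)" using s1 by (intro powr_mono2') auto
      then have "?c * r powr (- 1 - ?s) * \<bar>m (y + h) - m y\<bar> ^ 3 \<le> ?c * h powr (- 1 - ?s) * \<bar>m (y + h) - m y\<bar> ^ 3"
        by (intro mult_left_mono mult_right_mono) auto
      then show ?thesis using True r by (simp add: ennreal_mult[symmetric] ennreal_leI mult.assoc)
    qed (use \<open>h \<noteq> 0\<close> in \<open>auto simp: indicator_def\<close>)
  qed
  also have "\<dots> = ennreal ?c * g"
    unfolding g_def
    by (rule nn_integral_cmult) (use borel_measurable_continuous_onI[OF cd] in measurable)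
  also have "\<dots> \<le> \<dots> + ennreal ((2 * A) powr q)" by simp
  finally show ?thesis by (simp add: M_def g_def)
qed

lemma gn_integrated:
  assumes m: "cper m" and A: "0 < A" "pint (\<lambda>x. \<bar>m x\<bar>) \<le> A"
  shows "ennreal (Nq m) \<le> ennreal (64 * (2 * A) powr (3 * s1)) *
      (\<integral>\<^sup>+h\<in>{0..1}. ennreal (h powr (- 1 - 3 * s1)) * ennreal (Kh h m) \<partial>lborel)
      + ennreal ((2 * A) powr q)"
proof -
  have [measurable]: "m \<in> borel_measurable borel" by (rule cper_borel[OF m])
  let ?C = "ennreal (64 * (2 * A) powr (3 * s1))"
  let ?f = "\<lambda>h y. ennreal (h powr (- 1 - 3 * s1)) * ennreal (\<bar>m (y + h) - m y\<bar> ^ 3)"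
  have "ennreal (Nq m) = (\<integral>\<^sup>+y\<in>{0..1}. ennreal (\<bar>m y\<bar> powr q) \<partial>lborel)"
    unfolding Nq_def using q_gt by (intro pint_nn[symmetric] cper_powr[OF m]) auto
  also have "\<dots> \<le> (\<integral>\<^sup>+y. ?C * ((\<integral>\<^sup>+h\<in>{0..1}. ?f h y \<partial>lborel) * indicator {0..1} y)
      + ennreal ((2 * A) powr q) * indicator {0..1} y \<partial>lborel)"
    using gn_pointwise[OF m A]
    by (intro nn_integral_mono) (auto simp: indicator_def)
  also have "\<dots> = ?C * (\<integral>\<^sup>+y. (\<integral>\<^sup>+h\<in>{0..1}. ?f h y \<partial>lborel) * indicator {0..1} y \<partial>lborel)
      + ennreal ((2 * A) powr q)"
    by (subst nn_integral_add) (simp_all add: nn_integral_cmult nn_integral_cmult_indicator)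
  also have "(\<integral>\<^sup>+y. (\<integral>\<^sup>+h\<in>{0..1}. ?f h y \<partial>lborel) * indicator {0..1} y \<partial>lborel)
      = (\<integral>\<^sup>+y. (\<integral>\<^sup>+h. ?f h y * indicator {0..1} h * indicator {0..1} y \<partial>lborel) \<partial>lborel)"
    by (simp add: nn_integral_multc)
  also have "\<dots> = (\<integral>\<^sup>+h. (\<integral>\<^sup>+y. ?f h y * indicator {0..1} h * indicator {0..1} y \<partial>lborel) \<partial>lborel)"
    by (rule lborel_pair.Fubini') simp
  also have "\<dots> = (\<integral>\<^sup>+h\<in>{0..1}. ennreal (h powr (- 1 - 3 * s1)) * ennreal (Kh h m) \<partial>lborel)"
  proof (rule nn_integral_cong)
    fix h
    have "ennreal (Kh h m) = (\<integral>\<^sup>+y\<in>{0..1}. ennreal (\<bar>m (y + h) - m y\<bar> ^ 3) \<partial>lborel)"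
      unfolding Kh_def
      by (rule pint_nn[symmetric, OF cper_power[OF cper_abs[OF cper_diff[OF cper_shift[OF m] m]]]]) simp
    then show "(\<integral>\<^sup>+y. ?f h y * indicator {0..1} h * indicator {0..1} y \<partial>lborel)
        = ennreal (h powr (- 1 - 3 * s1)) * ennreal (Kh h m) * indicator {0..1} h"
      by (cases "h \<in> {0..1}") (simp_all add: nn_integral_cmult[symmetric] mult.assoc)
  qed
  finally show ?thesis .
qed

end

subsection \<open>Estimates at a fixed time\<close>

lemma DERIV_abs_cube: "((\<lambda>z::real. \<bar>z\<bar> ^ 3) has_real_derivative 3 * (z * \<bar>z\<bar>)) (at z)"
  and DERIV_mult_abs: "((\<lambda>z::real. z * \<bar>z\<bar>) has_real_derivative 2 * \<bar>z\<bar>) (at z)"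
proof -
  have sq: "((\<lambda>z::real. z * \<bar>z\<bar>) has_real_derivative 2 * \<bar>z\<bar>) (at z)" for z
  proof (cases "z = 0")
    case True
    have "((\<lambda>h::real. \<bar>h\<bar>) \<longlongrightarrow> 0) (at 0)" by (rule tendsto_rabs_zero) (rule tendsto_ident_at)
    moreover have "\<forall>\<^sub>F h in at (0::real). \<bar>h\<bar> = ((0 + h) * \<bar>0 + h\<bar> - 0 * \<bar>0\<bar>) / h"
      by (auto simp: eventually_at_filter)
    ultimately have "((\<lambda>h::real. ((0 + h) * \<bar>0 + h\<bar> - 0 * \<bar>0\<bar>) / h) \<longlongrightarrow> 0) (at 0)"
      by (rule Lim_transform_eventually)
    then show ?thesis using True by (simp add: DERIV_def)
  next
    case False
    have "\<forall>\<^sub>F w in nhds z. 0 < w * z"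
      by (rule order_tendstoD(1)[of _ "z * z"]) (use False in \<open>auto intro!: tendsto_intros simp: zero_less_mult_iff filterlim_ident\<close>)
    then have ev: "\<forall>\<^sub>F w in nhds z. \<bar>w\<bar> = sgn z * w"
      by eventually_elim (auto simp: zero_less_mult_iff)
    have "(abs has_real_derivative sgn z) (at z)"
      by (rule DERIV_cong_ev[THEN iffD2, OF refl _ refl, of _ "\<lambda>w. sgn z * w"])
         (use ev in \<open>auto intro!: derivative_eq_intros\<close>)
    from DERIV_mult[OF DERIV_ident this] show ?thesis by (simp add: abs_sgn mult.commute)
  qed
  show "((\<lambda>z::real. z * \<bar>z\<bar>) has_real_derivative 2 * \<bar>z\<bar>) (at z)" by (rule sq)
  have "\<bar>z\<bar> ^ 3 = z * (z * \<bar>z\<bar>)" for z :: real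
    by (simp add: power3_eq_cube abs_mult_self_eq flip: mult.assoc)
  then have "(\<lambda>z::real. \<bar>z\<bar> ^ 3) = (\<lambda>z. z * (z * \<bar>z\<bar>))" by blast
  then show "((\<lambda>z::real. \<bar>z\<bar> ^ 3) has_real_derivative 3 * (z * \<bar>z\<bar>)) (at z)"
    using DERIV_mult[OF DERIV_ident sq, of z] by simp
qed

text \<open>With b, p, R standing for the derivatives of a, m, Q, the right-hand side lists in order
  the h-derivative of the integrand of \<open>kPhi\<close>, the two densities paired with increments
  of a' and Q', and an exact y-derivative. Fixing the sign of the increment makes the identity
  polynomial.\<close>

lemma burgers_algebra:
  fixes m m1 p p1 a a1 b b1 Q Q1 R R1 :: real
  defines "d \<equiv> m1 - m"
  shows "\<bar>d\<bar> * ((b1 * m1\<^sup>2 + a1 * (2 * m1 * p1) + 2 * (R1 * m1 + Q1 * p1)) - (b * m\<^sup>2 + a * (2 * m * p) + 2 * (R * m + Q * p)))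
   = (1/6 * b1 * \<bar>d\<bar> ^ 3 + 1/6 * (a1 + a) * (3 * (d * \<bar>d\<bar>) * p1) + (1/2 * b1 * (m1 + m) * (d * \<bar>d\<bar>)
       + 1/2 * (a1 - a) * (p1 * (d * \<bar>d\<bar>) + (m1 + m) * (2 * \<bar>d\<bar> * p1))) + (R1 * (d * \<bar>d\<bar>) + (Q1 - Q) * (2 * \<bar>d\<bar> * p1)))
   + (b1 - b) * (\<bar>m1 ^ 3 - m ^ 3\<bar> / 3) + (R1 - R) * ((m1 + m) * \<bar>d\<bar>)
   + (- b * (2/3 * \<bar>d\<bar> ^ 3 - m1 * (d * \<bar>d\<bar>)) - a * (2/3 * (3 * (d * \<bar>d\<bar>) * (p1 - p)) - (p1 * (d * \<bar>d\<bar>) + m1 * (2 * \<bar>d\<bar> * (p1 - p))))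
       + (R * (d * \<bar>d\<bar>) + Q * (2 * \<bar>d\<bar> * (p1 - p))))"
proof (cases "m \<le> m1")
  case True
  then have "m ^ 3 \<le> m1 ^ 3" by (intro power_mono_odd) auto
  then show ?thesis using True unfolding d_def by (simp add: field_simps) algebra
next
  case False
  then have "m1 ^ 3 \<le> m ^ 3" by (intro power_mono_odd) auto
  then show ?thesis using False unfolding d_def by (simp add: abs_if field_simps) algebra
qed

section \<open>The quadratic flux and its energy, entropy and increment balances\<close>

locale quadratic_flux =
  fixes m m' a a' Q Q' :: "real \<Rightarrow> real"
  assumes m: "c1per m m'" and a: "c1per a a'" and Q: "c1per Q Q'"
begin

text \<open>Only the part of the flux that involves m; R is treated by Sobolev duality.\<close>

definition "flux y = a y * (m y)\<^sup>2 + 2 * (Q y * m y)"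
definition "flux' y = a' y * (m y)\<^sup>2 + a y * (2 * m y * m' y) + 2 * (Q' y * m y + Q y * m' y)"

lemmas cm = c1per_cper[OF m] and ca = c1per_cper[OF a] and cQ = c1per_cper[OF Q]
  and cm' = c1per_cper'[OF m] and ca' = c1per_cper'[OF a] and cQ' = c1per_cper'[OF Q]

lemma flux: "c1per flux flux'"
proof (rule c1perI)
  show "flux (x + 1) = flux x" for x
    using cper_periodic[OF cm] cper_periodic[OF ca] cper_periodic[OF cQ] by (simp add: flux_def)
  show "(flux has_real_derivative flux' x) (at x)" for x
    unfolding flux_def[abs_def] flux'_def
    by (rule derivative_eq_intros c1per_deriv[OF m] c1per_deriv[OF a] c1per_deriv[OF Q] refl)+
       (simp add: algebra_simps)
  show "continuous_on UNIV flux'"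
    unfolding flux'_def
    by (intro continuous_intros cper_cont[OF cm] cper_cont[OF ca] cper_cont[OF cQ] cper_cont[OF cm'] cper_cont[OF ca'] cper_cont[OF cQ'])
qed

text \<open>Where a >= a0 >= 0, the first term dominates a0 / 3 times the cubic increment; the other
  two carry increments of a and Q and are errors of order h.\<close>

definition "kPhi h = pint (\<lambda>y. 1/6 * (a (y + h) + a y) * \<bar>m (y + h) - m y\<bar> ^ 3
   + 1/2 * (a (y + h) - a y) * ((m (y + h) + m y) * ((m (y + h) - m y) * \<bar>m (y + h) - m y\<bar>))
   + (Q (y + h) - Q y) * ((m (y + h) - m y) * \<bar>m (y + h) - m y\<bar>))"

definition "kPhi' h = pint (\<lambda>y. \<bar>m (y + h) - m y\<bar> * (flux' (y + h) - flux' y))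
    - pint (\<lambda>y. (a' (y + h) - a' y) * (\<bar>m (y + h) ^ 3 - m y ^ 3\<bar> / 3))
    - pint (\<lambda>y. (Q' (y + h) - Q' y) * ((m (y + h) + m y) * \<bar>m (y + h) - m y\<bar>))"

text \<open>A Karman--Howarth--Monin identity for \<open>|\<delta>| \<delta>\<close>; all terms not displayed are exact
  \<open>y\<close>-derivatives because \<open>|\<delta>|\<close> depends only on the pair \<open>(m (y), m (y + h))\<close>.\<close>
lemma kPhi_deriv: "(kPhi has_real_derivative kPhi' h) (at h)"
proof -
  let ?d = "\<lambda>h y. m (y + h) - m y"
  let ?E = "\<lambda>h y. 1/6 * a' (y + h) * \<bar>?d h y\<bar> ^ 3 + 1/6 * (a (y + h) + a y) * (3 * (?d h y * \<bar>?d h y\<bar>) * m' (y + h))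
     + (1/2 * a' (y + h) * (m (y + h) + m y) * (?d h y * \<bar>?d h y\<bar>)
       + 1/2 * (a (y + h) - a y) * (m' (y + h) * (?d h y * \<bar>?d h y\<bar>) + (m (y + h) + m y) * (2 * \<bar>?d h y\<bar> * m' (y + h))))
     + (Q' (y + h) * (?d h y * \<bar>?d h y\<bar>) + (Q (y + h) - Q y) * (2 * \<bar>?d h y\<bar> * m' (y + h)))"
  have sh: "((\<lambda>h. f (y + h)) has_real_derivative f' (y + h)) (at h)" if "c1per f f'" for f f' h y
    using c1per_deriv[OF that, of "y + h"] DERIV_shift[of f "f' (y + h)" h y] by (simp add: add.commute)
  have dd: "((\<lambda>h. ?d h y) has_real_derivative m' (y + h)) (at h)" for h y
    using DERIV_diff[OF sh[OF m, of y h] DERIV_const[of "m y"]] by simp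
  have d3: "((\<lambda>h. \<bar>?d h y\<bar> ^ 3) has_real_derivative 3 * (?d h y * \<bar>?d h y\<bar>) * m' (y + h)) (at h)" for h y
    by (rule DERIV_chain2[OF DERIV_abs_cube dd])
  have d2: "((\<lambda>h. ?d h y * \<bar>?d h y\<bar>) has_real_derivative 2 * \<bar>?d h y\<bar> * m' (y + h)) (at h)" for h y
    by (rule DERIV_chain2[OF DERIV_mult_abs dd])
  note cont = continuous_on_compose2[OF cper_cont[OF cm, of UNIV]] continuous_on_compose2[OF cper_cont[OF ca, of UNIV]]
    continuous_on_compose2[OF cper_cont[OF cQ, of UNIV]] continuous_on_compose2[OF cper_cont[OF cm', of UNIV]]
    continuous_on_compose2[OF cper_cont[OF ca', of UNIV]] continuous_on_compose2[OF cper_cont[OF cQ', of UNIV]]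
  have "(kPhi has_field_derivative integral (cbox 0 1) (?E h)) (at h within UNIV)"
    unfolding kPhi_def[abs_def] cbox_interval[symmetric]
  proof (rule leibniz_rule_field_derivative)
    fix h y
    show "((\<lambda>h. 1/6 * (a (y + h) + a y) * \<bar>?d h y\<bar> ^ 3 + 1/2 * (a (y + h) - a y) * ((m (y + h) + m y) * (?d h y * \<bar>?d h y\<bar>))
        + (Q (y + h) - Q y) * (?d h y * \<bar>?d h y\<bar>)) has_field_derivative ?E h y) (at h within UNIV)"
    proof -
      have "((\<lambda>h. 1/6 * (a (y + h) + a y) * A h + 1/2 * (a (y + h) - a y) * ((m (y + h) + m y) * B h)
          + (Q (y + h) - Q y) * B h) has_real_derivative
          1/6 * a' (y + h) * A h + 1/6 * (a (y + h) + a y) * A'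
          + (1/2 * a' (y + h) * (m (y + h) + m y) * B h + 1/2 * (a (y + h) - a y) * (m' (y + h) * B h + (m (y + h) + m y) * B'))
          + (Q' (y + h) * B h + (Q (y + h) - Q y) * B')) (at h)"
        if "(A has_real_derivative A') (at h)" "(B has_real_derivative B') (at h)" for A B A' B'
        by (rule derivative_eq_intros sh[OF m] sh[OF a] sh[OF Q] that refl)+ (simp add: algebra_simps)
      from this[OF d3 d2] show ?thesis by simp
    qed
  next
    show "continuous_on (UNIV \<times> cbox 0 1) (\<lambda>(h, y). ?E h y)"
      unfolding case_prod_unfold by (intro continuous_intros cont) auto
    show "(\<lambda>y. 1/6 * (a (y + h) + a y) * \<bar>?d h y\<bar> ^ 3 + 1/2 * (a (y + h) - a y) * ((m (y + h) + m y) * (?d h y * \<bar>?d h y\<bar>))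
        + (Q (y + h) - Q y) * (?d h y * \<bar>?d h y\<bar>)) integrable_on cbox 0 1" for h
      unfolding cbox_interval by (intro integrable_continuous_real continuous_intros cont) auto
  qed auto
  moreover have "pint (?E h) = kPhi' h"
  proof -
    let ?\<Xi> = "\<lambda>y. - (a y * (2/3 * \<bar>?d h y\<bar> ^ 3 - m (y + h) * (?d h y * \<bar>?d h y\<bar>))) + Q y * (?d h y * \<bar>?d h y\<bar>)"
    let ?\<Xi>' = "\<lambda>y. - a' y * (2/3 * \<bar>?d h y\<bar> ^ 3 - m (y + h) * (?d h y * \<bar>?d h y\<bar>))
        - a y * (2/3 * (3 * (?d h y * \<bar>?d h y\<bar>) * (m' (y + h) - m' y)) - (m' (y + h) * (?d h y * \<bar>?d h y\<bar>) + m (y + h) * (2 * \<bar>?d h y\<bar> * (m' (y + h) - m' y))))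
       + (Q' y * (?d h y * \<bar>?d h y\<bar>) + Q y * (2 * \<bar>?d h y\<bar> * (m' (y + h) - m' y)))"
    note sm = c1per_shift[OF m, of h]
    have ds: "((\<lambda>y. m (y + h) - m y) has_real_derivative m' (y + h) - m' y) (at y)" for y
      by (rule DERIV_diff[OF c1per_deriv[OF sm] c1per_deriv[OF m]])
    have ds3: "((\<lambda>y. \<bar>?d h y\<bar> ^ 3) has_real_derivative 3 * (?d h y * \<bar>?d h y\<bar>) * (m' (y + h) - m' y)) (at y)" for y
      by (rule DERIV_chain2[OF DERIV_abs_cube ds])
    have ds2: "((\<lambda>y. ?d h y * \<bar>?d h y\<bar>) has_real_derivative 2 * \<bar>?d h y\<bar> * (m' (y + h) - m' y)) (at y)" for y
      by (rule DERIV_chain2[OF DERIV_mult_abs ds])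
    have \<Xi>: "c1per ?\<Xi> ?\<Xi>'"
    proof (rule c1perI)
      show "?\<Xi> (y + 1) = ?\<Xi> y" for y
        using cper_periodic[OF cm] cper_periodic[OF ca] cper_periodic[OF cQ] cper_periodic[OF c1per_cper[OF sm]] by simp
      show "(?\<Xi> has_real_derivative ?\<Xi>' y) (at y)" for y
      proof -
        have "((\<lambda>y. - (a y * (2/3 * A y - m (y + h) * B y)) + Q y * B y) has_real_derivative
            - a' y * (2/3 * A y - m (y + h) * B y) - a y * (2/3 * A' - (m' (y + h) * B y + m (y + h) * B'))
            + (Q' y * B y + Q y * B')) (at y)"
          if "(A has_real_derivative A') (at y)" "(B has_real_derivative B') (at y)" for A B A' B'
          by (rule derivative_eq_intros c1per_deriv[OF sm] c1per_deriv[OF a] c1per_deriv[OF Q] that refl)+ (simp add: algebra_simps)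
        from this[OF ds3 ds2] show ?thesis by simp
      qed
      show "continuous_on UNIV ?\<Xi>'" by (intro continuous_intros cont) auto
    qed
    let ?A = "\<lambda>y. \<bar>m (y + h) - m y\<bar> * (flux' (y + h) - flux' y)"
    let ?B = "\<lambda>y. (a' (y + h) - a' y) * (\<bar>m (y + h) ^ 3 - m y ^ 3\<bar> / 3)"
    let ?C = "\<lambda>y. (Q' (y + h) - Q' y) * ((m (y + h) + m y) * \<bar>m (y + h) - m y\<bar>)"
    have alg: "?A y = ?E h y + ?B y + ?C y + ?\<Xi>' y" for y
      unfolding flux'_def by (rule burgers_algebra)
    have iE: "?E h integrable_on {0..1}" and iA: "?A integrable_on {0..1}" and iB: "?B integrable_on {0..1}" and iC: "?C integrable_on {0..1}"
      unfolding flux'_def by (intro integrable_continuous_real continuous_intros cont; simp)+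
    have i\<Xi>: "?\<Xi>' integrable_on {0..1}" by (rule cper_integrable[OF c1per_cper'[OF \<Xi>]])
    have "pint ?A = pint (\<lambda>y. ?E h y + ?B y + ?C y + ?\<Xi>' y)" by (simp only: alg)
    also have "\<dots> = pint (?E h) + pint ?B + pint ?C + pint ?\<Xi>'"
      by (simp only: Henstock_Kurzweil_Integration.integral_add[OF integrable_add[OF integrable_add[OF iE iB] iC] i\<Xi>]
        Henstock_Kurzweil_Integration.integral_add[OF integrable_add[OF iE iB] iC] Henstock_Kurzweil_Integration.integral_add[OF iE iB])
    also have "pint ?\<Xi>' = 0" by (rule pint_deriv_0[OF \<Xi>])
    finally show ?thesis by (simp only: kPhi'_def)
  qed
  ultimately show ?thesis by simp
qed

lemma kPhi_0: "kPhi 0 = 0"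
  by (simp add: kPhi_def)

text \<open>m (a m^2)' = a' m^3 / 3 + (2 a m^3 / 3)' and 2 m (Q m)' = Q' m^2 + (Q m^2)', so only
  derivatives of the coefficients survive.\<close>

lemma energy_flux: "pint (\<lambda>y. m y * flux' y) = pint (\<lambda>y. a' y * (m y) ^ 3) / 3 + pint (\<lambda>y. Q' y * (m y)\<^sup>2)"
proof -
  let ?\<Xi> = "\<lambda>y. 2/3 * (a y * (m y) ^ 3) + Q y * (m y)\<^sup>2"
  let ?\<Xi>' = "\<lambda>y. 2/3 * (a' y * (m y) ^ 3 + a y * (3 * (m y)\<^sup>2 * m' y)) + (Q' y * (m y)\<^sup>2 + Q y * (2 * m y * m' y))"
  have \<Xi>: "c1per ?\<Xi> ?\<Xi>'"
  proof (rule c1perI)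
    show "?\<Xi> (y + 1) = ?\<Xi> y" for y
      using cper_periodic[OF cm] cper_periodic[OF ca] cper_periodic[OF cQ] by simp
    show "(?\<Xi> has_real_derivative ?\<Xi>' y) (at y)" for y
      by (rule derivative_eq_intros c1per_deriv[OF m] c1per_deriv[OF a] c1per_deriv[OF Q] refl)+ (simp add: algebra_simps)
    show "continuous_on UNIV ?\<Xi>'"
      by (intro continuous_intros cper_cont[OF cm] cper_cont[OF ca] cper_cont[OF cQ] cper_cont[OF cm'] cper_cont[OF ca'] cper_cont[OF cQ'])
  qed
  have cA: "cper (\<lambda>y. 1/3 * (a' y * (m y) ^ 3))" by (rule cper_mult[OF cper_const cper_mult[OF ca' cper_power[OF cm]]])
  have cB: "cper (\<lambda>y. Q' y * (m y)\<^sup>2)" by (rule cper_mult[OF cQ' cper_power[OF cm]])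
  have alg: "m y * flux' y = 1/3 * (a' y * (m y) ^ 3) + Q' y * (m y)\<^sup>2 + ?\<Xi>' y" for y
    unfolding flux'_def by (simp add: power2_eq_square power3_eq_cube algebra_simps)
  have "pint (\<lambda>y. m y * flux' y) = pint (\<lambda>y. 1/3 * (a' y * (m y) ^ 3)) + pint (\<lambda>y. Q' y * (m y)\<^sup>2) + pint ?\<Xi>'"
    unfolding alg by (simp only: pint_add[OF cper_add[OF cA cB] c1per_cper'[OF \<Xi>]] pint_add[OF cA cB])
  then show ?thesis using pint_deriv_0[OF \<Xi>] by (simp add: pint_cmult)
qed

text \<open>A first integration by parts puts the derivative on e (m); since z e1 and z^2 e1 have
  the primitives F1 and F2, a second one puts it on the coefficients.\<close>

lemma entropy_flux:
  assumes e: "\<And>z. (e has_real_derivative e1 z) (at z)" "continuous_on UNIV e1"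
    and F1: "\<And>z. (F1 has_real_derivative z * e1 z) (at z)" and F2: "\<And>z. (F2 has_real_derivative z\<^sup>2 * e1 z) (at z)"
  shows "pint (\<lambda>y. e (m y) * flux' y) = pint (\<lambda>y. a' y * F2 (m y)) + 2 * pint (\<lambda>y. Q' y * F1 (m y))"
proof -
  have em: "c1per (\<lambda>y. e (m y)) (\<lambda>y. e1 (m y) * m' y)" by (rule c1per_compose[OF m e])
  have f1: "c1per (\<lambda>y. F1 (m y)) (\<lambda>y. m y * e1 (m y) * m' y)"
    by (rule c1per_compose[OF m F1]) (intro continuous_intros e)
  have f2: "c1per (\<lambda>y. F2 (m y)) (\<lambda>y. (m y)\<^sup>2 * e1 (m y) * m' y)"
    by (rule c1per_compose[OF m F2]) (intro continuous_intros e)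
  have "pint (\<lambda>y. e (m y) * flux' y) = - pint (\<lambda>y. e1 (m y) * m' y * flux y)" by (rule pint_by_parts[OF em flux])
  also have "pint (\<lambda>y. e1 (m y) * m' y * flux y) = pint (\<lambda>y. a y * ((m y)\<^sup>2 * e1 (m y) * m' y) + 2 * (Q y * (m y * e1 (m y) * m' y)))"
    by (rule arg_cong[where f = pint]) (auto simp: flux_def algebra_simps power2_eq_square)
  also have "\<dots> = pint (\<lambda>y. a y * ((m y)\<^sup>2 * e1 (m y) * m' y)) + 2 * pint (\<lambda>y. Q y * (m y * e1 (m y) * m' y))"
    by (simp only: pint_add[OF cper_mult[OF ca c1per_cper'[OF f2]] cper_mult[OF cper_const cper_mult[OF cQ c1per_cper'[OF f1]]]] pint_cmult)
  finally show ?thesis using pint_by_parts[OF a f2] pint_by_parts[OF Q f1] by simp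
qed

end

text \<open>The absolute value of a C1 increment is Lipschitz, which gives finite seminorms; taking
  it is a contraction, and forming the increment costs the factor 4, the bound on
  \<open>fsym\<close>.\<close>

lemma abs_delta_fin_hom:
  assumes m: "c1per m m'" and g: "0 < g" "g \<le> 2"
  shows "cper (\<lambda>y. \<bar>m (y + h) - m y\<bar>)" "fin_hom g (\<lambda>y. \<bar>m (y + h) - m y\<bar>)"
    "hom2 g (\<lambda>y. \<bar>m (y + h) - m y\<bar>) \<le> 4 * hom2 g m"
proof -
  note cm = c1per_cper[OF m]
  have cd: "cper (\<lambda>y. m (y + h) - m y)" by (rule cper_diff[OF cper_shift[OF cm] cm])
  show ca: "cper (\<lambda>y. \<bar>m (y + h) - m y\<bar>)" by (rule cper_abs[OF cd])
  have d1: "c1per (\<lambda>y. m (y + h) - m y) (\<lambda>y. m' (y + h) - m' y)" by (rule c1per_diff[OF c1per_shift[OF m] m])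
  obtain L where L: "\<And>x y. \<bar>(m (x + h) - m x) - (m (y + h) - m y)\<bar> \<le> L * \<bar>x - y\<bar>"
    using c1per_lipschitz[OF d1] by metis
  show fa: "fin_hom g (\<lambda>y. \<bar>m (y + h) - m y\<bar>)"
  proof (rule lipschitz_fin_hom'[OF ca _ g(2)])
    show "\<bar>\<bar>m (x + h) - m x\<bar> - \<bar>m (y + h) - m y\<bar>\<bar> \<le> L * \<bar>x - y\<bar>" for x y
      by (rule order_trans[OF abs_triangle_ineq3 L])
  qed
  have "hom2 g (\<lambda>y. \<bar>m (y + h) - m y\<bar>) \<le> hom2 g (\<lambda>y. m (y + h) - m y)"
    by (rule hom2_contraction[OF g ca fa cd c1per_fin_hom[OF d1 g(2)] abs_triangle_ineq3])
  also have "\<dots> \<le> 4 * hom2 g m" by (rule hom2_delta(2)[OF cm c1per_fin_hom[OF m g(2)]])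
  finally show "hom2 g (\<lambda>y. \<bar>m (y + h) - m y\<bar>) \<le> 4 * hom2 g m" .
qed

lemma delta_pair:
  assumes m: "c1per m m'" and V: "c1per V V'" and g: "0 < g" "g \<le> 2"
  shows "\<bar>pint (\<lambda>y. \<bar>m (y + h) - m y\<bar> * (V' (y + h) - V' y))\<bar> \<le> 2 * hom2 g m + 2 * hom2 (2 - g) V"
proof -
  note u = abs_delta_fin_hom[OF m g, of h]
  have dV: "c1per (\<lambda>y. V (y + h) - V y) (\<lambda>y. V' (y + h) - V' y)" by (rule c1per_diff[OF c1per_shift[OF V] V])
  have "\<bar>pint (\<lambda>y. \<bar>m (y + h) - m y\<bar> * (V' (y + h) - V' y))\<bar>
      \<le> (1 * hom2 g (\<lambda>y. \<bar>m (y + h) - m y\<bar>) + hom2 (2 - g) (\<lambda>y. V (y + h) - V y) / 1) / 2"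
    using g by (intro sobolev_pair[OF u(1,2) dV]) auto
  also have "\<dots> \<le> (1 * (4 * hom2 g m) + 4 * hom2 (2 - g) V / 1) / 2"
    using u(3) hom2_delta(2)[OF c1per_cper[OF V] c1per_fin_hom[OF V, of "2 - g"], of h] g
    by (intro divide_right_mono add_mono) auto
  finally show ?thesis by simp
qed

lemma holder_shift: "holder \<alpha> A a \<Longrightarrow> holder \<alpha> A (\<lambda>y. a (y + h))"
  unfolding holder_def by (metis add.assoc add.commute)

lemma sewing_delta:
  assumes a: "c1per a a'" and G: "cper G" and A: "holder \<alpha> A a" and B: "l1mod \<sigma> B G" and s: "1 < \<alpha> + \<sigma>"
  shows "\<bar>pint (\<lambda>y. (a' (y + h) - a' y) * G y)\<bar> \<le> 2 * sew_const (\<alpha> + \<sigma>) * A * B"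
proof -
  have eq: "pint (\<lambda>y. (a' (y + h) - a' y) * G y) = pint (\<lambda>y. a' (y + h) * G y) - pint (\<lambda>y. a' y * G y)"
    unfolding left_diff_distrib
    by (rule pint_diff[OF cper_mult[OF cper_shift[OF c1per_cper'[OF a]] G] cper_mult[OF c1per_cper'[OF a] G]])
  have 1: "\<bar>pint (\<lambda>y. a' (y + h) * G y)\<bar> \<le> sew_const (\<alpha> + \<sigma>) * A * B"
    by (rule sewing[OF c1per_shift[OF a] G holder_shift[OF A] B s])
  have 2: "\<bar>pint (\<lambda>y. a' y * G y)\<bar> \<le> sew_const (\<alpha> + \<sigma>) * A * B"
    by (rule sewing[OF a G A B s])
  have "\<bar>u\<bar> \<le> S \<Longrightarrow> \<bar>v\<bar> \<le> S \<Longrightarrow> \<bar>u - v\<bar> \<le> 2 * S" for u v S :: real by linarith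
  from this[OF 1 2] show ?thesis unfolding eq by (simp only: mult.assoc)
qed

text \<open>The Hoelder constant of Q is controlled only in a time integral, so it is moved to the
  other factor of the pairing, where \<open>mod_bd\<close> weighs it quadratically.\<close>

lemma scaled_sewing:
  assumes a: "c1per a a'" and q: "0 < q" "holder \<alpha> q a"
  shows "c1per (\<lambda>y. a y / q) (\<lambda>y. a' y / q)" "holder \<alpha> 1 (\<lambda>y. a y / q)"
proof -
  show "c1per (\<lambda>y. a y / q) (\<lambda>y. a' y / q)" using c1per_cmult[OF a, of "1 / q"] by simp
  show "holder \<alpha> 1 (\<lambda>y. a y / q)" unfolding holder_def
  proof (intro conjI allI impI)
    fix y h :: real assume "0 < h \<and> h \<le> 1"
    then have "\<bar>a (y + h) - a y\<bar> \<le> q * h powr \<alpha>" using q by (simp add: holder_def)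
    then have "\<bar>a (y + h) - a y\<bar> / q \<le> q * h powr \<alpha> / q" using q by (intro divide_right_mono) auto
    then show "\<bar>a (y + h) / q - a y / q\<bar> \<le> 1 * h powr \<alpha>" using q by (simp add: diff_divide_distrib[symmetric])
  qed simp
qed

lemma pint_mult_add3:
  fixes u f g h :: "real \<Rightarrow> real"
  assumes "cper u" "cper f" "cper g" "cper h"
  shows "pint (\<lambda>y. u y * (f y + g y + h y)) = pint (\<lambda>y. u y * f y) + pint (\<lambda>y. u y * g y) + pint (\<lambda>y. u y * h y)"
proof -
  note c = cper_mult[OF assms(1,2)] cper_mult[OF assms(1,3)] cper_mult[OF assms(1,4)]
  show ?thesis
    unfolding distrib_left
    by (simp only: pint_add[OF cper_add[OF c(1,2)] c(3)] pint_add[OF c(1,2)])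
qed

locale slice = expo \<gamma> \<alpha> \<kappa> + quadratic_flux m m' a a' Q Q'
  for \<gamma> \<alpha> \<kappa> :: real and m m' a a' Q Q' :: "real \<Rightarrow> real" +
  fixes V V' R R' :: "real \<Rightarrow> real" and A qq :: real
  assumes V: "c1per V V'" and R: "c1per R R'"
    and A: "holder \<alpha> A a" and qq: "0 < qq" "holder \<alpha> qq Q"
begin

definition "mt y = V' y + flux' y + R' y"

lemma cV': "cper V'" and cR': "cper R'" and cflux': "cper flux'"
  using c1per_cper'[OF V] c1per_cper'[OF R] c1per_cper'[OF flux] by auto

lemma cmt: "cper mt"
  unfolding mt_def[abs_def] by (rule cper_add[OF cper_add[OF cV' cflux'] cR'])

lemma m_fin: "fin_hom \<gamma> m"
  by (rule c1per_fin_hom[OF m \<gamma>(2)])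

abbreviation "S \<equiv> sew_const (\<alpha> + \<sigma>)"

lemma S_pos: "0 < S" by (rule sew_const_pos[OF sigma(3)])

lemma A_nonneg: "0 \<le> A" using A by (simp add: holder_def)

lemma energy_fixed:
  assumes b: "l1mod \<sigma> b1 (\<lambda>y. m y ^ 3)" "l1mod \<sigma> b2 (\<lambda>y. qq * (m y)\<^sup>2)"
    and e: "0 < \<epsilon>" and coer: "pint (\<lambda>y. m y * V' y) \<le> - c * hom2 \<gamma> m"
  shows "pint (\<lambda>y. m y * mt y) \<le> - c * hom2 \<gamma> m + S * A * b1 + S * b2 + (\<epsilon> * hom2 \<gamma> m + hom2 (2 - \<gamma>) R / \<epsilon>) / 2"
proof -
  have 1: "\<bar>pint (\<lambda>y. a' y * m y ^ 3)\<bar> \<le> S * A * b1"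
    by (rule sewing[OF a cper_power[OF cm] A b(1) sigma(3)])
  note sq = scaled_sewing[OF Q qq]
  have "\<bar>pint (\<lambda>y. Q' y / qq * (qq * (m y)\<^sup>2))\<bar> \<le> S * 1 * b2"
    by (rule sewing[OF sq(1) cper_mult[OF cper_const cper_power[OF cm]] sq(2) b(2) sigma(3)])
  then have 2: "\<bar>pint (\<lambda>y. Q' y * (m y)\<^sup>2)\<bar> \<le> S * b2" using qq by simp
  have 3: "\<bar>pint (\<lambda>y. m y * R' y)\<bar> \<le> (\<epsilon> * hom2 \<gamma> m + hom2 (2 - \<gamma>) R / \<epsilon>) / 2"
    using \<gamma> by (intro sobolev_pair[OF cm m_fin R _ e]) auto
  have "pint (\<lambda>y. m y * mt y) = pint (\<lambda>y. m y * V' y) + (pint (\<lambda>y. a' y * (m y) ^ 3) / 3 + pint (\<lambda>y. Q' y * (m y)\<^sup>2)) + pint (\<lambda>y. m y * R' y)"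
    unfolding mt_def[abs_def] by (simp only: pint_mult_add3[OF cm cV' cflux' cR'] energy_flux)
  then show ?thesis using 1 2 3 coer by (simp only: abs_le_iff) linarith
qed

text \<open>As \<open>kPhi\<close> vanishes at 0, bounding \<open>kPhi'\<close> on (0, h) by the
  time-derivative term plus a constant gains the factor h; the error terms inside
  \<open>kPhi h\<close> turn out to be of the same order. The operator and R enter through
  \<open>delta_pair\<close>, the coefficients through \<open>sewing_delta\<close>.\<close>

lemma K_fixed:
  assumes b: "\<And>h. l1mod \<sigma> b1 (\<lambda>y. \<bar>m (y + h) ^ 3 - m y ^ 3\<bar> / 3)"
      "\<And>h. l1mod \<sigma> b2 (\<lambda>y. qq * ((m (y + h) + m y) * \<bar>m (y + h) - m y\<bar>))"
      "\<And>h. 0 < h \<Longrightarrow> h \<le> 1 \<Longrightarrow> pint (\<lambda>y. \<bar>m (y + h) + m y\<bar> * (m (y + h) - m y)\<^sup>2) \<le> h powr \<sigma> * b1"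
      "\<And>h. 0 < h \<Longrightarrow> h \<le> 1 \<Longrightarrow> qq * pint (\<lambda>y. (m (y + h) - m y)\<^sup>2) \<le> h powr \<sigma> * b2"
    and low: "0 \<le> a0" "\<And>y. a0 \<le> a y" and h: "0 < h" "h \<le> 1"
  shows "a0 / 3 * Kh h m \<le> integral {0..h} (\<lambda>r. pint (\<lambda>y. \<bar>m (y + r) - m y\<bar> * (mt (y + r) - mt y)))
     + h * ((2 * S + 1) * (A * b1 + b2) + 4 * hom2 \<gamma> m + 2 * hom2 (2 - \<gamma>) V + 2 * hom2 (2 - \<gamma>) R)"
proof -
  let ?W = "\<lambda>r. pint (\<lambda>y. \<bar>m (y + r) - m y\<bar> * (mt (y + r) - mt y))"
  let ?X = "2 * S * (A * b1 + b2) + 4 * hom2 \<gamma> m + 2 * hom2 (2 - \<gamma>) V + 2 * hom2 (2 - \<gamma>) R"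
  have bn: "0 \<le> b1" "0 \<le> b2" using b(1,2)[of 0] by (auto simp: l1mod_def)
  have g: "0 < \<gamma>" using \<gamma> by simp
  note sq = scaled_sewing[OF Q qq]
  have der: "kPhi' r \<le> ?W r + ?X" for r
  proof -
    have cd: "cper (\<lambda>y. \<bar>m (y + r) - m y\<bar>)" by (rule cper_abs[OF cper_diff[OF cper_shift[OF cm] cm]])
    note dl = cper_diff[OF cper_shift[OF cV'] cV', of r] cper_diff[OF cper_shift[OF cflux'] cflux', of r] cper_diff[OF cper_shift[OF cR'] cR', of r]
    have "?W r = pint (\<lambda>y. \<bar>m (y + r) - m y\<bar> * ((V' (y + r) - V' y) + (flux' (y + r) - flux' y) + (R' (y + r) - R' y)))"
      by (rule arg_cong[where f = pint]) (auto simp: mt_def algebra_simps)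
    also have "\<dots> = pint (\<lambda>y. \<bar>m (y + r) - m y\<bar> * (V' (y + r) - V' y)) + pint (\<lambda>y. \<bar>m (y + r) - m y\<bar> * (flux' (y + r) - flux' y))
        + pint (\<lambda>y. \<bar>m (y + r) - m y\<bar> * (R' (y + r) - R' y))"
      by (rule pint_mult_add3[OF cd dl])
    finally have W: "?W r = \<dots>" .
    note 1 = delta_pair[OF m V g \<gamma>(2), of r] and 2 = delta_pair[OF m R g \<gamma>(2), of r]
    have 3: "\<bar>pint (\<lambda>y. (a' (y + r) - a' y) * (\<bar>m (y + r) ^ 3 - m y ^ 3\<bar> / 3))\<bar> \<le> 2 * S * A * b1"
    proof (rule sewing_delta[OF a _ A b(1) sigma(3)])
      have "cper (\<lambda>y. 1 / 3 * \<bar>m (y + r) ^ 3 - m y ^ 3\<bar>)"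
        by (rule cper_mult[OF cper_const cper_abs[OF cper_diff[OF cper_power[OF cper_shift[OF cm]] cper_power[OF cm]]]])
      then show "cper (\<lambda>y. \<bar>m (y + r) ^ 3 - m y ^ 3\<bar> / 3)" by simp
    qed
    have "\<bar>pint (\<lambda>y. (Q' (y + r) / qq - Q' y / qq) * (qq * ((m (y + r) + m y) * \<bar>m (y + r) - m y\<bar>)))\<bar> \<le> 2 * S * 1 * b2"
      by (rule sewing_delta[OF sq(1) _ sq(2) b(2) sigma(3)])
         (rule cper_mult[OF cper_const cper_mult[OF cper_add[OF cper_shift[OF cm] cm] cd]])
    moreover have "(Q' (y + r) / qq - Q' y / qq) * (qq * w) = (Q' (y + r) - Q' y) * w" for y w
      using qq by (simp add: field_simps)
    ultimately have 4: "\<bar>pint (\<lambda>y. (Q' (y + r) - Q' y) * ((m (y + r) + m y) * \<bar>m (y + r) - m y\<bar>))\<bar> \<le> 2 * S * b2"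
      by simp
    have "\<bar>v\<bar> \<le> 2 * H + 2 * VV \<Longrightarrow> \<bar>w\<bar> \<le> 2 * H + 2 * RR \<Longrightarrow> \<bar>p\<bar> \<le> 2 * S * A * b1 \<Longrightarrow> \<bar>s\<bar> \<le> 2 * S * b2 \<Longrightarrow>
        f - p - s \<le> (v + f + w) + (2 * S * (A * b1 + b2) + 4 * H + 2 * VV + 2 * RR)" for v H VV w RR p s f
      by (simp only: abs_le_iff distrib_left mult.assoc) linarith
    from this[OF 1 2 3 4] show ?thesis unfolding kPhi'_def W .
  qed
  have cW: "continuous_on {0..h} ?W"
  proof (rule continuous_on_integral2)
    note ct = continuous_on_compose2[OF cper_cont[OF cm, of UNIV]] continuous_on_compose2[OF cper_cont[OF cmt, of UNIV]]
    show "continuous_on ({0..h} \<times> {0..1}) (\<lambda>(r, y). \<bar>m (y + r) - m y\<bar> * (mt (y + r) - mt y))"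
      unfolding case_prod_unfold by (intro continuous_intros ct) auto
  qed
  have "(kPhi' has_integral (kPhi h - kPhi 0)) {0..h}"
    using h kPhi_deriv
    by (intro fundamental_theorem_of_calculus) (auto simp: has_real_derivative_iff_has_vector_derivative[symmetric] intro: has_field_derivative_at_within)
  moreover have "((\<lambda>r. ?W r + ?X) has_integral (integral {0..h} ?W + ?X * h)) {0..h}"
    using has_integral_add[OF integrable_integral[OF integrable_continuous_real[OF cW]] has_integral_const_real[of ?X 0 h]] h
    by (simp add: mult.commute)
  ultimately have "kPhi h - kPhi 0 \<le> integral {0..h} ?W + ?X * h"
    by (rule has_integral_le) (rule der)
  then have up: "kPhi h \<le> integral {0..h} ?W + ?X * h" by (simp add: kPhi_0)
  have "a0 / 3 * Kh h m \<le> kPhi h + h * (A * b1 + b2)"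
  proof -
    let ?d = "\<lambda>y. m (y + h) - m y"
    \<comment> \<open>Increments of the coefficients give h^\<alpha>, those of m give h^\<sigma>;
      \<alpha> + \<sigma> > 1 and h <= 1 leave h.\<close>
    have hp: "h powr \<alpha> * h powr \<sigma> \<le> h"
      using h powr_mono'[of 1 "\<alpha> + \<sigma>" h] sigma(3) by (simp add: powr_add[symmetric])
    have cd: "cper ?d" by (rule cper_diff[OF cper_shift[OF cm] cm])
    let ?F = "\<lambda>y. 1/6 * (a (y + h) + a y) * \<bar>?d y\<bar> ^ 3
     + 1/2 * (a (y + h) - a y) * ((m (y + h) + m y) * (?d y * \<bar>?d y\<bar>)) + (Q (y + h) - Q y) * (?d y * \<bar>?d y\<bar>)"
    have cF: "cper ?F"
      by (intro cper_add[OF cper_add] cper_mult[OF cper_mult] cper_mult[OF cper_diff] cper_power cper_abs cd cper_const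
          cper_add[OF cper_shift[OF ca] ca] cper_diff[OF cper_shift[OF ca] ca] cper_mult[OF cper_add[OF cper_shift[OF cm] cm]]
          cper_mult[OF cd] cper_shift[OF cQ] cQ)
    let ?G = "\<lambda>y. A * h powr \<alpha> * (\<bar>m (y + h) + m y\<bar> * (?d y)\<^sup>2)"
    let ?I = "\<lambda>y. h powr \<alpha> * (qq * (?d y)\<^sup>2)"
    have cG: "cper ?G" by (rule cper_mult[OF cper_const cper_mult[OF cper_abs[OF cper_add[OF cper_shift[OF cm] cm]] cper_power[OF cd]]])
    have cI: "cper ?I" by (rule cper_mult[OF cper_const cper_mult[OF cper_const cper_power[OF cd]]])
    have pw: "a0 / 3 * \<bar>?d y\<bar> ^ 3 \<le> ?F y + ?G y + ?I y" for y
    proof -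
      have da: "\<bar>a (y + h) - a y\<bar> \<le> A * h powr \<alpha>" and dQ: "\<bar>Q (y + h) - Q y\<bar> \<le> qq * h powr \<alpha>"
        using A qq h by (auto simp: holder_def)
      have sq: "\<bar>?d y * \<bar>?d y\<bar>\<bar> = (?d y)\<^sup>2" by (simp add: abs_mult power2_eq_square abs_mult_self_eq)
      have 1: "\<bar>1/2 * (a (y + h) - a y) * ((m (y + h) + m y) * (?d y * \<bar>?d y\<bar>))\<bar> \<le> ?G y"
      proof -
        have "\<bar>1/2 * (a (y + h) - a y) * ((m (y + h) + m y) * (?d y * \<bar>?d y\<bar>))\<bar>
            = (1/2 * \<bar>a (y + h) - a y\<bar>) * (\<bar>m (y + h) + m y\<bar> * (?d y)\<^sup>2)"
          unfolding abs_mult[of _ "(m (y + h) + m y) * _"] abs_mult[of "m (y + h) + m y"] sq by (simp add: abs_mult)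
        also have "\<dots> \<le> (A * h powr \<alpha>) * (\<bar>m (y + h) + m y\<bar> * (?d y)\<^sup>2)"
          using da by (intro mult_right_mono) auto
        finally show ?thesis .
      qed
      have 2: "\<bar>(Q (y + h) - Q y) * (?d y * \<bar>?d y\<bar>)\<bar> \<le> ?I y"
      proof -
        have "\<bar>(Q (y + h) - Q y) * (?d y * \<bar>?d y\<bar>)\<bar> = \<bar>Q (y + h) - Q y\<bar> * (?d y)\<^sup>2"
          unfolding abs_mult[of "Q (y + h) - Q y"] sq ..
        also have "\<dots> \<le> (qq * h powr \<alpha>) * (?d y)\<^sup>2" using dQ by (intro mult_right_mono) auto
        finally show ?thesis by (simp add: mult_ac)
      qed
      have 3: "a0 / 3 * \<bar>?d y\<bar> ^ 3 \<le> 1/6 * (a (y + h) + a y) * \<bar>?d y\<bar> ^ 3"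
        using low(2)[of y] low(2)[of "y + h"] by (intro mult_right_mono) auto
      show ?thesis using 1 2 3 by (simp only: abs_le_iff) linarith
    qed
    have "a0 / 3 * Kh h m = pint (\<lambda>y. a0 / 3 * \<bar>?d y\<bar> ^ 3)" unfolding Kh_def by (rule pint_cmult[symmetric])
    also have "\<dots> \<le> pint (\<lambda>y. ?F y + ?G y + ?I y)"
      by (rule pint_mono[OF cper_mult[OF cper_const cper_power[OF cper_abs[OF cd]]] cper_add[OF cper_add[OF cF cG] cI] pw])
    also have "\<dots> = pint ?F + pint ?G + pint ?I"
      by (simp only: pint_add[OF cper_add[OF cF cG] cI] pint_add[OF cF cG])
    also have "pint ?F = kPhi h" unfolding kPhi_def ..
    also have "pint ?G \<le> h * (A * b1)"
    proof -
      have "pint ?G = A * h powr \<alpha> * pint (\<lambda>y. \<bar>m (y + h) + m y\<bar> * (?d y)\<^sup>2)" by (rule pint_cmult)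
      also have "\<dots> \<le> A * h powr \<alpha> * (h powr \<sigma> * b1)"
        using A_nonneg by (intro mult_left_mono b(3) h) auto
      also have "\<dots> = (h powr \<alpha> * h powr \<sigma>) * (A * b1)" by simp
      also have "\<dots> \<le> h * (A * b1)" using hp A_nonneg bn by (intro mult_right_mono) auto
      finally show ?thesis .
    qed
    also have "pint ?I \<le> h * b2"
    proof -
      have "pint ?I = h powr \<alpha> * (qq * pint (\<lambda>y. (?d y)\<^sup>2))" by (simp only: pint_cmult)
      also have "\<dots> \<le> h powr \<alpha> * (h powr \<sigma> * b2)" by (intro mult_left_mono b(4) h) auto
      also have "\<dots> = (h powr \<alpha> * h powr \<sigma>) * b2" by simp
      also have "\<dots> \<le> h * b2" using hp bn by (intro mult_right_mono) auto
      finally show ?thesis .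
    qed
    finally show ?thesis by (simp add: distrib_left)
  qed
  with up show ?thesis by (simp add: algebra_simps)
qed

end

text \<open>Both e + F and e - F are nondecreasing.\<close>

lemma dominated_variation:
  fixes F e :: "real \<Rightarrow> real"
  assumes F: "\<And>z. (F has_real_derivative F' z) (at z)" and e: "\<And>z. (e has_real_derivative e1 z) (at z)"
    and le: "\<And>z. \<bar>F' z\<bar> \<le> e1 z"
  shows "\<bar>F x - F y\<bar> \<le> \<bar>e x - e y\<bar>"
proof -
  have *: "\<bar>F y - F x\<bar> \<le> \<bar>e y - e x\<bar>" if "x \<le> y" for x y
  proof -
    have "0 \<le> e1 z - F' z" "0 \<le> e1 z + F' z" for z using le[of z] by (auto simp: abs_le_iff)
    then have "e x - F x \<le> e y - F y" "e x + F x \<le> e y + F y"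
      using DERIV_nonneg_imp_nondecreasing[OF that, of "\<lambda>z. e z - F z"] DERIV_diff[OF e F]
        DERIV_nonneg_imp_nondecreasing[OF that, of "\<lambda>z. e z + F z"] DERIV_add[OF e F] by blast+
    then show ?thesis by linarith
  qed
  show ?thesis using *[of x y] *[of y x] by (cases "x \<le> y") (auto simp: abs_minus_commute)
qed

text \<open>The cutoff with its first two derivatives. Because e1 is supported in [-1, 1], the
  densities z e1 and z^2 e1 are bounded by e1, so F1 and F2 vary less than e, and the seminorm of e
  (m) controls every flux term.\<close>

locale entropy =
  fixes \<eta> e e1 F1 F2 :: "real \<Rightarrow> real" and K C0 :: real
  assumes eta: "\<And>z. (\<eta> has_real_derivative e z) (at z)" and e: "\<And>z. (e has_real_derivative e1 z) (at z)"
    and e1: "continuous_on UNIV e1" "\<And>z. 0 \<le> e1 z" "\<And>z. e1 z \<le> K" "\<And>z. 1 < \<bar>z\<bar> \<Longrightarrow> e1 z = 0"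
    and e_le: "\<And>z. \<bar>e z\<bar> \<le> 1"
    and F1: "\<And>z. (F1 has_real_derivative z * e1 z) (at z)" "F1 0 = 0"
    and F2: "\<And>z. (F2 has_real_derivative z\<^sup>2 * e1 z) (at z)"
    and K: "0 < K" and eta_ge: "\<And>z. \<bar>z\<bar> \<le> \<eta> z" and eta_le: "\<And>z. \<eta> z \<le> \<bar>z\<bar> + C0"
begin

lemma F1_var: "\<bar>F1 x - F1 y\<bar> \<le> \<bar>e x - e y\<bar>"
proof (rule dominated_variation[OF F1(1) e])
  show "\<bar>z * e1 z\<bar> \<le> e1 z" for z
    using e1(2)[of z] e1(4)[of z] mult_right_mono[of "\<bar>z\<bar>" 1 "e1 z"] by (cases "\<bar>z\<bar> \<le> 1") (auto simp: abs_mult)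
qed

lemma F2_var: "\<bar>F2 x - F2 y\<bar> \<le> \<bar>e x - e y\<bar>"
proof (rule dominated_variation[OF F2 e])
  show "\<bar>z\<^sup>2 * e1 z\<bar> \<le> e1 z" for z
    using e1(2)[of z] e1(4)[of z] mult_right_mono[of "z\<^sup>2" 1 "e1 z"] by (cases "\<bar>z\<bar> \<le> 1") (auto simp: abs_mult abs_square_le_1)
qed

lemma F1_le: "\<bar>F1 z\<bar> \<le> 2"
  using F1_var[of z 0] e_le[of z] e_le[of 0] F1(2) by simp

context
  fixes m m' :: "real \<Rightarrow> real"
  assumes m: "c1per m m'"
begin

lemma em: "c1per (\<lambda>y. e (m y)) (\<lambda>y. e1 (m y) * m' y)"
  by (rule c1per_compose[OF m e e1(1)])

lemma F1m: "c1per (\<lambda>y. F1 (m y)) (\<lambda>y. m y * e1 (m y) * m' y)"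
  by (rule c1per_compose[OF m F1(1)]) (intro continuous_intros e1(1))

lemma F2m: "c1per (\<lambda>y. F2 (m y)) (\<lambda>y. (m y)\<^sup>2 * e1 (m y) * m' y)"
  by (rule c1per_compose[OF m F2]) (intro continuous_intros e1(1))

lemma Fm_hom2:
  assumes g: "0 < g" "g \<le> 2"
  shows "hom2 g (\<lambda>y. F1 (m y)) \<le> hom2 g (\<lambda>y. e (m y))" "hom2 g (\<lambda>y. F2 (m y)) \<le> hom2 g (\<lambda>y. e (m y))"
  by (rule hom2_contraction[OF g c1per_cper[OF F1m] c1per_fin_hom[OF F1m g(2)] c1per_cper[OF em] c1per_fin_hom[OF em g(2)] F1_var])
     (rule hom2_contraction[OF g c1per_cper[OF F2m] c1per_fin_hom[OF F2m g(2)] c1per_cper[OF em] c1per_fin_hom[OF em g(2)] F2_var])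

text \<open>Cauchy-Schwarz turns L2 increments of e (m) into L1 increments; hence the square root of
  the seminorm and the order g / 2.\<close>

lemma Fm_l1mod:
  assumes g: "0 < g" "g \<le> 2"
  shows "l1mod (g / 2) (2 * sqrt (hom2 g (\<lambda>y. e (m y)))) (\<lambda>y. F1 (m y))"
    "l1mod (g / 2) (2 * sqrt (hom2 g (\<lambda>y. e (m y)))) (\<lambda>y. F2 (m y))"
proof -
  have *: "l1mod (g / 2) (2 * sqrt (hom2 g (\<lambda>y. e (m y)))) (\<lambda>y. F (m y))"
    if F: "cper (\<lambda>y. F (m y))" "\<And>x y. \<bar>F x - F y\<bar> \<le> \<bar>e x - e y\<bar>" for F
    unfolding l1mod_def
  proof (intro conjI allI impI)
    fix r :: real assume r: "0 < r \<and> r \<le> 1"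
    note ce = c1per_cper[OF em]
    have cd: "cper (\<lambda>y. e (m (y + r)) - e (m y))" by (rule cper_diff[OF cper_shift[OF ce] ce])
    have "pint (\<lambda>y. \<bar>F (m (y + r)) - F (m y)\<bar>) \<le> pint (\<lambda>y. \<bar>e (m (y + r)) - e (m y)\<bar>)"
      by (rule pint_mono[OF cper_abs[OF cper_diff[OF cper_shift[OF F(1)] F(1)]] cper_abs[OF cd] F(2)])
    also have "\<dots> \<le> sqrt (pint (\<lambda>y. (e (m (y + r)) - e (m y))\<^sup>2))" by (rule pint_cauchy_schwarz[OF cd])
    also have "\<dots> \<le> sqrt (4 * r powr g * hom2 g (\<lambda>y. e (m y)))"
      by (intro real_sqrt_le_mono delta_sq_le[OF ce c1per_fin_hom[OF em g(2)]]) (use r g in auto)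
    also have "\<dots> = 2 * sqrt (hom2 g (\<lambda>y. e (m y))) * r powr (g / 2)"
      using r by (simp add: real_sqrt_mult powr_half_sqrt[symmetric] powr_powr)
    finally show "pint (\<lambda>y. \<bar>F (m (y + r)) - F (m y)\<bar>) \<le> 2 * sqrt (hom2 g (\<lambda>y. e (m y))) * r powr (g / 2)" .
  qed (simp add: hom2_nonneg)
  show "l1mod (g / 2) (2 * sqrt (hom2 g (\<lambda>y. e (m y)))) (\<lambda>y. F1 (m y))" by (rule *[OF c1per_cper[OF F1m] F1_var])
  show "l1mod (g / 2) (2 * sqrt (hom2 g (\<lambda>y. e (m y)))) (\<lambda>y. F2 (m y))" by (rule *[OF c1per_cper[OF F2m] F2_var])
qed

end

end

lemma convex_cutoff_entropy:
  assumes "convex_cutoff \<eta>"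
  shows "\<exists>F1 F2 K C0. entropy \<eta> (deriv \<eta>) (deriv (deriv \<eta>)) F1 F2 K C0"
proof -
  have sm: "(deriv ^^ n) \<eta> differentiable (at x)" for n x using assms by (auto simp: convex_cutoff_def smooth_def)
  have D: "((deriv ^^ n) \<eta> has_real_derivative (deriv ^^ Suc n) \<eta> x) (at x)" for n x
    using sm[of n x] by (simp add: DERIV_deriv_iff_real_differentiable)
  have d0: "(\<eta> has_real_derivative deriv \<eta> x) (at x)" and d1: "(deriv \<eta> has_real_derivative deriv (deriv \<eta>) x) (at x)"
    and d2: "(deriv (deriv \<eta>) has_real_derivative deriv (deriv (deriv \<eta>)) x) (at x)" for x
    using D[of 0 x] D[of 1 x] D[of 2 x] by (simp_all add: numeral_2_eq_2)
  have c2: "continuous_on UNIV (deriv (deriv \<eta>))"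
    by (intro continuous_at_imp_continuous_on ballI DERIV_isCont[OF d2])
  obtain C where C: "\<And>z. 0 \<le> deriv (deriv \<eta>) z" "\<And>z. deriv (deriv \<eta>) z \<le> C"
    using assms unfolding convex_cutoff_def by blast
  obtain C0 where C0: "\<And>z. 0 \<le> \<eta> z - \<bar>z\<bar>" "\<And>z. \<eta> z - \<bar>z\<bar> \<le> C0"
    using assms unfolding convex_cutoff_def by blast
  have e1: "\<bar>deriv \<eta> z\<bar> \<le> 1" for z using assms unfolding convex_cutoff_def by blast
  have sup: "deriv (deriv \<eta>) z = 0" if "1 < \<bar>z\<bar>" for z
    using assms that closure_subset[of "{z. deriv (deriv \<eta>) z \<noteq> 0}"] unfolding convex_cutoff_def by force
  have anti: "\<exists>F. \<forall>x. (F has_real_derivative f x) (at x)" if "continuous_on UNIV f" for f :: "real \<Rightarrow> real"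
  proof -
    have "isCont f x" for x using that by (simp add: continuous_on_eq_continuous_at)
    then show ?thesis
      using einterval_antiderivative[of "-\<infinity>" "\<infinity>" f] by (auto simp: has_real_derivative_iff_has_vector_derivative)
  qed
  have c3: "continuous_on UNIV (\<lambda>x. x\<^sup>2 * deriv (deriv \<eta>) x)" by (intro continuous_intros c2)
  obtain F2 where F2: "\<And>x. (F2 has_real_derivative x\<^sup>2 * deriv (deriv \<eta>) x) (at x)"
    using anti[OF c3] by blast
  have F1: "((\<lambda>z. z * deriv \<eta> z - \<eta> z + \<eta> 0) has_real_derivative z * deriv (deriv \<eta>) z) (at z)" for z
    by (rule derivative_eq_intros d0 d1 refl)+ simp
  \<comment> \<open>C + 1 in place of C makes the bound strictly positive; F1 is the explicit
    primitive z \<eta>' - \<eta>, normalised at 0.\<close>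
  have "entropy \<eta> (deriv \<eta>) (deriv (deriv \<eta>)) (\<lambda>z. z * deriv \<eta> z - \<eta> z + \<eta> 0) F2 (C + 1) C0"
  proof
    show "deriv (deriv \<eta>) z \<le> C + 1" for z using C(2)[of z] by simp
    show "0 < C + 1" using C(1)[of 0] C(2)[of 0] by linarith
    show "\<bar>z\<bar> \<le> \<eta> z" "\<eta> z \<le> \<bar>z\<bar> + C0" for z using C0[of z] by auto
  qed (use d0 d1 c2 C e1 sup F1 F2 in auto)
  then show ?thesis by blast
qed

section \<open>Two versions of the entropy balance at a fixed time\<close>

context quadratic_flux
begin

context
  fixes \<eta> e e1 F1 F2 K C0 \<gamma> c V V' R R'
  assumes ent: "entropy \<eta> e e1 F1 F2 K C0" and \<gamma>: "1 < \<gamma>" "\<gamma> \<le> 2" and c: "0 < c"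
    and V: "c1per V V'" and R: "c1per R R'"
    and coer: "pint (\<lambda>y. e (m y) * V' y) \<le> - c * hom2 \<gamma> (\<lambda>y. e (m y))"
begin

interpretation entropy \<eta> e e1 F1 F2 K C0 by (rule ent)

lemma L1_expand: "pint (\<lambda>y. e (m y) * (V' y + flux' y + R' y))
  \<le> - c * hom2 \<gamma> (\<lambda>y. e (m y)) + pint (\<lambda>y. F2 (m y) * a' y) + 2 * pint (\<lambda>y. F1 (m y) * Q' y)
    + (c / 2 * hom2 \<gamma> (\<lambda>y. e (m y)) + hom2 (2 - \<gamma>) R / (c / 2)) / 2"
proof -
  note p = em[OF m]
  have "\<bar>pint (\<lambda>y. e (m y) * R' y)\<bar> \<le> (c / 2 * hom2 \<gamma> (\<lambda>y. e (m y)) + hom2 (2 - \<gamma>) R / (c / 2)) / 2"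
    using \<gamma> c by (intro sobolev_pair[OF c1per_cper[OF p] c1per_fin_hom[OF p \<gamma>(2)] R]) auto
  moreover have "pint (\<lambda>y. e (m y) * (V' y + flux' y + R' y)) = pint (\<lambda>y. e (m y) * V' y)
      + (pint (\<lambda>y. F2 (m y) * a' y) + 2 * pint (\<lambda>y. F1 (m y) * Q' y)) + pint (\<lambda>y. e (m y) * R' y)"
    using entropy_flux[OF e e1(1) F1(1) F2]
    by (simp add: pint_mult_add3[OF c1per_cper[OF p] c1per_cper'[OF V] c1per_cper'[OF flux] c1per_cper'[OF R]] mult.commute)
  ultimately show ?thesis using coer by (simp only: abs_le_iff) linarith
qed

text \<open>a, Q0 and R are paired by Sobolev duality; the rest of Q, the corrector, only through
  |F1| <= 2, hence at the price of an L1 norm. The weight c / 2 in the three Young inequalities, the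
  one for Q0 counted twice, uses up the dissipation exactly.\<close>

lemma L1_fixed_Sobolev:
  assumes Q0: "c1per Q0 Q0'" and P: "c1per P P'" and l: "0 \<le> l" and Q': "\<And>y. Q' y = Q0' y + l * P' y"
  shows "pint (\<lambda>y. e (m y) * (V' y + flux' y + R' y))
    \<le> (hom2 (2 - \<gamma>) a + 2 * hom2 (2 - \<gamma>) Q0 + hom2 (2 - \<gamma>) R) / c + 4 * l * pint (\<lambda>y. \<bar>P' y\<bar>)"
proof -
  let ?p = "hom2 \<gamma> (\<lambda>y. e (m y))"
  have g: "0 < \<gamma>" and c2: "0 < c / 2" using \<gamma> c by auto
  note f1 = F1m[OF m] and f2 = F2m[OF m] and le = Fm_hom2[OF m g \<gamma>(2)]
  have 1: "\<bar>pint (\<lambda>y. F2 (m y) * a' y)\<bar> \<le> (c / 2 * ?p + hom2 (2 - \<gamma>) a / (c / 2)) / 2"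
    by (rule order_trans[OF sobolev_pair[OF c1per_cper[OF f2] c1per_fin_hom[OF f2 \<gamma>(2)] a less_imp_le[OF g] c2]])
       (use le(2) c in \<open>simp add: mult_left_mono divide_right_mono\<close>)
  have 2: "\<bar>pint (\<lambda>y. F1 (m y) * Q0' y)\<bar> \<le> (c / 2 * ?p + hom2 (2 - \<gamma>) Q0 / (c / 2)) / 2"
    by (rule order_trans[OF sobolev_pair[OF c1per_cper[OF f1] c1per_fin_hom[OF f1 \<gamma>(2)] Q0 less_imp_le[OF g] c2]])
       (use le(1) c in \<open>simp add: mult_left_mono divide_right_mono\<close>)
  note cP = c1per_cper'[OF P] and cf1 = c1per_cper[OF f1]
  have 3: "pint (\<lambda>y. F1 (m y) * P' y) \<le> 2 * pint (\<lambda>y. \<bar>P' y\<bar>)"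
  proof -
    have "pint (\<lambda>y. F1 (m y) * P' y) \<le> pint (\<lambda>y. 2 * \<bar>P' y\<bar>)"
    proof (rule pint_mono[OF cper_mult[OF cf1 cP] cper_mult[OF cper_const cper_abs[OF cP]]])
      show "F1 (m y) * P' y \<le> 2 * \<bar>P' y\<bar>" for y
        using mult_right_mono[OF F1_le[of "m y"] abs_ge_zero[of "P' y"]] by (simp add: abs_mult[symmetric])
    qed
    then show ?thesis by (simp only: pint_cmult)
  qed
  have "pint (\<lambda>y. F1 (m y) * Q' y) = pint (\<lambda>y. F1 (m y) * Q0' y + l * (F1 (m y) * P' y))"
    by (rule arg_cong[where f = pint]) (auto simp: Q' algebra_simps)
  also have "\<dots> = pint (\<lambda>y. F1 (m y) * Q0' y) + l * pint (\<lambda>y. F1 (m y) * P' y)"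
    by (simp only: pint_add[OF cper_mult[OF cf1 c1per_cper'[OF Q0]] cper_mult[OF cper_const cper_mult[OF cf1 cP]]] pint_cmult)
  also have "\<dots> \<le> pint (\<lambda>y. F1 (m y) * Q0' y) + l * (2 * pint (\<lambda>y. \<bar>P' y\<bar>))"
    using mult_left_mono[OF 3 l] by simp
  finally have 4: "pint (\<lambda>y. F1 (m y) * Q' y) \<le> pint (\<lambda>y. F1 (m y) * Q0' y) + 2 * l * pint (\<lambda>y. \<bar>P' y\<bar>)" by simp
  have "pint (\<lambda>y. e (m y) * (V' y + flux' y + R' y)) \<le> - c * ?p + (c / 2 * ?p + hom2 (2 - \<gamma>) a / (c / 2)) / 2
     + 2 * ((c / 2 * ?p + hom2 (2 - \<gamma>) Q0 / (c / 2)) / 2 + 2 * l * pint (\<lambda>y. \<bar>P' y\<bar>))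
     + (c / 2 * ?p + hom2 (2 - \<gamma>) R / (c / 2)) / 2"
  proof -
    have "x \<le> k + f + 2 * q + r \<Longrightarrow> f \<le> f' \<Longrightarrow> q0 \<le> q0' \<Longrightarrow> q \<le> q0 + w \<Longrightarrow> x \<le> k + f' + 2 * (q0' + w) + r"
      for x k f q r f' q0 q0' w :: real by (simp add: distrib_left)
    from this[OF L1_expand abs_le_D1[OF 1] abs_le_D1[OF 2] 4] show ?thesis .
  qed
  also have "\<dots> = (hom2 (2 - \<gamma>) a + 2 * hom2 (2 - \<gamma>) Q0 + hom2 (2 - \<gamma>) R) / c + 4 * l * pint (\<lambda>y. \<bar>P' y\<bar>)"
    using c by (simp add: field_simps)
  finally show ?thesis .
qed

text \<open>Here the coefficients enter through sewing, with moduli of order \<gamma> / 2 and size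
  the square root of the dissipation. Only the Hoelder constant of the full Q appears, so the bound
  is uniform in \<lambda>.\<close>

lemma L1_fixed_sewing:
  assumes A: "holder \<alpha> A a" and qq: "holder \<alpha> qq Q" and s: "1 < \<alpha> + \<gamma> / 2"
  shows "pint (\<lambda>y. e (m y) * (V' y + flux' y + R' y))
    \<le> (4 * (sew_const (\<alpha> + \<gamma> / 2) * A)\<^sup>2 + 16 * (sew_const (\<alpha> + \<gamma> / 2) * qq)\<^sup>2 + hom2 (2 - \<gamma>) R) / c"
proof -
  let ?p = "hom2 \<gamma> (\<lambda>y. e (m y))" and ?S = "sew_const (\<alpha> + \<gamma> / 2)"
  have g: "0 < \<gamma>" using \<gamma> by auto
  have p: "0 \<le> ?p" by (rule hom2_nonneg)
  note lm = Fm_l1mod[OF m g \<gamma>(2)]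
  have 1: "\<bar>pint (\<lambda>y. F2 (m y) * a' y)\<bar> \<le> ?S * A * (2 * sqrt ?p)"
    using sewing[OF a c1per_cper[OF F2m[OF m]] A lm(2) s] by (simp add: mult.commute)
  have 2: "\<bar>pint (\<lambda>y. F1 (m y) * Q' y)\<bar> \<le> ?S * qq * (2 * sqrt ?p)"
    using sewing[OF Q c1per_cper[OF F1m[OF m]] qq lm(1) s] by (simp add: mult.commute)
  have 3: "sqrt ?p * (2 * (?S * A)) \<le> (c / 2 * (sqrt ?p)\<^sup>2 + (2 * (?S * A))\<^sup>2 / (c / 2)) / 2"
    "sqrt ?p * (4 * (?S * qq)) \<le> (c / 2 * (sqrt ?p)\<^sup>2 + (4 * (?S * qq))\<^sup>2 / (c / 2)) / 2"
    using c by (intro young_mult; simp)+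
  have "pint (\<lambda>y. e (m y) * (V' y + flux' y + R' y)) \<le> - c * ?p + (c / 2 * ?p + (2 * (?S * A))\<^sup>2 / (c / 2)) / 2
     + (c / 2 * ?p + (4 * (?S * qq))\<^sup>2 / (c / 2)) / 2 + (c / 2 * ?p + hom2 (2 - \<gamma>) R / (c / 2)) / 2"
  proof -
    have "x \<le> - c * ?p + f + 2 * q + r \<Longrightarrow> f \<le> ?S * A * (2 * z) \<Longrightarrow> q \<le> ?S * qq * (2 * z) \<Longrightarrow>
        z * (2 * (?S * A)) \<le> f' \<Longrightarrow> z * (4 * (?S * qq)) \<le> q' \<Longrightarrow> x \<le> - c * ?p + f' + q' + r"
      for x f q r f' q' z :: real by (simp add: mult_ac)
    from this[OF L1_expand abs_le_D1[OF 1] abs_le_D1[OF 2] 3] show ?thesis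
      by (simp only: real_sqrt_pow2[OF p])
  qed
  also have "\<dots> = (4 * (?S * A)\<^sup>2 + 16 * (?S * qq)\<^sup>2 + hom2 (2 - \<gamma>) R) / c - c / 4 * ?p"
    using c by (simp add: field_simps power_mult_distrib)
  also have "\<dots> \<le> (4 * (?S * A)\<^sup>2 + 16 * (?S * qq)\<^sup>2 + hom2 (2 - \<gamma>) R) / c" using c p by simp
  finally show ?thesis .
qed

end

end

subsection \<open>Integration in time\<close>

abbreviation MT :: "real \<Rightarrow> real measure" where "MT T \<equiv> restrict_space lborel {0..T}"

lemma nn_MT: "(\<integral>\<^sup>+t\<in>{0..T}. X t \<partial>lborel) = (\<integral>\<^sup>+t. X t \<partial>MT T)"
  by (simp add: nn_integral_restrict_space)

lemma MT_const: "0 \<le> T \<Longrightarrow> (\<integral>\<^sup>+t. c \<partial>MT T) = c * ennreal T"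
  unfolding nn_MT[symmetric] by (simp add: nn_integral_cmult_indicator)

lemma cont_MT: "continuous_on {0..T} (f :: real \<Rightarrow> 'a::topological_space) \<Longrightarrow> f \<in> borel_measurable (MT T)"
  using borel_measurable_continuous_on_restrict[of "{0..T}" f] by (simp cong: measurable_cong_sets sets_restrict_space_cong)

lemma nn_MT_cont:
  fixes f :: "real \<Rightarrow> real"
  assumes "continuous_on {0..T} f" "\<And>t. t \<in> {0..T} \<Longrightarrow> 0 \<le> f t"
  shows "(\<integral>\<^sup>+t. ennreal (f t) \<partial>MT T) = ennreal (integral {0..T} f)"
  unfolding nn_MT[symmetric] using assms
  by (intro nn_integral_has_integral_lebesgue') (auto simp: has_integral_integral[symmetric] intro: integrable_continuous_real)

text \<open>The inequality holds almost everywhere and F may have an infinite integral, so all terms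
  are kept nonnegative: G' is split into positive and negative parts, and the integral of the
  continuous negative part, a finite number, is cancelled at the end.\<close>

lemma energy_integrate:
  fixes G G' P F :: "real \<Rightarrow> real"
  assumes T: "0 \<le> T" and G: "\<And>t. t \<in> {0..T} \<Longrightarrow> (G has_real_derivative G' t) (at t within {0..T})" "continuous_on {0..T} G'"
    and [measurable]: "P \<in> borel_measurable (MT T)" "F \<in> borel_measurable (MT T)"
    and pos: "\<And>t. t \<in> {0..T} \<Longrightarrow> 0 \<le> P t" "\<And>t. t \<in> {0..T} \<Longrightarrow> 0 \<le> F t" "0 \<le> G 0" "0 \<le> G T"
    and le: "AE t in MT T. G' t + P t \<le> F t"
  shows "ennreal (G T) + (\<integral>\<^sup>+t. ennreal (P t) \<partial>MT T) \<le> ennreal (G 0) + (\<integral>\<^sup>+t. ennreal (F t) \<partial>MT T)"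
proof -
  let ?p = "\<lambda>t. max (G' t) 0" and ?n = "\<lambda>t. max (- G' t) 0"
  have c: "continuous_on {0..T} ?p" "continuous_on {0..T} ?n" by (intro continuous_intros G(2))+
  have [measurable]: "?p \<in> borel_measurable (MT T)" "?n \<in> borel_measurable (MT T)" using c by (auto intro: cont_MT)
  have "AE t in MT T. t \<in> {0..T}" by (rule AE_I2) (simp add: space_restrict_space)
  with le have "AE t in MT T. ennreal (?p t) + ennreal (P t) \<le> ennreal (F t) + ennreal (?n t)"
    by eventually_elim (use pos in \<open>auto simp: ennreal_plus[symmetric] max_def simp del: ennreal_plus intro!: ennreal_leI\<close>)
  then have "(\<integral>\<^sup>+t. ennreal (?p t) + ennreal (P t) \<partial>MT T) \<le> (\<integral>\<^sup>+t. ennreal (F t) + ennreal (?n t) \<partial>MT T)"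
    by (rule nn_integral_mono_AE)
  then have 1: "ennreal (integral {0..T} ?p) + (\<integral>\<^sup>+t. ennreal (P t) \<partial>MT T)
      \<le> (\<integral>\<^sup>+t. ennreal (F t) \<partial>MT T) + ennreal (integral {0..T} ?n)"
    by (simp add: nn_integral_add nn_MT_cont[OF c(1)] nn_MT_cont[OF c(2)])
  have "(G' has_integral (G T - G 0)) {0..T}"
    by (rule fundamental_theorem_of_calculus[OF T]) (use G(1) in \<open>auto simp: has_real_derivative_iff_has_vector_derivative\<close>)
  moreover have "integral {0..T} ?p - integral {0..T} ?n = integral {0..T} (\<lambda>t. ?p t - ?n t)"
    by (rule Henstock_Kurzweil_Integration.integral_diff[symmetric]; intro integrable_continuous_real c)
  moreover have "(\<lambda>t. ?p t - ?n t) = G'" by (auto simp: max_def)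
  ultimately have eq: "G 0 + integral {0..T} ?p = G T + integral {0..T} ?n"
    by (simp add: integral_unique)
  have nn: "0 \<le> integral {0..T} ?p" "0 \<le> integral {0..T} ?n"
    by (intro Henstock_Kurzweil_Integration.integral_nonneg integrable_continuous_real c; simp)+
  have "ennreal (integral {0..T} ?n) + (ennreal (G T) + (\<integral>\<^sup>+t. ennreal (P t) \<partial>MT T))
      = ennreal (G T + integral {0..T} ?n) + (\<integral>\<^sup>+t. ennreal (P t) \<partial>MT T)"
    using pos nn by (simp add: add_ac)
  also have "\<dots> = ennreal (G 0) + (ennreal (integral {0..T} ?p) + (\<integral>\<^sup>+t. ennreal (P t) \<partial>MT T))"
    using pos nn by (simp add: eq[symmetric] add_ac)
  also have "\<dots> \<le> ennreal (integral {0..T} ?n) + (ennreal (G 0) + (\<integral>\<^sup>+t. ennreal (F t) \<partial>MT T))"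
    using add_left_mono[OF 1, of "ennreal (G 0)"] by (simp add: add_ac)
  finally show ?thesis by (simp add: ennreal_add_left_cancel_le)
qed

lemma tonelli_MT:
  fixes Kf :: "real \<Rightarrow> real \<Rightarrow> real"
  assumes K: "continuous_on ({0..T} \<times> UNIV) (\<lambda>(t, h). Kf t h)" and [measurable]: "w \<in> borel_measurable borel"
  shows "(\<integral>\<^sup>+t. (\<integral>\<^sup>+h\<in>{0..1}. w h * ennreal (Kf t h) \<partial>lborel) \<partial>MT T)
    = (\<integral>\<^sup>+h\<in>{0..1}. w h * (\<integral>\<^sup>+t. ennreal (Kf t h) \<partial>MT T) \<partial>lborel)"
    and "(\<lambda>t. \<integral>\<^sup>+h\<in>{0..1}. w h * ennreal (Kf t h) \<partial>lborel) \<in> borel_measurable (MT T)"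
proof -
  \<comment> \<open>Extension by zero outside the closed strip, where the integrand is arbitrary,
    gives a jointly Borel function.\<close>
  have "(\<lambda>x. indicator ({0..T} \<times> UNIV) x *\<^sub>R (case x of (t, h) \<Rightarrow> Kf t h)) \<in> borel_measurable borel"
    by (rule borel_measurable_continuous_on_indicator[OF _ K]) (intro borel_closed closed_Times; simp)
  moreover have "indicator ({0..T} \<times> UNIV) x *\<^sub>R (case x of (t, h) \<Rightarrow> Kf t h) = indicator {0..T} (fst x) * Kf (fst x) (snd x)" for x :: "real \<times> real"
    by (cases x) (auto simp: indicator_def)
  ultimately have [measurable]: "(\<lambda>x. indicator {0..T} (fst x) * Kf (fst x) (snd x)) \<in> borel_measurable (borel \<Otimes>\<^sub>M borel)"
    by (simp add: borel_prod)
  let ?k = "\<lambda>t h. w h * ennreal (indicator {0..T} t * Kf t h) * indicator {0..1} h"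
  have m: "(\<lambda>(t, h). ?k t h) \<in> borel_measurable (lborel \<Otimes>\<^sub>M lborel)"
    unfolding case_prod_unfold by measurable
  have [measurable]: "(\<lambda>t. indicator {0..T} t * Kf t h) \<in> borel_measurable borel" for h
    using measurable_compose[OF measurable_Pair2'[of h borel borel] \<open>_ \<in> borel_measurable (borel \<Otimes>\<^sub>M borel)\<close>] by simp
  have "(\<integral>\<^sup>+t. (\<integral>\<^sup>+h\<in>{0..1}. w h * ennreal (Kf t h) \<partial>lborel) \<partial>MT T) = (\<integral>\<^sup>+t. (\<integral>\<^sup>+h. ?k t h \<partial>lborel) \<partial>lborel)"
    unfolding nn_MT[symmetric] by (intro nn_integral_cong) (auto simp: indicator_def)
  also have "\<dots> = (\<integral>\<^sup>+h. (\<integral>\<^sup>+t. ?k t h \<partial>lborel) \<partial>lborel)"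
    by (rule lborel_pair.Fubini'[OF m, symmetric])
  also have "\<dots> = (\<integral>\<^sup>+h\<in>{0..1}. w h * (\<integral>\<^sup>+t. ennreal (Kf t h) \<partial>MT T) \<partial>lborel)"
  proof (intro nn_integral_cong)
    fix h
    have "(\<integral>\<^sup>+t. ?k t h \<partial>lborel) = (w h * indicator {0..1} h) * (\<integral>\<^sup>+t. ennreal (indicator {0..T} t * Kf t h) \<partial>lborel)"
      by (subst nn_integral_cmult[symmetric], measurable) (simp add: mult_ac)
    also have "(\<integral>\<^sup>+t. ennreal (indicator {0..T} t * Kf t h) \<partial>lborel) = (\<integral>\<^sup>+t. ennreal (Kf t h) \<partial>MT T)"
      unfolding nn_MT[symmetric] by (intro nn_integral_cong) (auto simp: indicator_def)
    finally show "(\<integral>\<^sup>+t. ?k t h \<partial>lborel) = w h * (\<integral>\<^sup>+t. ennreal (Kf t h) \<partial>MT T) * indicator {0..1} h"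
      by (simp add: mult_ac)
  qed
  finally show "(\<integral>\<^sup>+t. (\<integral>\<^sup>+h\<in>{0..1}. w h * ennreal (Kf t h) \<partial>lborel) \<partial>MT T)
    = (\<integral>\<^sup>+h\<in>{0..1}. w h * (\<integral>\<^sup>+t. ennreal (Kf t h) \<partial>MT T) \<partial>lborel)" .
  have "(\<lambda>t. \<integral>\<^sup>+h. ?k t h \<partial>lborel) \<in> borel_measurable (MT T)"
    by (intro measurable_restrict_space1 lborel.borel_measurable_nn_integral m)
  then show "(\<lambda>t. \<integral>\<^sup>+h\<in>{0..1}. w h * ennreal (Kf t h) \<partial>lborel) \<in> borel_measurable (MT T)"
    by (rule measurable_cong[THEN iffD1, rotated]) (auto simp: space_restrict_space intro!: nn_integral_cong)
qed

section \<open>Joint continuity on the strip and measurability in time\<close>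

definition jc :: "real \<Rightarrow> (real \<Rightarrow> real \<Rightarrow> real) \<Rightarrow> bool" where
  "jc T f \<longleftrightarrow> continuous_on ({0..T} \<times> UNIV) (\<lambda>p. f (fst p) (snd p))"

lemma jc_subst:
  assumes "jc T f" "continuous_on S u" "continuous_on S v" "\<And>x. x \<in> S \<Longrightarrow> u x \<in> {0..T}"
  shows "continuous_on S (\<lambda>x. f (u x) (v x))"
proof -
  have "(\<lambda>x. (u x, v x)) ` S \<subseteq> {0..T} \<times> UNIV" using assms(4) by blast
  from continuous_on_compose2[OF assms(1)[unfolded jc_def] continuous_on_Pair[OF assms(2,3)] this] show ?thesis by simp
qed

lemma jc_add: "jc T f \<Longrightarrow> jc T g \<Longrightarrow> jc T (\<lambda>t y. f t y + g t y)"
  and jc_mult: "jc T f \<Longrightarrow> jc T g \<Longrightarrow> jc T (\<lambda>t y. f t y * g t y)"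
  and jc_const: "jc T (\<lambda>t y. c)"
  unfolding jc_def by (intro continuous_intros; assumption)+

lemma jc_comp: "jc T f \<Longrightarrow> continuous_on UNIV F \<Longrightarrow> jc T (\<lambda>t y. F (f t y))"
  unfolding jc_def by (rule continuous_on_compose2[of UNIV F]) auto

lemma jc_pint: "jc T f \<Longrightarrow> continuous_on {0..T} (\<lambda>t. pint (f t))"
  by (rule continuous_on_integral2) (auto simp: jc_def case_prod_unfold elim: continuous_on_subset)

lemma jc_bounded:
  assumes f: "jc T f" "\<And>t. t \<in> {0..T} \<Longrightarrow> cper (f t)"
  shows "\<exists>B\<ge>0. \<forall>t\<in>{0..T}. \<forall>y. \<bar>f t y\<bar> \<le> B"
proof -
  have "compact ((\<lambda>p. f (fst p) (snd p)) ` ({0..T} \<times> {0..1}))"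
    by (intro compact_continuous_image compact_Times compact_Icc continuous_on_subset[OF f(1)[unfolded jc_def]]) auto
  then obtain B where B: "\<And>p. p \<in> {0..T} \<times> {0..1} \<Longrightarrow> \<bar>f (fst p) (snd p)\<bar> \<le> B"
    using compact_imp_bounded[of "(\<lambda>p. f (fst p) (snd p)) ` ({0..T} \<times> {0..1})"] unfolding bounded_iff by force
  have "\<bar>f t y\<bar> \<le> max B 0" if t: "t \<in> {0..T}" for t y
    using B[of "(t, frac y)"] cper_frac[OF f(2)[OF t], of y] t frac_ge_0[of y] frac_lt_1[of y] by (auto simp: less_imp_le)
  then show ?thesis by (intro exI[of _ "max B 0"]) auto
qed

lemma leibniz_MT:
  assumes "\<And>t y. t \<in> {0..T} \<Longrightarrow> ((\<lambda>s. f s y) has_real_derivative f' t y) (at t within {0..T})"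
    and "jc T f" "jc T f'" and t: "t \<in> {0..T}"
  shows "((\<lambda>t. integral {a..b} (f t)) has_real_derivative integral {a..b} (f' t)) (at t within {0..T})"
proof -
  have "((\<lambda>t. integral (cbox a b) (f t)) has_field_derivative integral (cbox a b) (f' t)) (at t within {0..T})"
  proof (rule leibniz_rule_field_derivative)
    show "f s integrable_on cbox a b" if "s \<in> {0..T}" for s
      unfolding cbox_interval by (intro integrable_continuous_real jc_subst[OF assms(2)]) (use that in \<open>auto intro: continuous_intros\<close>)
    show "continuous_on ({0..T} \<times> cbox a b) (\<lambda>(x, y). f' x y)"
      using assms(3) by (auto simp: jc_def case_prod_unfold elim: continuous_on_subset)
  qed (use assms t in auto)
  then show ?thesis by (simp add: cbox_interval)
qed

lemma meas_fc:
  assumes "jc T f" "\<And>t. t \<in> {0..T} \<Longrightarrow> cper (f t)"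
  shows "(\<lambda>t. fc (f t) k) \<in> borel_measurable (MT T)"
proof -
  have "continuous_on {0..T} (\<lambda>t. pint (\<lambda>x. complex_of_real (f t x) * cis (- 2 * pi * of_int k * x)))"
    by (rule continuous_on_integral2)
       (auto simp: case_prod_unfold intro!: continuous_intros jc_subst[OF assms(1)])
  then have "continuous_on {0..T} (\<lambda>t. fc (f t) k)"
    by (rule continuous_on_cong[THEN iffD1, OF refl, rotated]) (simp add: fc_pint[OF assms(2)])
  then show ?thesis by (rule cont_MT)
qed

lemma meas_weighted:
  assumes "jc T f" "\<And>t. t \<in> {0..T} \<Longrightarrow> cper (f t)"
  shows "(\<lambda>t. \<integral>\<^sup>+k. ennreal (w k * (cmod (fc (f t) k))\<^sup>2) \<partial>count_space UNIV) \<in> borel_measurable (MT T)"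
proof -
  have [measurable]: "\<And>k. (\<lambda>t. fc (f t) k) \<in> borel_measurable (MT T)" by (rule meas_fc[OF assms])
  have "(\<integral>\<^sup>+k. ennreal (w k * (cmod (fc (f t) k))\<^sup>2) \<partial>count_space UNIV)
     = (\<Sum>n. ennreal (w (int_decode n) * (cmod (fc (f t) (int_decode n)))\<^sup>2))" for t
    by (subst nn_integral_bij_count_space[OF bij_int_decode, symmetric]) (rule nn_integral_count_space_nat)
  then show ?thesis by simp
qed

lemma meas_hom2:
  assumes "jc T f" "\<And>t. t \<in> {0..T} \<Longrightarrow> c1per (f t) (f' t)" "g \<le> 2"
  shows "(\<lambda>t. hom2 g (f t)) \<in> borel_measurable (MT T)"
proof -
  have c: "cper (f t)" if "t \<in> {0..T}" for t by (rule c1per_cper[OF assms(2)[OF that]])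
  have "(\<lambda>t. enn2real (Hs_hom_sq (g / 2) (fc (f t)))) \<in> borel_measurable (MT T)"
    unfolding Hs_hom_sq_def by (intro borel_measurable_enn2real meas_weighted[OF assms(1) c])
  then show ?thesis
  proof (rule measurable_cong[THEN iffD1, rotated])
    fix t assume "t \<in> space (MT T)"
    then have "fin_hom (2 * (g / 2)) (f t)" using c1per_fin_hom[OF assms(2,3)] by (simp add: space_restrict_space)
    from Hs_hom_sq_hom2[OF this] show "enn2real (Hs_hom_sq (g / 2) (fc (f t))) = hom2 g (f t)" by (simp add: hom2_nonneg)
  qed
qed

text \<open>Countable suprema preserve measurability; this makes \<open>C_norm\<close> measurable in
  time.\<close>

lemma SUP_rat:
  fixes f :: "real \<Rightarrow> real"
  assumes "continuous_on UNIV f"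
  shows "(SUP x. ennreal (f x)) = (SUP x\<in>\<rat>. ennreal (f x))"
proof (rule antisym[OF SUP_least SUP_subset_mono])
  fix x
  show "ennreal (f x) \<le> (SUP x\<in>\<rat>. ennreal (f x))"
  proof (rule dense_le)
    fix c assume c: "c < ennreal (f x)"
    then obtain r where r: "c = ennreal r" "0 \<le> r" by (cases c) auto
    with c have "r < f x" by (simp add: ennreal_less_iff)
    moreover have "open {z. r < f z}" by (intro open_Collect_less continuous_intros assms)
    ultimately obtain d where d: "0 < d" "\<And>z. \<bar>z - x\<bar> < d \<Longrightarrow> r < f z"
      unfolding open_dist dist_real_def by blast
    obtain z where "z \<in> \<rat>" "x < z" "z < x + d" using Rats_dense_in_real[of x "x + d"] d by auto
    then have "c \<le> ennreal (f z)" using d(2)[of z] r by (auto intro: ennreal_leI)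
    also have "\<dots> \<le> (SUP x\<in>\<rat>. ennreal (f x))" using \<open>z \<in> \<rat>\<close> by (rule SUP_upper)
    finally show "c \<le> (SUP x\<in>\<rat>. ennreal (f x))" .
  qed
qed auto

lemma (in dyadic) meas_C_norm:
  assumes "jc T f" "\<And>t. t \<in> {0..T} \<Longrightarrow> cper (f t)"
  shows "(\<lambda>t. C_norm \<theta> \<phi> s (f t)) \<in> borel_measurable (MT T)"
proof -
  have [measurable]: "\<And>k. (\<lambda>t. fc (f t) k) \<in> borel_measurable (MT T)" by (rule meas_fc[OF assms])
  have [measurable]: "(\<lambda>t. blk J (f t) x) \<in> borel_measurable (MT T)" for J x unfolding blk_eq by measurable
  have "(SUP x. ennreal \<bar>blk J (f t) x\<bar>) = (SUP x\<in>\<rat>. ennreal \<bar>blk J (f t) x\<bar>)" for J t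
    by (rule SUP_rat) (rule cper_cont[OF cper_abs[OF cper_blk]])
  then show ?thesis unfolding C_norm_def
    by (simp only:) (intro borel_measurable_SUP borel_measurable_times; simp add: countable_rat)
qed

lemma Hs_sq_le:
  assumes s: "0 \<le> s" "s \<le> 1" and u: "cper u" "fin_hom (2 * s) u"
  shows "Hs_sq s (fc u) \<le> ennreal (2 * (pint (\<lambda>x. (u x)\<^sup>2) + hom2 (2 * s) u))"
proof -
  have w: "(1 + (2 * pi * of_int k)\<^sup>2) powr s \<le> 2 * (1 + lam k powr (2 * s))" for k :: int
  proof (cases "k = 0")
    case False
    have l: "1 \<le> lam k" by (rule lam_ge1[OF False])
    have "1 + (2 * pi * of_int k)\<^sup>2 \<le> 2 * (lam k)\<^sup>2" using power_mono[OF l, of 2] by (simp add: lam_def)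
    then have "(1 + (2 * pi * of_int k)\<^sup>2) powr s \<le> (2 * (lam k)\<^sup>2) powr s" using s by (intro powr_mono2) auto
    also have "\<dots> = 2 powr s * lam k powr (2 * s)" using l by (simp add: powr_mult powr_powr[symmetric])
    also have "\<dots> \<le> 2 * lam k powr (2 * s)" using s powr_mono[of s 1 2] by (intro mult_right_mono) auto
    finally show ?thesis by simp
  qed simp
  let ?c = "\<lambda>k. (cmod (fc u k))\<^sup>2"
  note p = parseval_sq[OF u(1)] and h = fin_hom_has_sum[OF u(2)]
  have sm: "((\<lambda>k. 2 * (?c k + lam k powr (2 * s) * ?c k)) has_sum 2 * (pint (\<lambda>x. (u x)\<^sup>2) + hom2 (2 * s) u)) UNIV"
    by (intro has_sum_cmult_right has_sum_add p h)
  have "Hs_sq s (fc u) \<le> (\<integral>\<^sup>+k. ennreal (2 * (?c k + lam k powr (2 * s) * ?c k)) \<partial>count_space UNIV)"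
    unfolding Hs_sq_def using mult_right_mono[OF w, of "?c _"] by (intro nn_integral_mono ennreal_leI) (simp add: algebra_simps)
  also have "\<dots> = ennreal (2 * (pint (\<lambda>x. (u x)\<^sup>2) + hom2 (2 * s) u))"
    using nn_infsum[OF _ has_sum_imp_summable[OF sm]] infsumI[OF sm] by simp
  finally show ?thesis .
qed

lemma hom2_le_Hs_sq:
  assumes s: "0 \<le> s" and u: "fin_hom (2 * s) u"
  shows "ennreal (hom2 (2 * s) u) \<le> Hs_sq s (fc u)"
  unfolding Hs_hom_sq_hom2[OF u, symmetric] Hs_hom_sq_def Hs_sq_def
proof (intro nn_integral_mono ennreal_leI mult_right_mono)
  show "\<bar>2 * pi * of_int k\<bar> powr (2 * s) \<le> (1 + (2 * pi * of_int k)\<^sup>2) powr s" for k :: int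
    using powr_mono2[OF s, of "(2 * pi * of_int k)\<^sup>2" "1 + (2 * pi * of_int k)\<^sup>2"]
    by (simp add: powr_powr[symmetric])
qed auto

text \<open>Joint continuity of the first space derivative is included so that seminorms of orders
  up to one are bounded on the closed strip.\<close>

definition jc1 :: "real \<Rightarrow> (real \<Rightarrow> real \<Rightarrow> real) \<Rightarrow> bool" where
  "jc1 T f \<longleftrightarrow> jc T f \<and> jc T (\<lambda>t. deriv (f t)) \<and> (\<forall>t\<in>{0..T}. c1per (f t) (deriv (f t)))"

lemma jc_cong: "jc T f \<Longrightarrow> (\<And>t y. t \<in> {0..T} \<Longrightarrow> f t y = g t y) \<Longrightarrow> jc T g"
  unfolding jc_def by (erule continuous_on_eq) (auto simp: mem_Times_iff)

lemma c1per_imp_deriv: "c1per f f' \<Longrightarrow> deriv f = f'"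
  by (rule ext) (rule DERIV_imp_deriv[OF c1per_deriv])

lemma jc1I:
  assumes "jc T f" "jc T f'" "\<And>t. t \<in> {0..T} \<Longrightarrow> c1per (f t) (f' t)"
  shows "jc1 T f"
  unfolding jc1_def using assms c1per_imp_deriv[OF assms(3)] by (auto intro: jc_cong[OF assms(2)])

lemma jc1D:
  assumes "jc1 T f"
  shows "jc T f" "jc T (\<lambda>t. deriv (f t))" "t \<in> {0..T} \<Longrightarrow> c1per (f t) (deriv (f t))"
    "t \<in> {0..T} \<Longrightarrow> cper (f t)" "t \<in> {0..T} \<Longrightarrow> cper (deriv (f t))"
  using assms by (auto simp: jc1_def intro: c1per_cper c1per_cper')

lemma jc1_mult: "jc1 T f \<Longrightarrow> jc1 T g \<Longrightarrow> jc1 T (\<lambda>t y. f t y * g t y)"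
  by (rule jc1I[OF jc_mult jc_add[OF jc_mult jc_mult] c1per_mult]; erule jc1D; assumption?)

lemma jc1_add: "jc1 T f \<Longrightarrow> jc1 T g \<Longrightarrow> jc1 T (\<lambda>t y. f t y + g t y)"
  by (rule jc1I[OF jc_add jc_add c1per_add]; erule jc1D; assumption?)

lemma jc1_const: "jc1 T (\<lambda>t y. c)"
  by (rule jc1I[OF jc_const jc_const c1per_const])

lemma jc1_smooth_strip:
  assumes "smooth_strip T f"
  shows "jc1 T f" "jc1 T (\<lambda>t. deriv (f t))" "\<exists>ft. jc T ft \<and> (\<forall>t\<in>{0..T}. \<forall>y. ((\<lambda>s. f s y) has_real_derivative ft t y) (at t within {0..T}))"
proof -
  obtain d where d: "strip_derivs T f d" using assms smooth_strip_derivs by blast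
  have jd: "jc T (d i j)" for i j using strip_derivs_cont[OF d] by (simp add: jc_def case_prod_unfold)
  have sm: "smper (f t)" if "t \<in> {0..T}" for t using smooth_strip_smper[OF assms that] .
  have 0: "d 0 0 t = f t" if "t \<in> {0..T}" for t using strip_derivsD(2)[OF d that] .
  have 1: "d 0 1 t = deriv (f t)" if t: "t \<in> {0..T}" for t
    using strip_derivsD(4)[OF d t, of 0 0] by (auto simp: 0[OF t] intro!: ext DERIV_imp_deriv[symmetric])
  have 2: "d 0 2 t = deriv (deriv (f t))" if t: "t \<in> {0..T}" for t
    using strip_derivsD(4)[OF d t, of 0 1] by (auto simp: 1[OF t, unfolded One_nat_def] numeral_2_eq_2 intro!: ext DERIV_imp_deriv[symmetric])
  show "jc1 T f"
    by (rule jc1I[OF jc_cong[OF jd[of 0 0]] jc_cong[OF jd[of 0 1]] smper_c1per(1)[OF sm]]) (simp_all only: 0 1)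
  show "jc1 T (\<lambda>t. deriv (f t))"
    by (rule jc1I[OF jc_cong[OF jd[of 0 1]] jc_cong[OF jd[of 0 2]] smper_c1per(1)[OF smper_c1per(2)[OF sm]]]) (simp_all only: 1 2)
  have "((\<lambda>s. f s y) has_real_derivative d 1 0 t y) (at t within {0..T})" if t: "t \<in> {0..T}" for t y
    using strip_derivsD(3)[OF d t, of 0 0 y]
    unfolding One_nat_def by (rule has_field_derivative_transform_within[OF _ zero_less_one t]) (simp only: 0)
  then show "\<exists>ft. jc T ft \<and> (\<forall>t\<in>{0..T}. \<forall>y. ((\<lambda>s. f s y) has_real_derivative ft t y) (at t within {0..T}))"
    using jd[of 1 0] by blast
qed

lemma jc1_Hs_bounded:
  assumes f: "jc1 T f" and s: "0 \<le> s" "s \<le> 1"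
  shows "\<exists>B. \<forall>t\<in>{0..T}. Hs_sq s (fc (f t)) \<le> ennreal B \<and> Hs_hom_sq s (fc (f t)) \<le> ennreal B
    \<and> hom2 (2 * s) (f t) \<le> B \<and> pint (\<lambda>x. \<bar>f t x\<bar>) \<le> B \<and> (\<forall>x. \<bar>f t x\<bar> \<le> B)"
proof -
  obtain B0 where B0: "0 \<le> B0" "\<And>t y. t \<in> {0..T} \<Longrightarrow> \<bar>f t y\<bar> \<le> B0"
    using jc_bounded[OF jc1D(1,4)[OF f]] by blast
  obtain B1 where B1: "0 \<le> B1" "\<And>t y. t \<in> {0..T} \<Longrightarrow> \<bar>deriv (f t) y\<bar> \<le> B1"
    using jc_bounded[OF jc1D(2,5)[OF f]] by blast
  define B where "B = 2 * (B0\<^sup>2 + B1\<^sup>2) + B0"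
  show ?thesis
  proof (intro exI[of _ B] ballI)
    fix t assume t: "t \<in> {0..T}"
    note c1 = jc1D(3)[OF f t] and c = jc1D(4)[OF f t] and c' = jc1D(5)[OF f t]
    have fin: "fin_hom (2 * s) (f t)" using s by (intro c1per_fin_hom[OF c1]) simp
    have sq: "u\<^sup>2 \<le> B\<^sup>2" if "\<bar>u\<bar> \<le> B" for u B :: real using that power_mono[OF that, of 2] by simp
    have p0: "pint (\<lambda>x. (f t x)\<^sup>2) \<le> B0\<^sup>2"
      using pint_mono[OF cper_power[OF c] cper_const, of 2 "B0\<^sup>2"] sq[OF B0(2)[OF t]] by simp
    have "hom2 2 (f t) \<le> B1\<^sup>2"
      using pint_mono[OF cper_power[OF c'] cper_const, of 2 "B1\<^sup>2"] sq[OF B1(2)[OF t]] by (simp add: c1per_hom2(2)[OF c1])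
    then have h: "hom2 (2 * s) (f t) \<le> B1\<^sup>2" using hom2_mono[OF c1per_hom2(1)[OF c1], of "2 * s"] s by simp
    have p1: "pint (\<lambda>x. \<bar>f t x\<bar>) \<le> B0"
      using pint_mono[OF cper_abs[OF c] cper_const, of B0] B0(2)[OF t] by simp
    have B: "B0 \<le> B" "B1\<^sup>2 \<le> B" "2 * (B0\<^sup>2 + B1\<^sup>2) \<le> B"
      using B0(1) zero_le_power2[of B0] zero_le_power2[of B1] unfolding B_def distrib_left by linarith+
    have "Hs_sq s (fc (f t)) \<le> ennreal (2 * (pint (\<lambda>x. (f t x)\<^sup>2) + hom2 (2 * s) (f t)))" by (rule Hs_sq_le[OF s c fin])
    also have "\<dots> \<le> ennreal B" by (rule ennreal_leI[OF order_trans[OF mult_left_mono[OF add_mono[OF p0 h]] B(3)]]) simp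
    finally show "Hs_sq s (fc (f t)) \<le> ennreal B \<and> Hs_hom_sq s (fc (f t)) \<le> ennreal B \<and> hom2 (2 * s) (f t) \<le> B
        \<and> pint (\<lambda>x. \<bar>f t x\<bar>) \<le> B \<and> (\<forall>x. \<bar>f t x\<bar> \<le> B)"
      using order_trans[OF h B(2)] order_trans[OF p1 B(1)] order_trans[OF B0(2)[OF t] B(1)]
      unfolding Hs_hom_sq_hom2[OF fin] by (auto intro: ennreal_leI)
  qed
qed

section \<open>Regularity of the coefficients and the equation on the strip\<close>

locale strip_solution =
  fixes \<theta> \<phi> :: "real \<Rightarrow> real" and \<gamma> \<beta> \<rho> T J0 J1 L Ma MQ0 MQ MR :: real and CS :: "real \<Rightarrow> real" and CD CA c0 c1 lam :: real
    and l \<psi> m :: "real \<Rightarrow> real \<Rightarrow> real"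
  assumes \<gamma>: "1 < \<gamma>" "\<gamma> \<le> 2"
    and bs: "bounded_solution \<theta> \<phi> \<gamma> \<beta> \<rho> T J0 J1 L Ma MQ0 MQ MR CS CD CA c0 c1 lam l \<psi> m"
begin

lemma T: "0 < T" and lam: "0 \<le> lam" and J0: "0 < J0"
  using bs by (auto simp: bounded_solution_def)

lemma smooth: "smooth_strip T l" "smooth_strip T \<psi>" "smooth_strip T m"
  using bs by (auto simp: bounded_solution_def transformed_solution_def)

lemma diffeo: "t \<in> {0..T} \<Longrightarrow> diffeo \<psi> t J0 J1"
  using bs smooth_strip_smper[OF smooth(2)] unfolding bounded_solution_def elliptic_bilipschitz_def
  by (intro diffeo.intro) auto

lemma jc1_m: "jc1 T m" and jc1_l: "jc1 T l" and jc1_psi: "jc1 T \<psi>"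
  using jc1_smooth_strip(1) smooth by auto

lemma jc1_Jac: "jc1 T (Jac \<psi>)"
proof -
  have J: "jc1 T (\<lambda>t y. 1 + deriv (\<psi> t) y)" by (rule jc1_add[OF jc1_const jc1_smooth_strip(2)[OF smooth(2)]])
  have eq: "Jac \<psi> t = (\<lambda>y. 1 + deriv (\<psi> t) y)" if "t \<in> {0..T}" for t by (rule diffeo.Jac_eq[OF diffeo[OF that]])
  show ?thesis
    by (rule jc1I[OF jc_cong[OF jc1D(1)[OF J]] jc1D(2)[OF J]]) (simp_all only: eq jc1D(3)[OF J])
qed

text \<open>At a point p with x = \<Phi> (p), the Lipschitz bound 1 / J0, uniform in time, reduces
  the claim to continuity of \<Psi> in time at the fixed x.\<close>

lemma jc_Phi: "jc T (Phi \<psi>)"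
  unfolding jc_def continuous_on_def
proof
  fix p assume p: "p \<in> {0..T} \<times> (UNIV :: real set)"
  let ?F = "at p within {0..T} \<times> UNIV" and ?x = "Phi \<psi> (fst p) (snd p)"
  have x: "Psi \<psi> (fst p) ?x = snd p" by (rule diffeo.Psi_Phi[OF diffeo]) (use p in auto)
  have "continuous_on ({0..T} \<times> UNIV) (\<lambda>q. snd q - Psi \<psi> (fst q) ?x)"
    unfolding Psi_def by (intro continuous_intros jc_subst[OF jc1D(1)[OF jc1_psi]]) auto
  then have "((\<lambda>q. snd q - Psi \<psi> (fst q) ?x) \<longlongrightarrow> snd p - Psi \<psi> (fst p) ?x) ?F"
    using p by (auto simp: continuous_on_def)
  then have "((\<lambda>q. \<bar>snd q - Psi \<psi> (fst q) ?x\<bar> / J0) \<longlongrightarrow> 0) ?F"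
    by (intro tendsto_divide_zero tendsto_rabs_zero) (simp add: x)
  moreover have "\<forall>\<^sub>F q in ?F. norm (Phi \<psi> (fst q) (snd q) - ?x) \<le> \<bar>snd q - Psi \<psi> (fst q) ?x\<bar> / J0"
    unfolding eventually_at_filter
  proof (intro always_eventually allI impI)
    fix q assume "q \<in> {0..T} \<times> (UNIV :: real set)"
    then have q: "fst q \<in> {0..T}" by auto
    show "norm (Phi \<psi> (fst q) (snd q) - ?x) \<le> \<bar>snd q - Psi \<psi> (fst q) ?x\<bar> / J0"
      using diffeo.Phi_lipschitz[OF diffeo[OF q], of "snd q" "Psi \<psi> (fst q) ?x"] by (simp add: diffeo.Phi_Psi[OF diffeo[OF q]])
  qed
  ultimately have "((\<lambda>q. Phi \<psi> (fst q) (snd q) - ?x) \<longlongrightarrow> 0) ?F" by (rule Lim_null_comparison[rotated])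
  then show "((\<lambda>q. Phi \<psi> (fst q) (snd q)) \<longlongrightarrow> ?x) ?F" by (rule Lim_null[THEN iffD2])
qed

lemma jc_comp_Phi: "jc T f \<Longrightarrow> jc T (\<lambda>t y. f t (Phi \<psi> t y))"
  unfolding jc_def[of T "\<lambda>t y. f t (Phi \<psi> t y)"]
  by (rule jc_subst) (use jc_Phi in \<open>auto simp: jc_def intro: continuous_intros\<close>)

lemma deriv_comp_Phi:
  "jc1 T f \<Longrightarrow> t \<in> {0..T} \<Longrightarrow> c1per (\<lambda>y. f t (Phi \<psi> t y)) (\<lambda>y. deriv (f t) (Phi \<psi> t y) * inverse (Jac \<psi> t (Phi \<psi> t y)))"
  by (rule diffeo.c1per_Phi[OF diffeo jc1D(3)])

lemma jc1_comp_Phi: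
  assumes "jc1 T f" shows "jc1 T (\<lambda>t y. f t (Phi \<psi> t y))"
proof (rule jc1I[OF jc_comp_Phi[OF jc1D(1)[OF assms]] jc_mult[OF jc_comp_Phi[OF jc1D(2)[OF assms]]] deriv_comp_Phi[OF assms]])
  show "jc T (\<lambda>t y. inverse (Jac \<psi> t (Phi \<psi> t y)))"
    using jc_comp_Phi[OF jc1D(1)[OF jc1_Jac]] diffeo.Jac_pos[OF diffeo] unfolding jc_def
    by (intro continuous_on_inverse) (auto simp: less_imp_neq[THEN not_sym])
qed

lemma jc1_a: "jc1 T (coef_a \<psi>)"
  using jc1_comp_Phi[OF jc1_mult[OF jc1_Jac jc1_Jac]] by (simp add: coef_a_def[abs_def] power2_eq_square)

lemma jc1_Q0: "jc1 T (coef_Q0 l \<psi>)"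
  using jc1_comp_Phi[OF jc1_mult[OF jc1_l jc1_Jac]] by (simp add: coef_Q0_def[abs_def])

lemma jc1_Q: "jc1 T (coef_Q lam l \<psi>)"
  using jc1_add[OF jc1_Q0 jc1_mult[OF jc1_const jc1_comp_Phi[OF jc1_psi]], of "lam / 2"] by (simp add: coef_Q_def[abs_def])

lemma jc1_R: "jc1 T (coef_R l \<psi>)"
  using jc1_comp_Phi[OF jc1_mult[OF jc1_l jc1_l]] by (simp add: coef_R_def[abs_def] power2_eq_square)

text \<open>In the variable x the Jacobian cancels and the derivative of \<psi> is J - 1; this is
  the origin of the norm of J - 1 in \<open>N_fun\<close>.\<close>

lemma pint_psi_Phi:
  assumes t: "t \<in> {0..T}"
  shows "pint (\<lambda>y. \<bar>deriv (\<psi> t) (Phi \<psi> t y) * inverse (Jac \<psi> t (Phi \<psi> t y))\<bar>) = pint (\<lambda>x. \<bar>Jac \<psi> t x - 1\<bar>)"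
proof -
  interpret diffeo \<psi> t J0 J1 by (rule diffeo[OF t])
  have "cper (\<lambda>y. \<bar>deriv (\<psi> t) (Phi \<psi> t y) * inverse (Jac \<psi> t (Phi \<psi> t y))\<bar>)"
    by (rule cper_abs[OF c1per_cper'[OF deriv_comp_Phi[OF jc1_psi t]]])
  from pint_Psi[OF this] have "pint (\<lambda>y. \<bar>deriv (\<psi> t) (Phi \<psi> t y) * inverse (Jac \<psi> t (Phi \<psi> t y))\<bar>)
      = pint (\<lambda>x. \<bar>deriv (\<psi> t) x * inverse (Jac \<psi> t x)\<bar> * Jac \<psi> t x)" by simp
  also have "\<dots> = pint (\<lambda>x. \<bar>Jac \<psi> t x - 1\<bar>)"
  proof (rule arg_cong[where f = pint], rule ext)
    fix x show "\<bar>deriv (\<psi> t) x * inverse (Jac \<psi> t x)\<bar> * Jac \<psi> t x = \<bar>Jac \<psi> t x - 1\<bar>"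
      using Jac_pos[of x] by (simp add: abs_mult) (simp add: Jac_eq)
  qed
  finally show ?thesis .
qed

abbreviation "a \<equiv> coef_a \<psi>"
abbreviation "Q \<equiv> coef_Q lam l \<psi>"
abbreviation "R \<equiv> coef_R l \<psi>"
abbreviation "V t \<equiv> Dop \<gamma> \<psi> t (m t)"

definition "mt t y = deriv (V t) y + deriv (\<lambda>z. a t z * (m t z)\<^sup>2 + 2 * Q t z * m t z + R t z) y"

lemma m_deriv: "t \<in> {0..T} \<Longrightarrow> ((\<lambda>s. m s y) has_real_derivative mt t y) (at t within {0..T})"
  using bs unfolding bounded_solution_def transformed_solution_def mt_def by blast

text \<open>The right-hand side of the equation is the time derivative of m, and derivatives within
  {0..T} are unique, also at the endpoints; so its joint continuity comes from the smoothness of m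
  rather than from an analysis of the nonlocal operator.\<close>

lemma jc_mt: "jc T mt"
proof -
  obtain ft where ft: "jc T ft" "\<And>t y. t \<in> {0..T} \<Longrightarrow> ((\<lambda>s. m s y) has_real_derivative ft t y) (at t within {0..T})"
    using jc1_smooth_strip(3)[OF smooth(3)] by blast
  show ?thesis
  proof (rule jc_cong[OF ft(1)])
    fix t y assume t: "t \<in> {0..T}"
    have "at t within {0..T} \<noteq> bot" 
      using T t at_within_Icc_at_right[OF T] at_within_Icc_at_left[OF T] at_within_Icc_at[of 0 t T]
      by (cases "t = 0"; cases "t = T") auto
    then show "ft t y = mt t y" by (rule has_field_derivative_unique[OF ft(2)[OF t] m_deriv[OF t]])
  qed
qed

lemma quadratic_flux: "t \<in> {0..T} \<Longrightarrow> quadratic_flux (m t) (deriv (m t)) (a t) (deriv (a t)) (Q t) (deriv (Q t))"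
  by (rule quadratic_flux.intro[OF jc1D(3)[OF jc1_m] jc1D(3)[OF jc1_a] jc1D(3)[OF jc1_Q]])

lemma mt_eq:
  assumes t: "t \<in> {0..T}"
  shows "mt t y = deriv (V t) y + quadratic_flux.flux' (m t) (deriv (m t)) (a t) (deriv (a t)) (Q t) (deriv (Q t)) y + deriv (R t) y"
proof -
  interpret quadratic_flux "m t" "deriv (m t)" "a t" "deriv (a t)" "Q t" "deriv (Q t)" by (rule quadratic_flux[OF t])
  have "(\<lambda>z. a t z * (m t z)\<^sup>2 + 2 * Q t z * m t z + R t z) = (\<lambda>z. flux z + R t z)"
    by (auto simp: flux_def)
  moreover have "deriv (\<lambda>z. flux z + R t z) = (\<lambda>y. flux' y + deriv (R t) y)"
    by (rule c1per_imp_deriv[OF c1per_add[OF flux jc1D(3)[OF jc1_R t]]])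
  ultimately show ?thesis by (simp add: mt_def)
qed

lemma pint_m_deriv:
  assumes E: "\<And>z. (E has_real_derivative e z) (at z)" "continuous_on UNIV e"
  shows "t \<in> {0..T} \<Longrightarrow> ((\<lambda>t. pint (\<lambda>y. E (m t y))) has_real_derivative pint (\<lambda>y. e (m t y) * mt t y)) (at t within {0..T})"
    and "continuous_on {0..T} (\<lambda>t. pint (\<lambda>y. e (m t y) * mt t y))"
proof -
  have cE: "continuous_on UNIV E" by (intro continuous_at_imp_continuous_on ballI DERIV_isCont[OF E(1)])
  note jm = jc1D(1)[OF jc1_m]
  have j: "jc T (\<lambda>t y. e (m t y) * mt t y)" by (rule jc_mult[OF jc_comp[OF jm E(2)] jc_mt])
  show "continuous_on {0..T} (\<lambda>t. pint (\<lambda>y. e (m t y) * mt t y))" by (rule jc_pint[OF j])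
  show "((\<lambda>t. pint (\<lambda>y. E (m t y))) has_real_derivative pint (\<lambda>y. e (m t y) * mt t y)) (at t within {0..T})" if "t \<in> {0..T}"
    by (rule leibniz_MT[OF _ jc_comp[OF jm cE] j that]) (rule DERIV_chain2[OF E(1) m_deriv])
qed

text \<open>The source is integrated up to T but the dissipation up to s, so that a bound
  independent of s yields both the supremum in time and the full dissipation.\<close>

lemma energy_le:
  assumes E: "\<And>z. (E has_real_derivative e z) (at z)" "continuous_on UNIV e" "\<And>z. 0 \<le> E z"
    and P: "P \<in> borel_measurable (MT T)" "\<And>t. t \<in> {0..T} \<Longrightarrow> 0 \<le> P t"
    and F: "F \<in> borel_measurable (MT T)" "\<And>t. t \<in> {0..T} \<Longrightarrow> 0 \<le> F t"
    and le: "AE t in MT T. pint (\<lambda>y. e (m t y) * mt t y) + P t \<le> F t" and s: "s \<in> {0..T}"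
  shows "ennreal (pint (\<lambda>y. E (m s y))) + (\<integral>\<^sup>+t. ennreal (P t) \<partial>MT s)
    \<le> ennreal (pint (\<lambda>y. E (m 0 y))) + (\<integral>\<^sup>+t. ennreal (F t) \<partial>MT T)"
proof -
  have cE: "continuous_on UNIV E" by (intro continuous_at_imp_continuous_on ballI DERIV_isCont[OF E(1)])
  have sub: "{0..s} \<subseteq> {0..T}" using s by auto
  have pos: "0 \<le> pint (\<lambda>y. E (m t y))" if "t \<in> {0..T}" for t
    by (rule pint_nonneg[OF cper_compose[OF jc1D(4)[OF jc1_m that] cE] E(3)])
  have "ennreal (pint (\<lambda>y. E (m s y))) + (\<integral>\<^sup>+t. ennreal (P t) \<partial>MT s)
    \<le> ennreal (pint (\<lambda>y. E (m 0 y))) + (\<integral>\<^sup>+t. ennreal (F t) \<partial>MT s)"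
  proof (rule energy_integrate)
    show "((\<lambda>t. pint (\<lambda>y. E (m t y))) has_real_derivative pint (\<lambda>y. e (m t y) * mt t y)) (at t within {0..s})" if "t \<in> {0..s}" for t
      by (rule DERIV_subset[OF pint_m_deriv(1)[OF E(1,2)] sub]) (use that sub in auto)
    show "continuous_on {0..s} (\<lambda>t. pint (\<lambda>y. e (m t y) * mt t y))" by (rule continuous_on_subset[OF pint_m_deriv(2)[OF E(1,2)] sub])
    show "P \<in> borel_measurable (MT s)" "F \<in> borel_measurable (MT s)"
      by (rule measurable_restrict_mono[OF P(1) sub] measurable_restrict_mono[OF F(1) sub])+
    show "AE t in MT s. pint (\<lambda>y. e (m t y) * mt t y) + P t \<le> F t"
      using le sub by (subst (asm) AE_restrict_space_iff, simp, subst AE_restrict_space_iff, simp) (auto elim: eventually_mono)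
  qed (use s sub P F pos T in auto)
  also have "(\<integral>\<^sup>+t. ennreal (F t) \<partial>MT s) \<le> (\<integral>\<^sup>+t. ennreal (F t) \<partial>MT T)"
    unfolding nn_MT[symmetric] using sub by (intro nn_integral_mono) (auto simp: indicator_def)
  finally show ?thesis by simp
qed

end

lemma L1_norm_pint: "cper f \<Longrightarrow> L1_norm f = ennreal (pint (\<lambda>x. \<bar>f x\<bar>))"
  unfolding L1_norm_def by (rule pint_nn[OF cper_abs]) auto

lemma L2_sq_pint: "cper f \<Longrightarrow> L2_sq f = ennreal (pint (\<lambda>x. (f x)\<^sup>2))"
  unfolding L2_sq_def by (rule pint_nn[OF cper_power]) auto

section \<open>The L1 bound by the functional N\<close>

locale coercive_solution = strip_solution + entropy \<eta> e e1 F1 F2 K C0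
  for \<eta> e e1 F1 F2 :: "real \<Rightarrow> real" and K C0 :: real +
  fixes c :: real
  assumes coer: "coercive \<gamma> J0 J1 (max K 1) c"
begin

lemma c: "0 < c"
  using coer by (simp add: coercive_def)


lemma V_deriv:
  assumes t: "t \<in> {0..T}"
  shows "c1per (V t) (deriv (V t))" "pint (\<lambda>y. m t y * deriv (V t) y) \<le> - c * hom2 \<gamma> (m t)"
    "pint (\<lambda>y. e (m t y) * deriv (V t) y) \<le> - c * hom2 \<gamma> (\<lambda>y. e (m t y))"
proof -
  note dm = diffeo[OF t] smooth_strip_smper[OF smooth(3) t]
  have sq: "((\<lambda>z. z\<^sup>2 / 2) has_real_derivative z) (at z)" for z :: real
    by (rule derivative_eq_intros refl | simp)+
  obtain V1 where V1: "c1per (V t) V1" "pint (\<lambda>y. m t y * V1 y) \<le> - c * hom2 \<gamma> (m t)"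
    using coerciveD[OF coer dm sq DERIV_ident] by auto
  have eK: "e1 z \<le> max K 1" for z using e1(3)[of z] by simp
  obtain V2 where V2: "c1per (V t) V2" "pint (\<lambda>y. e (m t y) * V2 y) \<le> - c * hom2 \<gamma> (\<lambda>y. e (m t y))"
    using coerciveD[OF coer dm eta e e1(1,2) eK] by blast
  have "deriv (V t) = V1" "deriv (V t) = V2" using c1per_imp_deriv[OF V1(1)] c1per_imp_deriv[OF V2(1)] .
  then show "c1per (V t) (deriv (V t))" "pint (\<lambda>y. m t y * deriv (V t) y) \<le> - c * hom2 \<gamma> (m t)"
    "pint (\<lambda>y. e (m t y) * deriv (V t) y) \<le> - c * hom2 \<gamma> (\<lambda>y. e (m t y))" using V1 V2 by simp_all
qed

lemma eta_nonneg: "0 \<le> \<eta> z"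
  using order_trans[OF abs_ge_zero eta_ge] .

lemma cont_e: "continuous_on UNIV e" and cont_eta: "continuous_on UNIV \<eta>"
  by (intro continuous_at_imp_continuous_on ballI DERIV_isCont[OF e] DERIV_isCont[OF eta])+

lemma L1_le_entropy: "s \<in> {0..T} \<Longrightarrow> pint (\<lambda>y. \<bar>m s y\<bar>) \<le> pint (\<lambda>y. \<eta> (m s y))"
  by (rule pint_mono[OF cper_abs[OF jc1D(4)[OF jc1_m]] cper_compose[OF jc1D(4)[OF jc1_m] cont_eta] eta_ge])

lemma jc1_J1: "jc1 T (\<lambda>t x. Jac \<psi> t x - 1)"
  using jc1_add[OF jc1_Jac jc1_const[of T "- 1"]] by simp

lemma s_range: "0 \<le> 1 - \<gamma> / 2" "1 - \<gamma> / 2 \<le> 1" and two_s: "2 * (1 - \<gamma> / 2) = 2 - \<gamma>"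
  using \<gamma> by auto

lemma N_fun_finite: "N_fun \<eta> \<gamma> T lam l \<psi> m < \<infinity>"
proof -
  have *: "(\<integral>\<^sup>+t\<in>{0..T}. X t \<partial>lborel) < \<infinity>" if "\<And>t. t \<in> {0..T} \<Longrightarrow> X t \<le> ennreal B" for X B
  proof -
    have "(\<integral>\<^sup>+t. X t \<partial>MT T) \<le> (\<integral>\<^sup>+t. ennreal B \<partial>MT T)"
      by (rule nn_integral_mono) (simp add: that space_restrict_space)
    also have "\<dots> < \<infinity>" using MT_const[OF less_imp_le[OF T], of "ennreal B"] by (simp add: ennreal_mult_less_top del: nn_integral_const)
    finally show ?thesis unfolding nn_MT .
  qed
  note bd = jc1_Hs_bounded[OF _ s_range]
  obtain Ba BQ BR BJ where B: "\<And>t. t \<in> {0..T} \<Longrightarrow> Hs_hom_sq (1 - \<gamma> / 2) (fc (a t)) \<le> ennreal Ba"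
    "\<And>t. t \<in> {0..T} \<Longrightarrow> Hs_sq (1 - \<gamma> / 2) (fc (coef_Q0 l \<psi> t)) \<le> ennreal BQ"
    "\<And>t. t \<in> {0..T} \<Longrightarrow> Hs_sq (1 - \<gamma> / 2) (fc (R t)) \<le> ennreal BR"
    "\<And>t. t \<in> {0..T} \<Longrightarrow> pint (\<lambda>x. \<bar>Jac \<psi> t x - 1\<bar>) \<le> BJ"
    using bd[OF jc1_a] bd[OF jc1_Q0] bd[OF jc1_R] bd[OF jc1_J1] by blast
  have J: "L1_norm (\<lambda>x. Jac \<psi> t x - 1) \<le> ennreal BJ" if "t \<in> {0..T}" for t
    unfolding L1_norm_pint[OF jc1D(4)[OF jc1_J1 that]] by (rule ennreal_leI[OF B(4)[OF that]])
  have "(\<integral>\<^sup>+y\<in>{0..1}. ennreal (\<eta> (m 0 y)) \<partial>lborel) < \<infinity>"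
    using T by (subst pint_nn[OF cper_compose[OF jc1D(4)[OF jc1_m] cont_eta] eta_nonneg]) auto
  then show ?thesis unfolding N_fun_def using *[OF B(1)] *[OF B(2)] *[OF B(3)] *[OF J]
    by (simp add: ennreal_mult_less_top)
qed

text \<open>The constant depends on the solution only through the coercivity constant c: 2 + 2 / c
  dominates all coefficients of the entropy balance, and one more unit covers the initial
  term.\<close>

lemma L1_le_N_fun:
  assumes s: "s \<in> {0..T}"
  shows "L1_norm (m s) \<le> ennreal (3 + 2 / c) * N_fun \<eta> \<gamma> T lam l \<psi> m"
proof -
  let ?J = "\<lambda>t. pint (\<lambda>x. \<bar>Jac \<psi> t x - 1\<bar>)" and ?h = "\<lambda>f t. hom2 (2 - \<gamma>) (f t)"
  define F where "F t = (?h a t + 2 * ?h (coef_Q0 l \<psi>) t + ?h R t) / c + 2 * lam * ?J t" for t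
  have g: "2 - \<gamma> \<le> 2" using \<gamma> by simp
  have [measurable]: "?h a \<in> borel_measurable (MT T)" "?h (coef_Q0 l \<psi>) \<in> borel_measurable (MT T)" "?h R \<in> borel_measurable (MT T)"
    by (rule meas_hom2[OF jc1D(1,3)[OF jc1_a] g] meas_hom2[OF jc1D(1,3)[OF jc1_Q0] g] meas_hom2[OF jc1D(1,3)[OF jc1_R] g]; assumption)+
  have [measurable]: "?J \<in> borel_measurable (MT T)"
    by (intro cont_MT jc_pint jc_comp[OF jc1D(1)[OF jc1_J1]] continuous_intros)
  have Jn: "0 \<le> ?J t" if "t \<in> {0..T}" for t by (rule pint_nonneg[OF cper_abs[OF jc1D(4)[OF jc1_J1 that]]]) simp
  have le: "pint (\<lambda>y. e (m t y) * mt t y) \<le> F t" if t: "t \<in> {0..T}" for t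
  proof -
    interpret q: quadratic_flux "m t" "deriv (m t)" "a t" "deriv (a t)" "Q t" "deriv (Q t)" by (rule quadratic_flux[OF t])
    \<comment> \<open>Q_\<lambda> exceeds Q0 by \<lambda> / 2 times \<psi> o \<Phi>; the factor 1 /
      2 is put into P' and \<lambda> stays outside.\<close>
    define P' where "P' y = 1 / 2 * (deriv (\<psi> t) (Phi \<psi> t y) * inverse (Jac \<psi> t (Phi \<psi> t y)))" for y
    have P: "c1per (\<lambda>y. 1 / 2 * \<psi> t (Phi \<psi> t y)) P'"
      unfolding P'_def[abs_def] by (rule c1per_cmult[OF deriv_comp_Phi[OF jc1_psi t]])
    have "c1per (\<lambda>y. coef_Q0 l \<psi> t y + lam * (1 / 2 * \<psi> t (Phi \<psi> t y))) (\<lambda>y. deriv (coef_Q0 l \<psi> t) y + lam * P' y)"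
      by (rule c1per_add[OF jc1D(3)[OF jc1_Q0 t] c1per_cmult[OF P]])
    then have "c1per (Q t) (\<lambda>y. deriv (coef_Q0 l \<psi> t) y + lam * P' y)" by (simp add: coef_Q_def[abs_def])
    then have Q': "deriv (Q t) y = deriv (coef_Q0 l \<psi> t) y + lam * P' y" for y by (simp add: c1per_imp_deriv)
    have "?J t = 2 * pint (\<lambda>y. \<bar>P' y\<bar>)"
      unfolding pint_psi_Phi[OF t, symmetric] P'_def abs_mult[of "1 / 2"] by (simp add: pint_cmult)
    then show ?thesis
      using q.L1_fixed_Sobolev[OF entropy_axioms \<gamma> c V_deriv(1)[OF t] jc1D(3)[OF jc1_R t] V_deriv(3)[OF t] jc1D(3)[OF jc1_Q0 t] P lam Q']
      by (simp add: mt_eq[OF t] F_def mult_ac)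
  qed
  have "ennreal (pint (\<lambda>y. \<eta> (m s y))) + (\<integral>\<^sup>+t. ennreal 0 \<partial>MT s)
    \<le> ennreal (pint (\<lambda>y. \<eta> (m 0 y))) + (\<integral>\<^sup>+t. ennreal (F t) \<partial>MT T)"
  proof (rule energy_le[OF eta cont_e eta_nonneg _ _ _ _ _ s])
    show "F \<in> borel_measurable (MT T)" unfolding F_def[abs_def] by measurable
    show "0 \<le> F t" if "t \<in> {0..T}" for t unfolding F_def using Jn[OF that] lam c by (simp add: hom2_nonneg)
    show "AE t in MT T. pint (\<lambda>y. e (m t y) * mt t y) + 0 \<le> F t"
      by (rule AE_I2) (use le in \<open>simp add: space_restrict_space\<close>)
  qed auto
  also have "(\<integral>\<^sup>+t. ennreal (F t) \<partial>MT T) \<le> (\<integral>\<^sup>+t. ennreal (2 + 2 / c) * (ennreal (?h a t) + ennreal (?h (coef_Q0 l \<psi>) t) + ennreal (?h R t)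
      + ennreal lam * ennreal (?J t)) \<partial>MT T)"
  proof (rule nn_integral_mono)
    fix t assume "t \<in> space (MT T)"
    then have t: "t \<in> {0..T}" by (simp add: space_restrict_space)
    note nn = hom2_nonneg[of "2 - \<gamma>" "a t"] hom2_nonneg[of "2 - \<gamma>" "coef_Q0 l \<psi> t"] hom2_nonneg[of "2 - \<gamma>" "R t"] mult_nonneg_nonneg[OF lam Jn[OF t]]
    have "(x + 2 * y + z) / c + 2 * w \<le> (2 + 2 / c) * (x + y + z + w)" if "0 \<le> x" "0 \<le> y" "0 \<le> z" "0 \<le> w" for x y z w
    proof -
      have "(2 + 2 / c) * (x + y + z + w) - ((x + 2 * y + z) / c + 2 * w) = 2 * (x + y + z) + (x + z + 2 * w) / c"
        using c by (simp add: field_simps)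
      moreover have "0 \<le> 2 * (x + y + z) + (x + z + 2 * w) / c" using that c by simp
      ultimately show ?thesis by linarith
    qed
    from this[OF nn] have "F t \<le> (2 + 2 / c) * (?h a t + ?h (coef_Q0 l \<psi>) t + ?h R t + lam * ?J t)" by (simp add: F_def mult.assoc)
    then have "ennreal (F t) \<le> ennreal ((2 + 2 / c) * (?h a t + ?h (coef_Q0 l \<psi>) t + ?h R t + lam * ?J t))" by (rule ennreal_leI)
    also have "\<dots> = ennreal (2 + 2 / c) * (ennreal (?h a t) + ennreal (?h (coef_Q0 l \<psi>) t) + ennreal (?h R t) + ennreal lam * ennreal (?J t))"
      using nn c lam Jn[OF t] by (simp add: ennreal_mult)
    finally show "ennreal (F t) \<le> \<dots>" .
  qed
  also have "\<dots> = ennreal (2 + 2 / c) * ((\<integral>\<^sup>+t. ennreal (?h a t) \<partial>MT T) + (\<integral>\<^sup>+t. ennreal (?h (coef_Q0 l \<psi>) t) \<partial>MT T)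
      + (\<integral>\<^sup>+t. ennreal (?h R t) \<partial>MT T) + ennreal lam * (\<integral>\<^sup>+t. ennreal (?J t) \<partial>MT T))"
    by (simp add: nn_integral_add nn_integral_cmult)
  also have "\<dots> \<le> ennreal (2 + 2 / c) * ((\<integral>\<^sup>+t. Hs_hom_sq (1 - \<gamma> / 2) (fc (a t)) \<partial>MT T) + (\<integral>\<^sup>+t. Hs_sq (1 - \<gamma> / 2) (fc (coef_Q0 l \<psi> t)) \<partial>MT T)
      + (\<integral>\<^sup>+t. Hs_sq (1 - \<gamma> / 2) (fc (R t)) \<partial>MT T) + ennreal lam * (\<integral>\<^sup>+t. L1_norm (\<lambda>x. Jac \<psi> t x - 1) \<partial>MT T))"
  proof (intro mult_left_mono add_mono nn_integral_mono)
    fix t assume "t \<in> space (MT T)"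
    then have t: "t \<in> {0..T}" by (simp add: space_restrict_space)
    have fin: "fin_hom (2 * (1 - \<gamma> / 2)) (f t)" if "jc1 T f" for f
      using \<gamma> by (intro c1per_fin_hom[OF jc1D(3)[OF that t]]) auto
    show "ennreal (?h a t) \<le> Hs_hom_sq (1 - \<gamma> / 2) (fc (a t))" using Hs_hom_sq_hom2[OF fin[OF jc1_a]] by (simp add: two_s)
    show "ennreal (?h (coef_Q0 l \<psi>) t) \<le> Hs_sq (1 - \<gamma> / 2) (fc (coef_Q0 l \<psi> t))"
      and "ennreal (?h R t) \<le> Hs_sq (1 - \<gamma> / 2) (fc (R t))"
      using hom2_le_Hs_sq[OF s_range(1) fin[OF jc1_Q0]] hom2_le_Hs_sq[OF s_range(1) fin[OF jc1_R]] by (simp_all add: two_s)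
    show "ennreal (?J t) \<le> L1_norm (\<lambda>x. Jac \<psi> t x - 1)" by (simp add: L1_norm_pint[OF jc1D(4)[OF jc1_J1 t]])
  qed auto
  finally have "ennreal (pint (\<lambda>y. \<eta> (m s y))) \<le> ennreal (pint (\<lambda>y. \<eta> (m 0 y))) + \<dots>" by simp
  also have "\<dots> \<le> ennreal (3 + 2 / c) * N_fun \<eta> \<gamma> T lam l \<psi> m"
  proof -
    have "x + ennreal (2 + 2 / c) * y \<le> ennreal (3 + 2 / c) * (x + y)" for x y
    proof -
      have "ennreal (3 + 2 / c) = 1 + ennreal (2 + 2 / c)" using c by (simp add: ennreal_plus[symmetric] del: ennreal_plus flip: ennreal_1)
      then show ?thesis by (simp add: distrib_right distrib_left add_mono add_increasing2 add.assoc)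
    qed
    moreover have "ennreal (pint (\<lambda>y. \<eta> (m 0 y))) = (\<integral>\<^sup>+y\<in>{0..1}. ennreal (\<eta> (m 0 y)) \<partial>lborel)"
      using T by (intro pint_nn[OF cper_compose[OF jc1D(4)[OF jc1_m] cont_eta] eta_nonneg, symmetric]) auto
    ultimately show ?thesis unfolding N_fun_def nn_MT by (simp only: add.assoc)
  qed
  finally show ?thesis
    unfolding L1_norm_pint[OF jc1D(4)[OF jc1_m s]] by (rule order_trans[OF ennreal_leI[OF L1_le_entropy[OF s]]])
qed

end

lemma hom2_0_le:
  assumes u: "cper u" shows "hom2 0 u \<le> pint (\<lambda>x. (u x)\<^sup>2)"
  unfolding hom2_def
proof (rule has_sum_mono[OF has_sum_infsum parseval_sq[OF u]])
  have "lam k powr 0 * x \<le> x" "\<bar>lam k powr 0 * x\<bar> \<le> x" if "0 \<le> x" for k x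
    using that by (auto simp: powr_def abs_mult)
  then show "lam k powr 0 * (cmod (fc u k))\<^sup>2 \<le> (cmod (fc u k))\<^sup>2" for k by simp
  show "(\<lambda>k. lam k powr 0 * (cmod (fc u k))\<^sup>2) summable_on UNIV"
    by (rule summable_dom[OF has_sum_imp_summable[OF parseval_sq[OF u]]]) (auto simp: powr_def abs_mult)
qed

text \<open>This is where s < 1/3 enters: the gain h in the third-order balance leaves h^(-3
  s).\<close>

lemma nn_powr_linear:
  assumes s: "s < 1 / 3" and x: "0 \<le> x"
  shows "(\<integral>\<^sup>+h\<in>{0..1}. ennreal (h powr (- 1 - 3 * s)) * ennreal (h * x) \<partial>lborel) = ennreal (x / (1 - 3 * s))"
proof -
  have "((\<lambda>h. h powr (- 3 * s)) has_integral (1 powr (- 3 * s + 1) / (- 3 * s + 1))) {0..1::real}"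
    by (rule has_integral_powr_from_0) (use s in auto)
  from has_integral_mult_left[OF this, of x] have I: "((\<lambda>h. h powr (- 3 * s) * x) has_integral (x / (1 - 3 * s))) {0..1}"
    by simp
  have "(\<integral>\<^sup>+h\<in>{0..1}. ennreal (h powr (- 1 - 3 * s)) * ennreal (h * x) \<partial>lborel) = (\<integral>\<^sup>+h\<in>{0..1}. ennreal (h powr (- 3 * s) * x) \<partial>lborel)"
  proof (rule nn_integral_cong)
    fix h :: real
    have "h powr (- 1 - 3 * s) * h = h powr (- 3 * s)" if "0 \<le> h"
    proof (cases "h = 0")
      case False
      then show ?thesis using that powr_add[of h "- 1 - 3 * s" 1] by simp
    qed simp
    then show "ennreal (h powr (- 1 - 3 * s)) * ennreal (h * x) * indicator {0..1} h = ennreal (h powr (- 3 * s) * x) * indicator {0..1} h"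
      using x by (auto simp: indicator_def ennreal_mult[symmetric] mult.assoc[symmetric])
  qed
  also have "\<dots> = ennreal (x / (1 - 3 * s))" by (rule nn_integral_has_integral_lebesgue'[OF _ I]) (use x in auto)
  finally show ?thesis .
qed

text \<open>Everything here is fixed before \<lambda>, l, \<psi> and m, which only the next locale
  introduces; constants defined in this locale are therefore uniform over all solutions with the
  given bounds.\<close>

locale solution_constants = dyadic \<theta> \<phi> + expo \<gamma> \<alpha> \<kappa> + entropy \<eta> e e1 F1 F2 K C0
  for \<theta> \<phi> :: "real \<Rightarrow> real" and \<gamma> \<alpha> \<kappa> :: real and \<eta> e e1 F1 F2 :: "real \<Rightarrow> real" and K C0 :: real +
  fixes \<beta> \<rho> T J0 J1 L Ma MQ0 MQ MR :: real and CS :: "real \<Rightarrow> real" and CD CA c0 c1 c C\<beta> C\<rho> M1 M2 :: real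
  assumes \<beta>: "\<alpha> < \<beta>" "\<beta> < 1" and T: "0 < T" and J0: "0 < J0" and coer: "coercive \<gamma> J0 J1 (max K 1) c"
    and C\<beta>: "0 < C\<beta>" "\<And>f f' M. \<lbrakk>c1per f f'; 0 \<le> M; C_norm \<theta> \<phi> \<beta> f \<le> ennreal M\<rbrakk> \<Longrightarrow> holder \<alpha> (C\<beta> * M) f"
    and C\<rho>: "0 < C\<rho>" "\<And>f f' M. \<lbrakk>c1per f f'; 0 \<le> M; C_norm \<theta> \<phi> \<rho> f \<le> ennreal M\<rbrakk> \<Longrightarrow> holder \<alpha> (C\<rho> * M) f"
begin

lemma c: "0 < c"
  using coer by (simp add: coercive_def)

definition "A = C\<beta> * max Ma 0"
text \<open>Bounds the time integral of \<open>qq\<close> squared, by (C\<rho> x + 1)^2 <= 2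
  C\<rho>^2 x^2 + 2 and x^2 <= 1 + x^p, where p = \<gamma> / (\<gamma> - 1) >= 2.\<close>

definition "XQ = 2 * C\<rho>\<^sup>2 * (T + MQ powr (\<gamma> / (\<gamma> - 1))) + 2 * T"
abbreviation "S \<equiv> sew_const (\<alpha> + \<sigma>)"
abbreviation "S' \<equiv> sew_const (\<alpha> + \<gamma> / 2)"
text \<open>The L1 bound uniform in \<lambda>: the initial entropy, the time integral of the
  right-hand side in \<open>L1_fixed_sewing\<close>, and 1 to make it positive.\<close>

definition "A1 = max M1 0 + C0 + (16 * S'\<^sup>2 / c * XQ + 1 / c * MR\<^sup>2 + 4 * (S' * A)\<^sup>2 / c * T) + 1"
definition "KV = 2 * CD\<^sup>2 + J1 ^ 4"
text \<open>The product of the factor in \<open>gn_integrated\<close>, of 1 / (1 - 3 s1) from the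
  integral of the weight, and of 3 / J0^2 from the ellipticity a >= J0^2.\<close>

definition "g1 = 64 * (2 * A1) powr (3 * s1) / (1 - 3 * s1) * (3 / J0\<^sup>2)"
definition "g2 = (2 * A1) powr q * T"

lemma A_nonneg: "0 \<le> A" using C\<beta>(1) by (simp add: A_def)

lemma S_pos: "0 < S" by (rule sew_const_pos[OF sigma(3)])

lemma XQ_nonneg: "0 \<le> XQ" using T by (simp add: XQ_def)

lemma C0_nonneg: "0 \<le> C0" using eta_ge[of 0] eta_le[of 0] by simp

lemma sub': "1 < \<alpha> + \<gamma> / 2"
proof -
  have "(1 - \<kappa>) * \<gamma> \<le> 1 * \<gamma>" using \<kappa> \<gamma> by (intro mult_right_mono) auto
  then show ?thesis using sub by simp
qed

lemma A1_pos: "0 < A1"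
proof -
  have "0 \<le> 16 * S'\<^sup>2 / c * XQ + 1 / c * MR\<^sup>2 + 4 * (S' * A)\<^sup>2 / c * T"
    using c T XQ_nonneg by (intro add_nonneg_nonneg mult_nonneg_nonneg divide_nonneg_nonneg) auto
  then show ?thesis using C0_nonneg by (simp add: A1_def)
qed

lemma KV_nonneg: "0 \<le> KV" by (simp add: KV_def)

lemma g1_nonneg: "0 \<le> g1" using s1 by (simp add: g1_def)

end

locale regular_solution = solution_constants +
  fixes lam :: real and l \<psi> m :: "real \<Rightarrow> real \<Rightarrow> real"
  assumes bs: "bounded_solution \<theta> \<phi> \<gamma> \<beta> \<rho> T J0 J1 L Ma MQ0 MQ MR CS CD CA c0 c1 lam l \<psi> m"
    and init: "initial_bounds m M1 M2"

sublocale regular_solution \<subseteq> coercive_solution \<theta> \<phi> \<gamma> \<beta> \<rho> T J0 J1 L Ma MQ0 MQ MR CS CD CA c0 c1 lam l \<psi> m \<eta> e e1 F1 F2 K C0 c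
  by unfold_locales (rule \<gamma> bs coer)+

section \<open>Norms of one solution and the L1 bound uniform in the parameter\<close>

context regular_solution
begin

definition "H t = hom2 \<gamma> (m t)"
definition "N t = Nq (m t)"
definition "LL t = L2 (m t)"
definition "X t = hom2 (2 - \<gamma>) (R t)"
text \<open>The summand 1 makes the Hoelder constant positive, as division by it requires. Where the
  norm is infinite \<open>enn2real\<close> gives 0, so the Hoelder bound is claimed only almost
  everywhere.\<close>

definition "qq t = C\<rho> * enn2real (C_norm \<theta> \<phi> \<rho> (Q t)) + 1"
definition "E = (SUP t\<in>{0..T}. LL t)"
text \<open>Here and in \<open>NN\<close> a real number is taken from an extended integral that is
  finite because m is smooth; this permits subtraction when terms are absorbed.\<close>

definition "HH = enn2real (\<integral>\<^sup>+t. ennreal (H t) \<partial>MT T)"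
definition "NN = enn2real (\<integral>\<^sup>+t. ennreal (N t) \<partial>MT T)"

lemma tin: "t \<in> space (MT T) \<Longrightarrow> t \<in> {0..T}" by (simp add: space_restrict_space)

lemma m_c1: "t \<in> {0..T} \<Longrightarrow> c1per (m t) (deriv (m t))" and m_cper: "t \<in> {0..T} \<Longrightarrow> cper (m t)"
  and m_fin: "t \<in> {0..T} \<Longrightarrow> fin_hom \<gamma> (m t)"
  using jc1D(3,4)[OF jc1_m] c1per_fin_hom[OF jc1D(3)[OF jc1_m] \<gamma>(2)] by auto

lemma cont_N: "continuous_on {0..T} N" and cont_LL: "continuous_on {0..T} LL"
proof -
  have "continuous_on UNIV (\<lambda>z::real. \<bar>z\<bar> powr q)" using q_gt by (intro continuous_on_powr' continuous_intros) auto
  from jc_pint[OF jc_comp[OF jc1D(1)[OF jc1_m] this]] show "continuous_on {0..T} N" by (simp add: N_def[abs_def] Nq_def)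
  have "continuous_on UNIV (\<lambda>z::real. z\<^sup>2)" by (intro continuous_intros)
  from jc_pint[OF jc_comp[OF jc1D(1)[OF jc1_m] this]] show "continuous_on {0..T} LL" by (simp add: LL_def[abs_def] L2_def)
qed

lemma meas [measurable]: "H \<in> borel_measurable (MT T)" "N \<in> borel_measurable (MT T)" "LL \<in> borel_measurable (MT T)"
  "X \<in> borel_measurable (MT T)" "qq \<in> borel_measurable (MT T)"
proof -
  have g: "2 - \<gamma> \<le> 2" using \<gamma> by simp
  show "H \<in> borel_measurable (MT T)" unfolding H_def[abs_def] by (rule meas_hom2[OF jc1D(1,3)[OF jc1_m] \<gamma>(2)])
  show "X \<in> borel_measurable (MT T)" unfolding X_def[abs_def] by (rule meas_hom2[OF jc1D(1,3)[OF jc1_R] g])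
  show "N \<in> borel_measurable (MT T)" "LL \<in> borel_measurable (MT T)" using cont_N cont_LL by (auto intro: cont_MT)
  have [measurable]: "(\<lambda>t. C_norm \<theta> \<phi> \<rho> (Q t)) \<in> borel_measurable (MT T)" by (rule meas_C_norm[OF jc1D(1,4)[OF jc1_Q]])
  show "qq \<in> borel_measurable (MT T)" unfolding qq_def[abs_def] by measurable
qed

lemma nonneg: "t \<in> {0..T} \<Longrightarrow> 0 \<le> H t" "t \<in> {0..T} \<Longrightarrow> 0 \<le> N t" "t \<in> {0..T} \<Longrightarrow> 0 \<le> LL t"
  "t \<in> {0..T} \<Longrightarrow> 0 \<le> X t"
  using Nq_nonneg L2_nonneg m_cper by (auto simp: H_def N_def LL_def X_def hom2_nonneg)

lemma qq_pos: "0 < qq t"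
  using C\<rho>(1) by (simp add: qq_def add_nonneg_pos)

lemma LL_le: "t \<in> {0..T} \<Longrightarrow> LL t \<le> E" and E_nonneg: "0 \<le> E" and E_least: "(\<And>t. t \<in> {0..T} \<Longrightarrow> LL t \<le> B) \<Longrightarrow> E \<le> B"
proof -
  have "bdd_above (LL ` {0..T})"
    by (intro bounded_imp_bdd_above compact_imp_bounded compact_continuous_image cont_LL compact_Icc)
  then show le: "t \<in> {0..T} \<Longrightarrow> LL t \<le> E" for t unfolding E_def by (rule cSUP_upper[rotated])
  show "0 \<le> E" using le[of 0] nonneg(3)[of 0] T by simp
  show "E \<le> B" if "\<And>t. t \<in> {0..T} \<Longrightarrow> LL t \<le> B" unfolding E_def by (rule cSUP_least) (use T that in auto)
qed

lemma int_H: "(\<integral>\<^sup>+t. ennreal (H t) \<partial>MT T) = ennreal HH" and int_N: "(\<integral>\<^sup>+t. ennreal (N t) \<partial>MT T) = ennreal NN"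
proof -
  have fin: "(\<integral>\<^sup>+t. ennreal (f t) \<partial>MT T) < \<infinity>" if "\<And>t. t \<in> {0..T} \<Longrightarrow> f t \<le> B" for f B
  proof -
    have "(\<integral>\<^sup>+t. ennreal (f t) \<partial>MT T) \<le> (\<integral>\<^sup>+t. ennreal B \<partial>MT T)"
      by (intro nn_integral_mono ennreal_leI that tin)
    also have "\<dots> < \<infinity>" using MT_const[OF less_imp_le[OF T], of "ennreal B"] by (simp add: ennreal_mult_less_top del: nn_integral_const)
    finally show ?thesis .
  qed
  obtain B where "\<And>t. t \<in> {0..T} \<Longrightarrow> hom2 (2 * (\<gamma> / 2)) (m t) \<le> B"
    using jc1_Hs_bounded[OF jc1_m, of "\<gamma> / 2"] \<gamma> by fastforce
  then show "(\<integral>\<^sup>+t. ennreal (H t) \<partial>MT T) = ennreal HH" unfolding HH_def using fin[of H B] by (simp add: H_def)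
  have "bdd_above (N ` {0..T})"
    by (intro bounded_imp_bdd_above compact_imp_bounded compact_continuous_image cont_N compact_Icc)
  then obtain B' where "\<forall>t\<in>{0..T}. N t \<le> B'" unfolding bdd_above_def by auto
  then show "(\<integral>\<^sup>+t. ennreal (N t) \<partial>MT T) = ennreal NN" unfolding NN_def using fin[of N B'] by simp
qed

lemma HH_nonneg: "0 \<le> HH" and NN_nonneg: "0 \<le> NN" by (auto simp: HH_def NN_def)

lemma coefs: "AE t in lborel. t \<in> {0..T} \<longrightarrow> C_norm \<theta> \<phi> \<beta> (a t) \<le> ennreal Ma"
  "(\<integral>\<^sup>+t\<in>{0..T}. ennpowr (C_norm \<theta> \<phi> \<rho> (Q t)) (\<gamma> / (\<gamma> - 1)) \<partial>lborel) \<le> ennreal (MQ powr (\<gamma> / (\<gamma> - 1)))"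
  "(\<integral>\<^sup>+t\<in>{0..T}. Hs_sq (1 - \<gamma> / 2) (fc (R t)) \<partial>lborel) \<le> ennreal (MR\<^sup>2)"
  using bs unfolding bounded_solution_def coefficient_bounds_def Let_def by blast+

lemma holder_ae: "AE t in MT T. holder \<alpha> A (a t) \<and> holder \<alpha> (qq t) (Q t)"
proof -
  let ?C = "\<lambda>t. C_norm \<theta> \<phi> \<rho> (Q t)"
  have [measurable]: "?C \<in> borel_measurable (MT T)" by (rule meas_C_norm[OF jc1D(1,4)[OF jc1_Q]])
  have 1: "AE t in MT T. C_norm \<theta> \<phi> \<beta> (a t) \<le> ennreal Ma" using coefs(1) by (simp add: AE_restrict_space_iff)
  have [measurable]: "(\<lambda>t. ennpowr (?C t) (\<gamma> / (\<gamma> - 1))) \<in> borel_measurable (MT T)" unfolding ennpowr_def by measurable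
  have "(\<integral>\<^sup>+t. ennpowr (?C t) (\<gamma> / (\<gamma> - 1)) \<partial>MT T) \<noteq> \<infinity>"
    using coefs(2) unfolding nn_MT by (auto simp: top_unique)
  then have 2: "AE t in MT T. ennpowr (?C t) (\<gamma> / (\<gamma> - 1)) \<noteq> \<infinity>" by (intro nn_integral_PInf_AE) auto
  have 3: "AE t in MT T. t \<in> {0..T}" by (rule AE_I2) (rule tin)
  from 1 2 3 show ?thesis
  proof eventually_elim
    fix t assume a: "C_norm \<theta> \<phi> \<beta> (a t) \<le> ennreal Ma" and q: "ennpowr (?C t) (\<gamma> / (\<gamma> - 1)) \<noteq> \<infinity>" and t: "t \<in> {0..T}"
    have "holder \<alpha> A (a t)" unfolding A_def
      by (rule C\<beta>(2)[OF jc1D(3)[OF jc1_a t]]) (auto intro: order_trans[OF a] ennreal_leI)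
    moreover have "?C t \<le> ennreal (enn2real (?C t))" using q by (auto simp: ennpowr_def less_top split: if_splits)
    then have "holder \<alpha> (C\<rho> * enn2real (?C t)) (Q t)" by (intro C\<rho>(2)[OF jc1D(3)[OF jc1_Q t]]) auto
    then have "holder \<alpha> (qq t) (Q t)" unfolding holder_def qq_def by (auto simp: distrib_right intro: add_increasing2)
    ultimately show "holder \<alpha> A (a t) \<and> holder \<alpha> (qq t) (Q t)" ..
  qed
qed

lemma int_qq: "(\<integral>\<^sup>+t. ennreal ((qq t)\<^sup>2) \<partial>MT T) \<le> ennreal XQ"
proof -
  let ?C = "\<lambda>t. C_norm \<theta> \<phi> \<rho> (Q t)" and ?p = "\<gamma> / (\<gamma> - 1)"
  have [measurable]: "?C \<in> borel_measurable (MT T)" by (rule meas_C_norm[OF jc1D(1,4)[OF jc1_Q]])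
  have p: "2 \<le> ?p" using \<gamma> by (simp add: field_simps)
  have pw: "ennreal ((qq t)\<^sup>2) \<le> ennreal (2 * C\<rho>\<^sup>2) * (1 + ennreal (enn2real (?C t) powr ?p)) + 2" for t
  proof -
    let ?x = "enn2real (?C t)"
    have "?x\<^sup>2 \<le> 1 + ?x powr ?p"
    proof (cases "?x \<le> 1")
      case True
      then show ?thesis using power_le_one[of ?x 2] by (simp add: add_increasing2)
    next
      case False
      then have "?x\<^sup>2 = ?x powr 2" by simp
      also have "\<dots> \<le> ?x powr ?p" using False p by (intro powr_mono) auto
      finally show ?thesis by simp
    qed
    moreover have "(C\<rho> * ?x + 1)\<^sup>2 \<le> 2 * C\<rho>\<^sup>2 * ?x\<^sup>2 + 2"
      using sum_squares_bound[of "C\<rho> * ?x" 1] by (simp add: power2_eq_square algebra_simps)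
    ultimately have "(qq t)\<^sup>2 \<le> 2 * C\<rho>\<^sup>2 * (1 + ?x powr ?p) + 2"
      unfolding qq_def using mult_left_mono[of "?x\<^sup>2" "1 + ?x powr ?p" "2 * C\<rho>\<^sup>2"] by simp
    then have "ennreal ((qq t)\<^sup>2) \<le> ennreal (2 * C\<rho>\<^sup>2 * (1 + ?x powr ?p) + 2)" by (rule ennreal_leI)
    then show ?thesis by (simp add: ennreal_mult)
  qed
  have "(\<integral>\<^sup>+t. ennreal ((qq t)\<^sup>2) \<partial>MT T) \<le> (\<integral>\<^sup>+t. ennreal (2 * C\<rho>\<^sup>2) * (1 + ennreal (enn2real (?C t) powr ?p)) + 2 \<partial>MT T)"
    by (rule nn_integral_mono) (rule pw)
  also have "\<dots> = ennreal (2 * C\<rho>\<^sup>2) * (ennreal T + (\<integral>\<^sup>+t. ennreal (enn2real (?C t) powr ?p) \<partial>MT T)) + 2 * ennreal T"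
    using MT_const[OF less_imp_le[OF T]] by (simp add: nn_integral_add nn_integral_cmult del: nn_integral_const)
  also have "(\<integral>\<^sup>+t. ennreal (enn2real (?C t) powr ?p) \<partial>MT T) \<le> (\<integral>\<^sup>+t. ennpowr (?C t) ?p \<partial>MT T)"
    by (intro nn_integral_mono) (auto simp: ennpowr_def)
  also have "\<dots> \<le> ennreal (MQ powr ?p)" using coefs(2) unfolding nn_MT .
  also have "ennreal (2 * C\<rho>\<^sup>2) * (ennreal T + ennreal (MQ powr ?p)) + 2 * ennreal T = ennreal XQ"
    unfolding XQ_def using T by (simp add: ennreal_mult ennreal_plus)
  finally show ?thesis by (simp add: add_mono mult_left_mono)
qed

lemma int_X: "(\<integral>\<^sup>+t. ennreal (X t) \<partial>MT T) \<le> ennreal (MR\<^sup>2)"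
proof -
  have "(\<integral>\<^sup>+t. ennreal (X t) \<partial>MT T) \<le> (\<integral>\<^sup>+t. Hs_sq (1 - \<gamma> / 2) (fc (R t)) \<partial>MT T)"
  proof (rule nn_integral_mono)
    fix t assume "t \<in> space (MT T)"
    then have "fin_hom (2 * (1 - \<gamma> / 2)) (R t)" using \<gamma> by (intro c1per_fin_hom[OF jc1D(3)[OF jc1_R tin]]) auto
    from hom2_le_Hs_sq[OF s_range(1) this] show "ennreal (X t) \<le> Hs_sq (1 - \<gamma> / 2) (fc (R t))" by (simp add: X_def two_s)
  qed
  also have "\<dots> \<le> ennreal (MR\<^sup>2)" using coefs(3) unfolding nn_MT .
  finally show ?thesis .
qed

text \<open>The integrated right-hand sides are combinations of the same five functions of time, so
  a balance is described by five coefficients and the integration is done once; \<open>I5\<close> is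
  the resulting bound.\<close>

definition "F5 k1 k2 k3 k4 k5 t = k1 * H t + k2 * N t + k3 * (qq t)\<^sup>2 + k4 * X t + k5"
definition "I5 k1 k2 k3 k4 k5 = k1 * HH + k2 * NN + k3 * XQ + k4 * MR\<^sup>2 + k5 * T"

lemma F5:
  assumes k: "0 \<le> k1" "0 \<le> k2" "0 \<le> k3" "0 \<le> k4" "0 \<le> k5"
  shows "F5 k1 k2 k3 k4 k5 \<in> borel_measurable (MT T)" "\<And>t. t \<in> {0..T} \<Longrightarrow> 0 \<le> F5 k1 k2 k3 k4 k5 t" "0 \<le> I5 k1 k2 k3 k4 k5"
    "(\<integral>\<^sup>+t. ennreal (F5 k1 k2 k3 k4 k5 t) \<partial>MT T) \<le> ennreal (I5 k1 k2 k3 k4 k5)"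
proof -
  show "F5 k1 k2 k3 k4 k5 \<in> borel_measurable (MT T)" unfolding F5_def[abs_def] by measurable
  show "0 \<le> F5 k1 k2 k3 k4 k5 t" if "t \<in> {0..T}" for t unfolding F5_def using k nonneg[OF that] by simp
  show "0 \<le> I5 k1 k2 k3 k4 k5" unfolding I5_def using k HH_nonneg NN_nonneg XQ_nonneg T by simp
  have "(\<integral>\<^sup>+t. ennreal (F5 k1 k2 k3 k4 k5 t) \<partial>MT T) = (\<integral>\<^sup>+t. ennreal k1 * ennreal (H t) + ennreal k2 * ennreal (N t)
      + ennreal k3 * ennreal ((qq t)\<^sup>2) + ennreal k4 * ennreal (X t) + ennreal k5 \<partial>MT T)"
    using k nonneg by (intro nn_integral_cong) (simp add: F5_def tin ennreal_mult ennreal_plus)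
  also have "\<dots> = ennreal k1 * ennreal HH + ennreal k2 * ennreal NN + ennreal k3 * (\<integral>\<^sup>+t. ennreal ((qq t)\<^sup>2) \<partial>MT T)
      + ennreal k4 * (\<integral>\<^sup>+t. ennreal (X t) \<partial>MT T) + ennreal k5 * ennreal T"
    using MT_const[OF less_imp_le[OF T]] by (simp add: nn_integral_add nn_integral_cmult int_H int_N del: nn_integral_const)
  also have "\<dots> \<le> ennreal k1 * ennreal HH + ennreal k2 * ennreal NN + ennreal k3 * ennreal XQ + ennreal k4 * ennreal (MR\<^sup>2) + ennreal k5 * ennreal T"
    by (intro add_mono mult_left_mono int_qq int_X) auto
  also have "\<dots> = ennreal (I5 k1 k2 k3 k4 k5)"
    unfolding I5_def using k HH_nonneg NN_nonneg XQ_nonneg T by (simp add: ennreal_mult ennreal_plus)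
  finally show "(\<integral>\<^sup>+t. ennreal (F5 k1 k2 k3 k4 k5 t) \<partial>MT T) \<le> ennreal (I5 k1 k2 k3 k4 k5)" .
qed

lemma L1_le:
  assumes s: "s \<in> {0..T}" shows "pint (\<lambda>y. \<bar>m s y\<bar>) \<le> A1"
proof -
  note k = order_refl[of "0::real"] order_refl[of "0::real"]
  have k': "0 \<le> 16 * S'\<^sup>2 / c" "0 \<le> 1 / c" "0 \<le> 4 * (S' * A)\<^sup>2 / c" using c by auto
  note F = F5[OF k k']
  let ?F = "F5 0 0 (16 * S'\<^sup>2 / c) (1 / c) (4 * (S' * A)\<^sup>2 / c)"
  have "AE t in MT T. t \<in> {0..T}" by (rule AE_I2) (rule tin)
  with holder_ae have ae: "AE t in MT T. pint (\<lambda>y. e (m t y) * mt t y) + 0 \<le> ?F t"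
  proof eventually_elim
    fix t assume h: "holder \<alpha> A (a t) \<and> holder \<alpha> (qq t) (Q t)" and t: "t \<in> {0..T}"
    interpret qf: quadratic_flux "m t" "deriv (m t)" "a t" "deriv (a t)" "Q t" "deriv (Q t)" by (rule quadratic_flux[OF t])
    have "pint (\<lambda>y. e (m t y) * mt t y) \<le> (4 * (S' * A)\<^sup>2 + 16 * (S' * qq t)\<^sup>2 + X t) / c"
      using qf.L1_fixed_sewing[OF entropy_axioms \<gamma> c V_deriv(1)[OF t] jc1D(3)[OF jc1_R t] V_deriv(3)[OF t] conjunct1[OF h] conjunct2[OF h] sub']
      by (simp add: mt_eq[OF t] X_def)
    also have "\<dots> = ?F t" using c by (simp add: F5_def field_simps power_mult_distrib)
    finally show "pint (\<lambda>y. e (m t y) * mt t y) + 0 \<le> ?F t" by simp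
  qed
  have "ennreal (pint (\<lambda>y. \<eta> (m s y))) + (\<integral>\<^sup>+t. ennreal 0 \<partial>MT s)
    \<le> ennreal (pint (\<lambda>y. \<eta> (m 0 y))) + (\<integral>\<^sup>+t. ennreal (?F t) \<partial>MT T)"
    by (rule energy_le[OF eta cont_e eta_nonneg _ _ F(1,2) ae s]) auto
  also have "\<dots> \<le> ennreal (max M1 0 + C0) + ennreal (I5 0 0 (16 * S'\<^sup>2 / c) (1 / c) (4 * (S' * A)\<^sup>2 / c))"
  proof (intro add_mono F(4) ennreal_leI)
    have m0: "cper (m 0)" using m_cper T by simp
    have "pint (\<lambda>y. \<eta> (m 0 y)) \<le> pint (\<lambda>y. \<bar>m 0 y\<bar> + C0)"
      by (rule pint_mono[OF cper_compose[OF m0 cont_eta] cper_add[OF cper_abs[OF m0] cper_const] eta_le])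
    also have "\<dots> = pint (\<lambda>y. \<bar>m 0 y\<bar>) + C0" by (simp add: pint_add[OF cper_abs[OF m0] cper_const])
    also have "pint (\<lambda>y. \<bar>m 0 y\<bar>) \<le> max M1 0"
      using init unfolding initial_bounds_def L1_norm_pint[OF m0] by (auto simp: ennreal_le_iff2 max_def)
    finally show "pint (\<lambda>y. \<eta> (m 0 y)) \<le> max M1 0 + C0" by simp
  qed
  finally have "ennreal (pint (\<lambda>y. \<eta> (m s y))) \<le> ennreal (max M1 0 + C0 + I5 0 0 (16 * S'\<^sup>2 / c) (1 / c) (4 * (S' * A)\<^sup>2 / c))"
    using C0_nonneg F(3) by simp
  then have "pint (\<lambda>y. \<eta> (m s y)) \<le> max M1 0 + C0 + I5 0 0 (16 * S'\<^sup>2 / c) (1 / c) (4 * (S' * A)\<^sup>2 / c)"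
    using C0_nonneg F(3) by (subst (asm) ennreal_le_iff) auto
  then show ?thesis using L1_le_entropy[OF s] by (simp add: A1_def I5_def)
qed

text \<open>For \<gamma> < 2 this is the assumed bound on D. For \<gamma> = 2 the seminorm has order
  0, and V is a times the derivative of m with a <= J1^2.\<close>

lemma V_bound:
  assumes t: "t \<in> {0..T}" shows "hom2 (2 - \<gamma>) (V t) \<le> KV * (LL t + H t)"
proof (cases "\<gamma> < 2")
  case True
  note V = V_deriv(1)[OF t] and mf = m_fin[OF t]
  have s: "0 \<le> \<gamma> / 2" "\<gamma> / 2 \<le> 1" using \<gamma> by auto
  have Hm: "Hs_sq (\<gamma> / 2) (fc (m t)) \<le> ennreal (2 * (LL t + H t))"
    using Hs_sq_le[OF s m_cper[OF t]] mf by (simp add: LL_def L2_def H_def)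
  have per: "periodic1 (m t)" using m_cper[OF t] by (simp add: cper_def)
  have "set_integrable lborel {0..1} (\<lambda>x. (m t x)\<^sup>2)"
    by (rule borel_integrable_atLeastAtMost') (rule cper_cont[OF cper_power[OF m_cper[OF t]]])
  then have "in_Hs (\<gamma> / 2) (m t)"
    unfolding in_Hs_def using per cper_borel[OF m_cper[OF t]] order.strict_trans1[OF Hm ennreal_less_top] by simp
  then have D: "Hs_sq (1 - \<gamma> / 2) (fc (V t)) \<le> ennreal (CD\<^sup>2) * Hs_sq (\<gamma> / 2) (fc (m t))"
    using bs True t unfolding bounded_solution_def operator_bounds_def by blast
  have fin: "fin_hom (2 * (1 - \<gamma> / 2)) (V t)" using \<gamma> by (intro c1per_fin_hom[OF V]) auto
  have "ennreal (hom2 (2 - \<gamma>) (V t)) \<le> Hs_sq (1 - \<gamma> / 2) (fc (V t))"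
    using hom2_le_Hs_sq[OF s_range(1) fin] by (simp add: two_s)
  also have "\<dots> \<le> ennreal (CD\<^sup>2) * ennreal (2 * (LL t + H t))" by (rule order_trans[OF D mult_left_mono[OF Hm]]) simp
  also have "\<dots> = ennreal (2 * CD\<^sup>2 * (LL t + H t))" 
    by (subst ennreal_mult[symmetric]) (use nonneg[OF t] in \<open>auto simp: mult_ac\<close>)
  finally have "hom2 (2 - \<gamma>) (V t) \<le> 2 * CD\<^sup>2 * (LL t + H t)" using nonneg[OF t] by (subst (asm) ennreal_le_iff) auto
  also have "\<dots> \<le> KV * (LL t + H t)" using nonneg[OF t] by (intro mult_right_mono) (auto simp: KV_def)
  finally show ?thesis .
next
  case False
  then have g: "\<gamma> = 2" using \<gamma> by simp
  interpret df: diffeo \<psi> t J0 J1 by (rule diffeo[OF t])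
  have V: "V t y = a t y * deriv (m t) y" for y by (simp add: Dop_def g)
  have cV: "cper (V t)" by (rule c1per_cper[OF V_deriv(1)[OF t]])
  note cm = jc1D(5)[OF jc1_m t]
  have "hom2 (2 - \<gamma>) (V t) \<le> pint (\<lambda>y. (V t y)\<^sup>2)" using hom2_0_le[OF cV] by (simp add: g)
  also have "\<dots> \<le> pint (\<lambda>y. J1 ^ 4 * (deriv (m t) y)\<^sup>2)"
  proof (rule pint_mono[OF cper_power[OF cV] cper_mult[OF cper_const cper_power[OF cm]]])
    fix y
    have "(a t y)\<^sup>2 \<le> (J1\<^sup>2)\<^sup>2" using df.coef_a_bounds[of y] by (intro power_mono) (auto intro: order_trans[OF zero_le_power2])
    then show "(V t y)\<^sup>2 \<le> J1 ^ 4 * (deriv (m t) y)\<^sup>2" unfolding V by (simp add: power_mult_distrib mult_right_mono)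
  qed
  also have "\<dots> = J1 ^ 4 * H t" unfolding H_def pint_cmult by (simp add: g c1per_hom2(2)[OF m_c1[OF t]])
  also have "\<dots> \<le> KV * (LL t + H t)" using nonneg[OF t] by (intro mult_mono) (auto simp: KV_def)
  finally show ?thesis .
qed

end

section \<open>The energy and third-order balances integrated in time\<close>

context regular_solution
begin

lemma slice_at:
  assumes t: "t \<in> {0..T}" and h: "holder \<alpha> A (a t) \<and> holder \<alpha> (qq t) (Q t)"
  shows "slice \<gamma> \<alpha> \<kappa> (m t) (deriv (m t)) (a t) (deriv (a t)) (Q t) (deriv (Q t)) (V t) (deriv (V t)) (R t) (deriv (R t)) A (qq t)"
  using h by (intro slice.intro expo_axioms quadratic_flux[OF t] slice_axioms.intro V_deriv(1)[OF t] jc1D(3)[OF jc1_R t] qq_pos) auto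

lemma slice_mt:
  assumes "t \<in> {0..T}" "holder \<alpha> A (a t) \<and> holder \<alpha> (qq t) (Q t)"
  shows "slice.mt (m t) (deriv (m t)) (a t) (deriv (a t)) (Q t) (deriv (Q t)) (deriv (V t)) (deriv (R t)) = mt t"
  by (rule ext) (simp only: slice.mt_def[OF slice_at[OF assms]] mt_eq[OF assms(1)])

lemma bd_le:
  assumes "moduli \<epsilon> C" "t \<in> {0..T}"
  shows "mod_bd \<epsilon> C 0 (m t) = \<epsilon> * H t + \<epsilon> * N t + C" "mod_bd \<epsilon> C (qq t) (m t) \<le> \<epsilon> * H t + \<epsilon> * E * (qq t)\<^sup>2 + \<epsilon> * N t + C"
proof -
  show "mod_bd \<epsilon> C 0 (m t) = \<epsilon> * H t + \<epsilon> * N t + C" by (simp add: mod_bd_def H_def N_def)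
  have "\<epsilon> * ((qq t)\<^sup>2 * LL t) \<le> \<epsilon> * ((qq t)\<^sup>2 * E)"
    using assms LL_le[OF assms(2)] by (intro mult_left_mono) (auto simp: moduli_def)
  then show "mod_bd \<epsilon> C (qq t) (m t) \<le> \<epsilon> * H t + \<epsilon> * E * (qq t)\<^sup>2 + \<epsilon> * N t + C"
    by (simp add: mod_bd_def H_def N_def LL_def mult_ac)
qed

text \<open>Both bounds come from one inequality at time s: dropping the dissipation and taking the
  supremum over s, or taking s = T and dropping the energy.\<close>

lemma energy_bound:
  assumes M: "moduli \<epsilon> C"
  defines "I \<equiv> I5 (S * A * \<epsilon> + S * \<epsilon> + \<epsilon> / 2) (S * A * \<epsilon> + S * \<epsilon>) (S * \<epsilon> * E) (1 / (2 * \<epsilon>)) (S * A * C + S * C)"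
  shows "E / 2 \<le> M2\<^sup>2 / 2 + I" "c * HH \<le> M2\<^sup>2 / 2 + I"
proof -
  have C: "0 < \<epsilon>" "0 \<le> C" using M by (auto simp: moduli_def)
  note sg = S_pos A_nonneg E_nonneg
  have k: "0 \<le> S * A * \<epsilon> + S * \<epsilon> + \<epsilon> / 2" "0 \<le> S * A * \<epsilon> + S * \<epsilon>" "0 \<le> S * \<epsilon> * E" "0 \<le> 1 / (2 * \<epsilon>)" "0 \<le> S * A * C + S * C"
    using C sg by (auto intro!: add_nonneg_nonneg mult_nonneg_nonneg)
  note F = F5[OF k]
  let ?F = "F5 (S * A * \<epsilon> + S * \<epsilon> + \<epsilon> / 2) (S * A * \<epsilon> + S * \<epsilon>) (S * \<epsilon> * E) (1 / (2 * \<epsilon>)) (S * A * C + S * C)"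
  have "AE t in MT T. t \<in> {0..T}" by (rule AE_I2) (rule tin)
  with holder_ae have ae: "AE t in MT T. pint (\<lambda>y. m t y * mt t y) + c * H t \<le> ?F t"
  proof eventually_elim
    fix t assume h: "holder \<alpha> A (a t) \<and> holder \<alpha> (qq t) (Q t)" and t: "t \<in> {0..T}"
    interpret sl: slice \<gamma> \<alpha> \<kappa> "m t" "deriv (m t)" "a t" "deriv (a t)" "Q t" "deriv (Q t)" "V t" "deriv (V t)" "R t" "deriv (R t)" A "qq t"
      by (rule slice_at[OF t h])
    have "pint (\<lambda>y. m t y * mt t y) \<le> - c * H t + S * A * mod_bd \<epsilon> C 0 (m t) + S * mod_bd \<epsilon> C (qq t) (m t) + (\<epsilon> * H t + X t / \<epsilon>) / 2"
      using sl.energy_fixed[OF modulus_cube[OF M m_cper[OF t] m_fin[OF t]] modulus_square[OF M m_cper[OF t] m_fin[OF t] less_imp_le[OF qq_pos]] C(1) V_deriv(2)[OF t]] by (simp add: slice_mt[OF t h] H_def X_def)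
    also have "S * mod_bd \<epsilon> C (qq t) (m t) \<le> S * (\<epsilon> * H t + \<epsilon> * E * (qq t)\<^sup>2 + \<epsilon> * N t + C)"
      using S_pos by (intro mult_left_mono bd_le(2)[OF M t]) auto
    finally show "pint (\<lambda>y. m t y * mt t y) + c * H t \<le> ?F t"
      unfolding bd_le(1)[OF M t] F5_def by (simp add: algebra_simps add_divide_distrib)
  qed
  have sq: "((\<lambda>z. z\<^sup>2 / 2) has_real_derivative z) (at z)" for z :: real
    by (rule derivative_eq_intros refl | simp)+
  have half: "pint (\<lambda>y. (m s y)\<^sup>2 / 2) = LL s / 2" for s by (simp add: LL_def L2_def)
  have main: "ennreal (LL s / 2) + (\<integral>\<^sup>+t. ennreal (c * H t) \<partial>MT s) \<le> ennreal (M2\<^sup>2 / 2 + I)" if s: "s \<in> {0..T}" for s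
  proof -
    have "ennreal (LL s / 2) + (\<integral>\<^sup>+t. ennreal (c * H t) \<partial>MT s) \<le> ennreal (LL 0 / 2) + (\<integral>\<^sup>+t. ennreal (?F t) \<partial>MT T)"
      unfolding half[symmetric]
      by (rule energy_le[OF sq _ _ _ _ F(1,2) ae s]) (use nonneg(1) c in \<open>auto intro: continuous_intros\<close>)
    also have "\<dots> \<le> ennreal (M2\<^sup>2 / 2) + ennreal I"
    proof (intro add_mono ennreal_leI)
      have m0: "cper (m 0)" using m_cper T by simp
      have "LL 0 \<le> M2\<^sup>2" using init unfolding initial_bounds_def L2_sq_pint[OF m0] by (simp add: LL_def L2_def)
      then show "LL 0 / 2 \<le> M2\<^sup>2 / 2" by simp
    qed (use F(4) in \<open>simp add: I_def\<close>)
    finally show ?thesis using F(3) by (simp add: I_def)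
  qed
  have nn: "0 \<le> M2\<^sup>2 / 2 + I" using F(3) by (simp add: I_def)
  have "E \<le> 2 * (M2\<^sup>2 / 2 + I)"
  proof (rule E_least)
    fix t assume t: "t \<in> {0..T}"
    have "ennreal (LL t / 2) \<le> ennreal (M2\<^sup>2 / 2 + I)" by (rule order_trans[OF _ main[OF t]]) simp
    then show "LL t \<le> 2 * (M2\<^sup>2 / 2 + I)" using nn by (subst (asm) ennreal_le_iff) auto
  qed
  then show "E / 2 \<le> M2\<^sup>2 / 2 + I" by simp
  have "ennreal (c * HH) = ennreal c * (\<integral>\<^sup>+t. ennreal (H t) \<partial>MT T)"
    using c HH_nonneg by (simp add: int_H ennreal_mult)
  also have "\<dots> = (\<integral>\<^sup>+t. ennreal (c * H t) \<partial>MT T)"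
    using c by (simp add: nn_integral_cmult[symmetric] ennreal_mult' cong: nn_integral_cong)
  also have "\<dots> \<le> ennreal (M2\<^sup>2 / 2 + I)" by (rule order_trans[OF _ main[of T]]) (use T in auto)
  finally show "c * HH \<le> M2\<^sup>2 / 2 + I" using nn by (subst (asm) ennreal_le_iff) auto
qed

text \<open>The third-order balance at step h has the bound \<open>h * YI \<epsilon> C\<close>: 4 E
  comes from the boundary terms in time, the rest from the right-hand side of
  \<open>K_fixed\<close>, and the prefactor from dividing by J0^2 / 3.\<close>

definition "YI \<epsilon> C = 3 / J0\<^sup>2 * (4 * E + I5 ((2 * S + 1) * (A * \<epsilon> + \<epsilon>) + 4 + 2 * KV) ((2 * S + 1) * (A * \<epsilon> + \<epsilon>))
    ((2 * S + 1) * \<epsilon> * E) 2 ((2 * S + 1) * (A * C + C) + 2 * KV * E))"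

lemma K_bound:
  assumes M: "moduli \<epsilon> C"
  shows "0 \<le> YI \<epsilon> C" "\<And>h. 0 < h \<Longrightarrow> h \<le> 1 \<Longrightarrow> (\<integral>\<^sup>+t. ennreal (Kh h (m t)) \<partial>MT T) \<le> ennreal (h * YI \<epsilon> C)"
proof -
  have C: "0 < \<epsilon>" "0 \<le> C" using M by (auto simp: moduli_def)
  note sg = S_pos A_nonneg E_nonneg KV_nonneg
  let ?k1 = "(2 * S + 1) * (A * \<epsilon> + \<epsilon>) + 4 + 2 * KV" and ?k2 = "(2 * S + 1) * (A * \<epsilon> + \<epsilon>)" and ?k3 = "(2 * S + 1) * \<epsilon> * E"
    and ?k5 = "(2 * S + 1) * (A * C + C) + 2 * KV * E"
  have k: "0 \<le> ?k1" "0 \<le> ?k2" "0 \<le> ?k3" "0 \<le> (2::real)" "0 \<le> ?k5"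
    using C sg by (auto intro!: add_nonneg_nonneg mult_nonneg_nonneg)
  note F = F5[OF k]
  let ?F = "F5 ?k1 ?k2 ?k3 2 ?k5" and ?I = "I5 ?k1 ?k2 ?k3 2 ?k5"
  show "0 \<le> YI \<epsilon> C" unfolding YI_def using F(3) E_nonneg by simp
  fix h :: real assume h: "0 < h" "h \<le> 1"
  let ?d = "\<lambda>t r y. m t (y + r) - m t y"
  let ?g = "\<lambda>t r. pint (\<lambda>y. ?d t r y * \<bar>?d t r y\<bar> / 2)"
  let ?w = "\<lambda>t r. pint (\<lambda>y. \<bar>?d t r y\<bar> * (mt t (y + r) - mt t y))"
  note cm = jc_subst[OF jc1D(1)[OF jc1_m]] and cmt = jc_subst[OF jc_mt]
  have jd: "jc T (\<lambda>t y. ?d t r y * \<bar>?d t r y\<bar> / 2)" "jc T (\<lambda>t y. \<bar>?d t r y\<bar> * (mt t (y + r) - mt t y))" for r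
    unfolding jc_def by (intro continuous_intros cm cmt; auto)+
  have jg: "jc T ?g" "jc T ?w"
    unfolding jc_def by (rule continuous_on_integral2; unfold case_prod_unfold; intro continuous_intros cm cmt; auto)+
  have dg: "((\<lambda>t. ?g t r) has_real_derivative ?w t r) (at t within {0..T})" if t: "t \<in> {0..T}" for t r
  proof (rule leibniz_MT[OF _ jd t])
    fix t y assume t: "t \<in> {0..T}"
    have "((\<lambda>t. ?d t r y) has_real_derivative mt t (y + r) - mt t y) (at t within {0..T})"
      by (rule DERIV_diff[OF m_deriv[OF t] m_deriv[OF t]])
    from DERIV_cdivide[OF DERIV_chain2[OF DERIV_mult_abs this], of 2]
    show "((\<lambda>t. ?d t r y * \<bar>?d t r y\<bar> / 2) has_real_derivative \<bar>?d t r y\<bar> * (mt t (y + r) - mt t y)) (at t within {0..T})"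
      by (simp add: mult_ac)
  qed
  have g_le: "\<bar>?g t r\<bar> \<le> 2 * E" if t: "t \<in> {0..T}" for t r
  proof -
    note c = m_cper[OF t]
    have cd: "cper (?d t r)" by (rule cper_diff[OF cper_shift[OF c] c])
    have cg: "cper (\<lambda>y. ?d t r y * \<bar>?d t r y\<bar> / 2)"
      using cper_mult[OF cper_const cper_mult[OF cd cper_abs[OF cd]], of "1 / 2"] by simp
    have "\<bar>?g t r\<bar> \<le> pint (\<lambda>y. \<bar>?d t r y * \<bar>?d t r y\<bar> / 2\<bar>)" by (rule pint_abs_le[OF cg])
    also have "\<dots> \<le> pint (\<lambda>y. (m t (y + r))\<^sup>2 + (m t y)\<^sup>2)"
    proof (rule pint_mono[OF cper_abs[OF cg] cper_add[OF cper_power[OF cper_shift[OF c]] cper_power[OF c]]])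
      fix y show "\<bar>?d t r y * \<bar>?d t r y\<bar> / 2\<bar> \<le> (m t (y + r))\<^sup>2 + (m t y)\<^sup>2"
        using sum_squares_bound[of "m t (y + r)" "- m t y"] by (simp add: abs_mult power2_eq_square[symmetric] power2_diff)
    qed
    also have "\<dots> = LL t + LL t"
      by (simp add: pint_add[OF cper_power[OF cper_shift[OF c]] cper_power[OF c]] LL_def L2_def pint_shift[OF cper_power[OF c]])
    finally show ?thesis using LL_le[OF t] by simp
  qed
  have G_le: "\<bar>integral {0..h} (?g t)\<bar> \<le> 2 * E * h" if t: "t \<in> {0..T}" for t
    using integral_bound[of 0 h "?g t" "2 * E"] h g_le[OF t] jc_subst[OF jg(1) continuous_on_const continuous_on_id] t by auto
  \<comment> \<open>Minus the functional for |d| d / 2 integrated over steps in (0, h), raised by 2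
    E h so that it is nonnegative, as \<open>energy_integrate\<close> requires.\<close>
  let ?G = "\<lambda>t. 2 * E * h - integral {0..h} (?g t)" and ?G' = "\<lambda>t. - integral {0..h} (?w t)"
  have "AE t in MT T. t \<in> {0..T}" by (rule AE_I2) (rule tin)
  with holder_ae have ae: "AE t in MT T. ?G' t + J0\<^sup>2 / 3 * Kh h (m t) \<le> h * ?F t"
  proof eventually_elim
    fix t assume ho: "holder \<alpha> A (a t) \<and> holder \<alpha> (qq t) (Q t)" and t: "t \<in> {0..T}"
    interpret sl: slice \<gamma> \<alpha> \<kappa> "m t" "deriv (m t)" "a t" "deriv (a t)" "Q t" "deriv (Q t)" "V t" "deriv (V t)" "R t" "deriv (R t)" A "qq t"
      by (rule slice_at[OF t ho])
    note Mt = M m_cper[OF t] m_fin[OF t] and qp = less_imp_le[OF qq_pos[of t]]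
    have "J0\<^sup>2 / 3 * Kh h (m t) \<le> integral {0..h} (?w t) + h * ((2 * S + 1) * (A * mod_bd \<epsilon> C 0 (m t) + mod_bd \<epsilon> C (qq t) (m t))
        + 4 * H t + 2 * hom2 (2 - \<gamma>) (V t) + 2 * X t)"
      using sl.K_fixed[OF modulus_abs_cube[OF Mt] modulus_square_delta[OF Mt qp] cubic_increment[OF Mt] quadratic_increment[OF Mt qp] zero_le_power2 diffeo.coef_a_bounds(1)[OF diffeo[OF t]] h] by (simp add: slice_mt[OF t ho] H_def X_def)
    also have "(2 * S + 1) * (A * mod_bd \<epsilon> C 0 (m t) + mod_bd \<epsilon> C (qq t) (m t)) + 4 * H t + 2 * hom2 (2 - \<gamma>) (V t) + 2 * X t \<le>
       (2 * S + 1) * (A * (\<epsilon> * H t + \<epsilon> * N t + C) + (\<epsilon> * H t + \<epsilon> * E * (qq t)\<^sup>2 + \<epsilon> * N t + C)) + 4 * H t + 2 * (KV * (E + H t)) + 2 * X t"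
    proof -
      have "KV * (LL t + H t) \<le> KV * (E + H t)" using LL_le[OF t] KV_nonneg by (intro mult_left_mono) auto
      then have "hom2 (2 - \<gamma>) (V t) \<le> KV * (E + H t)" using V_bound[OF t] by simp
      then show ?thesis unfolding bd_le(1)[OF M t] using S_pos
        by (intro add_mono mult_left_mono bd_le(2)[OF M t] order_refl) auto
    qed
    also have "\<dots> = ?F t" unfolding F5_def by (simp add: algebra_simps)
    finally show "?G' t + J0\<^sup>2 / 3 * Kh h (m t) \<le> h * ?F t" using h by (simp add: mult_left_mono)
  qed
  have cK: "continuous_on {0..T} (\<lambda>t. Kh h (m t))"
  proof -
    have "jc T (\<lambda>t y. \<bar>?d t h y\<bar> ^ 3)" unfolding jc_def by (intro continuous_intros cm) auto
    from jc_pint[OF this] show ?thesis by (simp add: Kh_def)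
  qed
  have [measurable]: "(\<lambda>t. Kh h (m t)) \<in> borel_measurable (MT T)" by (rule cont_MT[OF cK])
  have Kpos: "0 \<le> Kh h (m t)" if "t \<in> {0..T}" for t
    unfolding Kh_def by (rule pint_nonneg[OF cper_power[OF cper_abs[OF cper_diff[OF cper_shift[OF m_cper[OF that]] m_cper[OF that]]]]]) simp
  note F(1)[measurable]
  have "ennreal (?G T) + (\<integral>\<^sup>+t. ennreal (J0\<^sup>2 / 3 * Kh h (m t)) \<partial>MT T) \<le> ennreal (?G 0) + (\<integral>\<^sup>+t. ennreal (h * ?F t) \<partial>MT T)"
  proof (rule energy_integrate[OF less_imp_le[OF T] _ _ _ _ _ _ _ _ ae])
    show "(?G has_real_derivative ?G' t) (at t within {0..T})" if "t \<in> {0..T}" for t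
      using DERIV_diff[OF DERIV_const leibniz_MT[OF dg jg that]] by simp
    show "continuous_on {0..T} ?G'"
      by (intro continuous_intros continuous_on_integral2) (use jg(2) in \<open>auto simp: jc_def case_prod_unfold elim: continuous_on_subset\<close>)
    show "0 \<le> ?G 0" "0 \<le> ?G T" using G_le[of 0] G_le[of T] T by (auto simp: abs_le_iff)
  qed (use Kpos F(2) h in auto)
  then have "(\<integral>\<^sup>+t. ennreal (J0\<^sup>2 / 3 * Kh h (m t)) \<partial>MT T) \<le> ennreal (?G 0) + (\<integral>\<^sup>+t. ennreal (h * ?F t) \<partial>MT T)"
    by (rule order_trans[rotated]) simp
  also have "\<dots> \<le> ennreal (4 * E * h) + ennreal h * ennreal ?I"
  proof (intro add_mono ennreal_leI)
    have "\<bar>x\<bar> \<le> 2 * E * h \<Longrightarrow> 2 * E * h - x \<le> 4 * E * h" for x by linarith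
    from this[OF G_le[of 0]] show "?G 0 \<le> 4 * E * h" using T by simp
    show "(\<integral>\<^sup>+t. ennreal (h * ?F t) \<partial>MT T) \<le> ennreal h * ennreal ?I"
      using h mult_left_mono[OF F(4), of "ennreal h"] by (simp add: ennreal_mult' nn_integral_cmult)
  qed
  also have "\<dots> = ennreal (h * (4 * E + ?I))"
    using h F(3) E_nonneg by (simp add: ennreal_mult[symmetric] ennreal_plus[symmetric] distrib_left mult_ac del: ennreal_plus)
  finally have le: "(\<integral>\<^sup>+t. ennreal (J0\<^sup>2 / 3 * Kh h (m t)) \<partial>MT T) \<le> ennreal (h * (4 * E + ?I))" .
  have "(\<integral>\<^sup>+t. ennreal (Kh h (m t)) \<partial>MT T) = ennreal (3 / J0\<^sup>2) * (\<integral>\<^sup>+t. ennreal (J0\<^sup>2 / 3 * Kh h (m t)) \<partial>MT T)"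
    using J0 by (subst nn_integral_cmult[symmetric], measurable) (auto simp: ennreal_mult'[symmetric] intro!: nn_integral_cong)
  also have "\<dots> \<le> ennreal (3 / J0\<^sup>2) * ennreal (h * (4 * E + ?I))" by (rule mult_left_mono[OF le]) simp
  also have "\<dots> = ennreal (h * YI \<epsilon> C)" unfolding YI_def by (simp add: ennreal_mult'[symmetric] mult_ac)
  finally show "(\<integral>\<^sup>+t. ennreal (Kh h (m t)) \<partial>MT T) \<le> ennreal (h * YI \<epsilon> C)" .
qed

lemma jc_Kh: "continuous_on ({0..T} \<times> UNIV) (\<lambda>(t, h). Kh h (m t))"
  unfolding case_prod_unfold Kh_def
  by (rule continuous_on_integral2; unfold case_prod_unfold; intro continuous_intros jc_subst[OF jc1D(1)[OF jc1_m]]) auto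

text \<open>Tonelli's theorem brings the time integral inside, where \<open>K_bound\<close> applies
  to each fixed step.\<close>

lemma K_integral:
  assumes M: "moduli \<epsilon> C" and s: "s < 1 / 3"
  shows "(\<integral>\<^sup>+t. (\<integral>\<^sup>+h\<in>{0..1}. ennreal (h powr (- 1 - 3 * s)) * ennreal (Kh h (m t)) \<partial>lborel) \<partial>MT T) \<le> ennreal (YI \<epsilon> C / (1 - 3 * s))"
proof -
  have "(\<integral>\<^sup>+t. (\<integral>\<^sup>+h\<in>{0..1}. ennreal (h powr (- 1 - 3 * s)) * ennreal (Kh h (m t)) \<partial>lborel) \<partial>MT T)
     = (\<integral>\<^sup>+h\<in>{0..1}. ennreal (h powr (- 1 - 3 * s)) * (\<integral>\<^sup>+t. ennreal (Kh h (m t)) \<partial>MT T) \<partial>lborel)"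
    by (rule tonelli_MT(1)[OF jc_Kh]) measurable
  also have "\<dots> \<le> (\<integral>\<^sup>+h\<in>{0..1}. ennreal (h powr (- 1 - 3 * s)) * ennreal (h * YI \<epsilon> C) \<partial>lborel)"
  proof (rule nn_integral_mono)
    fix h :: real
    consider "h \<notin> {0..1}" | "h = 0" | "0 < h" "h \<le> 1" by fastforce
    then show "ennreal (h powr (- 1 - 3 * s)) * (\<integral>\<^sup>+t. ennreal (Kh h (m t)) \<partial>MT T) * indicator {0..1} h
        \<le> ennreal (h powr (- 1 - 3 * s)) * ennreal (h * YI \<epsilon> C) * indicator {0..1} h"
    proof cases
      case 3
      show ?thesis by (intro mult_right_mono mult_left_mono K_bound(2)[OF M 3]) auto
    qed simp_all
  qed
  also have "\<dots> = ennreal (YI \<epsilon> C / (1 - 3 * s))" by (rule nn_powr_linear[OF s K_bound(1)[OF M]])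
  finally show ?thesis .
qed

lemma NN_bound:
  assumes M: "moduli \<epsilon> C"
  shows "NN \<le> 64 * (2 * A1) powr (3 * s1) * (YI \<epsilon> C / (1 - 3 * s1)) + g2"
proof -
  let ?c = "64 * (2 * A1) powr (3 * s1)" and ?x = "YI \<epsilon> C / (1 - 3 * s1)"
  let ?I = "\<lambda>t. \<integral>\<^sup>+h\<in>{0..1}. ennreal (h powr (- 1 - 3 * s1)) * ennreal (Kh h (m t)) \<partial>lborel"
  have x: "0 \<le> ?x" using K_bound(1)[OF M] s1 by simp
  have pw: "ennreal (N t) \<le> ennreal ?c * ?I t + ennreal ((2 * A1) powr q)" if "t \<in> {0..T}" for t
    unfolding N_def by (rule gn_integrated[OF m_cper[OF that] A1_pos L1_le[OF that]])
  have [measurable]: "?I \<in> borel_measurable (MT T)" by (rule tonelli_MT(2)[OF jc_Kh]) measurable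
  have "ennreal NN \<le> (\<integral>\<^sup>+t. ennreal ?c * ?I t + ennreal ((2 * A1) powr q) \<partial>MT T)"
    unfolding int_N[symmetric] by (intro nn_integral_mono pw tin)
  also have "\<dots> = (\<integral>\<^sup>+t. ennreal ?c * ?I t \<partial>MT T) + ennreal ((2 * A1) powr q) * ennreal T"
    using MT_const[OF less_imp_le[OF T]] by (simp add: nn_integral_add del: nn_integral_const)
  also have "(\<integral>\<^sup>+t. ennreal ?c * ?I t \<partial>MT T) \<le> ennreal ?c * ennreal ?x"
    using s1 by (simp add: nn_integral_cmult mult_left_mono K_integral[OF M])
  finally have "ennreal NN \<le> ennreal ?c * ennreal ?x + ennreal ((2 * A1) powr q) * ennreal T" by simp
  also have "\<dots> = ennreal (?c * ?x + g2)"
  proof -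
    have "ennreal v * ennreal w + ennreal d * ennreal T = ennreal (v * w + d * T)" if "0 \<le> v" "0 \<le> w" "0 \<le> d" for v w d
      using that T by (simp add: ennreal_mult)
    then show ?thesis using x by (simp add: g2_def)
  qed
  finally have "ennreal NN \<le> ennreal (?c * ?x + g2)" .
  moreover have "0 \<le> ?c * ?x + g2" using x T by (intro add_nonneg_nonneg mult_nonneg_nonneg x) (auto simp: g2_def)
  ultimately show ?thesis by (simp only: ennreal_le_iff)
qed

end

section \<open>Closing the system of inequalities\<close>

context solution_constants
begin

text \<open>Coefficients of the linear inequalities: \<open>n1\<close> and \<open>n0\<close> belong
  to \<open>YI\<close>, \<open>P1\<close> and \<open>P0\<close> to the L^q norm after half of it has
  been absorbed, whence their factor 2, and \<open>D0\<close> to the energy balance.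
  \<open>BB\<close> is the final bound for E + HH.\<close>

definition "n1 \<epsilon> = 4 + ((2 * S + 1) * (A * \<epsilon> + \<epsilon>) + 4 + 2 * KV) + (2 * S + 1) * \<epsilon> * XQ + 2 * KV * T"
definition "n0 C = 2 * MR\<^sup>2 + (2 * S + 1) * (A * C + C) * T"
definition "P1 \<epsilon> = 2 * g1 * n1 \<epsilon>"
definition "P0 C = 2 * g1 * n0 C + 2 * g2"
definition "D0 = S * A + S + 1 / 2 + S * XQ"
definition "BB \<epsilon> C \<delta> D = (M2\<^sup>2 + 2 * (MR\<^sup>2 / (2 * \<delta>) + (S * A * D + S * D) * T) + 2 * \<delta> * D0 * P0 C) / (min (1 / 2) c / 2)"

lemma P1_nonneg: "0 < \<epsilon> \<Longrightarrow> 0 \<le> P1 \<epsilon>"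
  unfolding P1_def n1_def using S_pos A_nonneg KV_nonneg XQ_nonneg T g1_nonneg
  by (intro mult_nonneg_nonneg add_nonneg_nonneg) auto

lemma D0_pos: "0 < D0"
  unfolding D0_def using S_pos A_nonneg XQ_nonneg by (intro add_pos_nonneg add_nonneg_pos mult_nonneg_nonneg) auto

end

context regular_solution
begin

text \<open>Products of E with XQ and T are linear in E because both are data; the coefficients of E
  and of HH are merged into one, and the surplus is nonnegative.\<close>

lemma YI_le:
  assumes M: "moduli \<epsilon> C"
  shows "YI \<epsilon> C \<le> 3 / J0\<^sup>2 * (n1 \<epsilon> * (E + HH) + n0 C + (2 * S + 1) * (A * \<epsilon> + \<epsilon>) * NN)"
proof -
  have C: "0 < \<epsilon>" "0 \<le> C" using M by (auto simp: moduli_def)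
  let ?k = "(2 * S + 1) * (A * \<epsilon> + \<epsilon>)"
  have nn: "0 \<le> ?k" "0 \<le> (2 * S + 1) * \<epsilon> * XQ" "0 \<le> KV * T"
    using C S_pos A_nonneg KV_nonneg XQ_nonneg T by auto
  have "4 * E + I5 (?k + 4 + 2 * KV) ?k ((2 * S + 1) * \<epsilon> * E) 2 ((2 * S + 1) * (A * C + C) + 2 * KV * E)
     = n1 \<epsilon> * (E + HH) + n0 C + ?k * NN - ((?k + 4 + 2 * KV) * E + (4 + (2 * S + 1) * \<epsilon> * XQ + 2 * (KV * T)) * HH)"
    unfolding I5_def n1_def n0_def by (simp add: algebra_simps)
  also have "\<dots> \<le> n1 \<epsilon> * (E + HH) + n0 C + ?k * NN"
  proof -
    have "0 \<le> (?k + 4 + 2 * KV) * E + (4 + (2 * S + 1) * \<epsilon> * XQ + 2 * (KV * T)) * HH"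
      using nn C S_pos A_nonneg T XQ_nonneg KV_nonneg E_nonneg HH_nonneg by (intro add_nonneg_nonneg mult_nonneg_nonneg) auto
    then show ?thesis by linarith
  qed
  finally show ?thesis unfolding YI_def by (intro mult_left_mono) auto
qed

text \<open>Smallness of \<epsilon> puts at most half of NN on the right-hand side, and NN is a
  finite number, so it can be subtracted.\<close>

lemma NN_linear:
  assumes M: "moduli \<epsilon> C" and small: "g1 * ((2 * S + 1) * (A * \<epsilon> + \<epsilon>)) \<le> 1 / 2"
  shows "NN \<le> P1 \<epsilon> * (E + HH) + P0 C"
proof -
  let ?k = "(2 * S + 1) * (A * \<epsilon> + \<epsilon>)"
  have "NN \<le> 64 * (2 * A1) powr (3 * s1) / (1 - 3 * s1) * YI \<epsilon> C + g2" using NN_bound[OF M] by simp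
  also have "64 * (2 * A1) powr (3 * s1) / (1 - 3 * s1) * YI \<epsilon> C
      \<le> 64 * (2 * A1) powr (3 * s1) / (1 - 3 * s1) * (3 / J0\<^sup>2 * (n1 \<epsilon> * (E + HH) + n0 C + ?k * NN))"
    using s1 by (intro mult_left_mono YI_le[OF M]) auto
  also have "\<dots> = g1 * (n1 \<epsilon> * (E + HH) + n0 C + ?k * NN)" by (simp only: g1_def mult.assoc)
  also have "\<dots> = g1 * (n1 \<epsilon> * (E + HH)) + g1 * n0 C + (g1 * ?k) * NN" by (simp only: distrib_left[of g1] mult.assoc)
  also have "(g1 * ?k) * NN \<le> 1 / 2 * NN" by (rule mult_right_mono[OF small NN_nonneg])
  finally have "NN \<le> 2 * (g1 * (n1 \<epsilon> * (E + HH))) + 2 * (g1 * n0 C) + 2 * g2" by simp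
  then show ?thesis by (simp only: P1_def P0_def mult.assoc)
qed

text \<open>The energy balance is taken with a second parameter \<delta>, because the L^q norm
  brings back E + HH with the factor \<open>P1 \<epsilon>\<close>, whose size is known only after
  \<epsilon>. Supremum and dissipation obey the same bound, so their estimates are added.\<close>

lemma EH_bound:
  assumes M: "moduli \<epsilon> C" and small: "g1 * ((2 * S + 1) * (A * \<epsilon> + \<epsilon>)) \<le> 1 / 2"
    and M': "moduli \<delta> D" and small': "2 * \<delta> * D0 * (1 + P1 \<epsilon>) \<le> min (1 / 2) c / 2"
  shows "E + HH \<le> BB \<epsilon> C \<delta> D"
proof -
  have d: "0 < \<delta>" using M' by (simp add: moduli_def)
  let ?I = "I5 (S * A * \<delta> + S * \<delta> + \<delta> / 2) (S * A * \<delta> + S * \<delta>) (S * \<delta> * E) (1 / (2 * \<delta>)) (S * A * D + S * D)"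
  let ?b = "MR\<^sup>2 / (2 * \<delta>) + (S * A * D + S * D) * T"
  let ?c = "min (1 / 2) c"
  note nn = S_pos A_nonneg XQ_nonneg E_nonneg HH_nonneg NN_nonneg
  have "?I = \<delta> * D0 * (E + HH + NN) + ?b - \<delta> * ((S * A + S + 1 / 2) * E + S * XQ * HH + (1 / 2 + S * XQ) * NN)"
    unfolding I5_def D0_def by (simp add: algebra_simps)
  also have "\<dots> \<le> \<delta> * D0 * (E + HH + NN) + ?b"
    using d nn by (simp add: add_nonneg_nonneg)
  also have "\<dots> \<le> \<delta> * D0 * (E + HH + (P1 \<epsilon> * (E + HH) + P0 C)) + ?b"
    using d D0_pos NN_linear[OF M small] by (intro add_right_mono mult_left_mono add_left_mono) auto
  finally have I: "?I \<le> \<delta> * D0 * (E + HH + (P1 \<epsilon> * (E + HH) + P0 C)) + ?b" .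
  have "?c * (E + HH) \<le> 1 / 2 * E + c * HH"
    unfolding distrib_left using nn by (intro add_mono mult_right_mono) auto
  also have "\<dots> \<le> (M2\<^sup>2 / 2 + ?I) + (M2\<^sup>2 / 2 + ?I)"
    using energy_bound[OF M'] by (intro add_mono) auto
  also have "\<dots> \<le> M2\<^sup>2 + 2 * (\<delta> * D0 * (E + HH + (P1 \<epsilon> * (E + HH) + P0 C)) + ?b)" using I by simp
  also have "\<dots> = M2\<^sup>2 + 2 * ?b + 2 * \<delta> * D0 * P0 C + (2 * \<delta> * D0 * (1 + P1 \<epsilon>)) * (E + HH)" by (simp add: algebra_simps)
  also have "\<dots> \<le> M2\<^sup>2 + 2 * ?b + 2 * \<delta> * D0 * P0 C + ?c / 2 * (E + HH)"
    using small' nn by (intro add_left_mono mult_right_mono) auto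
  finally have "?c * (E + HH) \<le> M2\<^sup>2 + 2 * ?b + 2 * \<delta> * D0 * P0 C + ?c / 2 * (E + HH)" .
  moreover have "x * y \<le> z + x / 2 * y \<Longrightarrow> x / 2 * y \<le> z" for x y z :: real by (simp add: field_simps)
  ultimately have "?c / 2 * (E + HH) \<le> M2\<^sup>2 + 2 * ?b + 2 * \<delta> * D0 * P0 C" by blast
  moreover have "0 < ?c / 2" using c by simp
  ultimately show ?thesis unfolding BB_def by (simp add: pos_le_divide_eq mult.commute)
qed

lemma energy_fun_le: "energy_fun \<gamma> T m \<le> ennreal (E + 2 * (E * T + HH))"
proof -
  have "(SUP t\<in>{0..T}. L2_sq (m t)) \<le> ennreal E"
  proof (rule SUP_least)
    fix t assume t: "t \<in> {0..T}"
    show "L2_sq (m t) \<le> ennreal E"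
      unfolding L2_sq_pint[OF m_cper[OF t]] using LL_le[OF t] by (intro ennreal_leI) (simp add: LL_def L2_def)
  qed
  moreover have "(\<integral>\<^sup>+t\<in>{0..T}. Hs_sq (\<gamma> / 2) (fc (m t)) \<partial>lborel) \<le> ennreal (2 * (E * T + HH))"
  proof -
    have "(\<integral>\<^sup>+t. Hs_sq (\<gamma> / 2) (fc (m t)) \<partial>MT T) \<le> (\<integral>\<^sup>+t. ennreal (F5 2 0 0 0 (2 * E) t) \<partial>MT T)"
    proof (rule nn_integral_mono)
      fix t assume "t \<in> space (MT T)"
      then have t: "t \<in> {0..T}" by (rule tin)
      have "Hs_sq (\<gamma> / 2) (fc (m t)) \<le> ennreal (2 * (LL t + H t))"
        using Hs_sq_le[of "\<gamma> / 2" "m t"] \<gamma> m_cper[OF t] m_fin[OF t] by (simp add: LL_def L2_def H_def)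
      also have "\<dots> \<le> ennreal (F5 2 0 0 0 (2 * E) t)" using LL_le[OF t] by (intro ennreal_leI) (simp add: F5_def)
      finally show "Hs_sq (\<gamma> / 2) (fc (m t)) \<le> ennreal (F5 2 0 0 0 (2 * E) t)" .
    qed
    also have "\<dots> \<le> ennreal (I5 2 0 0 0 (2 * E))" using E_nonneg by (intro F5(4)) auto
    finally show ?thesis unfolding nn_MT by (simp add: I5_def distrib_left add.commute mult.assoc)
  qed
  ultimately show ?thesis unfolding energy_fun_def
    using E_nonneg HH_nonneg T by (subst ennreal_plus) (auto intro: add_mono)
qed

lemma Z_fun_le:
  assumes M: "moduli \<epsilon> C" and CB: "0 < CB" "\<forall>G B. cper G \<longrightarrow> l1mod \<sigma> B G \<longrightarrow>
     B11_norm \<theta> \<phi> (1 - \<beta>) G \<le> ennreal (CB * (B + pint (\<lambda>x. \<bar>G x\<bar>)))"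
  shows "Z_fun \<theta> \<phi> \<beta> T m \<le> ennreal (CB * \<epsilon> * HH + CB * (\<epsilon> + 1) * NN + CB * (C + 1) * T)"
proof -
  have e: "0 < \<epsilon>" "0 \<le> C" using M by (auto simp: moduli_def)
  have k: "0 \<le> CB * \<epsilon>" "0 \<le> CB * (\<epsilon> + 1)" "0 \<le> (0::real)" "0 \<le> (0::real)" "0 \<le> CB * (C + 1)" using e CB by auto
  have "Z_fun \<theta> \<phi> \<beta> T m = (\<integral>\<^sup>+t. B11_norm \<theta> \<phi> (1 - \<beta>) (\<lambda>y. m t y ^ 3) \<partial>MT T)" unfolding Z_fun_def nn_MT ..
  also have "\<dots> \<le> (\<integral>\<^sup>+t. ennreal (F5 (CB * \<epsilon>) (CB * (\<epsilon> + 1)) 0 0 (CB * (C + 1)) t) \<partial>MT T)"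
  proof (rule nn_integral_mono)
    fix t assume "t \<in> space (MT T)"
    then have t: "t \<in> {0..T}" by (rule tin)
    note cm = m_cper[OF t]
    have cN: "cper (\<lambda>x. \<bar>m t x\<bar> powr q)" using q_gt by (intro cper_powr[OF cm]) auto
    \<comment> \<open>The lowest block needs the L1 norm of m^3, which q > 3 reduces to the L^q
      norm.\<close>
    have "pint (\<lambda>x. \<bar>m t x ^ 3\<bar>) \<le> pint (\<lambda>x. 1 + \<bar>m t x\<bar> powr q)"
    proof (rule pint_mono[OF cper_abs[OF cper_power[OF cm]] cper_add[OF cper_const cN]])
      fix x
      show "\<bar>m t x ^ 3\<bar> \<le> 1 + \<bar>m t x\<bar> powr q"
      proof (cases "\<bar>m t x\<bar> \<le> 1")
        case True
        then show ?thesis using power_le_one[of "\<bar>m t x\<bar>" 3] by (simp add: power_abs add_increasing2)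
      next
        case False
        then have "\<bar>m t x\<bar> ^ 3 = \<bar>m t x\<bar> powr 3" by simp
        also have "\<dots> \<le> \<bar>m t x\<bar> powr q" using False q_gt by (intro powr_mono) auto
        finally show ?thesis by (simp add: power_abs)
      qed
    qed
    also have "\<dots> = 1 + N t" by (simp add: pint_add[OF cper_const cN] N_def Nq_def)
    finally have "CB * (mod_bd \<epsilon> C 0 (m t) + pint (\<lambda>x. \<bar>m t x ^ 3\<bar>)) \<le> F5 (CB * \<epsilon>) (CB * (\<epsilon> + 1)) 0 0 (CB * (C + 1)) t"
      using mult_left_mono[of "mod_bd \<epsilon> C 0 (m t) + pint (\<lambda>x. \<bar>m t x ^ 3\<bar>)" "\<epsilon> * H t + \<epsilon> * N t + C + (1 + N t)" CB] CB(1) bd_le(1)[OF M t]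
      by (simp add: F5_def algebra_simps)
    then show "B11_norm \<theta> \<phi> (1 - \<beta>) (\<lambda>y. m t y ^ 3) \<le> ennreal (F5 (CB * \<epsilon>) (CB * (\<epsilon> + 1)) 0 0 (CB * (C + 1)) t)"
      using CB(2) cper_power[OF cm, of 3] modulus_cube[OF M cm m_fin[OF t]] by (blast intro: order_trans ennreal_leI)
  qed
  also have "\<dots> \<le> ennreal (I5 (CB * \<epsilon>) (CB * (\<epsilon> + 1)) 0 0 (CB * (C + 1)))" by (rule F5(4)[OF k])
  finally show ?thesis by (simp add: I5_def)
qed

lemma K_fun_le:
  assumes M: "moduli \<epsilon> C" and s: "s < 1 / 3"
  shows "K_fun s T m \<le> ennreal (YI \<epsilon> C / (1 - 3 * s))"
proof -
  have "(\<integral>\<^sup>+y\<in>{0..1}. ennreal (\<bar>m t (y + h) - m t y\<bar> ^ 3) \<partial>lborel) = ennreal (Kh h (m t))" if "t \<in> {0..T}" for t h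
    unfolding Kh_def by (rule pint_nn[OF cper_power[OF cper_abs[OF cper_diff[OF cper_shift m_cper]]]]) (use m_cper that in auto)
  then have "K_fun s T m = (\<integral>\<^sup>+t. (\<integral>\<^sup>+h\<in>{0..1}. ennreal (h powr (- 1 - 3 * s)) * ennreal (Kh h (m t)) \<partial>lborel) \<partial>MT T)"
    unfolding K_fun_def nn_MT by (intro nn_integral_cong) (simp add: tin)
  then show ?thesis using K_integral[OF M s] by simp
qed

end

lemma (in solution_constants) uniform_bounds:
  defines "sol \<equiv> \<lambda>lam l \<psi> m. bounded_solution \<theta> \<phi> \<gamma> \<beta> \<rho> T J0 J1 L Ma MQ0 MQ MR CS CD CA c0 c1 lam l \<psi> m \<and> initial_bounds m M1 M2"
  shows "\<exists>B. \<forall>lam l \<psi> m. sol lam l \<psi> m \<longrightarrow> energy_fun \<gamma> T m + Z_fun \<theta> \<phi> \<beta> T m \<le> ennreal B"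
    and "s < 1 / 3 \<Longrightarrow> \<exists>B. \<forall>lam l \<psi> m. sol lam l \<psi> m \<longrightarrow> K_fun s T m \<le> ennreal B"
proof -
  \<comment> \<open>Makes the coefficient of the L^q norm in its own inequality at most 1/2; the
    summand 1 guards against division by zero.\<close>
  define \<epsilon> where "\<epsilon> = 1 / (2 * (g1 * ((2 * S + 1) * (A + 1)) + 1))"
  have gp: "0 \<le> g1 * ((2 * S + 1) * (A + 1))" using g1_nonneg S_pos A_nonneg by auto
  have e: "0 < \<epsilon>" using gp by (simp add: \<epsilon>_def)
  have small: "g1 * ((2 * S + 1) * (A * \<epsilon> + \<epsilon>)) \<le> 1 / 2"
  proof -
    have "g1 * ((2 * S + 1) * (A * \<epsilon> + \<epsilon>)) = g1 * ((2 * S + 1) * (A + 1)) * \<epsilon>" by (simp add: algebra_simps)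
    also have "\<dots> \<le> 1 / 2" using gp by (simp add: \<epsilon>_def field_simps)
    finally show ?thesis .
  qed
  obtain C where M: "moduli \<epsilon> C" using moduli_exists[OF e] by blast
  \<comment> \<open>Makes what returns to the right of the energy inequality at most half of
    \<open>min (1 / 2) c\<close>, the coefficient of E + HH on its left.\<close>
  define \<delta> where "\<delta> = min (1 / 2) c / 2 / (2 * (D0 * (1 + P1 \<epsilon>)))"
  have Dp: "0 < D0 * (1 + P1 \<epsilon>)" using D0_pos P1_nonneg[OF e] by (simp add: add_pos_nonneg)
  have d: "0 < \<delta>" using Dp c by (simp add: \<delta>_def)
  have "\<delta> * (2 * (D0 * (1 + P1 \<epsilon>))) = min (1 / 2) c / 2"
    unfolding \<delta>_def using Dp by (intro nonzero_eq_divide_eq[THEN iffD1]) auto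
  then have small': "2 * \<delta> * D0 * (1 + P1 \<epsilon>) \<le> min (1 / 2) c / 2" by (simp add: mult_ac)
  obtain D where M': "moduli \<delta> D" using moduli_exists[OF d] by blast
  let ?B = "BB \<epsilon> C \<delta> D"
  let ?N = "P1 \<epsilon> * ?B + P0 C"
  have reg: "regular_solution \<theta> \<phi> \<gamma> \<alpha> \<kappa> \<eta> e e1 F1 F2 K C0 \<beta> \<rho> T J0 J1 L Ma MQ0 MQ MR CS CD CA c0 c1 c C\<beta> C\<rho> M1 M2 lam l \<psi> m"
    if "sol lam l \<psi> m" for lam l \<psi> m
    using that by unfold_locales (auto simp: sol_def)
  show "\<exists>B. \<forall>lam l \<psi> m. sol lam l \<psi> m \<longrightarrow> energy_fun \<gamma> T m + Z_fun \<theta> \<phi> \<beta> T m \<le> ennreal B"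
  proof -
    \<comment> \<open>1 - \<beta> < 1 - \<alpha> < \<sigma>, so the moduli of m^3 have more than the
      regularity asked for in \<open>Z_fun\<close>.\<close>
    have "0 < 1 - \<beta>" "1 - \<beta> < \<sigma>" using \<beta> sigma(3) by auto
    then obtain CB where CB: "0 < CB" "\<forall>G B. cper G \<longrightarrow> l1mod \<sigma> B G \<longrightarrow> B11_norm \<theta> \<phi> (1 - \<beta>) G \<le> ennreal (CB * (B + pint (\<lambda>x. \<bar>G x\<bar>)))"
      using B11_bound[OF _ _ sigma(2)] by blast
    show ?thesis
    proof (intro exI allI impI)
      fix lam l \<psi> m assume s: "sol lam l \<psi> m"
      interpret r: regular_solution \<theta> \<phi> \<gamma> \<alpha> \<kappa> \<eta> e e1 F1 F2 K C0 \<beta> \<rho> T J0 J1 L Ma MQ0 MQ MR CS CD CA c0 c1 c C\<beta> C\<rho> M1 M2 lam l \<psi> m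
        by (rule reg[OF s])
      have eh: "r.E + r.HH \<le> ?B" by (rule r.EH_bound[OF M small M' small'])
      have nn: "r.NN \<le> ?N"
        using r.NN_linear[OF M small] mult_left_mono[OF eh P1_nonneg[OF e]] by linarith
      have b: "r.E \<le> ?B" "r.HH \<le> ?B" using eh r.E_nonneg r.HH_nonneg by auto
      have "energy_fun \<gamma> T m \<le> ennreal (?B + 2 * (?B * T + ?B))"
        using b T by (intro order_trans[OF r.energy_fun_le] ennreal_leI add_mono mult_left_mono mult_right_mono) auto
      moreover have "Z_fun \<theta> \<phi> \<beta> T m \<le> ennreal (CB * \<epsilon> * ?B + CB * (\<epsilon> + 1) * ?N + CB * (C + 1) * T)"
        using b nn CB(1) e by (intro order_trans[OF r.Z_fun_le[OF M CB]] ennreal_leI add_right_mono add_mono mult_left_mono) auto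
      ultimately have "energy_fun \<gamma> T m + Z_fun \<theta> \<phi> \<beta> T m \<le> ennreal (?B + 2 * (?B * T + ?B)) + ennreal (CB * \<epsilon> * ?B + CB * (\<epsilon> + 1) * ?N + CB * (C + 1) * T)"
        by (rule add_mono)
      also have "\<dots> = ennreal ((?B + 2 * (?B * T + ?B)) + (CB * \<epsilon> * ?B + CB * (\<epsilon> + 1) * ?N + CB * (C + 1) * T))"
      proof (rule ennreal_plus[symmetric])
        have pB: "0 \<le> ?B" and pN: "0 \<le> ?N" by (rule order_trans[OF r.E_nonneg b(1)] order_trans[OF r.NN_nonneg nn])+
        show "0 \<le> ?B + 2 * (?B * T + ?B)" using pB T by simp
        have "0 \<le> C" using M by (simp add: moduli_def)
        then have "0 \<le> CB * \<epsilon> * x + CB * (\<epsilon> + 1) * y + CB * (C + 1) * T" if "0 \<le> x" "0 \<le> y" for x y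
          using that CB(1) e T by (intro add_nonneg_nonneg mult_nonneg_nonneg) auto
        from this[OF pB pN] show "0 \<le> CB * \<epsilon> * ?B + CB * (\<epsilon> + 1) * ?N + CB * (C + 1) * T" .
      qed
      finally show "energy_fun \<gamma> T m + Z_fun \<theta> \<phi> \<beta> T m \<le> \<dots>" .
    qed
  qed
  show "\<exists>B. \<forall>lam l \<psi> m. sol lam l \<psi> m \<longrightarrow> K_fun s T m \<le> ennreal B" if s3: "s < 1 / 3"
  proof (intro exI allI impI)
    fix lam l \<psi> m assume s: "sol lam l \<psi> m"
    interpret r: regular_solution \<theta> \<phi> \<gamma> \<alpha> \<kappa> \<eta> e e1 F1 F2 K C0 \<beta> \<rho> T J0 J1 L Ma MQ0 MQ MR CS CD CA c0 c1 c C\<beta> C\<rho> M1 M2 lam l \<psi> m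
      by (rule reg[OF s])
    have eh: "r.E + r.HH \<le> ?B" by (rule r.EH_bound[OF M small M' small'])
    have nn: "r.NN \<le> ?N"
      using r.NN_linear[OF M small] mult_left_mono[OF eh P1_nonneg[OF e]] by linarith
    have "0 \<le> n1 \<epsilon>" unfolding n1_def using e S_pos A_nonneg KV_nonneg XQ_nonneg T by (intro add_nonneg_nonneg mult_nonneg_nonneg) auto
    moreover have "0 \<le> (2 * S + 1) * (A * \<epsilon> + \<epsilon>)" using e S_pos A_nonneg by (intro add_nonneg_nonneg mult_nonneg_nonneg) auto
    ultimately have "r.YI \<epsilon> C \<le> 3 / J0\<^sup>2 * (n1 \<epsilon> * ?B + n0 C + (2 * S + 1) * (A * \<epsilon> + \<epsilon>) * ?N)"
      by (intro order_trans[OF r.YI_le[OF M]] mult_left_mono[OF add_mono[OF add_right_mono]] mult_left_mono eh nn) auto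
    then show "K_fun s T m \<le> ennreal (3 / J0\<^sup>2 * (n1 \<epsilon> * ?B + n0 C + (2 * S + 1) * (A * \<epsilon> + \<epsilon>) * ?N) / (1 - 3 * s))"
      using s3 by (intro order_trans[OF r.K_fun_le[OF M s3]] ennreal_leI divide_right_mono) auto
  qed
qed

theorem theorem3p5:
  fixes \<theta> \<phi> \<eta> :: "real \<Rightarrow> real" and \<gamma> \<beta> \<rho> :: real
  assumes "dyadic_partition \<theta> \<phi>" and "convex_cutoff \<eta>"
    and "1 < \<gamma>" and "\<gamma> \<le> 2"
    and "1 - \<gamma> / 2 < \<rho>" and "1 - \<gamma> / 2 < \<beta>" and "\<beta> < 1"
  shows
    "(\<forall>J0 J1 L. \<exists>C::real. \<forall>T Ma MQ0 MQ MR CS CD CA c0 c1 lam l \<psi> m.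
        bounded_solution \<theta> \<phi> \<gamma> \<beta> \<rho> T J0 J1 L Ma MQ0 MQ MR CS CD CA c0 c1 lam l \<psi> m \<longrightarrow>
        (SUP t\<in>{0..T}. L1_norm (m t)) \<le> ennreal C * N_fun \<eta> \<gamma> T lam l \<psi> m \<and>
        N_fun \<eta> \<gamma> T lam l \<psi> m < \<infinity>)
     \<and> (\<forall>T J0 J1 L Ma MQ0 MQ MR CS CD CA c0 c1 M1 M2.
        (\<exists>C::real. \<forall>lam l \<psi> m.
           bounded_solution \<theta> \<phi> \<gamma> \<beta> \<rho> T J0 J1 L Ma MQ0 MQ MR CS CD CA c0 c1 lam l \<psi> m \<and>
           initial_bounds m M1 M2 \<longrightarrow>
           energy_fun \<gamma> T m + Z_fun \<theta> \<phi> \<beta> T m \<le> ennreal C) \<and>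
        (\<forall>s. 0 < s \<and> s < 1 / 3 \<longrightarrow>
           (\<exists>C::real. \<forall>lam l \<psi> m.
              bounded_solution \<theta> \<phi> \<gamma> \<beta> \<rho> T J0 J1 L Ma MQ0 MQ MR CS CD CA c0 c1 lam l \<psi> m \<and>
              initial_bounds m M1 M2 \<longrightarrow>
              K_fun s T m \<le> ennreal C)))"
proof -
  obtain F1 F2 K C0 where ent: "entropy \<eta> (deriv \<eta>) (deriv (deriv \<eta>)) F1 F2 K C0"
    using convex_cutoff_entropy[OF assms(2)] by blast
  have K: "0 < max K 1" by simp
  have bsD: "0 < T" "0 < J0" if "bounded_solution \<theta> \<phi> \<gamma> \<beta> \<rho> T J0 J1 L Ma MQ0 MQ MR CS CD CA c0 c1 lam l \<psi> m"
    for T J0 J1 L Ma MQ0 MQ MR CS CD CA c0 c1 lam l \<psi> m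
    using that by (auto simp: bounded_solution_def)
  show ?thesis
  proof (intro conjI allI)
    fix J0 J1 L :: real
    show "\<exists>C::real. \<forall>T Ma MQ0 MQ MR CS CD CA c0 c1 lam l \<psi> m.
        bounded_solution \<theta> \<phi> \<gamma> \<beta> \<rho> T J0 J1 L Ma MQ0 MQ MR CS CD CA c0 c1 lam l \<psi> m \<longrightarrow>
        (SUP t\<in>{0..T}. L1_norm (m t)) \<le> ennreal C * N_fun \<eta> \<gamma> T lam l \<psi> m \<and>
        N_fun \<eta> \<gamma> T lam l \<psi> m < \<infinity>"
    proof (cases "0 < J0")
      case True
      obtain c where c: "coercive \<gamma> J0 J1 (max K 1) c" using coercivity[OF assms(3,4) K True] by blast
      show ?thesis
      proof (intro exI allI impI)
        fix T Ma MQ0 MQ MR CS CD CA c0 c1 lam l \<psi> m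
        assume bs: "bounded_solution \<theta> \<phi> \<gamma> \<beta> \<rho> T J0 J1 L Ma MQ0 MQ MR CS CD CA c0 c1 lam l \<psi> m"
        interpret coercive_solution \<theta> \<phi> \<gamma> \<beta> \<rho> T J0 J1 L Ma MQ0 MQ MR CS CD CA c0 c1 lam l \<psi> m \<eta> "deriv \<eta>" "deriv (deriv \<eta>)" F1 F2 K C0 c
          by (intro coercive_solution.intro strip_solution.intro coercive_solution_axioms.intro assms bs ent c; assumption)
        show "(SUP t\<in>{0..T}. L1_norm (m t)) \<le> ennreal (3 + 2 / c) * N_fun \<eta> \<gamma> T lam l \<psi> m \<and> N_fun \<eta> \<gamma> T lam l \<psi> m < \<infinity>"
          using L1_le_N_fun N_fun_finite by (intro conjI SUP_least) auto
      qed
    next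
      \<comment> \<open>For J0 <= 0 no solution satisfies the hypotheses, and any constant will
        do.\<close>
      case False
      then have "\<not> bounded_solution \<theta> \<phi> \<gamma> \<beta> \<rho> T J0 J1 L Ma MQ0 MQ MR CS CD CA c0 c1 lam l \<psi> m"
        for T Ma MQ0 MQ MR CS CD CA c0 c1 lam l \<psi> m using bsD(2) by blast
      then show ?thesis by simp
    qed
  next
    fix T J0 J1 L Ma MQ0 MQ MR :: real and CS :: "real \<Rightarrow> real" and CD CA c0 c1 M1 M2 :: real
    let ?sol = "\<lambda>lam l \<psi> m. bounded_solution \<theta> \<phi> \<gamma> \<beta> \<rho> T J0 J1 L Ma MQ0 MQ MR CS CD CA c0 c1 lam l \<psi> m \<and> initial_bounds m M1 M2"
    have "(\<exists>C::real. \<forall>lam l \<psi> m. ?sol lam l \<psi> m \<longrightarrow> energy_fun \<gamma> T m + Z_fun \<theta> \<phi> \<beta> T m \<le> ennreal C) \<and>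
      (\<forall>s<1/3. \<exists>C::real. \<forall>lam l \<psi> m. ?sol lam l \<psi> m \<longrightarrow> K_fun s T m \<le> ennreal C)"
    proof (cases "0 < T \<and> 0 < J0")
      case True
      then have TJ: "0 < T" "0 < J0" by auto
      obtain c where c: "coercive \<gamma> J0 J1 (max K 1) c" using coercivity[OF assms(3,4) K TJ(2)] by blast
      \<comment> \<open>Below both Hoelder exponents, to leave room for the loss in
        \<open>C_norm_holder\<close>, and above 1 - \<gamma> / 2, so that \<alpha> + \<gamma> / 2 >
        1.\<close>
      obtain \<alpha> where \<alpha>: "1 - \<gamma> / 2 < \<alpha>" "\<alpha> < min \<beta> \<rho>" using dense[of "1 - \<gamma> / 2" "min \<beta> \<rho>"] assms by auto
      \<comment> \<open>Spends half of the excess: \<alpha> + (1 - \<kappa>) \<gamma> / 2 - 1 is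
        half of \<alpha> + \<gamma> / 2 - 1.\<close>
      define \<kappa> where "\<kappa> = (\<alpha> + \<gamma> / 2 - 1) / \<gamma>"
      have k: "\<kappa> * \<gamma> = \<alpha> + \<gamma> / 2 - 1" using assms by (simp add: \<kappa>_def)
      interpret dyadic \<theta> \<phi> by (rule dyadic.intro[OF assms(1)])
      have a: "0 < \<alpha>" "\<alpha> < 1" "\<alpha> < \<beta>" "\<alpha> < \<rho>" using \<alpha> assms by auto
      obtain C\<beta> where C\<beta>: "0 < C\<beta>" "\<And>f f' M. \<lbrakk>c1per f f'; 0 \<le> M; C_norm \<theta> \<phi> \<beta> f \<le> ennreal M\<rbrakk> \<Longrightarrow> holder \<alpha> (C\<beta> * M) f"
        using C_norm_holder[OF a(1,2,3)] by blast
      obtain C\<rho> where C\<rho>: "0 < C\<rho>" "\<And>f f' M. \<lbrakk>c1per f f'; 0 \<le> M; C_norm \<theta> \<phi> \<rho> f \<le> ennreal M\<rbrakk> \<Longrightarrow> holder \<alpha> (C\<rho> * M) f"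
        using C_norm_holder[OF a(1,2,4)] by blast
      have ex: "expo \<gamma> \<alpha> \<kappa>"
      proof
        show "0 < \<kappa>" "\<kappa> < 1" using \<alpha> a assms by (auto simp: \<kappa>_def)
        have "(1 - \<kappa>) * \<gamma> = \<gamma> - (\<alpha> + \<gamma> / 2 - 1)" by (simp only: left_diff_distrib k mult_1)
        then show "1 < \<alpha> + (1 - \<kappa>) * \<gamma> / 2" using \<alpha> by (simp add: field_simps)
      qed (use a assms in auto)
      interpret solution_constants \<theta> \<phi> \<gamma> \<alpha> \<kappa> \<eta> "deriv \<eta>" "deriv (deriv \<eta>)" F1 F2 K C0 \<beta> \<rho> T J0 J1 L Ma MQ0 MQ MR CS CD CA c0 c1 c C\<beta> C\<rho> M1 M2
        by (intro solution_constants.intro solution_constants_axioms.intro dyadic_axioms ex ent a(3) assms TJ c C\<beta> C\<rho>; assumption)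
      show ?thesis using uniform_bounds by blast
    next
      case False
      then have "\<not> bounded_solution \<theta> \<phi> \<gamma> \<beta> \<rho> T J0 J1 L Ma MQ0 MQ MR CS CD CA c0 c1 lam l \<psi> m" for lam l \<psi> m
        by (auto simp: bounded_solution_def)
      then show ?thesis by simp
    qed
    then show "\<exists>C::real. \<forall>lam l \<psi> m. ?sol lam l \<psi> m \<longrightarrow> energy_fun \<gamma> T m + Z_fun \<theta> \<phi> \<beta> T m \<le> ennreal C"
      and "0 < s \<and> s < 1 / 3 \<longrightarrow> (\<exists>C::real. \<forall>lam l \<psi> m. ?sol lam l \<psi> m \<longrightarrow> K_fun s T m \<le> ennreal C)" for s
      by blast+
  qed
qed

end
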